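(* Let $\alpha>-\frac12$, $1\le p\le2$, $1\le q\le+\infty$ and $\beta>0$. Then $$\mathcal{B}\mathcal{D}_{p,q}^{\beta,\alpha}\subset\mathcal{E}\mathcal{D}_{p,q}^{\beta,\alpha}.$$
   Context: Let $\alpha>-\frac12$. The measure $\mu_\alpha$ on $\mathbb{R}$ is $d\mu_\alpha(x)=\frac{|x|^{2\alpha+1}}{2^{\alpha+1}\Gamma(\alpha+1)}\,dx$; $L^p(\mu_\alpha)=L^p(\mathbb{R},d\mu_\alpha)$ with norm $\|\cdot\|_{p,\alpha}$. Dunkl transform: for $\lambda\in\mathbb{C}$, $x\in\mathbb{R}$, the Dunkl kernel is $E_\alpha(\lambda x)=j_\alpha(i\lambda x)+\frac{\lambda x}{2(\alpha+1)}j_{\alpha+1}(i\lambda x)$, where $j_\alpha(z)=\Gamma(\alpha+1)\sum_{n\ge0}\frac{(-1)^n(z/2)^{2n}}{n!\,\Gamma(n+\alpha+1)}$ is the normalized Bessel function. For $f\in L^1(\mu_\alpha)$, $\mathcal{F}_\alpha(f)(x)=\int_{\mathbb{R}}E_\alpha(-ixy)f(y)\,d\mu_\alpha(y)$. One has $\|\mathcal{F}_\alpha(f)\|_{\infty,\alpha}\le\|f\|_{1,\alpha}$ and the Plancherel formula $\|\mathcal{F}_\alpha(f)\|_{2,\alpha}=\|f\|_{2,\alpha}$, so $\mathcal{F}_\alpha$ extends to $L^p(\mu_\alpha)$ for $1\le p\le2$. Dunkl translation: for $x,y,z\in\mathbb{R}$ let $$W_\alpha(x,y,z)=\frac{\Gamma(\alpha+1)^2}{2^{\alpha-1}\sqrt{\pi}\,\Gamma(\alpha+\frac12)}\,(1-b_{x,y,z}+b_{z,x,y}+b_{z,y,x})\,\Delta_\alpha(x,y,z),$$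 where $b_{x,y,z}=\frac{x^2+y^2-z^2}{2xy}$ if $x,y\in\mathbb{R}\setminus\{0\}$, $z\in\mathbb{R}$, and $b_{x,y,z}=0$ otherwise; and $\Delta_\alpha(x,y,z)=\frac{\left([(|x|+|y|)^2-z^2][z^2-(|x|-|y|)^2]\right)^{\alpha-\frac12}}{|xyz|^{2\alpha}}$ if $|z|\in[\,||x|-|y||,\,|x|+|y|\,]$, and $0$ otherwise. Let $\gamma_{x,y}$ be the signed measure given by $d\gamma_{x,y}(z)=W_\alpha(x,y,z)\,d\mu_\alpha(z)$ if $x,y\ne0$, $\gamma_{x,y}=\delta_x$ if $y=0$, $\gamma_{x,y}=\delta_y$ if $x=0$. For continuous $f$, $\tau_x(f)(y)=\int_{\mathbb{R}}f(z)\,d\gamma_{x,y}(z)$. The operator $\tau_x$ extends to a bounded operator on $L^p(\mu_\alpha)$ with $\|\tau_x(f)\|_{p,\alpha}\le4\|f\|_{p,\alpha}$. Modulus: for $f\in L^p(\mu_\alpha)$ and $x>0$, $w_{p,\alpha}(f,x)=\sup_{|t|\le x}\|\tau_t(f)-f\|_{p,\alpha}$. The Besov-Dunkl space $\mathcal{B}\mathcal{D}_{p,q}^{\beta,\alpha}$ is the set of $f\in L^p(\mu_\alpha)$ with $\int_0^{+\infty}\left(\frac{w_{p,\alpha}(f,x)}{x^\beta}\right)^q\frac{dx}{x}<+\infty$ if $q<+\infty$, and $\sup_{x\in(0,+\infty)}\frac{w_{p,\alpha}(f,x)}{x^\beta}<+\infty$ if $q=+\infty$. For $f\in L^p(\mu_\alpha)$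 and $x>0$ let $\mathbf{E}_{p,\alpha}(f,x)=\inf\{\|f-g\|_{p,\alpha}:\ g\in L^p(\mu_\alpha),\ \mathrm{supp}(\mathcal{F}_\alpha(g))\subset[-x,x]\}$. The space $\mathcal{E}\mathcal{D}_{p,q}^{\beta,\alpha}$ is the set of $f\in L^p(\mu_\alpha)$ with $\int_1^{+\infty}\left(x^\beta\,\mathbf{E}_{p,\alpha}(f,x)\right)^q\frac{dx}{x}<+\infty$ if $q<+\infty$, and $\sup_{x\in(1,+\infty)}x^\beta\,\mathbf{E}_{p,\alpha}(f,x)<+\infty$ if $q=+\infty$. *)

theory Defs
  imports "HOL-Analysis.Analysis"
begin

section \<open>Lebesgue spaces\<close>

text \<open>Elements of \<open>L\<^sup>p(M)\<close> are represented by measurable complex-valued functions. The spaces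
  defined below are invariant under equality almost everywhere.\<close>

definition Lp_space :: "'a measure \<Rightarrow> real \<Rightarrow> ('a \<Rightarrow> complex) set" where
  "Lp_space M p = {f \<in> borel_measurable M. integrable M (\<lambda>x. norm (f x) powr p)}"

definition Lp_norm :: "'a measure \<Rightarrow> real \<Rightarrow> ('a \<Rightarrow> complex) \<Rightarrow> real" where
  "Lp_norm M p f = (LINT x|M. norm (f x) powr p) powr (1 / p)"

text \<open>Membership of the differences in \<open>L\<^sup>p\<close> is required since \<^const>\<open>Lp_norm\<close> is \<open>0\<close> outside
  of \<open>L\<^sup>p\<close>.\<close>

definition Lp_tendsto ::
    "'a measure \<Rightarrow> real \<Rightarrow> (nat \<Rightarrow> 'a \<Rightarrow> complex) \<Rightarrow> ('a \<Rightarrow> complex) \<Rightarrow> bool" where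
  "Lp_tendsto M p u f \<longleftrightarrow>
     (\<forall>n. (\<lambda>x. u n x - f x) \<in> Lp_space M p) \<and>
     (\<lambda>n. Lp_norm M p (\<lambda>x. u n x - f x)) \<longlonglongrightarrow> 0"

text \<open>The support of a function class: the complement of the largest open set on which the
  function vanishes almost everywhere.\<close>

definition ess_support :: "'a::topological_space measure \<Rightarrow> ('a \<Rightarrow> complex) \<Rightarrow> 'a set" where
  "ess_support M f = - \<Union>{U. open U \<and> (AE x in M. x \<in> U \<longrightarrow> f x = 0)}"


section \<open>Dunkl transform\<close>

definition dunkl_measure :: "real \<Rightarrow> real measure" where
  "dunkl_measure \<alpha> = density lborel
     (\<lambda>x. ennreal (\<bar>x\<bar> powr (2 * \<alpha> + 1) / (2 powr (\<alpha> + 1) * Gamma (\<alpha> + 1))))"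

definition bessel_j :: "real \<Rightarrow> complex \<Rightarrow> complex" where
  "bessel_j \<alpha> z = complex_of_real (Gamma (\<alpha> + 1)) *
     (\<Sum>n. (-1) ^ n * (z / 2) ^ (2 * n) / (fact n * complex_of_real (Gamma (real n + \<alpha> + 1))))"

text \<open>\<open>dunkl_kernel \<alpha> (l x)\<close> is the Dunkl kernel \<open>E\<^sub>\<alpha>(l x)\<close>, which depends on the complex
  parameter \<open>l\<close> and the real variable \<open>x\<close> only through their product.\<close>

definition dunkl_kernel :: "real \<Rightarrow> complex \<Rightarrow> complex" where
  "dunkl_kernel \<alpha> w =
     bessel_j \<alpha> (\<i> * w) + w / (2 * (complex_of_real \<alpha> + 1)) * bessel_j (\<alpha> + 1) (\<i> * w)"

definition dunkl_transform_L1 :: "real \<Rightarrow> (real \<Rightarrow> complex) \<Rightarrow> real \<Rightarrow> complex" where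
  "dunkl_transform_L1 \<alpha> f x =
     (LINT y|dunkl_measure \<alpha>. dunkl_kernel \<alpha> (- \<i> * complex_of_real x * complex_of_real y) * f y)"

text \<open>The isometric extension to \<open>L\<^sup>2\<close> given by the Plancherel formula, by density of
  \<open>L\<^sup>1 \<inter> L\<^sup>2\<close>. The choice only fixes a representative.\<close>

definition dunkl_transform_L2 :: "real \<Rightarrow> (real \<Rightarrow> complex) \<Rightarrow> real \<Rightarrow> complex" where
  "dunkl_transform_L2 \<alpha> f = (SOME h. h \<in> Lp_space (dunkl_measure \<alpha>) 2 \<and>
     (\<exists>u. (\<forall>n. u n \<in> Lp_space (dunkl_measure \<alpha>) 1 \<inter> Lp_space (dunkl_measure \<alpha>) 2) \<and>
          Lp_tendsto (dunkl_measure \<alpha>) 2 u f \<and>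
          Lp_tendsto (dunkl_measure \<alpha>) 2 (\<lambda>n. dunkl_transform_L1 \<alpha> (u n)) h))"

text \<open>The extension to \<open>L\<^sup>p \<subseteq> L\<^sup>1 + L\<^sup>2\<close> for \<open>1 \<le> p \<le> 2\<close>. Since the transforms on \<open>L\<^sup>1\<close> and
  \<open>L\<^sup>2\<close> agree on \<open>L\<^sup>1 \<inter> L\<^sup>2\<close>, the result is, up to equality almost everywhere, independent of
  the decomposition.\<close>

definition dunkl_transform :: "real \<Rightarrow> (real \<Rightarrow> complex) \<Rightarrow> real \<Rightarrow> complex" where
  "dunkl_transform \<alpha> f = (SOME h. \<exists>f1 \<in> Lp_space (dunkl_measure \<alpha>) 1. \<exists>f2 \<in> Lp_space (dunkl_measure \<alpha>) 2.
     (AE x in dunkl_measure \<alpha>. f x = f1 x + f2 x) \<and>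
     h = (\<lambda>x. dunkl_transform_L1 \<alpha> f1 x + dunkl_transform_L2 \<alpha> f2 x))"


section \<open>Dunkl translation\<close>

definition dunkl_b :: "real \<Rightarrow> real \<Rightarrow> real \<Rightarrow> real" where
  "dunkl_b x y z = (if x \<noteq> 0 \<and> y \<noteq> 0 then (x\<^sup>2 + y\<^sup>2 - z\<^sup>2) / (2 * x * y) else 0)"

definition dunkl_Delta :: "real \<Rightarrow> real \<Rightarrow> real \<Rightarrow> real \<Rightarrow> real" where
  "dunkl_Delta \<alpha> x y z =
     (if \<bar>z\<bar> \<in> {\<bar>\<bar>x\<bar> - \<bar>y\<bar>\<bar>..\<bar>x\<bar> + \<bar>y\<bar>}
      then (((\<bar>x\<bar> + \<bar>y\<bar>)\<^sup>2 - z\<^sup>2) * (z\<^sup>2 - (\<bar>x\<bar> - \<bar>y\<bar>)\<^sup>2)) powr (\<alpha> - 1 / 2) / \<bar>x * y * z\<bar> powr (2 * \<alpha>)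
      else 0)"

definition dunkl_W :: "real \<Rightarrow> real \<Rightarrow> real \<Rightarrow> real \<Rightarrow> real" where
  "dunkl_W \<alpha> x y z =
     (Gamma (\<alpha> + 1))\<^sup>2 / (2 powr (\<alpha> - 1) * sqrt pi * Gamma (\<alpha> + 1 / 2)) *
     (1 - dunkl_b x y z + dunkl_b z x y + dunkl_b z y x) * dunkl_Delta \<alpha> x y z"

text \<open>The integral of \<open>f\<close> against the signed measure \<open>\<gamma>\<^sub>x\<^sub>,\<^sub>y\<close>, which has density
  \<^const>\<open>dunkl_W\<close> with respect to \<^const>\<open>dunkl_measure\<close> if \<open>x, y \<noteq> 0\<close> and is a Dirac measure
  otherwise.\<close>

definition dunkl_gamma_integral :: "real \<Rightarrow> real \<Rightarrow> real \<Rightarrow> (real \<Rightarrow> complex) \<Rightarrow> complex" where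
  "dunkl_gamma_integral \<alpha> x y f =
     (if y = 0 then f x else if x = 0 then f y
      else LINT z|dunkl_measure \<alpha>. complex_of_real (dunkl_W \<alpha> x y z) * f z)"

definition dunkl_translation_cont :: "real \<Rightarrow> real \<Rightarrow> (real \<Rightarrow> complex) \<Rightarrow> real \<Rightarrow> complex" where
  "dunkl_translation_cont \<alpha> x f y = dunkl_gamma_integral \<alpha> x y f"

text \<open>The bounded extension to \<open>L\<^sup>p\<close>, by density of the continuous functions in \<open>L\<^sup>p\<close>.
  The choice only fixes a representative.\<close>

definition dunkl_translation :: "real \<Rightarrow> real \<Rightarrow> real \<Rightarrow> (real \<Rightarrow> complex) \<Rightarrow> real \<Rightarrow> complex" where
  "dunkl_translation \<alpha> p x f = (SOME h. h \<in> Lp_space (dunkl_measure \<alpha>) p \<and>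
     (\<exists>u. (\<forall>n. continuous_on UNIV (u n) \<and> u n \<in> Lp_space (dunkl_measure \<alpha>) p) \<and>
          Lp_tendsto (dunkl_measure \<alpha>) p u f \<and>
          Lp_tendsto (dunkl_measure \<alpha>) p (\<lambda>n. dunkl_translation_cont \<alpha> x (u n)) h))"


section \<open>Besov--Dunkl spaces and best approximation\<close>

text \<open>The supremum below is over a set bounded by \<open>5 * Lp_norm (dunkl_measure \<alpha>) p f\<close>, and the
  infimum in \<open>dunkl_best_approx\<close> is over a nonempty set of nonnegative reals.\<close>

definition dunkl_modulus :: "real \<Rightarrow> real \<Rightarrow> (real \<Rightarrow> complex) \<Rightarrow> real \<Rightarrow> real" where
  "dunkl_modulus p \<alpha> f x =
     (SUP t \<in> {t. \<bar>t\<bar> \<le> x}. Lp_norm (dunkl_measure \<alpha>) p (\<lambda>y. dunkl_translation \<alpha> p t f y - f y))"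

definition besov_dunkl :: "real \<Rightarrow> ennreal \<Rightarrow> real \<Rightarrow> real \<Rightarrow> (real \<Rightarrow> complex) set" where
  "besov_dunkl p q \<beta> \<alpha> = {f \<in> Lp_space (dunkl_measure \<alpha>) p.
     if q < \<infinity>
     then (\<integral>\<^sup>+x\<in>{0<..}. ennreal ((dunkl_modulus p \<alpha> f x / x powr \<beta>) powr enn2real q / x) \<partial>lborel) < \<infinity>
     else bdd_above ((\<lambda>x. dunkl_modulus p \<alpha> f x / x powr \<beta>) ` {0<..})}"

definition dunkl_best_approx :: "real \<Rightarrow> real \<Rightarrow> (real \<Rightarrow> complex) \<Rightarrow> real \<Rightarrow> real" where
  "dunkl_best_approx p \<alpha> f x =
     Inf {Lp_norm (dunkl_measure \<alpha>) p (\<lambda>y. f y - g y) | g.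
            g \<in> Lp_space (dunkl_measure \<alpha>) p \<and>
            ess_support (dunkl_measure \<alpha>) (dunkl_transform \<alpha> g) \<subseteq> {-x..x}}"

definition approx_dunkl :: "real \<Rightarrow> ennreal \<Rightarrow> real \<Rightarrow> real \<Rightarrow> (real \<Rightarrow> complex) set" where
  "approx_dunkl p q \<beta> \<alpha> = {f \<in> Lp_space (dunkl_measure \<alpha>) p.
     if q < \<infinity>
     then (\<integral>\<^sup>+x\<in>{1<..}. ennreal ((x powr \<beta> * dunkl_best_approx p \<alpha> f x) powr enn2real q / x) \<partial>lborel) < \<infinity>
     else bdd_above ((\<lambda>x. x powr \<beta> * dunkl_best_approx p \<alpha> f x) ` {1<..})}"

end

theory Submission
  imports Defs "HOL-Real_Asymp.Real_Asymp"
begin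

text \<open>
  For \<open>f\<close> in \<open>L\<^sup>p\<close> let \<open>g\<close> be the Dunkl convolution of \<open>f\<close> with \<open>\<Phi>(x t)\<close>, normalised to total mass
  one, where \<open>\<Phi>\<close> is the transform of \<open>(1 - \<lambda>\<^sup>2)\<^sup>m\<close> on \<open>[-1, 1]\<close>. Since \<open>\<Phi>\<close> is a Bessel function of
  large order, it decays fast, and Jensen's inequality bounds \<open>\<parallel>f - g\<parallel>\<^sub>p\<close> by the moduli of \<open>f\<close> at the
  dyadic scales \<open>2\<^sup>j / x\<close>, with weights \<open>2\<^sup>-\<^sup>j\<^sup>\<sigma>\<close> for a \<open>\<sigma> > \<beta>\<close> of our choice. Raising this to the power
  \<open>q\<close>, integrating, and substituting \<open>2\<^sup>j / x\<close> for \<open>x\<close> gives the embedding.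

  The transform of \<open>g\<close> is supported in \<open>[-x, x]\<close> by the product formula for the Dunkl kernel, which
  reduces to the Chu-Vandermonde identity for the coefficients of the power series, and by Gaussian
  summability: the Gaussian is its own transform, so the product formula turns it into a heat kernel
  that decays away from the diagonal. The heat kernel also satisfies Schur's test, which bounds the
  transform on \<open>L\<^sup>2\<close> and so gives its extension to \<open>L\<^sup>p\<close>.
\<close>

section \<open>Bessel series\<close>

text \<open>The translation measures are signed, so positivity is out of reach. What survives is
  that the absolute value of W is at most \<open>4 * W_const \<alpha>\<close> times the weight
  \<Delta>, which is symmetric in its three arguments and has uniformly bounded mass in each of
  them. The central tool is an averaging identity: for an even multiplier h, the kernel obtained by
  integrating h(x) times E(-ixy) times the conjugate of E(-ixz) is, up to the constant
  \<open>\<kappa>\<close>, the average of the transform of h against W(t, y, z) in t. A Gaussian h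
  gives the heat kernel, a band-limited h gives the kernel of the convolution. Evenness of h removes
  the imaginary part of the kernel product, so the identity concerns its real part
  \<open>bes_prod\<close>. An inversion argument occurs at two places, each time as a Gaussian
  limit: the mass of \<Phi> is positive because the multiplier is positive at 0, and the transform
  of the convolution kernel vanishes outside the band. Bessel functions are written in the variable
  v = x^2 because the product formula evaluates them at x^2 (y^2 + z^2 - 2 y z s), with no square
  root to take.\<close>

text \<open>For real \<open>x\<close>, the normalized Bessel function \<open>j\<^sub>\<nu>(x)\<close> is \<open>bes \<nu> (x\<^sup>2)\<close>.\<close>

definition bes_coeff :: "real \<Rightarrow> nat \<Rightarrow> real" where
  "bes_coeff \<nu> n = (-1) ^ n / (4 ^ n * fact n * pochhammer (\<nu> + 1) n)"

definition bes :: "real \<Rightarrow> real \<Rightarrow> real" where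
  "bes \<nu> v = (\<Sum>n. bes_coeff \<nu> n * v ^ n)"

text \<open>A crude geometric bound, one factor at a time; the first factor may be below 1, hence
  the \<open>min\<close>. The factorial in \<open>bes_coeff\<close> then absorbs the geometric
  growth and the series is dominated by an exponential series.\<close>

lemma pochhammer_lower:
  fixes \<nu> :: real
  assumes "\<nu> > -1"
  shows "pochhammer (\<nu> + 1) n \<ge> (min 1 (\<nu> + 1)) ^ n"
proof (induction n)
  case (Suc n)
  have "min 1 (\<nu> + 1) ^ n * min 1 (\<nu> + 1) \<le> pochhammer (\<nu> + 1) n * (\<nu> + 1 + real n)"
    using assms Suc pochhammer_pos[of "\<nu> + 1" n] by (intro mult_mono) auto
  then show ?case by (simp add: pochhammer_Suc mult.commute)
qed simp

lemma bes_abs_summable: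
  assumes "\<nu> > -1"
  shows "summable (\<lambda>n. \<bar>bes_coeff \<nu> n\<bar> * v ^ n)"
proof (rule summable_comparison_test')
  define c where "c = 4 * min 1 (\<nu> + 1)"
  have c: "c > 0" using assms by (auto simp: c_def)
  show "summable (\<lambda>n. inverse (fact n) * (\<bar>v\<bar> / c) ^ n)"
    by (rule summable_exp)
  fix n :: nat assume "n \<ge> 0"
  have p: "pochhammer (\<nu> + 1) n > 0" using assms by (intro pochhammer_pos) auto
  have "c ^ n \<le> 4 ^ n * pochhammer (\<nu> + 1) n"
    unfolding c_def power_mult_distrib using pochhammer_lower[OF assms, of n] by simp
  then have "\<bar>v\<bar> ^ n / (fact n * (4 ^ n * pochhammer (\<nu> + 1) n)) \<le> \<bar>v\<bar> ^ n / (fact n * c ^ n)"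
    using c p by (intro divide_left_mono mult_left_mono) auto
  then show "norm (\<bar>bes_coeff \<nu> n\<bar> * v ^ n) \<le> inverse (fact n) * (\<bar>v\<bar> / c) ^ n"
    using p by (simp add: bes_coeff_def abs_mult power_abs power_divide field_simps)
qed

lemma bes_norm_summable:
  assumes "\<nu> > -1"
  shows "summable (\<lambda>n. norm (bes_coeff \<nu> n * v ^ n))"
  using bes_abs_summable[OF assms, of "\<bar>v\<bar>"] by (simp add: abs_mult power_abs)

lemma bes_sums:
  assumes "\<nu> > -1"
  shows "(\<lambda>n. bes_coeff \<nu> n * v ^ n) sums bes \<nu> v"
  unfolding bes_def using summable_norm_cancel[OF bes_norm_summable[OF assms]] by (rule summable_sums)

lemma bes_continuous: 
  assumes "\<nu> > -1"
  shows "continuous_on UNIV (bes \<nu>)"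
proof -
  have "isCont (\<lambda>v. \<Sum>n. bes_coeff \<nu> n * v ^ n) v" for v :: real
  proof (rule isCont_powser)
    show "summable (\<lambda>n. bes_coeff \<nu> n * (\<bar>v\<bar> + 1) ^ n)"
      using bes_sums[OF assms] by (rule sums_summable)
  qed simp
  then show ?thesis
    by (simp add: continuous_on_eq_continuous_at bes_def [abs_def])
qed

lemma bes_measurable [measurable]: 
  assumes "\<nu> > -1"
  shows "bes \<nu> \<in> borel_measurable borel"
  using bes_continuous[OF assms] by (rule borel_measurable_continuous_onI)

text \<open>A contiguous relation that trades two orders for a factor v: wherever the functions on
  the right are bounded, \<open>bes (\<nu> + 2) v\<close> is O(1/v). It drives
  \<open>bes_decay\<close>.\<close>

lemma bes_recurrence:
  assumes "\<nu> > -1"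
  shows "v * bes (\<nu> + 2) v = 4 * (\<nu> + 1) * (\<nu> + 2) * (bes (\<nu> + 1) v - bes \<nu> v)"
proof -
  have A: "(\<lambda>n. bes_coeff (\<nu> + 1) n * v ^ n - bes_coeff \<nu> n * v ^ n) sums (bes (\<nu> + 1) v - bes \<nu> v)"
    using assms by (intro sums_diff bes_sums) auto
  have c: "bes_coeff (\<nu> + 1) (Suc n) - bes_coeff \<nu> (Suc n) =
      bes_coeff (\<nu> + 2) n / (4 * (\<nu> + 1) * (\<nu> + 2))" for n
  proof -
    define P where "P = pochhammer (\<nu> + 3) n"
    have P: "P > 0" using assms by (auto simp: P_def intro!: pochhammer_pos)
    have "pochhammer (\<nu> + 2) (Suc n) = (\<nu> + 2) * P"
      using pochhammer_rec[of "\<nu> + 2" n] by (simp add: P_def add.assoc)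
    moreover have "pochhammer (\<nu> + 1) (Suc n) * (\<nu> + 2 + n) = pochhammer (\<nu> + 1) (Suc (Suc n))"
      by (simp add: pochhammer_Suc ac_simps)
    moreover have "pochhammer (\<nu> + 1) (Suc (Suc n)) = (\<nu> + 1) * ((\<nu> + 2) * P)"
      using pochhammer_rec[of "\<nu> + 1" "Suc n"] pochhammer_rec[of "\<nu> + 2" n] by (simp add: P_def add.assoc)
    ultimately have 1: "pochhammer (\<nu> + 2) (Suc n) = (\<nu> + 2) * P"
      "pochhammer (\<nu> + 1) (Suc n) = (\<nu> + 1) * (\<nu> + 2) * P / (\<nu> + 2 + n)"
      using assms by (auto simp: field_simps)
    have "(-1) ^ Suc n / (4 ^ Suc n * fact (Suc n) * ((\<nu> + 2) * P)) -
       (-1) ^ Suc n / (4 ^ Suc n * fact (Suc n) * ((\<nu> + 1) * (\<nu> + 2) * P / (\<nu> + 2 + n))) =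
       (-1) ^ n / (4 ^ n * fact n * P) / (4 * (\<nu> + 1) * (\<nu> + 2))"
      using assms P by (simp add: divide_simps) (simp add: algebra_simps)
    with 1 show ?thesis by (simp add: bes_coeff_def P_def add.assoc)
  qed
  \<comment> \<open>Both series start with 1, so the constant terms cancel and a factor v splits
    off.\<close>
  have "(\<lambda>n. bes_coeff (\<nu> + 1) (Suc n) * v ^ Suc n - bes_coeff \<nu> (Suc n) * v ^ Suc n) sums
     (bes (\<nu> + 1) v - bes \<nu> v)"
    using A sums_Suc_iff[of "\<lambda>n. bes_coeff (\<nu> + 1) n * v ^ n - bes_coeff \<nu> n * v ^ n" "bes (\<nu> + 1) v - bes \<nu> v"]
    by (simp add: bes_coeff_def)
  moreover have "bes_coeff (\<nu> + 1) (Suc n) * v ^ Suc n - bes_coeff \<nu> (Suc n) * v ^ Suc n =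
       v / (4 * (\<nu> + 1) * (\<nu> + 2)) * (bes_coeff (\<nu> + 2) n * v ^ n)" for n
    unfolding left_diff_distrib[symmetric] c by simp
  ultimately have "(\<lambda>n. v / (4 * (\<nu> + 1) * (\<nu> + 2)) * (bes_coeff (\<nu> + 2) n * v ^ n)) sums
     (bes (\<nu> + 1) v - bes \<nu> v)" by simp
  moreover have "(\<lambda>n. v / (4 * (\<nu> + 1) * (\<nu> + 2)) * (bes_coeff (\<nu> + 2) n * v ^ n)) sums
     (v / (4 * (\<nu> + 1) * (\<nu> + 2)) * bes (\<nu> + 2) v)"
    using assms by (intro sums_mult bes_sums) auto
  ultimately have "bes (\<nu> + 1) v - bes \<nu> v = v / (4 * (\<nu> + 1) * (\<nu> + 2)) * bes (\<nu> + 2) v"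
    by (rule sums_unique2)
  then show ?thesis using assms by simp
qed

lemma pochhammer_half: "pochhammer (1/2) n * (4 ^ n * fact n) = (fact (2 * n) :: real)"
  using fact_double[where 'a = real, of n] power_mult[of "2::real" 2 n] by simp

lemma bes_half: "bes (-1/2) (x\<^sup>2) = cos x"
proof -
  have "bes_coeff (-1/2) n * (x\<^sup>2) ^ n = (-1) ^ n / fact (2 * n) * x ^ (2 * n)" for n
    using pochhammer_half[of n] by (simp add: bes_coeff_def mult_ac flip: power_mult)
  then have "(\<lambda>n. (-1) ^ n / fact (2 * n) * x ^ (2 * n)) sums bes (-1/2) (x\<^sup>2)"
    using bes_sums[of "-1/2" "x\<^sup>2"] by simp
  from sums_unique2[OF this cos_paired] show ?thesis .
qed

text \<open>Since q is nonnegative, the integral of the absolute value of the n-th term is exactly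
  the n-th term of the series in \<open>sm\<close>, which permits termwise integration. Poisson's
  integral, the product formula, the transform of the Gaussian and Sonine's integral are thereby all
  reduced to computing moments.\<close>

lemma bes_moments:
  fixes q :: "'a \<Rightarrow> real"
  assumes \<nu>: "\<nu> > -1" and int: "\<And>n. integrable N (\<lambda>s. q s ^ n)"
    and q: "AE s in N. q s \<ge> 0"
    and sm: "summable (\<lambda>n. \<bar>bes_coeff \<nu> n\<bar> * \<bar>v\<bar> ^ n * (LINT s|N. q s ^ n))"
  shows "integrable N (\<lambda>s. bes \<nu> (v * q s))"
    and "(\<lambda>n. bes_coeff \<nu> n * v ^ n * (LINT s|N. q s ^ n)) sums (LINT s|N. bes \<nu> (v * q s))"
proof -
  let ?f = "\<lambda>n s. bes_coeff \<nu> n * v ^ n * q s ^ n"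
  have i: "integrable N (?f n)" for n using int by auto
  have a: "AE s in N. summable (\<lambda>n. norm (?f n s))"
    using bes_norm_summable[OF \<nu>, of "v * q s" for s]
    by (intro always_eventually allI) (simp add: power_mult_distrib mult.assoc)
  have "(LINT s|N. norm (?f n s)) = \<bar>bes_coeff \<nu> n\<bar> * \<bar>v\<bar> ^ n * (LINT s|N. q s ^ n)" for n
  proof -
    have "(LINT s|N. norm (?f n s)) = (LINT s|N. \<bar>bes_coeff \<nu> n\<bar> * \<bar>v\<bar> ^ n * q s ^ n)"
    proof (intro integral_cong_AE)
      show "(\<lambda>s. norm (?f n s)) \<in> borel_measurable N"
        using borel_measurable_integrable[OF i[of n]] by measurable
      show "(\<lambda>s. \<bar>bes_coeff \<nu> n\<bar> * \<bar>v\<bar> ^ n * q s ^ n) \<in> borel_measurable N"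
        using int[of n] by (intro borel_measurable_integrable integrable_mult_right)
      show "AE s in N. norm (?f n s) = \<bar>bes_coeff \<nu> n\<bar> * \<bar>v\<bar> ^ n * q s ^ n"
        using q by eventually_elim (simp add: abs_mult power_abs)
    qed
    then show ?thesis by simp
  qed
  then have s: "summable (\<lambda>n. LINT s|N. norm (?f n s))" using sm by simp
  have e: "(\<Sum>n. ?f n s) = bes \<nu> (v * q s)" for s
    by (simp add: bes_def power_mult_distrib mult.assoc)
  show "integrable N (\<lambda>s. bes \<nu> (v * q s))"
    using integrable_suminf[OF i a s] e by simp
  show "(\<lambda>n. bes_coeff \<nu> n * v ^ n * (LINT s|N. q s ^ n)) sums (LINT s|N. bes \<nu> (v * q s))"
    using sums_integral[OF i a s] e by simp
qed

section \<open>The Gegenbauer weight\<close>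

definition gegen :: "real \<Rightarrow> real measure" where
  "gegen \<alpha> = density lborel (\<lambda>s. ennreal (indicator {-1..1} s * (1 - s\<^sup>2) powr (\<alpha> - 1/2)))"

lemma sets_gegen [measurable_cong, simp]: "sets (gegen \<alpha>) = sets borel"
  by (simp add: gegen_def)

lemma space_gegen [simp]: "space (gegen \<alpha>) = UNIV"
  by (simp add: gegen_def)

lemma AE_gegen: "AE s in gegen \<alpha>. -1 \<le> s \<and> s \<le> 1"
  unfolding gegen_def by (subst AE_density) (auto simp: indicator_def)

text \<open>The affine map s = 2t - 1 turns 1 - s^2 into 4t(1 - t), and the weight becomes the
  integrand of Euler's Beta integral with both parameters equal to \<alpha> + 1/2 > 0.\<close>

lemma integrable_gegen_weight:
  assumes "\<alpha> > -1/2"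
  shows "integrable lborel (\<lambda>s::real. indicator {-1..1} s * (1 - s\<^sup>2) powr (\<alpha> - 1/2))"
proof -
  let ?f = "\<lambda>s::real. indicator {-1..1} s * (1 - s\<^sup>2) powr (\<alpha> - 1/2)"
  have b: "set_integrable lborel {0..1} (\<lambda>t::real. t powr (\<alpha> + 1/2 - 1) * (1 - t) powr (\<alpha> + 1/2 - 1))"
    using assms by (intro integrable_Beta) auto
  have "integrable lborel (\<lambda>t. 4 powr (\<alpha> - 1/2) * (indicator {0..1} t *\<^sub>R (t powr (\<alpha> - 1/2) * (1 - t) powr (\<alpha> - 1/2))))"
    using b unfolding set_integrable_def by (intro integrable_mult_right) auto
  moreover have "4 powr (\<alpha> - 1/2) * (indicator {0..1} t *\<^sub>R (t powr (\<alpha> - 1/2) * (1 - t) powr (\<alpha> - 1/2))) = ?f (-1 + 2 * t)" for t :: real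
  proof (cases "t \<in> {0..1}")
    case True
    have "1 - (-1 + 2 * t)\<^sup>2 = 4 * (t * (1 - t))" by (simp add: power2_eq_square algebra_simps)
    then show ?thesis using True by (simp add: powr_mult)
  qed (auto simp: indicator_def)
  ultimately have "integrable lborel (\<lambda>t. ?f (-1 + 2 * t))"
    by (simp only: )
  then show ?thesis by (subst (asm) lborel_integrable_real_affine_iff) auto
qed

lemma gegen_integral:
  fixes f :: "real \<Rightarrow> real"
  assumes [measurable]: "f \<in> borel_measurable borel"
  shows "(LINT s|gegen \<alpha>. f s) = (LINT s|lborel. indicator {-1..1} s * (1 - s\<^sup>2) powr (\<alpha> - 1/2) * f s)"
  unfolding gegen_def by (subst integral_density) auto

lemma finite_gegen:
  assumes "\<alpha> > -1/2"
  shows "finite_measure (gegen \<alpha>)"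
proof
  have "emeasure (gegen \<alpha>) UNIV = (\<integral>\<^sup>+ s. ennreal (indicator {-1..1} s * (1 - s\<^sup>2) powr (\<alpha> - 1/2)) \<partial>lborel)"
    unfolding gegen_def by (subst emeasure_density) auto
  also have "\<dots> < \<infinity>"
    using integrable_gegen_weight[OF assms] by (subst nn_integral_eq_integral) auto
  finally show "emeasure (gegen \<alpha>) (space (gegen \<alpha>)) \<noteq> \<infinity>" by simp
qed

lemma integrable_gegen_bounded:
  fixes f :: "real \<Rightarrow> real"
  assumes "\<alpha> > -1/2" and [measurable]: "f \<in> borel_measurable borel"
    and "\<And>s. -1 \<le> s \<Longrightarrow> s \<le> 1 \<Longrightarrow> \<bar>f s\<bar> \<le> K"
  shows "integrable (gegen \<alpha>) f"
proof -
  interpret finite_measure "gegen \<alpha>" by (rule finite_gegen) fact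
  show ?thesis
    using AE_gegen[of \<alpha>] assms(3) by (intro integrable_const_bound[of _ K]) auto
qed

lemma abs_power_le_one: "\<bar>s\<bar> \<le> 1 \<Longrightarrow> \<bar>(s::real) ^ n\<bar> \<le> 1"
  by (simp add: power_abs power_le_one)

lemma integrable_gegen_power:
  assumes "\<alpha> > -1/2"
  shows "integrable (gegen \<alpha>) (\<lambda>s. s ^ n)"
  using assms by (intro integrable_gegen_bounded[where K = 1]) (auto intro: abs_power_le_one)

definition gmass :: "real \<Rightarrow> real" where
  "gmass \<alpha> = (LINT s|gegen \<alpha>. 1)"

lemma gmass_pos:
  assumes "\<alpha> > -1/2"
  shows "gmass \<alpha> > 0"
proof -
  have "gmass \<alpha> = (LINT s|lborel. indicator {-1..1} s * (1 - s\<^sup>2) powr (\<alpha> - 1/2))"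
    unfolding gmass_def by (subst gegen_integral) auto
  moreover have "\<dots> \<noteq> 0"
  proof
    assume "(LINT s|lborel. indicator {-1..1} s * (1 - s\<^sup>2) powr (\<alpha> - 1/2)) = 0"
    then have "AE s in lborel. indicator {-1..1} s * (1 - s\<^sup>2) powr (\<alpha> - 1/2) = 0"
      using integrable_gegen_weight[OF assms]
      by (subst (asm) integral_nonneg_eq_0_iff_AE) auto
    then have "AE s in lborel. s \<notin> {-1<..<1::real}"
    proof eventually_elim
      case (elim s)
      show ?case
      proof
        assume "s \<in> {-1<..<1}"
        then have "\<bar>s\<bar> < 1" by auto
        then have "s\<^sup>2 < 1" by (simp add: abs_square_less_1)
        with elim \<open>s \<in> {-1<..<1}\<close> show False by (auto simp: indicator_def)
      qed
    qed
    then have "{-1<..<1::real} \<in> null_sets lborel"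
      by (subst AE_iff_null_sets) auto
    then show False by (simp add: null_sets_def)
  qed
  moreover have "(LINT s|lborel. indicator {-1..1} s * (1 - s\<^sup>2) powr (\<alpha> - 1/2)) \<ge> 0"
    by (intro integral_nonneg_AE) auto
  ultimately show ?thesis by linarith
qed

text \<open>The function \<open>s ^ k * (1 - s^2) powr (\<alpha> + 1/2)\<close> vanishes at both
  ends, and its derivative is the weight times a combination of \<open>s ^ (k - 1)\<close> and
  \<open>s ^ Suc k\<close>. The resulting two-step recursion determines all moments.\<close>

lemma gegen_FTC:
  assumes \<alpha>: "\<alpha> > -1/2"
  shows "(2 * \<alpha> + 1 + k) * (LINT s|gegen \<alpha>. s ^ Suc k) = k * (LINT s|gegen \<alpha>. s ^ (k - 1))"
proof -
  let ?w = "\<lambda>s::real. (1 - s\<^sup>2) powr (\<alpha> - 1/2)"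
  let ?g = "\<lambda>s::real. k * s ^ (k - 1) - (2 * \<alpha> + 1 + k) * s ^ Suc k"
  let ?F = "\<lambda>s::real. s ^ k * (1 - s\<^sup>2) powr (\<alpha> + 1/2)"
  have cont: "continuous_on {-1..1} ?F"
    using \<alpha> by (intro continuous_intros continuous_on_powr') (auto simp: abs_square_le_1 abs_le_iff)
  have "((\<lambda>s. ?w s * ?g s) has_integral (?F 1 - ?F (-1))) {-1..1}"
  \<comment> \<open>For \<alpha> < 1/2 the weight is singular at the end points, so the derivative
    is only taken in the interior.\<close>
  proof (rule fundamental_theorem_of_calculus_interior[OF _ cont])
    fix s :: real assume s: "s \<in> {-1<..<1}"
    then have p: "1 - s\<^sup>2 > 0" by (simp add: abs_square_less_1 abs_less_iff)
    have w: "(1 - s\<^sup>2) powr (\<alpha> + 1/2) = ?w s * (1 - s\<^sup>2)"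
      using powr_add[of "1 - s\<^sup>2" "\<alpha> - 1/2" 1] p by (simp add: add.commute)
    have "(?F has_real_derivative (k * s ^ (k - 1)) * (1 - s\<^sup>2) powr (\<alpha> + 1/2) + 
       s ^ k * ((\<alpha> + 1/2) * (1 - s\<^sup>2) powr (\<alpha> + 1/2 - 1) * (- (2 * s)))) (at s)"
      using p by (auto intro!: derivative_eq_intros)
    also have "(k * s ^ (k - 1)) * (1 - s\<^sup>2) powr (\<alpha> + 1/2) + 
       s ^ k * ((\<alpha> + 1/2) * (1 - s\<^sup>2) powr (\<alpha> + 1/2 - 1) * (- (2 * s))) = ?w s * ?g s"
    proof -
      have e: "\<alpha> + 1/2 - 1 = \<alpha> - 1/2" by simp
      have k2: "real k * s ^ (k - 1) * s\<^sup>2 = k * s ^ Suc k"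
        by (cases k) (auto simp: power2_eq_square)
      have "(k * s ^ (k - 1)) * (?w s * (1 - s\<^sup>2)) + s ^ k * ((\<alpha> + 1/2) * ?w s * (- (2 * s)))
         = ?w s * (k * s ^ (k - 1) - k * s ^ (k - 1) * s\<^sup>2 - (2 * \<alpha> + 1) * s ^ Suc k)"
        by (simp add: algebra_simps)
      also have "\<dots> = ?w s * ?g s" unfolding k2 by (simp add: algebra_simps)
      finally show ?thesis unfolding w e .
    qed
    finally show "(?F has_vector_derivative ?w s * ?g s) (at s)"
      by (simp add: has_real_derivative_iff_has_vector_derivative)
  qed simp
  then have 1: "((\<lambda>s. indicator {-1..1} s * ?w s * ?g s) has_integral 0) UNIV"
  proof (subst (asm) has_integral_restrict_UNIV[symmetric])
    have "(\<lambda>s. if s \<in> {-1..1} then ?w s * ?g s else 0) = (\<lambda>s. indicator {-1..1} s * ?w s * ?g s)"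
      by (auto simp: fun_eq_iff indicator_def)
    moreover assume "((\<lambda>s. if s \<in> {-1..1} then ?w s * ?g s else 0) has_integral (?F 1 - ?F (-1))) UNIV"
    ultimately show ?thesis by simp
  qed
  have ig: "integrable (gegen \<alpha>) ?g"
    by (intro Bochner_Integration.integrable_diff integrable_mult_right integrable_gegen_power[OF \<alpha>])
  then have "integrable lborel (\<lambda>s. (indicator {-1..1} s * ?w s) *\<^sub>R ?g s)"
    unfolding gegen_def by (subst (asm) integrable_density) auto
  then have "((\<lambda>s. indicator {-1..1} s * ?w s * ?g s) has_integral 
      (LINT s|lborel. indicator {-1..1} s * ?w s * ?g s)) UNIV"
    using has_integral_integral_lborel[of "\<lambda>s. indicator {-1..1} s * ?w s * ?g s"]
    by (simp only: real_scaleR_def)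
  from has_integral_unique[OF this 1] have "(LINT s|gegen \<alpha>. ?g s) = 0"
    by (subst gegen_integral) auto
  then show ?thesis
    using integrable_gegen_power[OF \<alpha>]
    by (subst (asm) Bochner_Integration.integral_diff) (auto simp del: power_Suc)
qed

text \<open>The recursion at k = 0 reads (2\<alpha> + 1) times the first moment = 0, and it then
  propagates to all odd orders.\<close>

lemma gegen_odd_moment:
  assumes \<alpha>: "\<alpha> > -1/2"
  shows "(LINT s|gegen \<alpha>. s ^ Suc (2 * n)) = 0"
proof (induction n)
  case 0 then show ?case using gegen_FTC[OF \<alpha>, of 0] \<alpha> by simp
next
  case (Suc n)
  have "(2 * \<alpha> + 1 + real (2 * Suc n)) * (LINT s|gegen \<alpha>. s ^ Suc (2 * Suc n)) = 0"
    using gegen_FTC[OF \<alpha>, of "2 * Suc n"] Suc by simp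
  then show ?case using \<alpha> by (simp del: power_Suc)
qed

text \<open>By \<open>pochhammer_half\<close>, the fraction is the quotient of the Pochhammer
  symbols of 1/2 and of \<alpha> + 1.\<close>

lemma gegen_even_moment:
  assumes \<alpha>: "\<alpha> > -1/2"
  shows "(LINT s|gegen \<alpha>. s ^ (2 * n)) =
    gmass \<alpha> * (fact (2 * n) / (4 ^ n * fact n * pochhammer (\<alpha> + 1) n))"
proof (induction n)
  case (Suc n)
  have p: "pochhammer (\<alpha> + 1) n > 0" using assms by (intro pochhammer_pos) auto
  have "(2 * \<alpha> + 2 + 2 * n) * (LINT s|gegen \<alpha>. s ^ (2 * Suc n)) = (2 * n + 1) * (LINT s|gegen \<alpha>. s ^ (2 * n))"
    using gegen_FTC[OF \<alpha>, of "2 * n + 1"] by (simp add: algebra_simps)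
  moreover have "2 * \<alpha> + 2 + 2 * n > 0" using \<alpha> by linarith
  ultimately have "(LINT s|gegen \<alpha>. s ^ (2 * Suc n)) = 
     (2 * n + 1) / (2 * \<alpha> + 2 + 2 * n) * (LINT s|gegen \<alpha>. s ^ (2 * n))"
    by (simp add: field_simps)
  also have "\<dots> = gmass \<alpha> * ((2 * n + 1) / (2 * \<alpha> + 2 + 2 * n) * (fact (2 * n) / (4 ^ n * fact n * pochhammer (\<alpha> + 1) n)))"
    unfolding Suc by simp
  also have "(2 * n + 1) / (2 * \<alpha> + 2 + 2 * n) * (fact (2 * n) / (4 ^ n * fact n * pochhammer (\<alpha> + 1) n))
     = fact (2 * Suc n) / (4 ^ Suc n * fact (Suc n) * pochhammer (\<alpha> + 1) (Suc n))"
  proof -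
    have "\<alpha> + 1 + n > 0" using \<alpha> by linarith
    moreover have "2 * \<alpha> + 2 + 2 * n > 0" using \<alpha> by linarith
    ultimately show ?thesis using p 
      by (simp add: pochhammer_Suc divide_simps) (simp add: algebra_simps)
  qed
  finally show ?case .
qed (simp add: gmass_def)

text \<open>Poisson's integral represents the Bessel function as an average of cosines.\<close>

lemma bes_bounded:
  assumes \<alpha>: "\<alpha> > -1/2" and v: "v \<ge> 0"
  shows "\<bar>bes \<alpha> v\<bar> \<le> 1"
proof -
  define B where "B = gmass \<alpha>"
  have B: "B > 0" using gmass_pos[OF \<alpha>] by (simp add: B_def)
  define x where "x = sqrt v"
  have x: "x\<^sup>2 = v" using v by (simp add: x_def)
  \<comment> \<open>The even moment replaces the Pochhammer symbol of 1/2 in the cosine coefficients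
    by that of \<alpha> + 1, which changes the order from -1/2 to \<alpha>.\<close>
  have m: "bes_coeff (-1/2) n * w * (LINT s|gegen \<alpha>. (s\<^sup>2) ^ n) = B * (bes_coeff \<alpha> n * w)" for n w
  proof -
    have "bes_coeff (-1/2) n * fact (2 * n) = (-1) ^ n"
      using pochhammer_half[of n] by (simp add: bes_coeff_def mult_ac)
    then have "bes_coeff (-1/2) n * (LINT s|gegen \<alpha>. s ^ (2 * n)) = B * bes_coeff \<alpha> n"
      unfolding gegen_even_moment[OF \<alpha>] B_def[symmetric]
      by (simp add: bes_coeff_def[of \<alpha>] mult.left_commute[of _ B] mult_ac)
    then show ?thesis by (simp add: mult_ac flip: power_mult)
  qed
  have int: "integrable (gegen \<alpha>) (\<lambda>s. (s\<^sup>2) ^ n)" for n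
    using integrable_gegen_power[OF \<alpha>, of "2 * n"] by (simp add: power_mult)
  have "\<bar>bes_coeff (-1/2) n\<bar> * \<bar>v\<bar> ^ n * (LINT s|gegen \<alpha>. (s\<^sup>2) ^ n) = B * norm (bes_coeff \<alpha> n * v ^ n)" for n
  proof -
    have "(LINT s|gegen \<alpha>. (s\<^sup>2) ^ n) \<ge> 0" by (intro integral_nonneg_AE) auto
    then have "\<bar>bes_coeff (-1/2) n\<bar> * \<bar>v\<bar> ^ n * (LINT s|gegen \<alpha>. (s\<^sup>2) ^ n)
      = \<bar>bes_coeff (-1/2) n * v ^ n * (LINT s|gegen \<alpha>. (s\<^sup>2) ^ n)\<bar>"
      by (simp add: abs_mult power_abs)
    also have "\<dots> = B * norm (bes_coeff \<alpha> n * v ^ n)"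
      by (subst m) (use B in \<open>simp add: abs_mult\<close>)
    finally show ?thesis .
  qed
  then have sm: "summable (\<lambda>n. \<bar>bes_coeff (-1/2) n\<bar> * \<bar>v\<bar> ^ n * (LINT s|gegen \<alpha>. (s\<^sup>2) ^ n))"
    using summable_mult[OF bes_norm_summable[of \<alpha> v], of B] \<alpha> by simp
  have a: "AE s in gegen \<alpha>. 0 \<le> s\<^sup>2" by simp
  have h: "(-1/2::real) > -1" by simp
  have "(\<lambda>n. bes_coeff (-1/2) n * v ^ n * (LINT s|gegen \<alpha>. (s\<^sup>2) ^ n)) sums
      (LINT s|gegen \<alpha>. bes (-1/2) (v * s\<^sup>2))"
    by (rule bes_moments(2)[OF h int a sm])
  then have "(\<lambda>n. B * (bes_coeff \<alpha> n * v ^ n)) sums (LINT s|gegen \<alpha>. bes (-1/2) (v * s\<^sup>2))"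
    unfolding m .
  moreover have "(\<lambda>n. B * (bes_coeff \<alpha> n * v ^ n)) sums (B * bes \<alpha> v)"
    using \<alpha> by (intro sums_mult bes_sums) auto
  ultimately have "B * bes \<alpha> v = (LINT s|gegen \<alpha>. bes (-1/2) (v * s\<^sup>2))"
    by (metis sums_unique2)
  also have "\<dots> = (LINT s|gegen \<alpha>. cos (x * s))"
    by (simp add: bes_half[symmetric] x power_mult_distrib)
  finally have "\<bar>B * bes \<alpha> v\<bar> = \<bar>LINT s|gegen \<alpha>. cos (x * s)\<bar>" by simp
  also have "\<dots> \<le> (LINT s|gegen \<alpha>. \<bar>cos (x * s)\<bar>)" by (rule integral_abs_bound)
  also have "\<dots> \<le> B" unfolding B_def gmass_def
    by (intro integral_mono integrable_gegen_bounded[where K=1] \<alpha>) auto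
  finally show ?thesis using B by (simp add: abs_mult)
qed

text \<open>Induction on k with \<open>bes_recurrence\<close> at order \<alpha> + 2k. Its right-hand
  side contains the orders \<alpha> + 1 + 2k and \<alpha> + 2k, so the induction hypothesis is
  applied at both \<alpha> + 1 and \<alpha>; hence \<alpha> is generalized. The rate is not sharp,
  but k can be taken as large as desired.\<close>

lemma bes_decay:
  assumes "\<alpha> > -1/2"
  shows "\<exists>C. \<forall>v\<ge>0. \<bar>bes (\<alpha> + 2 * real k) v\<bar> * v ^ k \<le> C"
  using assms
proof (induction k arbitrary: \<alpha>)
  case 0
  then show ?case using bes_bounded by auto
next
  case (Suc k)
  from Suc.IH[of \<alpha>] Suc.prems obtain C1 where C1: "\<And>v. v \<ge> 0 \<Longrightarrow> \<bar>bes (\<alpha> + 2 * real k) v\<bar> * v ^ k \<le> C1" by blast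
  from Suc.IH[of "\<alpha> + 1"] Suc.prems obtain C2 where C2: "\<And>v. v \<ge> 0 \<Longrightarrow> \<bar>bes (\<alpha> + 1 + 2 * real k) v\<bar> * v ^ k \<le> C2" by fastforce
  define \<nu> where "\<nu> = \<alpha> + 2 * real k"
  have \<nu>: "\<nu> > -1" using Suc.prems by (simp add: \<nu>_def)
  define D where "D = 4 * (\<nu> + 1) * (\<nu> + 2)"
  have D: "D > 0" using \<nu> by (simp add: D_def)
  have "\<bar>bes (\<alpha> + 2 * real (Suc k)) v\<bar> * v ^ Suc k \<le> D * (C2 + C1)" if v: "v \<ge> 0" for v
  proof -
    have "\<bar>bes (\<alpha> + 2 * real (Suc k)) v\<bar> * v ^ Suc k = \<bar>v * bes (\<nu> + 2) v\<bar> * v ^ k"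
      using v by (simp add: \<nu>_def abs_mult algebra_simps)
    also have "\<dots> = D * \<bar>bes (\<nu> + 1) v - bes \<nu> v\<bar> * v ^ k"
      unfolding bes_recurrence[OF \<nu>] D_def[symmetric] using D by (simp add: abs_mult)
    also have "\<dots> \<le> D * (\<bar>bes (\<nu> + 1) v\<bar> + \<bar>bes \<nu> v\<bar>) * v ^ k"
      using D v by (intro mult_right_mono mult_left_mono) auto
    also have "\<dots> = D * (\<bar>bes (\<alpha> + 1 + 2 * real k) v\<bar> * v ^ k + \<bar>bes (\<alpha> + 2 * real k) v\<bar> * v ^ k)"
      by (simp add: \<nu>_def algebra_simps)
    also have "\<dots> \<le> D * (C2 + C1)"
      using C1[OF v] C2[OF v] D by (intro mult_left_mono) auto
    finally show ?thesis .
  qed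
  then show ?case by blast
qed

section \<open>The product formula\<close>

text \<open>The coefficient of w^n in \<open>bes \<alpha> (w * Y) * bes \<alpha> (w * Z)\<close>
  divided by \<open>bes_coeff \<alpha> n\<close>. At squares Y = y^2 and Z = z^2 it turns out to be
  the normalized n-th moment of y^2 + z^2 - 2yzs under the Gegenbauer weight; the agreement of the
  two descriptions is the product formula on the level of coefficients.\<close>

definition bes_poly :: "real \<Rightarrow> real \<Rightarrow> real \<Rightarrow> nat \<Rightarrow> real" where
  "bes_poly \<alpha> Y Z n = (\<Sum>a\<le>n. fact n * pochhammer (\<alpha> + 1) n /
     (fact a * fact (n - a) * pochhammer (\<alpha> + 1) a * pochhammer (\<alpha> + 1) (n - a)) * (Y ^ a * Z ^ (n - a)))"

lemma pochhammer_split: "pochhammer (z::real) (a + b) = pochhammer z a * pochhammer (z + a) b"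
  using pochhammer_product'[of z a b] by simp

text \<open>Up to the common factor \<open>fact b * pochhammer \<nu> a\<close>, the summand is the
  product of the generalized binomial coefficients b over m and \<nu> + a - 1 over a - m, so
  Vandermonde's convolution applies. The terms with m > b vanish there, which accounts for the
  \<open>min\<close>.\<close>

lemma chu_vandermonde:
  assumes \<nu>: "(\<nu>::real) > 0"
  shows "(\<Sum>m\<le>min a b. 1 / (fact (a - m) * fact (b - m) * fact m * pochhammer \<nu> m)) =
     pochhammer \<nu> (a + b) / (fact a * fact b * pochhammer \<nu> a * pochhammer \<nu> b)"
proof -
  have pos: "pochhammer \<nu> k > 0" for k using \<nu> by (rule pochhammer_pos)
  have b1: "(real b gchoose k) = (if k \<le> b then fact b / (fact k * fact (b - k)) else 0)" for k
    by (simp add: binomial_gbinomial[symmetric] binomial_fact)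
  have g1: "(\<nu> + a - 1 gchoose (a - m)) = pochhammer \<nu> a / (pochhammer \<nu> m * fact (a - m))" if "m \<le> a" for m
  proof -
    have "pochhammer \<nu> a = pochhammer \<nu> m * pochhammer (\<nu> + m) (a - m)"
      using pochhammer_split[of \<nu> m "a - m"] that by simp
    then show ?thesis using pos[of m] that
      by (simp add: gbinomial_pochhammer' of_nat_diff add.commute)
  qed
  have g2: "(real b + (\<nu> + a - 1) gchoose a) = pochhammer \<nu> (a + b) / (pochhammer \<nu> b * fact a)"
    using pochhammer_split[of \<nu> b a] pos[of b] by (simp add: gbinomial_pochhammer' add_ac)
  have "(\<Sum>m\<le>min a b. 1 / (fact (a - m) * fact (b - m) * fact m * pochhammer \<nu> m)) =
     (\<Sum>m\<le>a. if m \<le> b then 1 / (fact (a - m) * fact (b - m) * fact m * pochhammer \<nu> m) else 0)"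
    by (rule sum.mono_neutral_cong_left) auto
  also have "\<dots> = (\<Sum>m\<le>a. (real b gchoose m) * (\<nu> + a - 1 gchoose (a - m))) / (fact b * pochhammer \<nu> a)"
    unfolding sum_divide_distrib using pos 
    by (intro sum.cong refl) (auto simp: b1 g1 field_simps less_imp_neq[OF pos, symmetric])
  also have "\<dots> = (real b + (\<nu> + a - 1) gchoose a) / (fact b * pochhammer \<nu> a)"
    using gbinomial_Vandermonde[of "real b" "\<nu> + a - 1" a] by (simp add: atLeast0AtMost)
  also have "\<dots> = pochhammer \<nu> (a + b) / (fact a * fact b * pochhammer \<nu> a * pochhammer \<nu> b)"
    unfolding g2 by (simp add: mult_ac)
  finally show ?thesis .
qed

text \<open>The shape in which the moments arrive is a polynomial in Y + Z and YZ. Expanding the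
  powers of Y + Z and collecting the coefficient of Y^a Z^(n - a) leaves a sum over m, which
  \<open>chu_vandermonde\<close> evaluates.\<close>

lemma bes_poly_alt:
  assumes \<alpha>: "\<alpha> > -1"
  shows "bes_poly \<alpha> Y Z n = 
    (\<Sum>m\<le>n div 2. fact n / (fact (n - 2 * m) * fact m * pochhammer (\<alpha> + 1) m) * (Y + Z) ^ (n - 2 * m) * (Y * Z) ^ m)"
proof -
  have pos: "pochhammer (\<alpha> + 1) k > 0" for k using \<alpha> by (intro pochhammer_pos) auto
  let ?g = "\<lambda>a m. fact n * (1 / (fact (a - m) * fact (n - a - m) * fact m * pochhammer (\<alpha> + 1) m)) * (Y ^ a * Z ^ (n - a))"
  have "(\<Sum>m\<le>n div 2. fact n / (fact (n - 2 * m) * fact m * pochhammer (\<alpha> + 1) m) * (Y + Z) ^ (n - 2 * m) * (Y * Z) ^ m)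
    = (\<Sum>m\<le>n div 2. \<Sum>i\<le>n - 2 * m. ?g (m + i) m)"
  proof (intro sum.cong refl)
    fix m assume "m \<in> {..n div 2}"
    then have m: "2 * m \<le> n" by auto
    have "(Y + Z) ^ (n - 2 * m) * (Y * Z) ^ m = 
       (\<Sum>i\<le>n - 2 * m. fact (n - 2 * m) / (fact i * fact (n - 2 * m - i)) * (Y ^ (m + i) * Z ^ (n - (m + i))))"
      unfolding binomial_ring sum_distrib_right
    proof (intro sum.cong refl)
      fix i assume i: "i \<in> {..n - 2 * m}"
      with m have "n - (m + i) = (n - 2 * m - i) + m" by auto
      then have "Y ^ (m + i) * Z ^ (n - (m + i)) = Y ^ i * Z ^ (n - 2 * m - i) * (Y * Z) ^ m"
        by (simp add: power_add power_mult_distrib mult_ac)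
      then show "of_nat (n - 2 * m choose i) * Y ^ i * Z ^ (n - 2 * m - i) * (Y * Z) ^ m =
         fact (n - 2 * m) / (fact i * fact (n - 2 * m - i)) * (Y ^ (m + i) * Z ^ (n - (m + i)))"
        using i by (simp add: binomial_fact)
    qed
    then have "fact n / (fact (n - 2 * m) * fact m * pochhammer (\<alpha> + 1) m) * ((Y + Z) ^ (n - 2 * m) * (Y * Z) ^ m) =
      (\<Sum>i\<le>n - 2 * m. fact n / (fact (n - 2 * m) * fact m * pochhammer (\<alpha> + 1) m) * 
       (fact (n - 2 * m) / (fact i * fact (n - 2 * m - i)) * (Y ^ (m + i) * Z ^ (n - (m + i)))))"
      by (simp only: sum_distrib_left)
    also have "\<dots> = (\<Sum>i\<le>n - 2 * m. ?g (m + i) m)"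
    proof (intro sum.cong refl)
      fix i assume i: "i \<in> {..n - 2 * m}"
      have e: "n - (m + i) - m = n - 2 * m - i" by simp
      show "fact n / (fact (n - 2 * m) * fact m * pochhammer (\<alpha> + 1) m) * 
       (fact (n - 2 * m) / (fact i * fact (n - 2 * m - i)) * (Y ^ (m + i) * Z ^ (n - (m + i)))) = ?g (m + i) m"
        unfolding e by (simp add: mult_ac)
    qed
    finally show "fact n / (fact (n - 2 * m) * fact m * pochhammer (\<alpha> + 1) m) * (Y + Z) ^ (n - 2 * m) * (Y * Z) ^ m = 
      (\<Sum>i\<le>n - 2 * m. ?g (m + i) m)"
      by (simp only: mult.assoc)
  qed
  also have "\<dots> = (\<Sum>(m, i)\<in>(SIGMA m:{..n div 2}. {..n - 2 * m}). ?g (m + i) m)"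
    by (subst sum.Sigma) auto
  \<comment> \<open>With a = m + i, the condition i \<ge> 0 becomes m \<le> a, and i \<le> n - 2m
    becomes m \<le> n - a.\<close>
  also have "\<dots> = (\<Sum>(a, m)\<in>(SIGMA a:{..n}. {..min a (n - a)}). ?g a m)"
    by (rule sum.reindex_bij_witness[of _ "\<lambda>(a, m). (m, a - m)" "\<lambda>(m, i). (m + i, m)"]) auto
  also have "\<dots> = (\<Sum>a\<le>n. \<Sum>m\<le>min a (n - a). ?g a m)"
    by (subst sum.Sigma) auto
  also have "\<dots> = bes_poly \<alpha> Y Z n"
    unfolding bes_poly_def
  proof (intro sum.cong refl)
    fix a assume a: "a \<in> {..n}"
    have "(\<Sum>m\<le>min a (n - a). ?g a m) = fact n * (\<Sum>m\<le>min a (n - a). 1 / (fact (a - m) * fact (n - a - m) * fact m * pochhammer (\<alpha> + 1) m)) * (Y ^ a * Z ^ (n - a))"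
      by (simp only: sum_distrib_left sum_distrib_right)
    also have "\<dots> = fact n * (pochhammer (\<alpha> + 1) (a + (n - a)) / (fact a * fact (n - a) * pochhammer (\<alpha> + 1) a * pochhammer (\<alpha> + 1) (n - a))) * (Y ^ a * Z ^ (n - a))"
      using \<alpha> by (subst chu_vandermonde) auto
    finally show "(\<Sum>m\<le>min a (n - a). ?g a m) = fact n * pochhammer (\<alpha> + 1) n /
     (fact a * fact (n - a) * pochhammer (\<alpha> + 1) a * pochhammer (\<alpha> + 1) (n - a)) * (Y ^ a * Z ^ (n - a))"
      using a by simp
  qed
  finally show ?thesis by simp
qed

lemma bes_prod_sums:
  assumes \<alpha>: "\<alpha> > -1"
  shows "(\<lambda>n. bes_coeff \<alpha> n * w ^ n * bes_poly \<alpha> Y Z n) sums (bes \<alpha> (w * Y) * bes \<alpha> (w * Z))"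
proof -
  have pos: "pochhammer (\<alpha> + 1) k > 0" for k using \<alpha> by (intro pochhammer_pos) auto
  have "(\<lambda>n. \<Sum>a\<le>n. (bes_coeff \<alpha> a * (w * Y) ^ a) * (bes_coeff \<alpha> (n - a) * (w * Z) ^ (n - a))) sums
    ((\<Sum>n. bes_coeff \<alpha> n * (w * Y) ^ n) * (\<Sum>n. bes_coeff \<alpha> n * (w * Z) ^ n))"
    using bes_norm_summable[OF \<alpha>] by (intro Cauchy_product_sums)
  moreover have "(\<Sum>a\<le>n. (bes_coeff \<alpha> a * (w * Y) ^ a) * (bes_coeff \<alpha> (n - a) * (w * Z) ^ (n - a))) =
     bes_coeff \<alpha> n * w ^ n * bes_poly \<alpha> Y Z n" for n
    unfolding bes_poly_def sum_distrib_left
  proof (intro sum.cong refl)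
    fix a assume "a \<in> {..n}"
    then obtain b where n: "n = a + b" by (auto simp: le_iff_add)
    show "(bes_coeff \<alpha> a * (w * Y) ^ a) * (bes_coeff \<alpha> (n - a) * (w * Z) ^ (n - a)) =
       bes_coeff \<alpha> n * w ^ n * (fact n * pochhammer (\<alpha> + 1) n /
     (fact a * fact (n - a) * pochhammer (\<alpha> + 1) a * pochhammer (\<alpha> + 1) (n - a)) * (Y ^ a * Z ^ (n - a)))"
      using pos[of n] pos[of a] pos[of b] unfolding n
      by (simp add: bes_coeff_def power_add power_mult_distrib field_simps)
  qed
  ultimately show ?thesis by (simp add: bes_def)
qed

lemma gegen_integral_sum_power:
  fixes Y r :: real
  assumes \<alpha>: "\<alpha> > -1/2"
  shows "(LINT s|gegen \<alpha>. s ^ j * (Y - r * s) ^ n) =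
     (\<Sum>l\<le>n. (n choose l) * Y ^ (n - l) * (- r) ^ l * (LINT s|gegen \<alpha>. s ^ (j + l)))"
proof -
  have "(LINT s|gegen \<alpha>. s ^ j * (Y - r * s) ^ n) = 
    (LINT s|gegen \<alpha>. (\<Sum>l\<le>n. (n choose l) * Y ^ (n - l) * (- r) ^ l * s ^ (j + l)))"
  proof (intro Bochner_Integration.integral_cong refl)
    fix s :: real
    have "(Y - r * s) ^ n = (\<Sum>l\<le>n. of_nat (n choose l) * ((- r) ^ l * s ^ l) * Y ^ (n - l))"
      using binomial_ring[of "(- r) * s" Y n] unfolding power_mult_distrib by simp
    then show "s ^ j * (Y - r * s) ^ n = (\<Sum>l\<le>n. (n choose l) * Y ^ (n - l) * (- r) ^ l * s ^ (j + l))"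
      by (simp add: sum_distrib_left power_add mult_ac)
  qed
  then show ?thesis
    using integrable_gegen_power[OF \<alpha>] by (simp add: Bochner_Integration.integral_sum)
qed

lemma sum_even_half:
  fixes f :: "nat \<Rightarrow> real"
  assumes "\<And>l. odd l \<Longrightarrow> f l = 0"
  shows "(\<Sum>l\<le>n. f l) = (\<Sum>m\<le>n div 2. f (2 * m))"
proof -
  have "(\<Sum>m\<le>n div 2. f (2 * m)) = sum f ((\<lambda>m. 2 * m) ` {..n div 2})"
    by (subst sum.reindex) (auto simp: inj_on_def)
  also have "\<dots> = (\<Sum>l\<le>n. f l)"
  proof (intro sum.mono_neutral_left ballI)
    fix l assume "l \<in> {..n} - (\<lambda>m. 2 * m) ` {..n div 2}"
    then have "odd l" by (auto simp: image_iff elim!: evenE)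
    then show "f l = 0" by (rule assms)
  qed auto
  finally show ?thesis by simp
qed

text \<open>Only even powers of s survive in the binomial expansion. The factor
  \<open>fact (2 * m)\<close> of their moments cancels against the binomial coefficient, and the sum
  of \<open>bes_poly_alt\<close> remains.\<close>

lemma gegen_moment_even_part:
  assumes \<alpha>: "\<alpha> > -1/2"
  shows "(LINT s|gegen \<alpha>. (Y\<^sup>2 + Z\<^sup>2 - 2 * Y * Z * s) ^ n) = gmass \<alpha> * bes_poly \<alpha> (Y\<^sup>2) (Z\<^sup>2) n"
proof -
  have pos: "pochhammer (\<alpha> + 1) k > 0" for k using \<alpha> by (intro pochhammer_pos) auto
  have "(LINT s|gegen \<alpha>. (Y\<^sup>2 + Z\<^sup>2 - 2 * Y * Z * s) ^ n) = 
    (\<Sum>l\<le>n. (n choose l) * (Y\<^sup>2 + Z\<^sup>2) ^ (n - l) * (- (2 * Y * Z)) ^ l * (LINT s|gegen \<alpha>. s ^ l))"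
    using gegen_integral_sum_power[OF \<alpha>, of 0 "Y\<^sup>2 + Z\<^sup>2" "2 * Y * Z" n] by simp
  also have "\<dots> = (\<Sum>m\<le>n div 2. (n choose (2 * m)) * (Y\<^sup>2 + Z\<^sup>2) ^ (n - 2 * m) * (- (2 * Y * Z)) ^ (2 * m) * (LINT s|gegen \<alpha>. s ^ (2 * m)))"
  proof (rule sum_even_half)
    fix l :: nat assume "odd l"
    then obtain k where "l = Suc (2 * k)" by (auto elim!: oddE)
    then show "(n choose l) * (Y\<^sup>2 + Z\<^sup>2) ^ (n - l) * (- (2 * Y * Z)) ^ l * (LINT s|gegen \<alpha>. s ^ l) = 0"
      using gegen_odd_moment[OF \<alpha>, of k] by (simp del: power_Suc)
  qed
  also have "\<dots> = gmass \<alpha> * bes_poly \<alpha> (Y\<^sup>2) (Z\<^sup>2) n"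
    using \<alpha>
  proof (subst bes_poly_alt, simp, unfold sum_distrib_left, intro sum.cong refl)
    fix m assume "m \<in> {..n div 2}"
    then have m: "2 * m \<le> n" by auto
    have e: "(- (2 * Y * Z)) ^ (2 * m) = 4 ^ m * (Y\<^sup>2 * Z\<^sup>2) ^ m"
      by (simp add: power_mult power_mult_distrib)
    show "(n choose (2 * m)) * (Y\<^sup>2 + Z\<^sup>2) ^ (n - 2 * m) * (- (2 * Y * Z)) ^ (2 * m) * (LINT s|gegen \<alpha>. s ^ (2 * m)) =
      gmass \<alpha> * (fact n / (fact (n - 2 * m) * fact m * pochhammer (\<alpha> + 1) m) * (Y\<^sup>2 + Z\<^sup>2) ^ (n - 2 * m) * (Y\<^sup>2 * Z\<^sup>2) ^ m)"
      unfolding e gegen_even_moment[OF \<alpha>] using pos[of m] m by (simp add: binomial_fact mult_ac)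
  qed
  finally show ?thesis .
qed

text \<open>The additional factor s selects the odd powers of the expansion. The moment of order 2m
  + 2 contributes \<open>pochhammer (\<alpha> + 1) (Suc m)\<close>, which is \<alpha> + 1 times
  \<open>pochhammer (\<alpha> + 2) m\<close>; so the order rises to \<alpha> + 1, as it does in the
  odd part of the Dunkl kernel.\<close>

lemma gegen_moment_odd_part:
  assumes \<alpha>: "\<alpha> > -1/2"
  shows "(LINT s|gegen \<alpha>. s * (Y\<^sup>2 + Z\<^sup>2 - 2 * Y * Z * s) ^ Suc n) = 
    - gmass \<alpha> * Y * Z * (Suc n / (\<alpha> + 1)) * bes_poly (\<alpha> + 1) (Y\<^sup>2) (Z\<^sup>2) n"
proof -
  have pos: "pochhammer (\<alpha> + 1) k > 0" "pochhammer (\<alpha> + 2) k > 0" for k using \<alpha> by (auto intro!: pochhammer_pos)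
  let ?c = "\<lambda>l. (Suc n choose l) * (Y\<^sup>2 + Z\<^sup>2) ^ (Suc n - l) * (- (2 * Y * Z)) ^ l * (LINT s|gegen \<alpha>. s ^ Suc l)"
  have "(LINT s|gegen \<alpha>. s * (Y\<^sup>2 + Z\<^sup>2 - 2 * Y * Z * s) ^ Suc n) = (\<Sum>l\<le>Suc n. ?c l)"
    using gegen_integral_sum_power[OF \<alpha>, of 1 "Y\<^sup>2 + Z\<^sup>2" "2 * Y * Z" "Suc n"] by simp
  also have "\<dots> = ?c 0 + (\<Sum>l\<le>n. ?c (Suc l))"
    by (rule sum.atMost_Suc_shift)
  also have "?c 0 = 0"
    using gegen_odd_moment[OF \<alpha>, of 0] by simp
  also have "(\<Sum>l\<le>n. ?c (Suc l)) = (\<Sum>m\<le>n div 2. ?c (Suc (2 * m)))"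
  proof (rule sum_even_half)
    fix l :: nat assume "odd l"
    then obtain k where "l = Suc (2 * k)" by (auto elim!: oddE)
    then have "Suc (Suc l) = Suc (2 * Suc k)" by simp
    then show "?c (Suc l) = 0"
      using gegen_odd_moment[OF \<alpha>, of "Suc k"] by (simp del: power_Suc)
  qed
  also have "\<dots> = - gmass \<alpha> * Y * Z * (Suc n / (\<alpha> + 1)) * bes_poly (\<alpha> + 1) (Y\<^sup>2) (Z\<^sup>2) n"
    using \<alpha>
  proof (subst bes_poly_alt, simp, unfold sum_distrib_left, intro sum.cong refl)
    fix m assume "m \<in> {..n div 2}"
    then have m: "2 * m \<le> n" by auto
    have e: "(- (2 * Y * Z)) ^ Suc (2 * m) = - 2 * Y * Z * (4 ^ m * (Y\<^sup>2 * Z\<^sup>2) ^ m)"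
      by (simp add: power_mult power_mult_distrib)
    have "Suc (Suc (2 * m)) = 2 * Suc m" by simp
    then have l: "(LINT s|gegen \<alpha>. s ^ Suc (Suc (2 * m))) = gmass \<alpha> * (fact (2 * Suc m) / (4 ^ Suc m * fact (Suc m) * pochhammer (\<alpha> + 1) (Suc m)))"
      by (simp only: gegen_even_moment[OF \<alpha>])
    have b: "real (Suc n choose Suc (2 * m)) = fact (Suc n) / (fact (Suc (2 * m)) * fact (n - 2 * m))"
      using m by (subst binomial_fact) auto
    have p: "pochhammer (\<alpha> + 1) (Suc m) = (\<alpha> + 1) * pochhammer (\<alpha> + 2) m"
      by (simp add: pochhammer_rec add.assoc)
    have f: "fact (2 * Suc m) = 2 * real (Suc m) * fact (Suc (2 * m))" by simp
    have s: "Suc n - Suc (2 * m) = n - 2 * m" by simp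
    show "?c (Suc (2 * m)) = - gmass \<alpha> * Y * Z * (Suc n / (\<alpha> + 1)) *
      (fact n / (fact (n - 2 * m) * fact m * pochhammer (\<alpha> + 1 + 1) m) * (Y\<^sup>2 + Z\<^sup>2) ^ (n - 2 * m) * (Y\<^sup>2 * Z\<^sup>2) ^ m)"
      unfolding e l b p f s fact_Suc[of n] fact_Suc[of m] using pos[of m] \<alpha> 
      by (simp add: add.assoc divide_simps del: fact_Suc)
  qed
  finally show ?thesis by simp
qed

text \<open>The real part of E(-ixy) times the conjugate of E(-ixz), see
  \<open>ker_mult_cnj\<close>: the product of the even parts of the two kernels plus the product of
  their odd parts.\<close>

definition bes_prod :: "real \<Rightarrow> real \<Rightarrow> real \<Rightarrow> real \<Rightarrow> real" where
  "bes_prod \<alpha> x y z = bes \<alpha> ((x * y)\<^sup>2) * bes \<alpha> ((x * z)\<^sup>2) +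
     (x * y / (2 * (\<alpha> + 1)) * bes (\<alpha> + 1) ((x * y)\<^sup>2)) * (x * z / (2 * (\<alpha> + 1)) * bes (\<alpha> + 1) ((x * z)\<^sup>2))"

lemma gegen_arg_nonneg: "-1 \<le> s \<Longrightarrow> s \<le> 1 \<Longrightarrow> 0 \<le> (y::real)\<^sup>2 + z\<^sup>2 - 2 * y * z * s"
proof -
  assume "-1 \<le> s" "s \<le> 1"
  then have "\<bar>y * z * s\<bar> \<le> \<bar>y * z\<bar>" by (simp add: abs_mult mult_left_le)
  moreover have "2 * \<bar>y * z\<bar> \<le> y\<^sup>2 + z\<^sup>2"
    using zero_le_power2[of "\<bar>y\<bar> - \<bar>z\<bar>"] by (simp add: power2_diff abs_mult)
  ultimately show ?thesis by (auto simp: abs_le_iff)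
qed

text \<open>In the weight 1 + s, the constant 1 produces the product of the even parts and s the
  product of the odd parts. The two are integrated together, because 1 + s is nonnegative on [-1, 1]
  and gives a measure for \<open>bes_moments\<close>, which s alone does not.\<close>

lemma gegen_product_formula:
  assumes \<alpha>: "\<alpha> > -1/2"
  shows "(LINT s|gegen \<alpha>. (1 + s) * bes \<alpha> (x\<^sup>2 * (y\<^sup>2 + z\<^sup>2 - 2 * y * z * s))) = gmass \<alpha> * bes_prod \<alpha> x y z"
proof -
  define q where "q s = y\<^sup>2 + z\<^sup>2 - 2 * y * z * s" for s
  define N where "N = density (gegen \<alpha>) (\<lambda>s. ennreal (1 + s))"
  have [measurable]: "q \<in> borel_measurable borel" unfolding q_def by measurable
  have [measurable]: "bes \<alpha> \<in> borel_measurable borel" using \<alpha> by (intro bes_measurable) auto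
  have al: "\<alpha> > -1" "\<alpha> + 1 > -1" using \<alpha> by auto
  have ae: "AE s in gegen \<alpha>. 0 \<le> 1 + s"
    using AE_gegen[of \<alpha>] by eventually_elim auto
  define K where "K = y\<^sup>2 + z\<^sup>2 + 2 * \<bar>y * z\<bar>"
  have qK: "0 \<le> q s \<and> q s \<le> K" if "-1 \<le> s" "s \<le> 1" for s
  proof -
    have "\<bar>y * z * s\<bar> \<le> \<bar>y * z\<bar>" using that by (simp add: abs_mult mult_left_le)
    then show ?thesis
      using gegen_arg_nonneg[OF that, of y z] unfolding q_def K_def abs_le_iff by (simp add: mult_ac)
  qed
  have K: "K \<ge> 0" by (simp add: K_def)
  have qp: "\<bar>q s ^ n\<bar> \<le> K ^ n" if "-1 \<le> s" "s \<le> 1" for s n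
    using qK[OF that] by (simp add: power_abs power_mono)
  have ig: "integrable (gegen \<alpha>) (\<lambda>s. q s ^ n)" for n
    using qp by (intro integrable_gegen_bounded[OF \<alpha>]) auto
  have ig2: "integrable (gegen \<alpha>) (\<lambda>s. s * q s ^ n)" for n
  proof (rule integrable_gegen_bounded[OF \<alpha>, where K = "K ^ n"])
    fix s :: real assume s: "-1 \<le> s" "s \<le> 1"
    have "\<bar>s\<bar> * \<bar>q s ^ n\<bar> \<le> 1 * K ^ n"
      using s qp[OF s, of n] by (intro mult_mono) auto
    then show "\<bar>s * q s ^ n\<bar> \<le> K ^ n" by (simp add: abs_mult)
  qed auto
  have dens: "integrable N f \<longleftrightarrow> integrable (gegen \<alpha>) (\<lambda>s. (1 + s) * f s)"
    "(LINT s|N. f s) = (LINT s|gegen \<alpha>. (1 + s) * f s)" if [measurable]: "f \<in> borel_measurable borel" for f :: "real \<Rightarrow> real"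
    unfolding N_def using ae by (auto simp: integrable_density integral_density)
  have e: "(1 + s) * q s ^ n = q s ^ n + s * q s ^ n" for s n by (simp add: algebra_simps)
  have iN: "integrable N (\<lambda>s. q s ^ n)" for n
    by (subst dens) (auto simp: e intro!: Bochner_Integration.integrable_add ig ig2)
  have mN: "(LINT s|N. q s ^ n) = (LINT s|gegen \<alpha>. q s ^ n) + (LINT s|gegen \<alpha>. s * q s ^ n)" for n
    by (subst dens) (auto simp: e ig ig2)
  have aN: "AE s in N. -1 \<le> s \<and> s \<le> 1"
    unfolding N_def using AE_gegen[of \<alpha>] by (subst AE_density) auto
  have qN: "AE s in N. 0 \<le> q s"
    using aN by eventually_elim (use qK in auto)
  have bN: "(LINT s|N. q s ^ n) \<le> (LINT s|N. 1) * K ^ n" for n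
  proof -
    have "(LINT s|N. q s ^ n) \<le> (LINT s|N. K ^ n)"
    proof (rule integral_mono_AE[OF iN])
      have "integrable N (\<lambda>s. q s ^ 0)" by (rule iN)
      then have "integrable N (\<lambda>s. K ^ n * q s ^ 0)" by (rule integrable_mult_right)
      then show "integrable N (\<lambda>s. K ^ n)" by simp
      show "AE s in N. q s ^ n \<le> K ^ n"
        using aN by eventually_elim (use qK in \<open>auto intro!: power_mono\<close>)
    qed
    then show ?thesis by (simp add: mult.commute)
  qed
  have nn: "(LINT s|N. q s ^ n) \<ge> 0" for n
    using qN by (intro integral_nonneg_AE) auto
  have sm: "summable (\<lambda>n. \<bar>bes_coeff \<alpha> n\<bar> * \<bar>x\<^sup>2\<bar> ^ n * (LINT s|N. q s ^ n))"
  proof (rule summable_comparison_test')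
    show "summable (\<lambda>n. (LINT s|N. 1) * (\<bar>bes_coeff \<alpha> n\<bar> * (x\<^sup>2 * K) ^ n))"
      by (intro summable_mult bes_abs_summable al)
    fix n :: nat
    have "\<bar>bes_coeff \<alpha> n\<bar> * \<bar>x\<^sup>2\<bar> ^ n * (LINT s|N. q s ^ n) \<le> \<bar>bes_coeff \<alpha> n\<bar> * \<bar>x\<^sup>2\<bar> ^ n * ((LINT s|N. 1) * K ^ n)"
      using bN by (intro mult_left_mono) auto
    then show "norm (\<bar>bes_coeff \<alpha> n\<bar> * \<bar>x\<^sup>2\<bar> ^ n * (LINT s|N. q s ^ n)) \<le> (LINT s|N. 1) * (\<bar>bes_coeff \<alpha> n\<bar> * (x\<^sup>2 * K) ^ n)"
      using nn[of n] by (simp add: abs_mult power_mult_distrib mult_ac)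
  qed
  have S1: "(\<lambda>n. bes_coeff \<alpha> n * (x\<^sup>2) ^ n * (LINT s|N. q s ^ n)) sums (LINT s|N. bes \<alpha> (x\<^sup>2 * q s))"
    by (rule bes_moments(2)[OF al(1) iN qN sm])
  have even: "(\<lambda>n. bes_coeff \<alpha> n * (x\<^sup>2) ^ n * (LINT s|gegen \<alpha>. q s ^ n)) sums 
     (gmass \<alpha> * (bes \<alpha> ((x * y)\<^sup>2) * bes \<alpha> ((x * z)\<^sup>2)))"
    using sums_mult[OF bes_prod_sums[OF al(1), of "x\<^sup>2" "y\<^sup>2" "z\<^sup>2"], of "gmass \<alpha>"]
    unfolding q_def gegen_moment_even_part[OF \<alpha>] by (simp add: power_mult_distrib mult_ac)
  define c where "c = x\<^sup>2 * y * z / (4 * (\<alpha> + 1)\<^sup>2)"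
  \<comment> \<open>The term n = 0 is zero since the first moment vanishes. The term n + 1 at order
    \<alpha> matches the term n at order \<alpha> + 1, and the shift supplies the factor x^2 of the
    odd parts.\<close>
  have odd: "(\<lambda>n. bes_coeff \<alpha> n * (x\<^sup>2) ^ n * (LINT s|gegen \<alpha>. s * q s ^ n)) sums 
     (gmass \<alpha> * (c * (bes (\<alpha> + 1) ((x * y)\<^sup>2) * bes (\<alpha> + 1) ((x * z)\<^sup>2))))"
  proof -
    have cf: "bes_coeff \<alpha> (Suc n) * (x\<^sup>2) ^ Suc n * (LINT s|gegen \<alpha>. s * q s ^ Suc n) =
       gmass \<alpha> * c * (bes_coeff (\<alpha> + 1) n * (x\<^sup>2) ^ n * bes_poly (\<alpha> + 1) (y\<^sup>2) (z\<^sup>2) n)" for n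
    proof -
      define P where "P = pochhammer (\<alpha> + 2) n"
      have P: "P > 0" unfolding P_def using \<alpha> by (intro pochhammer_pos) auto
      have p: "pochhammer (\<alpha> + 1) (Suc n) = (\<alpha> + 1) * P"
        by (simp add: pochhammer_rec add.assoc P_def)
      have a: "\<alpha> + 1 > 0" using \<alpha> by simp
      have b: "bes_coeff \<alpha> (Suc n) * (Suc n / (\<alpha> + 1)) = - bes_coeff (\<alpha> + 1) n / (4 * (\<alpha> + 1)\<^sup>2)"
        unfolding bes_coeff_def p using P a
        by (simp add: add.assoc P_def[symmetric] divide_simps power2_eq_square)
      have "bes_coeff \<alpha> (Suc n) * (x\<^sup>2) ^ Suc n * (LINT s|gegen \<alpha>. s * q s ^ Suc n) =
        - (bes_coeff \<alpha> (Suc n) * (Suc n / (\<alpha> + 1))) * (x\<^sup>2) ^ Suc n * gmass \<alpha> * y * z * bes_poly (\<alpha> + 1) (y\<^sup>2) (z\<^sup>2) n"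
        unfolding q_def gegen_moment_odd_part[OF \<alpha>] by (simp only: mult_ac minus_mult_left minus_mult_right)
      also have "\<dots> = gmass \<alpha> * c * (bes_coeff (\<alpha> + 1) n * (x\<^sup>2) ^ n * bes_poly (\<alpha> + 1) (y\<^sup>2) (z\<^sup>2) n)"
        unfolding b c_def by (simp add: mult_ac)
      finally show ?thesis .
    qed
    have "(\<lambda>n. gmass \<alpha> * c * (bes_coeff (\<alpha> + 1) n * (x\<^sup>2) ^ n * bes_poly (\<alpha> + 1) (y\<^sup>2) (z\<^sup>2) n)) sums
       (gmass \<alpha> * c * (bes (\<alpha> + 1) (x\<^sup>2 * y\<^sup>2) * bes (\<alpha> + 1) (x\<^sup>2 * z\<^sup>2)))"
      by (intro sums_mult bes_prod_sums al)
    then have "(\<lambda>n. bes_coeff \<alpha> (Suc n) * (x\<^sup>2) ^ Suc n * (LINT s|gegen \<alpha>. s * q s ^ Suc n)) sums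
       (gmass \<alpha> * (c * (bes (\<alpha> + 1) ((x * y)\<^sup>2) * bes (\<alpha> + 1) ((x * z)\<^sup>2))))"
      unfolding cf by (simp add: power_mult_distrib mult.assoc)
    moreover have "(LINT s|gegen \<alpha>. s) = 0" using gegen_odd_moment[OF \<alpha>, of 0] by simp
    ultimately show ?thesis
      using sums_Suc_iff[of "\<lambda>n. bes_coeff \<alpha> n * (x\<^sup>2) ^ n * (LINT s|gegen \<alpha>. s * q s ^ n)"] by simp
  qed
  have "(\<lambda>n. bes_coeff \<alpha> n * (x\<^sup>2) ^ n * (LINT s|N. q s ^ n)) sums (gmass \<alpha> * (bes \<alpha> ((x * y)\<^sup>2) * bes \<alpha> ((x * z)\<^sup>2)) + 
      gmass \<alpha> * (c * (bes (\<alpha> + 1) ((x * y)\<^sup>2) * bes (\<alpha> + 1) ((x * z)\<^sup>2))))"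
    unfolding mN using sums_add[OF even odd] by (simp add: algebra_simps)
  from sums_unique2[OF S1 this] 
  have "(LINT s|N. bes \<alpha> (x\<^sup>2 * q s)) = gmass \<alpha> * bes_prod \<alpha> x y z"
    by (simp add: bes_prod_def c_def power2_eq_square algebra_simps)
  then show ?thesis by (subst (asm) dens) (auto simp: q_def)
qed

section \<open>Dunkl measure, kernel and translation kernel\<close>

lemma nn_integral_reflect:
  fixes f :: "real \<Rightarrow> ennreal"
  assumes [measurable]: "f \<in> borel_measurable borel"
  shows "(\<integral>\<^sup>+x. f (- x) \<partial>lborel) = (\<integral>\<^sup>+x. f x \<partial>lborel)"
  using nn_integral_real_affine[of f "-1" 0] by simp

lemma AE_lborel_neq: "AE x in lborel. x \<noteq> (c::real)"
  by (rule AE_lborel_singleton)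

lemma nn_integral_even_half:
  fixes f :: "real \<Rightarrow> ennreal"
  assumes [measurable]: "f \<in> borel_measurable borel" and even: "\<And>x. f (- x) = f x"
  shows "(\<integral>\<^sup>+x. f x \<partial>lborel) = 2 * (\<integral>\<^sup>+x. f x * indicator {0<..} x \<partial>lborel)"
proof -
  have "(\<integral>\<^sup>+x. f x \<partial>lborel) = (\<integral>\<^sup>+x. f x * indicator {0<..} x + f x * indicator {..<0} x \<partial>lborel)"
    using AE_lborel_neq[of 0] by (intro nn_integral_cong_AE) (auto simp: indicator_def)
  also have "\<dots> = (\<integral>\<^sup>+x. f x * indicator {0<..} x \<partial>lborel) + (\<integral>\<^sup>+x. f x * indicator {..<0} x \<partial>lborel)"
    by (intro nn_integral_add) auto
  also have "(\<integral>\<^sup>+x. f x * indicator {..<0} x \<partial>lborel) = (\<integral>\<^sup>+x. f (- x) * indicator {..<0} (- x) \<partial>lborel)"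
    by (rule nn_integral_reflect[symmetric]) auto
  also have "\<dots> = (\<integral>\<^sup>+x. f x * indicator {0<..} x \<partial>lborel)"
    by (intro nn_integral_cong) (auto simp: even indicator_def)
  finally show ?thesis by (simp add: mult_2)
qed

lemma bessel_j_of_real:
  assumes \<nu>: "\<nu> > -1"
  shows "bessel_j \<nu> (complex_of_real u) = complex_of_real (bes \<nu> (u\<^sup>2))"
proof -
  have G: "Gamma (\<nu> + 1) > 0" using \<nu> by (intro Gamma_real_pos) auto
  have "(\<lambda>n. bes_coeff \<nu> n * (u\<^sup>2) ^ n / Gamma (\<nu> + 1)) sums (bes \<nu> (u\<^sup>2) / Gamma (\<nu> + 1))"
    by (intro sums_divide bes_sums \<nu>)
  then have "(\<lambda>n. complex_of_real (bes_coeff \<nu> n * (u\<^sup>2) ^ n / Gamma (\<nu> + 1))) sums complex_of_real (bes \<nu> (u\<^sup>2) / Gamma (\<nu> + 1))"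
    by (rule sums_of_real)
  moreover have "complex_of_real (bes_coeff \<nu> n * (u\<^sup>2) ^ n / Gamma (\<nu> + 1)) =
     (-1) ^ n * (complex_of_real u / 2) ^ (2 * n) / (fact n * complex_of_real (Gamma (real n + \<nu> + 1)))" for n
  proof -
    have "\<nu> + 1 \<notin> \<int>\<^sub>\<le>\<^sub>0" using \<nu> by (auto elim!: nonpos_Ints_cases)
    then have p: "pochhammer (\<nu> + 1) n = Gamma (real n + \<nu> + 1) / Gamma (\<nu> + 1)"
      by (simp add: pochhammer_Gamma add_ac)
    have "bes_coeff \<nu> n * (u\<^sup>2) ^ n / Gamma (\<nu> + 1) = (-1) ^ n * (u / 2) ^ (2 * n) / (fact n * Gamma (real n + \<nu> + 1))"
      unfolding bes_coeff_def p using G by (simp add: power_divide power_mult)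
    then show ?thesis by simp
  qed
  ultimately have "(\<lambda>n. (-1) ^ n * (complex_of_real u / 2) ^ (2 * n) / (fact n * complex_of_real (Gamma (real n + \<nu> + 1)))) sums
     complex_of_real (bes \<nu> (u\<^sup>2) / Gamma (\<nu> + 1))" by simp
  then show ?thesis using G unfolding bessel_j_def by (simp add: sums_iff)
qed

section \<open>Symmetries and bounds of the weight \<Delta> and of W\<close>

lemma dunkl_Delta_nonneg: "dunkl_Delta \<alpha> x y z \<ge> 0"
  by (simp add: dunkl_Delta_def)

lemma triangle_iff: "\<bar>z\<bar> \<in> {\<bar>\<bar>x\<bar> - \<bar>y\<bar>\<bar>..\<bar>x\<bar> + \<bar>y\<bar>} \<longleftrightarrow> 
   \<bar>z\<bar> \<le> \<bar>x\<bar> + \<bar>y\<bar> \<and> \<bar>x\<bar> \<le> \<bar>y\<bar> + \<bar>z\<bar> \<and> \<bar>y\<bar> \<le> \<bar>x\<bar> + \<bar>z::real\<bar>"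
  unfolding atLeastAtMost_iff by arith

text \<open>For a triangle with sides |x|, |y|, |z|, both sides are 16 times the squared area
  (Heron). In the right-hand form the permutation of the sides is a polynomial identity.\<close>

lemma heron_alt: "((\<bar>x\<bar> + \<bar>y\<bar>)\<^sup>2 - z\<^sup>2) * (z\<^sup>2 - (\<bar>x\<bar> - \<bar>y\<bar>)\<^sup>2) =
   4 * x\<^sup>2 * y\<^sup>2 - (x\<^sup>2 + y\<^sup>2 - (z::real)\<^sup>2)\<^sup>2"
proof -
  have 1: "(\<bar>x\<bar> + \<bar>y\<bar>)\<^sup>2 - z\<^sup>2 = (x\<^sup>2 + y\<^sup>2 - z\<^sup>2) + 2 * \<bar>x\<bar> * \<bar>y\<bar>" by (simp add: power2_sum)
  have 2: "z\<^sup>2 - (\<bar>x\<bar> - \<bar>y\<bar>)\<^sup>2 = 2 * \<bar>x\<bar> * \<bar>y\<bar> - (x\<^sup>2 + y\<^sup>2 - z\<^sup>2)" by (simp add: power2_diff)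
  have "(a + b) * (b - a) = b\<^sup>2 - a\<^sup>2" for a b :: real by (simp add: power2_eq_square algebra_simps)
  then show ?thesis unfolding 1 2 by (simp add: power_mult_distrib)
qed

lemma dunkl_Delta_alt: "dunkl_Delta \<alpha> x y z = 
  (if \<bar>z\<bar> \<le> \<bar>x\<bar> + \<bar>y\<bar> \<and> \<bar>x\<bar> \<le> \<bar>y\<bar> + \<bar>z\<bar> \<and> \<bar>y\<bar> \<le> \<bar>x\<bar> + \<bar>z\<bar> then 
   (4 * x\<^sup>2 * y\<^sup>2 - (x\<^sup>2 + y\<^sup>2 - z\<^sup>2)\<^sup>2) powr (\<alpha> - 1/2) / \<bar>x * y * z\<bar> powr (2 * \<alpha>) else 0)"
  unfolding dunkl_Delta_def triangle_iff heron_alt ..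

lemma dunkl_Delta_swap12: "dunkl_Delta \<alpha> x y z = dunkl_Delta \<alpha> y x z"
  unfolding dunkl_Delta_alt by (simp add: add.commute mult_ac conj_commute)

lemma dunkl_Delta_swap13: "dunkl_Delta \<alpha> x y z = dunkl_Delta \<alpha> z y x"
proof -
  have "4 * x\<^sup>2 * y\<^sup>2 - (x\<^sup>2 + y\<^sup>2 - z\<^sup>2)\<^sup>2 = 4 * z\<^sup>2 * y\<^sup>2 - (z\<^sup>2 + y\<^sup>2 - x\<^sup>2)\<^sup>2"
    by (simp add: power2_eq_square algebra_simps)
  moreover have "(\<bar>z\<bar> \<le> \<bar>x\<bar> + \<bar>y\<bar> \<and> \<bar>x\<bar> \<le> \<bar>y\<bar> + \<bar>z\<bar> \<and> \<bar>y\<bar> \<le> \<bar>x\<bar> + \<bar>z\<bar>) =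
     (\<bar>x\<bar> \<le> \<bar>z\<bar> + \<bar>y\<bar> \<and> \<bar>z\<bar> \<le> \<bar>y\<bar> + \<bar>x\<bar> \<and> \<bar>y\<bar> \<le> \<bar>z\<bar> + \<bar>x\<bar>)" by auto
  moreover have "x * y * z = z * y * x" by simp
  ultimately show ?thesis unfolding dunkl_Delta_alt by (simp only:)
qed

lemma dunkl_Delta_uminus [simp]: "dunkl_Delta \<alpha> (- x) y z = dunkl_Delta \<alpha> x y z"
  by (simp add: dunkl_Delta_alt)

lemma dunkl_Delta_measurable [measurable]:
  assumes [measurable]: "f \<in> borel_measurable M" "g \<in> borel_measurable M" "h \<in> borel_measurable M"
  shows "(\<lambda>x. dunkl_Delta \<alpha> (f x) (g x) (h x)) \<in> borel_measurable M"
  unfolding dunkl_Delta_alt by measurable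

lemma dunkl_b_measurable [measurable]:
  assumes [measurable]: "f \<in> borel_measurable M" "g \<in> borel_measurable M" "h \<in> borel_measurable M"
  shows "(\<lambda>x. dunkl_b (f x) (g x) (h x)) \<in> borel_measurable M"
  unfolding dunkl_b_def by measurable

lemma dunkl_W_measurable [measurable]:
  assumes [measurable]: "f \<in> borel_measurable M" "g \<in> borel_measurable M" "h \<in> borel_measurable M"
  shows "(\<lambda>x. dunkl_W \<alpha> (f x) (g x) (h x)) \<in> borel_measurable M"
  unfolding dunkl_W_def by measurable

text \<open>Law of cosines: in a triangle with sides |x|, |y|, |z| the value is, up to sign, the
  cosine of the angle between the first two sides.\<close>

lemma dunkl_b_bound:
  assumes "\<bar>z\<bar> \<le> \<bar>x\<bar> + \<bar>y\<bar>" "\<bar>x\<bar> \<le> \<bar>y\<bar> + \<bar>z\<bar>" "\<bar>y\<bar> \<le> \<bar>x\<bar> + \<bar>z\<bar>"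
  shows "\<bar>dunkl_b x y z\<bar> \<le> 1"
proof (cases "x = 0 \<or> y = 0")
  case False
  have "\<bar>z\<bar>\<^sup>2 \<le> (\<bar>x\<bar> + \<bar>y\<bar>)\<^sup>2" using assms by (intro power_mono) auto
  moreover have "\<bar>\<bar>x\<bar> - \<bar>y\<bar>\<bar>\<^sup>2 \<le> \<bar>z\<bar>\<^sup>2" using assms by (intro power_mono; arith)
  ultimately have "\<bar>x\<^sup>2 + y\<^sup>2 - z\<^sup>2\<bar> \<le> 2 * \<bar>x\<bar> * \<bar>y\<bar>"
    by (auto simp: power2_sum power2_diff abs_le_iff)
  then show ?thesis using False by (simp add: dunkl_b_def abs_mult divide_le_eq)
qed (auto simp: dunkl_b_def)

definition W_const :: "real \<Rightarrow> real" where
  "W_const \<alpha> = (Gamma (\<alpha> + 1))\<^sup>2 / (2 powr (\<alpha> - 1) * sqrt pi * Gamma (\<alpha> + 1 / 2))"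

lemma dunkl_W_alt: "dunkl_W \<alpha> x y z = 
    W_const \<alpha> * (1 - dunkl_b x y z + dunkl_b z x y + dunkl_b z y x) * dunkl_Delta \<alpha> x y z"
  by (simp only: dunkl_W_def W_const_def)

text \<open>Where \<Delta> is nonzero, the bracket in W consists of four terms of absolute value at
  most 1. This is the origin of the factor 4 in \<open>CW\<close>.\<close>

lemma dunkl_W_bound: 
  assumes "W_const \<alpha> \<ge> 0" 
  shows "\<bar>dunkl_W \<alpha> x y z\<bar> \<le> 4 * W_const \<alpha> * dunkl_Delta \<alpha> x y z"
proof (cases "\<bar>z\<bar> \<le> \<bar>x\<bar> + \<bar>y\<bar> \<and> \<bar>x\<bar> \<le> \<bar>y\<bar> + \<bar>z\<bar> \<and> \<bar>y\<bar> \<le> \<bar>x\<bar> + \<bar>z\<bar>")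
  case True
  then have "\<bar>dunkl_b x y z\<bar> \<le> 1" "\<bar>dunkl_b z x y\<bar> \<le> 1" "\<bar>dunkl_b z y x\<bar> \<le> 1"
    by (auto intro!: dunkl_b_bound)
  then have "\<bar>1 - dunkl_b x y z + dunkl_b z x y + dunkl_b z y x\<bar> \<le> 4" by linarith
  then have "W_const \<alpha> * \<bar>1 - dunkl_b x y z + dunkl_b z x y + dunkl_b z y x\<bar> * dunkl_Delta \<alpha> x y z \<le>
     W_const \<alpha> * 4 * dunkl_Delta \<alpha> x y z"
    using assms dunkl_Delta_nonneg by (intro mult_right_mono mult_left_mono)
  then show ?thesis
    using assms dunkl_Delta_nonneg[of \<alpha> x y z] by (simp add: dunkl_W_alt abs_mult mult_ac)
next
  case False
  then have "dunkl_Delta \<alpha> x y z = 0" unfolding dunkl_Delta_alt by auto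
  then show ?thesis by (simp add: dunkl_W_def)
qed

text \<open>Two of the three cosines change sign with x and cancel. What remains, 1 plus the cosine
  of the angle opposite to x, is the weight 1 + s of the product formula.\<close>

lemma dunkl_W_even_part:
  "dunkl_W \<alpha> x y z + dunkl_W \<alpha> (- x) y z = 2 * W_const \<alpha> * (1 + dunkl_b z y x) * dunkl_Delta \<alpha> x y z"
proof -
  have "dunkl_b (- x) y z = - dunkl_b x y z" "dunkl_b z (- x) y = - dunkl_b z x y" 
    "dunkl_b z y (- x) = dunkl_b z y x"
    by (simp_all add: dunkl_b_def)
  then show ?thesis by (simp add: dunkl_W_alt algebra_simps)
qed

section \<open>The Dunkl measure: null sets, symmetry and scaling\<close>

locale dunkl =
  fixes \<alpha> :: real
  assumes \<alpha>: "\<alpha> > -1/2"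
begin

lemma \<alpha>1: "\<alpha> > -1" "\<alpha> + 1 > -1" "\<alpha> + 1 > 0" "2 * \<alpha> + 1 > 0"
  using \<alpha> by auto

abbreviation M :: "real measure" where "M \<equiv> dunkl_measure \<alpha>"

definition mconst :: real where "mconst = 2 powr (\<alpha> + 1) * Gamma (\<alpha> + 1)"

lemma mconst: "mconst > 0"
  using \<alpha>1 by (auto simp: mconst_def intro!: mult_pos_pos Gamma_real_pos)

lemma W_const: "W_const \<alpha> > 0"
  using \<alpha> by (auto simp: W_const_def intro!: divide_pos_pos mult_pos_pos zero_less_power Gamma_real_pos)

lemma M_def: "M = density lborel (\<lambda>x. ennreal (\<bar>x\<bar> powr (2 * \<alpha> + 1) / mconst))"
  by (simp add: dunkl_measure_def mconst_def)

lemma sets_M [measurable_cong, simp]: "sets M = sets borel"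
  by (simp add: M_def)

lemma space_M [simp]: "space M = UNIV"
  by (simp add: M_def)

lemma sets_MM [simp]: "sets (M \<Otimes>\<^sub>M M) = sets (borel \<Otimes>\<^sub>M borel)"
  by (intro sets_pair_measure_cong) auto

lemma AE_M_neq: "AE x in M. x \<noteq> c"
  unfolding M_def using AE_lborel_neq[of c] by (subst AE_density) auto

lemma AE_M_lborel: "(AE x in lborel. P x) \<Longrightarrow> (AE x in M. P x)"
  unfolding M_def by (subst AE_density) auto

lemma sigma_finite_M: "sigma_finite_measure M"
  unfolding M_def by (subst sigma_finite_measure.sigma_finite_iff_density_finite[OF sigma_finite_lborel]) auto

sublocale M: sigma_finite_measure M
  by (rule sigma_finite_M)

sublocale MM: pair_sigma_finite M M ..

lemma nn_integral_M:
  assumes [measurable]: "f \<in> borel_measurable borel"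
  shows "(\<integral>\<^sup>+x. f x \<partial>M) = (\<integral>\<^sup>+x. ennreal (\<bar>x\<bar> powr (2 * \<alpha> + 1) / mconst) * f x \<partial>lborel)"
  unfolding M_def by (subst nn_integral_density) auto

lemma distr_M_uminus: "distr M borel uminus = M"
proof (rule measure_eqI)
  fix A assume "A \<in> sets (distr M borel uminus)"
  then have [measurable]: "A \<in> sets borel" by simp
  have "emeasure (distr M borel uminus) A = (\<integral>\<^sup>+x. indicator A x \<partial>distr M borel uminus)"
    by (subst nn_integral_indicator) auto
  also have "\<dots> = (\<integral>\<^sup>+x. indicator A (- x) \<partial>M)"
    by (subst nn_integral_distr) auto
  also have "\<dots> = (\<integral>\<^sup>+x. ennreal (\<bar>- x\<bar> powr (2 * \<alpha> + 1) / mconst) * indicator A (- x) \<partial>lborel)"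
    by (subst nn_integral_M) auto
  also have "\<dots> = (\<integral>\<^sup>+x. ennreal (\<bar>x\<bar> powr (2 * \<alpha> + 1) / mconst) * indicator A x \<partial>lborel)"
    by (rule nn_integral_reflect[of "\<lambda>x. ennreal (\<bar>x\<bar> powr (2 * \<alpha> + 1) / mconst) * indicator A x"]) auto
  also have "\<dots> = (\<integral>\<^sup>+x. indicator A x \<partial>M)"
    by (subst nn_integral_M) auto
  finally show "emeasure (distr M borel uminus) A = emeasure M A" by simp
qed simp

lemma integral_M_uminus:
  fixes f :: "real \<Rightarrow> 'b::{banach, second_countable_topology}"
  assumes [measurable]: "f \<in> borel_measurable borel"
  shows "(LINT x|M. f (- x)) = (LINT x|M. f x)"
    and "integrable M (\<lambda>x. f (- x)) \<longleftrightarrow> integrable M f"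
  using integral_distr[of uminus M borel f] integrable_distr_eq[of uminus M borel f]
  by (simp_all add: distr_M_uminus)

lemma integral_M_even_part:
  fixes f :: "real \<Rightarrow> 'b::{banach, second_countable_topology}"
  assumes "integrable M f"
  shows "(LINT x|M. f x) = (LINT x|M. (1/2) *\<^sub>R (f x + f (- x)))"
proof -
  have m: "f \<in> borel_measurable borel" using borel_measurable_integrable[OF assms] by simp
  have "integrable M (\<lambda>x. f (- x))" using assms integral_M_uminus(2)[OF m] by simp
  then have "(LINT x|M. (1/2) *\<^sub>R (f x + f (- x))) = (1/2) *\<^sub>R ((LINT x|M. f x) + (LINT x|M. f x))"
    using assms integral_M_uminus(1)[OF m] by simp
  then show ?thesis by (simp add: scaleR_2[symmetric])
qed

lemma nn_integral_M_scale:
  assumes r: "r > 0" and [measurable]: "f \<in> borel_measurable borel"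
  shows "(\<integral>\<^sup>+x. f x \<partial>M) = ennreal (r powr (2 * \<alpha> + 2)) * (\<integral>\<^sup>+x. f (r * x) \<partial>M)"
proof -
  have "(\<integral>\<^sup>+x. f x \<partial>M) = (\<integral>\<^sup>+x. ennreal (\<bar>x\<bar> powr (2 * \<alpha> + 1) / mconst) * f x \<partial>lborel)"
    by (subst nn_integral_M) auto
  also have "\<dots> = ennreal \<bar>r\<bar> * (\<integral>\<^sup>+x. ennreal (\<bar>0 + r * x\<bar> powr (2 * \<alpha> + 1) / mconst) * f (0 + r * x) \<partial>lborel)"
    using r by (intro nn_integral_real_affine) auto
  also have "\<dots> = (\<integral>\<^sup>+x. ennreal r * (ennreal (\<bar>r * x\<bar> powr (2 * \<alpha> + 1) / mconst) * f (r * x)) \<partial>lborel)"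
    using r by (subst nn_integral_cmult) auto
  also have "\<dots> = (\<integral>\<^sup>+x. ennreal (r powr (2 * \<alpha> + 2)) * (ennreal (\<bar>x\<bar> powr (2 * \<alpha> + 1) / mconst) * f (r * x)) \<partial>lborel)"
  proof (intro nn_integral_cong)
    fix x :: real
    have e: "r powr (2 * \<alpha> + 2) = r * r powr (2 * \<alpha> + 1)"
      using r powr_add[of r 1 "2 * \<alpha> + 1"] by (simp add: add.commute)
    have "r * (\<bar>r * x\<bar> powr (2 * \<alpha> + 1) / mconst) = r powr (2 * \<alpha> + 2) * (\<bar>x\<bar> powr (2 * \<alpha> + 1) / mconst)"
      unfolding e using r by (simp add: abs_mult powr_mult)
    then have "ennreal r * ennreal (\<bar>r * x\<bar> powr (2 * \<alpha> + 1) / mconst) = ennreal (r powr (2 * \<alpha> + 2)) * ennreal (\<bar>x\<bar> powr (2 * \<alpha> + 1) / mconst)"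
      using r mconst by (simp flip: ennreal_mult)
    then show "ennreal r * (ennreal (\<bar>r * x\<bar> powr (2 * \<alpha> + 1) / mconst) * f (r * x)) =
      ennreal (r powr (2 * \<alpha> + 2)) * (ennreal (\<bar>x\<bar> powr (2 * \<alpha> + 1) / mconst) * f (r * x))"
      by (simp only: mult.assoc[symmetric])
  qed
  also have "\<dots> = ennreal (r powr (2 * \<alpha> + 2)) * (\<integral>\<^sup>+x. f (r * x) \<partial>M)"
    by (subst nn_integral_cmult, measurable, subst nn_integral_M) auto
  finally show ?thesis .
qed

lemma emeasure_M_bounded: "emeasure M {-r..r} < \<infinity>"
proof -
  have "emeasure M {-r..r} = (\<integral>\<^sup>+x. ennreal (\<bar>x\<bar> powr (2 * \<alpha> + 1) / mconst) * indicator {-r..r} x \<partial>lborel)"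
    unfolding M_def by (subst emeasure_density) auto
  also have "\<dots> \<le> (\<integral>\<^sup>+x. ennreal (\<bar>r\<bar> powr (2 * \<alpha> + 1) / mconst) * indicator {-r..r} x \<partial>lborel)"
    using \<alpha> mconst
    by (intro nn_integral_mono) (auto simp: indicator_def intro!: ennreal_leI divide_right_mono powr_mono2)
  also have "\<dots> = ennreal (\<bar>r\<bar> powr (2 * \<alpha> + 1) / mconst) * emeasure lborel {-r..r}"
    by (subst nn_integral_cmult_indicator) auto
  also have "\<dots> < \<infinity>"
    by (auto simp: ennreal_mult_less_top emeasure_lborel_Icc_eq)
  finally show ?thesis .
qed

subsection \<open>The kernel\<close>

definition ker_even :: "real \<Rightarrow> real" where "ker_even u = bes \<alpha> (u\<^sup>2)"
definition ker_odd :: "real \<Rightarrow> real" where "ker_odd u = u / (2 * (\<alpha> + 1)) * bes (\<alpha> + 1) (u\<^sup>2)"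

definition ker :: "real \<Rightarrow> real \<Rightarrow> complex" where
  "ker x y = dunkl_kernel \<alpha> (- \<i> * complex_of_real x * complex_of_real y)"

text \<open>The argument i * (-i x y) = xy of the Bessel functions is real, so the even part of the
  kernel is real and the odd part purely imaginary.\<close>

lemma ker_eq: "ker x y = complex_of_real (ker_even (x * y)) - \<i> * complex_of_real (ker_odd (x * y))"
proof -
  have "\<i> * (- \<i> * complex_of_real x * complex_of_real y) = complex_of_real (x * y)"
    by (simp add: mult.assoc[symmetric])
  then show ?thesis using \<alpha>1
    by (simp only: ker_def dunkl_kernel_def bessel_j_of_real ker_even_def ker_odd_def) simp
qed

lemma ker_even_measurable [measurable]: "ker_even \<in> borel_measurable borel"
  using bes_measurable[OF \<alpha>1(1)] unfolding ker_even_def by measurable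

lemma ker_odd_measurable [measurable]: "ker_odd \<in> borel_measurable borel"
  using bes_measurable[OF \<alpha>1(2)] unfolding ker_odd_def by measurable

lemma ker_measurable [measurable]:
  assumes [measurable]: "f \<in> borel_measurable N" "g \<in> borel_measurable N"
  shows "(\<lambda>x. ker (f x) (g x)) \<in> borel_measurable N"
  unfolding ker_eq by measurable

lemma ker_commute: "ker x y = ker y x"
  by (simp add: ker_eq mult.commute)

lemma cnj_ker: "cnj (ker x y) = ker (- x) y" "cnj (ker x y) = ker x (- y)"
  by (simp_all add: ker_eq ker_even_def ker_odd_def)

lemma bes_prod_alt: "bes_prod \<alpha> x y z = ker_even (x * y) * ker_even (x * z) + ker_odd (x * y) * ker_odd (x * z)"
  by (simp add: bes_prod_def ker_even_def ker_odd_def)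

lemma ker_even_bound: "\<bar>ker_even u\<bar> \<le> 1"
  unfolding ker_even_def using \<alpha> by (intro bes_bounded) auto

text \<open>At z = y the product formula expresses the squared modulus as an average of values of
  \<open>bes \<alpha>\<close>, each at most 1 in absolute value. The weight 1 + s has total mass
  \<open>gmass \<alpha>\<close>, because the first moment is zero.\<close>

lemma norm_ker: "norm (ker x y) \<le> 1"
proof -
  have [measurable]: "bes \<alpha> \<in> borel_measurable borel" by (rule bes_measurable[OF \<alpha>1(1)])
  have "(norm (ker x y))\<^sup>2 = bes_prod \<alpha> x y y"
    by (simp only: ker_eq cmod_power2 bes_prod_alt) (simp add: power2_eq_square)
  also have "\<dots> \<le> 1"
  proof -
    have b: "\<bar>bes \<alpha> (x\<^sup>2 * (y\<^sup>2 + y\<^sup>2 - 2 * y * y * s))\<bar> \<le> 1" if "-1 \<le> s" "s \<le> 1" for s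
      using gegen_arg_nonneg[OF that, of y y] by (intro bes_bounded \<alpha>) auto
    have i1: "integrable (gegen \<alpha>) (\<lambda>s. 1 + s)"
      by (rule integrable_gegen_bounded[OF \<alpha>, where K = 2]) auto
    have i2: "integrable (gegen \<alpha>) (\<lambda>s. (1 + s) * bes \<alpha> (x\<^sup>2 * (y\<^sup>2 + y\<^sup>2 - 2 * y * y * s)))"
    proof (rule integrable_gegen_bounded[OF \<alpha>, where K = 2])
      fix s :: real assume s: "-1 \<le> s" "s \<le> 1"
      have "\<bar>1 + s\<bar> * \<bar>bes \<alpha> (x\<^sup>2 * (y\<^sup>2 + y\<^sup>2 - 2 * y * y * s))\<bar> \<le> 2 * 1"
        using s b[OF s] by (intro mult_mono) auto
      then show "\<bar>(1 + s) * bes \<alpha> (x\<^sup>2 * (y\<^sup>2 + y\<^sup>2 - 2 * y * y * s))\<bar> \<le> 2" by (simp add: abs_mult)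
    qed measurable
    have "gmass \<alpha> * bes_prod \<alpha> x y y = (LINT s|gegen \<alpha>. (1 + s) * bes \<alpha> (x\<^sup>2 * (y\<^sup>2 + y\<^sup>2 - 2 * y * y * s)))"
      by (rule gegen_product_formula[OF \<alpha>, symmetric])
    also have "\<dots> \<le> (LINT s|gegen \<alpha>. 1 + s)"
    proof (rule integral_mono_AE[OF i2 i1])
      show "AE s in gegen \<alpha>. (1 + s) * bes \<alpha> (x\<^sup>2 * (y\<^sup>2 + y\<^sup>2 - 2 * y * y * s)) \<le> 1 + s"
        using AE_gegen[of \<alpha>]
      proof eventually_elim
        case (elim s)
        then have "(1 + s) * bes \<alpha> (x\<^sup>2 * (y\<^sup>2 + y\<^sup>2 - 2 * y * y * s)) \<le> (1 + s) * 1"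
          using b[of s] by (intro mult_left_mono) auto
        then show ?case by simp
      qed
    qed
    also have "\<dots> = (LINT s|gegen \<alpha>. 1) + (LINT s|gegen \<alpha>. s)"
      by (rule Bochner_Integration.integral_add; rule integrable_gegen_bounded[OF \<alpha>, where K = 1]; simp)
    also have "\<dots> = gmass \<alpha>"
      using gegen_odd_moment[OF \<alpha>, of 0] by (simp add: gmass_def)
    finally show ?thesis using gmass_pos[OF \<alpha>] by simp
  qed
  finally show ?thesis by (simp add: power2_le_iff_abs_le abs_square_le_1)
qed

subsection \<open>The translation kernel\<close>

text \<open>The 2 counts the two signs of t in \<open>Delta_substitution\<close>, and the power of 4
  is left over from Heron's expression 4 p^2 (1 - s^2).\<close>

definition Delta_const :: real where "Delta_const = 2 * 4 powr (\<alpha> - 1/2) / mconst"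

lemma Delta_const: "Delta_const > 0"
  using mconst by (simp add: Delta_const_def)

lemma nn_integral_gegen_uminus:
  assumes [measurable]: "F \<in> borel_measurable borel"
  shows "(\<integral>\<^sup>+s. F (- s) \<partial>gegen \<alpha>) = (\<integral>\<^sup>+s. F s \<partial>gegen \<alpha>)"
proof -
  have "(\<integral>\<^sup>+s. F (- s) \<partial>gegen \<alpha>) = (\<integral>\<^sup>+s. ennreal (indicator {-1..1} (- s) * (1 - (- s)\<^sup>2) powr (\<alpha> - 1/2)) * F (- s) \<partial>lborel)"
    unfolding gegen_def by (subst nn_integral_density) (auto intro!: nn_integral_cong simp: indicator_def)
  also have "\<dots> = (\<integral>\<^sup>+s. ennreal (indicator {-1..1} s * (1 - s\<^sup>2) powr (\<alpha> - 1/2)) * F s \<partial>lborel)"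
    by (rule nn_integral_reflect[of "\<lambda>s. ennreal (indicator {-1..1} s * (1 - s\<^sup>2) powr (\<alpha> - 1/2)) * F s"]) measurable
  also have "\<dots> = (\<integral>\<^sup>+s. F s \<partial>gegen \<alpha>)"
    unfolding gegen_def by (subst nn_integral_density) auto
  finally show ?thesis .
qed

text \<open>The cosine \<open>s\<close> of the angle opposite to the side \<open>t\<close> turns \<open>\<Delta>\<close> into the Gegenbauer weight.\<close>

lemma Delta_substitution:
  assumes yz: "y \<noteq> 0" "z \<noteq> 0" and [measurable]: "F \<in> borel_measurable borel"
  shows "(\<integral>\<^sup>+t. ennreal (dunkl_Delta \<alpha> t y z) * F ((y\<^sup>2 + z\<^sup>2 - t\<^sup>2) / (2 * y * z)) \<partial>M) =
    ennreal Delta_const * (\<integral>\<^sup>+s. F s \<partial>gegen \<alpha>)"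
proof -
  define p where "p = \<bar>y\<bar> * \<bar>z\<bar>"
  have p: "p > 0" using yz by (simp add: p_def)
  define lo where "lo = \<bar>\<bar>y\<bar> - \<bar>z\<bar>\<bar>"
  define hi where "hi = \<bar>y\<bar> + \<bar>z\<bar>"
  \<comment> \<open>\<open>S\<close> increases from -1 to 1 on the range of |t|, as the substitution
    rule wants. The cosine itself is \<open>S\<close> or its negative, depending on the sign of yz,
    and \<open>\<sigma>\<close> records which. The sign drops out at the end because the Gegenbauer
    weight is even.\<close>
  define S where "S t = (t\<^sup>2 - y\<^sup>2 - z\<^sup>2) / (2 * p)" for t
  define \<sigma> where "\<sigma> = - sgn (y * z)"
  have \<sigma>: "\<sigma> = 1 \<or> \<sigma> = -1" using yz by (auto simp: \<sigma>_def sgn_if)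
  have \<sigma>S: "(y\<^sup>2 + z\<^sup>2 - t\<^sup>2) / (2 * y * z) = \<sigma> * S t" for t
  proof -
    have "y * z = sgn (y * z) * p" by (simp add: p_def abs_mult[symmetric] sgn_mult_abs)
    then have "2 * y * z = - \<sigma> * (2 * p)" by (simp add: mult.assoc \<sigma>_def)
    moreover have "(a - t\<^sup>2) / (- \<sigma> * (2 * p)) = \<sigma> * ((t\<^sup>2 - a) / (2 * p))" for a
      using \<sigma> p by (auto simp: divide_simps)
    ultimately show ?thesis unfolding S_def by (simp only: diff_diff_eq)
  qed
  define G where "G s = ennreal ((1 - s\<^sup>2) powr (\<alpha> - 1/2)) * F (\<sigma> * s)" for s
  have [measurable]: "G \<in> borel_measurable borel" unfolding G_def by measurable
  have lohi: "0 \<le> lo" "lo < hi" using yz by (auto simp: lo_def hi_def)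
  have S1: "S lo = -1" "S hi = 1"
    using p unfolding S_def lo_def hi_def p_def by (auto simp: power2_diff power2_sum field_simps)
  let ?h = "\<lambda>t. ennreal (\<bar>t\<bar> powr (2 * \<alpha> + 1) / mconst) * (ennreal (dunkl_Delta \<alpha> t y z) * F (\<sigma> * S t))"
  have [measurable]: "S \<in> borel_measurable borel" unfolding S_def by measurable
  have "(\<integral>\<^sup>+t. ennreal (dunkl_Delta \<alpha> t y z) * F ((y\<^sup>2 + z\<^sup>2 - t\<^sup>2) / (2 * y * z)) \<partial>M) = (\<integral>\<^sup>+t. ?h t \<partial>lborel)"
    unfolding \<sigma>S by (subst nn_integral_M) auto
  also have "\<dots> = 2 * (\<integral>\<^sup>+t. ?h t * indicator {0<..} t \<partial>lborel)"
    by (rule nn_integral_even_half) (auto simp: S_def)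
  also have "(\<integral>\<^sup>+t. ?h t * indicator {0<..} t \<partial>lborel) = 
     (\<integral>\<^sup>+t. ennreal (4 powr (\<alpha> - 1/2) / mconst) * (G (S t) * ennreal (t / p) * indicator {lo..hi} t) \<partial>lborel)"
  proof (intro nn_integral_cong_AE)
    show "AE t in lborel. ?h t * indicator {0<..} t = ennreal (4 powr (\<alpha> - 1/2) / mconst) * (G (S t) * ennreal (t / p) * indicator {lo..hi} t)"
      using AE_lborel_neq[of 0]
    proof eventually_elim
      case (elim t)
      show ?case
      proof (cases "t > 0 \<and> t \<in> {lo..hi}")
        case True
        then have tri: "\<bar>z\<bar> \<le> \<bar>t\<bar> + \<bar>y\<bar> \<and> \<bar>t\<bar> \<le> \<bar>y\<bar> + \<bar>z\<bar> \<and> \<bar>y\<bar> \<le> \<bar>t\<bar> + \<bar>z\<bar>"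
          by (auto simp: lo_def hi_def)
        have "4 * t\<^sup>2 * y\<^sup>2 - (t\<^sup>2 + y\<^sup>2 - z\<^sup>2)\<^sup>2 = 4 * y\<^sup>2 * z\<^sup>2 - (t\<^sup>2 - y\<^sup>2 - z\<^sup>2)\<^sup>2"
          by (simp add: power2_eq_square algebra_simps)
        also have "y\<^sup>2 * z\<^sup>2 = p\<^sup>2" by (simp add: p_def power_mult_distrib)
        then have "4 * y\<^sup>2 * z\<^sup>2 - (t\<^sup>2 - y\<^sup>2 - z\<^sup>2)\<^sup>2 = 4 * p\<^sup>2 * (1 - (S t)\<^sup>2)"
          using p by (simp add: S_def power_divide field_simps)
        finally have h: "4 * t\<^sup>2 * y\<^sup>2 - (t\<^sup>2 + y\<^sup>2 - z\<^sup>2)\<^sup>2 = 4 * p\<^sup>2 * (1 - (S t)\<^sup>2)" .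
        have p1: "(4 * p\<^sup>2 * (1 - (S t)\<^sup>2)) powr (\<alpha> - 1/2) = 4 powr (\<alpha> - 1/2) * p powr (2 * \<alpha> - 1) * (1 - (S t)\<^sup>2) powr (\<alpha> - 1/2)"
        proof -
          have "p\<^sup>2 powr (\<alpha> - 1/2) = p powr (2 * \<alpha> - 1)"
            using p powr_powr[of p 2 "\<alpha> - 1/2"] by (simp add: algebra_simps)
          then show ?thesis by (simp only: powr_mult)
        qed
        have p2: "\<bar>t * y * z\<bar> powr (2 * \<alpha>) = t powr (2 * \<alpha>) * p powr (2 * \<alpha>)"
          using True by (simp add: abs_mult p_def powr_mult mult.assoc)
        have D: "dunkl_Delta \<alpha> t y z = 4 powr (\<alpha> - 1/2) * p powr (2 * \<alpha> - 1) * (1 - (S t)\<^sup>2) powr (\<alpha> - 1/2) / (t powr (2 * \<alpha>) * p powr (2 * \<alpha>))"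
          unfolding dunkl_Delta_alt h p1 p2 using tri by simp
        have p3: "p powr (2 * \<alpha>) = p powr (2 * \<alpha> - 1) * p" 
          using p powr_add[of p "2 * \<alpha> - 1" 1] by simp
        have t3: "t powr (2 * \<alpha> + 1) = t powr (2 * \<alpha>) * t"
          using True powr_add[of t "2 * \<alpha>" 1] by simp
        \<comment> \<open>All powers of t and p cancel except t / p, which is the derivative of
          \<open>S\<close>.\<close>
        have "\<bar>t\<bar> powr (2 * \<alpha> + 1) / mconst * dunkl_Delta \<alpha> t y z = 
           4 powr (\<alpha> - 1/2) / mconst * ((1 - (S t)\<^sup>2) powr (\<alpha> - 1/2) * (t / p))"
          unfolding D p3 using True t3 p mconst by (simp add: field_simps)
        then have "ennreal (\<bar>t\<bar> powr (2 * \<alpha> + 1) / mconst) * ennreal (dunkl_Delta \<alpha> t y z) = 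
           ennreal (4 powr (\<alpha> - 1/2) / mconst) * (ennreal ((1 - (S t)\<^sup>2) powr (\<alpha> - 1/2)) * ennreal (t / p))"
          using mconst True p dunkl_Delta_nonneg by (simp flip: ennreal_mult)
        then show ?thesis using True unfolding G_def
          by (simp add: mult.assoc[symmetric]) (simp add: mult_ac)
      next
        case False
        then have "t < 0 \<or> \<not> (\<bar>z\<bar> \<le> \<bar>t\<bar> + \<bar>y\<bar> \<and> \<bar>t\<bar> \<le> \<bar>y\<bar> + \<bar>z\<bar> \<and> \<bar>y\<bar> \<le> \<bar>t\<bar> + \<bar>z\<bar>) \<and> t \<notin> {lo..hi}" 
          using elim by (auto simp: lo_def hi_def)
        then show ?thesis
        proof
          assume "t < 0" 
          then have "t \<notin> {lo..hi}" using lohi by auto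
          then show ?thesis using \<open>t < 0\<close> by simp
        next
          assume *: "\<not> (\<bar>z\<bar> \<le> \<bar>t\<bar> + \<bar>y\<bar> \<and> \<bar>t\<bar> \<le> \<bar>y\<bar> + \<bar>z\<bar> \<and> \<bar>y\<bar> \<le> \<bar>t\<bar> + \<bar>z\<bar>) \<and> t \<notin> {lo..hi}"
          then have "dunkl_Delta \<alpha> t y z = 0" unfolding dunkl_Delta_alt by auto
          then show ?thesis using * by simp
        qed
      qed
    qed
  qed
  also have "\<dots> = ennreal (4 powr (\<alpha> - 1/2) / mconst) * (\<integral>\<^sup>+t. G (S t) * ennreal (t / p) * indicator {lo..hi} t \<partial>lborel)"
    by (rule nn_integral_cmult) measurable
  also have "(\<integral>\<^sup>+t. G (S t) * ennreal (t / p) * indicator {lo..hi} t \<partial>lborel) = (\<integral>\<^sup>+s. G s * indicator {S lo..S hi} s \<partial>lborel)"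
  proof (rule nn_integral_substitution_aux[symmetric])
    show "(S has_real_derivative t / p) (at t)" for t
      unfolding S_def using p by (auto intro!: derivative_eq_intros)
    show "continuous_on {lo..hi} (\<lambda>t. t / p)" using p by (intro continuous_intros) auto
  qed (use lohi p in auto)
  also have "\<dots> = (\<integral>\<^sup>+s. F (\<sigma> * s) \<partial>gegen \<alpha>)"
    unfolding S1 G_def gegen_def
    by (subst nn_integral_density) (auto intro!: nn_integral_cong simp: indicator_def)
  also have "\<dots> = (\<integral>\<^sup>+s. F s \<partial>gegen \<alpha>)"
    using \<sigma> nn_integral_gegen_uminus[of F] by auto
  finally show ?thesis using mconst
    by (simp add: Delta_const_def ennreal_mult[symmetric] mult.assoc[symmetric] flip: ennreal_numeral)
qed

lemma Delta_integral_le: "(\<integral>\<^sup>+t. ennreal (dunkl_Delta \<alpha> t y z) \<partial>M) \<le> ennreal (Delta_const * gmass \<alpha>)"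
proof (cases "y = 0 \<or> z = 0")
  case True
  have "(\<integral>\<^sup>+t. ennreal (dunkl_Delta \<alpha> t y z) \<partial>M) = (\<integral>\<^sup>+t. 0 \<partial>M)"
  proof (intro nn_integral_cong_AE)
    \<comment> \<open>If one side is zero, the triangle inequalities force |t| to equal the other
      one, which happens on a null set.\<close>
    show "AE t in M. ennreal (dunkl_Delta \<alpha> t y z) = 0"
      using AE_M_neq[of y] AE_M_neq[of "-y"] AE_M_neq[of z] AE_M_neq[of "-z"]
      by eventually_elim (use True in \<open>auto simp: dunkl_Delta_alt abs_if split: if_splits\<close>)
  qed
  then show ?thesis by simp
next
  case False
  interpret finite_measure "gegen \<alpha>" by (rule finite_gegen[OF \<alpha>])
  have "(\<integral>\<^sup>+t. ennreal (dunkl_Delta \<alpha> t y z) \<partial>M) = ennreal Delta_const * emeasure (gegen \<alpha>) UNIV"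
    using Delta_substitution[of y z "\<lambda>_. 1"] False by simp
  also have "emeasure (gegen \<alpha>) UNIV = ennreal (gmass \<alpha>)"
    by (simp add: gmass_def emeasure_eq_measure)
  finally show ?thesis using Delta_const by (simp add: ennreal_mult')
qed

definition CW :: real where "CW = 4 * W_const \<alpha> * Delta_const * gmass \<alpha>"

lemma CW: "CW > 0"
  unfolding CW_def using W_const Delta_const gmass_pos[OF \<alpha>] by auto

lemma W_le_Delta: "ennreal \<bar>dunkl_W \<alpha> x y z\<bar> \<le> ennreal (4 * W_const \<alpha>) * ennreal (dunkl_Delta \<alpha> x y z)"
  using dunkl_W_bound[of \<alpha> x y z] W_const dunkl_Delta_nonneg[of \<alpha> x y z]
  by (simp flip: ennreal_mult)

text \<open>W is not symmetric but its majorant \<Delta> is, so one substitution bounds the mass in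
  each of the three variables. This uniformity is behind Schur's test for the heat kernel and behind
  the boundedness of translations.\<close>

lemma W_integral_le:
  "(\<integral>\<^sup>+t. ennreal \<bar>dunkl_W \<alpha> t y z\<bar> \<partial>M) \<le> ennreal CW"
  "(\<integral>\<^sup>+t. ennreal \<bar>dunkl_W \<alpha> y t z\<bar> \<partial>M) \<le> ennreal CW"
  "(\<integral>\<^sup>+t. ennreal \<bar>dunkl_W \<alpha> y z t\<bar> \<partial>M) \<le> ennreal CW"
proof -
  have *: "(\<integral>\<^sup>+t. ennreal \<bar>w t\<bar> \<partial>M) \<le> ennreal CW"
    if "\<And>t. ennreal \<bar>w t\<bar> \<le> ennreal (4 * W_const \<alpha>) * ennreal (dunkl_Delta \<alpha> t y z)" for w y z
  proof -
    have "(\<integral>\<^sup>+t. ennreal \<bar>w t\<bar> \<partial>M) \<le> (\<integral>\<^sup>+t. ennreal (4 * W_const \<alpha>) * ennreal (dunkl_Delta \<alpha> t y z) \<partial>M)"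
      by (intro nn_integral_mono that)
    also have "\<dots> = ennreal (4 * W_const \<alpha>) * (\<integral>\<^sup>+t. ennreal (dunkl_Delta \<alpha> t y z) \<partial>M)"
      by (subst nn_integral_cmult) auto
    also have "\<dots> \<le> ennreal (4 * W_const \<alpha>) * ennreal (Delta_const * gmass \<alpha>)"
      by (intro mult_left_mono Delta_integral_le) auto
    also have "\<dots> = ennreal CW"
      using W_const Delta_const gmass_pos[OF \<alpha>] by (simp add: CW_def mult.assoc flip: ennreal_mult)
    finally show ?thesis .
  qed
  show "(\<integral>\<^sup>+t. ennreal \<bar>dunkl_W \<alpha> t y z\<bar> \<partial>M) \<le> ennreal CW"
    by (rule * W_le_Delta)+
  show "(\<integral>\<^sup>+t. ennreal \<bar>dunkl_W \<alpha> y t z\<bar> \<partial>M) \<le> ennreal CW"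
    by (rule *[of _ y z]) (metis W_le_Delta dunkl_Delta_swap12)
  show "(\<integral>\<^sup>+t. ennreal \<bar>dunkl_W \<alpha> y z t\<bar> \<partial>M) \<le> ennreal CW"
    by (rule *[of _ z y]) (metis W_le_Delta dunkl_Delta_swap13)
qed

lemma integrable_W: "integrable M (\<lambda>t. dunkl_W \<alpha> t y z)"
  using W_integral_le(1)[of y z] by (intro integrableI_bounded) (auto intro: le_less_trans)

text \<open>\<open>Delta_substitution\<close> as an identity of image measures, which makes it
  available for integrands of both signs.\<close>

lemma Delta_distr:
  assumes yz: "y \<noteq> 0" "z \<noteq> 0"
  shows "distr (density M (\<lambda>t. ennreal (dunkl_Delta \<alpha> t y z))) borel (\<lambda>t. (y\<^sup>2 + z\<^sup>2 - t\<^sup>2) / (2 * y * z)) =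
     density (gegen \<alpha>) (\<lambda>_. ennreal Delta_const)" (is "?L = ?R")
proof (rule measure_eqI)
  fix A assume "A \<in> sets ?L"
  then have [measurable]: "A \<in> sets borel" by simp
  have "emeasure ?L A = (\<integral>\<^sup>+s. indicator A s \<partial>?L)"
    by (subst nn_integral_indicator) auto
  also have "\<dots> = (\<integral>\<^sup>+t. indicator A ((y\<^sup>2 + z\<^sup>2 - t\<^sup>2) / (2 * y * z)) \<partial>density M (\<lambda>t. ennreal (dunkl_Delta \<alpha> t y z)))"
    by (subst nn_integral_distr) auto
  also have "\<dots> = (\<integral>\<^sup>+t. ennreal (dunkl_Delta \<alpha> t y z) * indicator A ((y\<^sup>2 + z\<^sup>2 - t\<^sup>2) / (2 * y * z)) \<partial>M)"
    by (subst nn_integral_density) auto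
  also have "\<dots> = ennreal Delta_const * (\<integral>\<^sup>+s. indicator A s \<partial>gegen \<alpha>)"
    by (rule Delta_substitution[OF yz]) measurable
  also have "\<dots> = emeasure ?R A"
    by (subst emeasure_density) (auto simp: nn_integral_cmult)
  finally show "emeasure ?L A = emeasure ?R A" .
qed simp

definition W_mass :: real where "W_mass = W_const \<alpha> * Delta_const"

lemma W_mass: "W_mass > 0"
  using W_const Delta_const by (simp add: W_mass_def)

lemma integrable_W_mult:
  assumes [measurable]: "h \<in> borel_measurable borel" and K: "\<And>t. \<bar>h t\<bar> \<le> K"
  shows "integrable M (\<lambda>t. dunkl_W \<alpha> t y z * h t)"
proof (rule Bochner_Integration.integrable_bound)
  show "integrable M (\<lambda>t. K * dunkl_W \<alpha> t y z)" using integrable_W by simp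
  show "AE t in M. norm (dunkl_W \<alpha> t y z * h t) \<le> norm (K * dunkl_W \<alpha> t y z)"
    using K by (intro always_eventually) (auto simp: abs_mult mult.commute intro!: mult_right_mono order_trans[OF K])
qed measurable

text \<open>Against a function of t^2 only the even part of W in t counts. By
  \<open>dunkl_W_even_part\<close> this is 1 plus the cosine opposite to t, times \<Delta>, and the
  substitution turns it into the weight 1 + s.\<close>

lemma W_even_integral:
  assumes yz: "y \<noteq> 0" "z \<noteq> 0" and [measurable]: "h \<in> borel_measurable borel" and K: "\<And>v. v \<ge> 0 \<Longrightarrow> \<bar>h v\<bar> \<le> K"
  shows "(LINT t|M. dunkl_W \<alpha> t y z * h (t\<^sup>2)) = W_mass * (LINT s|gegen \<alpha>. (1 + s) * h (y\<^sup>2 + z\<^sup>2 - 2 * y * z * s))"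
proof -
  let ?T = "\<lambda>t. (y\<^sup>2 + z\<^sup>2 - t\<^sup>2) / (2 * y * z)"
  let ?G = "\<lambda>s. (1 + s) * h (y\<^sup>2 + z\<^sup>2 - 2 * y * z * s)"
  have i: "integrable M (\<lambda>t. dunkl_W \<alpha> t y z * h (t\<^sup>2))"
    using K by (intro integrable_W_mult[where K = K]) auto
  have "(LINT t|M. dunkl_W \<alpha> t y z * h (t\<^sup>2)) = (LINT t|M. W_const \<alpha> * (dunkl_Delta \<alpha> t y z * ?G (?T t)))"
    unfolding integral_M_even_part[OF i]
  proof (intro Bochner_Integration.integral_cong refl)
    fix t
    have "y\<^sup>2 + z\<^sup>2 - 2 * y * z * ?T t = t\<^sup>2" using yz by simp
    moreover have "dunkl_b z y t = ?T t" using yz by (simp add: dunkl_b_def mult_ac add.commute)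
    moreover have "(1/2) *\<^sub>R (dunkl_W \<alpha> t y z * h (t\<^sup>2) + dunkl_W \<alpha> (- t) y z * h ((- t)\<^sup>2)) = 
      (1/2) * (dunkl_W \<alpha> t y z + dunkl_W \<alpha> (- t) y z) * h (t\<^sup>2)"
      by (simp add: algebra_simps)
    ultimately show "(1/2) *\<^sub>R (dunkl_W \<alpha> t y z * h (t\<^sup>2) + dunkl_W \<alpha> (- t) y z * h ((- t)\<^sup>2)) = 
       W_const \<alpha> * (dunkl_Delta \<alpha> t y z * ?G (?T t))"
      unfolding dunkl_W_even_part by simp
  qed
  also have "\<dots> = W_const \<alpha> * (LINT t|M. dunkl_Delta \<alpha> t y z * ?G (?T t))"
    by simp
  also have "(LINT t|M. dunkl_Delta \<alpha> t y z * ?G (?T t)) = (LINT t|density M (\<lambda>t. ennreal (dunkl_Delta \<alpha> t y z)). ?G (?T t))"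
    by (subst integral_density) (auto simp: dunkl_Delta_nonneg)
  also have "\<dots> = (LINT s|distr (density M (\<lambda>t. ennreal (dunkl_Delta \<alpha> t y z))) borel ?T. ?G s)"
    by (subst integral_distr) auto
  also have "\<dots> = Delta_const * (LINT s|gegen \<alpha>. ?G s)"
    unfolding Delta_distr[OF yz] using Delta_const by (subst integral_density) auto
  finally show ?thesis by (simp add: W_mass_def)
qed

text \<open>The function \<open>ker_even (x * t)\<close> depends on t only through t^2, so this is
  \<open>gegen_product_formula\<close> carried back to the variable t.\<close>

lemma W_product_formula:
  assumes yz: "y \<noteq> 0" "z \<noteq> 0"
  shows "(LINT t|M. dunkl_W \<alpha> t y z * ker_even (x * t)) = W_mass * gmass \<alpha> * bes_prod \<alpha> x y z"
proof -
  have [measurable]: "bes \<alpha> \<in> borel_measurable borel" by (rule bes_measurable[OF \<alpha>1(1)])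
  have "(LINT t|M. dunkl_W \<alpha> t y z * ker_even (x * t)) = (LINT t|M. dunkl_W \<alpha> t y z * bes \<alpha> (x\<^sup>2 * t\<^sup>2))"
    by (simp add: ker_even_def power_mult_distrib)
  also have "\<dots> = W_mass * (LINT s|gegen \<alpha>. (1 + s) * bes \<alpha> (x\<^sup>2 * (y\<^sup>2 + z\<^sup>2 - 2 * y * z * s)))"
    using \<alpha> by (intro W_even_integral[OF yz, where K = 1]) (auto intro!: bes_bounded)
  finally show ?thesis by (simp add: gegen_product_formula[OF \<alpha>])
qed

lemma ker_mult_cnj: "ker x y * cnj (ker x z) = complex_of_real (bes_prod \<alpha> x y z) + 
   \<i> * complex_of_real (ker_even (x * y) * ker_odd (x * z) - ker_odd (x * y) * ker_even (x * z))"
  by (simp add: ker_eq bes_prod_alt complex_eq_iff algebra_simps)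

end

section \<open>Boundedness of the Dunkl transform on square integrable functions\<close>

lemma nn_integral_UN_incseq:
  assumes [measurable]: "f \<in> borel_measurable N" "\<And>n::nat. A n \<in> sets N" and "incseq A"
  shows "(\<integral>\<^sup>+x. f x * indicator (\<Union>n. A n) x \<partial>N) = (SUP n. \<integral>\<^sup>+x. f x * indicator (A n) x \<partial>N)"
proof -
  have "(SUP n. emeasure (density N f) (A n)) = emeasure (density N f) (\<Union>n. A n)"
    using assms by (intro SUP_emeasure_incseq) auto
  then show ?thesis by (simp add: emeasure_density)
qed

text \<open>Substitution on the compact intervals [0, n + 1], then monotone convergence in
  n.\<close>

lemma nn_integral_square_substitution:
  fixes f :: "real \<Rightarrow> ennreal"
  assumes [measurable]: "f \<in> borel_measurable borel"
  shows "(\<integral>\<^sup>+t. f (t\<^sup>2) * ennreal (2 * t) * indicator {0..} t \<partial>lborel) = (\<integral>\<^sup>+u. f u * indicator {0..} u \<partial>lborel)"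
proof -
  let ?A = "\<lambda>n. {0..(real (Suc n))\<^sup>2}" and ?B = "\<lambda>n. {0..real (Suc n)}"
  have UA: "(\<Union>n. ?A n) = {0..}"
  proof (intro equalityI subsetI)
    fix x :: real assume "x \<in> {0..}"
    then have "0 \<le> x" by simp
    obtain n where "x \<le> real n" using real_arch_simple by blast
    then have "x \<le> real (Suc n) * 1" by simp
    also have "\<dots> \<le> real (Suc n) * real (Suc n)" by (intro mult_left_mono) auto
    finally have "x \<in> ?A n" using \<open>0 \<le> x\<close> by (simp add: power2_eq_square)
    then show "x \<in> (\<Union>n. ?A n)" by blast
  qed auto
  have UB: "(\<Union>n. ?B n) = {0..}"
  proof (intro equalityI subsetI)
    fix x :: real assume "x \<in> {0..}"
    then have "0 \<le> x" by simp
    obtain n where "x \<le> real n" using real_arch_simple by blast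
    then have "x \<in> ?B n" using \<open>0 \<le> x\<close> by simp
    then show "x \<in> (\<Union>n. ?B n)" by blast
  qed auto
  have inc: "incseq ?A"
    unfolding incseq_def
  proof (intro allI impI)
    fix m n :: nat assume "m \<le> n"
    then have "(real (Suc m))\<^sup>2 \<le> (real (Suc n))\<^sup>2" by (intro power_mono) auto
    then show "?A m \<subseteq> ?A n" by (simp only: atLeastatMost_subset_iff order_refl simp_thms)
  qed
  have "(\<integral>\<^sup>+u. f u * indicator {0..} u \<partial>lborel) = (SUP n. \<integral>\<^sup>+u. f u * indicator (?A n) u \<partial>lborel)"
    unfolding UA[symmetric] using inc by (intro nn_integral_UN_incseq) auto
  also have "\<dots> = (SUP n. \<integral>\<^sup>+t. f (t\<^sup>2) * ennreal (2 * t) * indicator (?B n) t \<partial>lborel)"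
  proof (rule SUP_cong[OF refl])
    fix n :: nat
    have "(\<integral>\<^sup>+u. f u * indicator {0\<^sup>2..(real (Suc n))\<^sup>2} u \<partial>lborel) = (\<integral>\<^sup>+t. f (t\<^sup>2) * ennreal (2 * t) * indicator (?B n) t \<partial>lborel)"
      by (intro nn_integral_substitution_aux) (auto intro!: derivative_eq_intros continuous_intros)
    then show "(\<integral>\<^sup>+u. f u * indicator (?A n) u \<partial>lborel) = (\<integral>\<^sup>+t. f (t\<^sup>2) * ennreal (2 * t) * indicator (?B n) t \<partial>lborel)"
      by simp
  qed
  also have "\<dots> = (\<integral>\<^sup>+t. f (t\<^sup>2) * ennreal (2 * t) * indicator (\<Union>n. ?B n) t \<partial>lborel)"
    by (rule nn_integral_UN_incseq[symmetric]) (auto simp: incseq_def)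
  finally show ?thesis unfolding UB ..
qed

lemma borel_measurable_cnj [measurable (raw)]:
  "f \<in> borel_measurable N \<Longrightarrow> (\<lambda>x. cnj (f x)) \<in> borel_measurable N"
  by (rule borel_measurable_continuous_on[of cnj f N]) (auto intro!: continuous_intros)

text \<open>Integrability is no issue: the Bochner integral of a function that is not integrable is
  0 by convention.\<close>

lemma norm_integral_le_nn:
  fixes f :: "'a \<Rightarrow> 'b::{banach, second_countable_topology}"
  shows "ennreal (norm (integral\<^sup>L N f)) \<le> (\<integral>\<^sup>+x. ennreal (norm (f x)) \<partial>N)"
proof (cases "integrable N f")
  case True then show ?thesis by (rule integral_norm_bound_ennreal)
qed (simp add: not_integrable_integral_eq)

context dunkl
begin

lemma Fubini_M:
  fixes f :: "real \<Rightarrow> real \<Rightarrow> 'b::{banach, second_countable_topology}"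
  assumes [measurable]: "case_prod f \<in> borel_measurable (borel \<Otimes>\<^sub>M borel)"
    and fin: "(\<integral>\<^sup>+x. \<integral>\<^sup>+y. ennreal (norm (f x y)) \<partial>M \<partial>M) < \<infinity>"
  shows "(LINT x|M. LINT y|M. f x y) = (LINT y|M. LINT x|M. f x y)"
    and "AE x in M. integrable M (f x)"
    and "AE y in M. integrable M (\<lambda>x. f x y)"
    and "integrable M (\<lambda>x. LINT y|M. f x y)"
proof -
  have i: "integrable (M \<Otimes>\<^sub>M M) (case_prod f)"
  proof (rule integrableI_bounded)
    have "(\<integral>\<^sup>+x. \<integral>\<^sup>+y. ennreal (norm (f x y)) \<partial>M \<partial>M) = (\<integral>\<^sup>+p. ennreal (norm (case_prod f p)) \<partial>(M \<Otimes>\<^sub>M M))"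
      using M.nn_integral_fst[of "\<lambda>p. ennreal (norm (case_prod f p))" M] by simp
    then show "(\<integral>\<^sup>+p. ennreal (norm (case_prod f p)) \<partial>(M \<Otimes>\<^sub>M M)) < \<infinity>" using fin by simp
  qed simp
  show "(LINT x|M. LINT y|M. f x y) = (LINT y|M. LINT x|M. f x y)"
    by (rule MM.Fubini_integral[OF i, symmetric])
  show "AE x in M. integrable M (f x)"
    using MM.AE_integrable_fst[OF i] by simp
  show "AE y in M. integrable M (\<lambda>x. f x y)"
    using MM.AE_integrable_snd[OF i] by simp
  show "integrable M (\<lambda>x. LINT y|M. f x y)"
    by (rule MM.integrable_fst[OF i])
qed

section \<open>Gaussians, their transforms and the heat kernel\<close>

text \<open>The mass of exp(-x^2) under the Dunkl measure, by \<open>nn_gaussian_moment_1\<close> at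
  n = 0.\<close>

definition g0 :: real where "g0 = Gamma (\<alpha> + 1) / mconst"

lemma g0: "g0 > 0"
  using mconst \<alpha>1 by (simp add: g0_def Gamma_real_pos)

lemma g0_alt: "g0 = 2 powr (- (\<alpha> + 1))"
proof -
  have "Gamma (\<alpha> + 1) > 0" using \<alpha>1 by (intro Gamma_real_pos) auto
  then show ?thesis unfolding powr_minus_divide by (simp add: g0_def mconst_def)
qed

lemma nn_gaussian_moment_1:
  "(\<integral>\<^sup>+x. ennreal (exp (- x\<^sup>2) * (x\<^sup>2) ^ n) \<partial>M) = ennreal (g0 * pochhammer (\<alpha> + 1) n)"
proof -
  let ?f = "\<lambda>u::real. ennreal (u powr (n + \<alpha>) * exp (- u) / mconst)"
  have "(\<integral>\<^sup>+x. ennreal (exp (- x\<^sup>2) * (x\<^sup>2) ^ n) \<partial>M) = 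
    (\<integral>\<^sup>+x. ennreal (\<bar>x\<bar> powr (2 * \<alpha> + 1) / mconst) * ennreal (exp (- x\<^sup>2) * (x\<^sup>2) ^ n) \<partial>lborel)"
    by (subst nn_integral_M) auto
  also have "\<dots> = 2 * (\<integral>\<^sup>+x. ennreal (\<bar>x\<bar> powr (2 * \<alpha> + 1) / mconst) * ennreal (exp (- x\<^sup>2) * (x\<^sup>2) ^ n) * indicator {0<..} x \<partial>lborel)"
    by (rule nn_integral_even_half) auto
  also have "\<dots> = (\<integral>\<^sup>+x. 2 * (ennreal (\<bar>x\<bar> powr (2 * \<alpha> + 1) / mconst) * ennreal (exp (- x\<^sup>2) * (x\<^sup>2) ^ n) * indicator {0<..} x) \<partial>lborel)"
    by (rule nn_integral_cmult[symmetric]) measurable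
  also have "\<dots> = (\<integral>\<^sup>+x. ?f (x\<^sup>2) * ennreal (2 * x) * indicator {0..} x \<partial>lborel)"
  proof (intro nn_integral_cong_AE)
    show "AE x in lborel. 2 * (ennreal (\<bar>x\<bar> powr (2 * \<alpha> + 1) / mconst) * ennreal (exp (- x\<^sup>2) * (x\<^sup>2) ^ n) * indicator {0<..} x)
      = ?f (x\<^sup>2) * ennreal (2 * x) * indicator {0..} x"
      using AE_lborel_neq[of 0]
    proof eventually_elim
      case (elim x)
      show ?case
      proof (cases "x > 0")
        case True
        have "(x\<^sup>2) powr (n + \<alpha>) = (x\<^sup>2) ^ n * x powr (2 * \<alpha>)"
          using True powr_powr[of x 2 \<alpha>] by (simp add: powr_add powr_realpow)
        moreover have "x powr (2 * \<alpha> + 1) = x powr (2 * \<alpha>) * x" using True powr_add[of x "2 * \<alpha>" 1] by simp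
        ultimately have "2 * (\<bar>x\<bar> powr (2 * \<alpha> + 1) / mconst * (exp (- x\<^sup>2) * (x\<^sup>2) ^ n)) = 
           (x\<^sup>2) powr (n + \<alpha>) * exp (- x\<^sup>2) / mconst * (2 * x)"
          using True by simp
        note key = this
        have "2 * (ennreal (\<bar>x\<bar> powr (2 * \<alpha> + 1) / mconst) * ennreal (exp (- x\<^sup>2) * (x\<^sup>2) ^ n)) =
            ennreal (2 * (\<bar>x\<bar> powr (2 * \<alpha> + 1) / mconst * (exp (- x\<^sup>2) * (x\<^sup>2) ^ n)))"
        proof -
          have "2 * (ennreal a * ennreal b) = ennreal (2 * (a * b))" if "a \<ge> 0" "b \<ge> 0" for a b
            using that by (simp add: ennreal_mult)
          then show ?thesis using mconst by simp
        qed
        also have "\<dots> = ennreal ((x\<^sup>2) powr (n + \<alpha>) * exp (- x\<^sup>2) / mconst * (2 * x))"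
          by (simp only: key)
        also have "\<dots> = ?f (x\<^sup>2) * ennreal (2 * x)"
          using True mconst by (intro ennreal_mult) auto
        finally have "2 * (ennreal (\<bar>x\<bar> powr (2 * \<alpha> + 1) / mconst) * ennreal (exp (- x\<^sup>2) * (x\<^sup>2) ^ n)) =
          ?f (x\<^sup>2) * ennreal (2 * x)" .
        moreover have "indicator {0<..} x = (1::ennreal)" "indicator {0..} x = (1::ennreal)" using True by auto
        ultimately show ?thesis by (simp only: mult_1_right)
      next
        case False then show ?thesis using elim by simp
      qed
    qed
  qed
  also have "\<dots> = (\<integral>\<^sup>+u. ?f u * indicator {0..} u \<partial>lborel)"
    by (rule nn_integral_square_substitution) measurable
  also have "\<dots> = (\<integral>\<^sup>+u. ennreal (1 / mconst) * ennreal (indicator {0..} u * u powr (n + \<alpha> + 1 - 1) / exp u) \<partial>lborel)"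
    using mconst by (intro nn_integral_cong) (auto simp: indicator_def exp_minus field_simps simp flip: ennreal_mult)
  also have "\<dots> = ennreal (1 / mconst) * ennreal (Gamma (n + \<alpha> + 1))"
    using \<alpha> by (subst Gamma_conv_nn_integral_real) (auto intro!: nn_integral_cmult)
  also have "\<dots> = ennreal (g0 * pochhammer (\<alpha> + 1) n)"
  proof -
    have "\<alpha> + 1 \<notin> \<int>\<^sub>\<le>\<^sub>0" using \<alpha>1 by (auto elim!: nonpos_Ints_cases)
    then have "Gamma (n + \<alpha> + 1) = pochhammer (\<alpha> + 1) n * Gamma (\<alpha> + 1)"
      using \<alpha>1 by (simp add: pochhammer_Gamma add_ac Gamma_eq_zero_iff)
    then show ?thesis using mconst \<alpha>1 by (simp add: g0_def mult.commute flip: ennreal_mult')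
  qed
  finally show ?thesis .
qed

lemma nn_gaussian_moment:
  assumes r: "r > 0"
  shows "(\<integral>\<^sup>+x. ennreal (exp (- (x / r)\<^sup>2) * (x\<^sup>2) ^ n) \<partial>M) = 
    ennreal (r powr (2 * \<alpha> + 2) * g0 * (pochhammer (\<alpha> + 1) n * (r\<^sup>2) ^ n))"
proof -
  have "(\<integral>\<^sup>+x. ennreal (exp (- (x / r)\<^sup>2) * (x\<^sup>2) ^ n) \<partial>M) = 
    ennreal (r powr (2 * \<alpha> + 2)) * (\<integral>\<^sup>+x. ennreal (exp (- (r * x / r)\<^sup>2) * ((r * x)\<^sup>2) ^ n) \<partial>M)"
    by (rule nn_integral_M_scale[OF r]) measurable
  also have "\<dots> = ennreal (r powr (2 * \<alpha> + 2)) * (\<integral>\<^sup>+x. ennreal ((r\<^sup>2) ^ n) * ennreal (exp (- x\<^sup>2) * (x\<^sup>2) ^ n) \<partial>M)"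
    using r by (simp add: power_mult_distrib mult_ac flip: ennreal_mult)
  also have "\<dots> = ennreal (r powr (2 * \<alpha> + 2)) * (ennreal ((r\<^sup>2) ^ n) * ennreal (g0 * pochhammer (\<alpha> + 1) n))"
    by (subst nn_integral_cmult) (auto simp: nn_gaussian_moment_1)
  also have "\<dots> = ennreal (r powr (2 * \<alpha> + 2) * g0 * (pochhammer (\<alpha> + 1) n * (r\<^sup>2) ^ n))"
    using r g0 pochhammer_pos[OF \<alpha>1(3), of n] by (simp add: mult_ac flip: ennreal_mult)
  finally show ?thesis .
qed

definition gau :: "real \<Rightarrow> real \<Rightarrow> real" where "gau r x = exp (- (x / r)\<^sup>2)"

lemma gau_measurable [measurable]: "gau r \<in> borel_measurable borel"
  unfolding gau_def by measurable

lemma gau_pos: "gau r x > 0" and gau_le_1: "gau r x \<le> 1" and gau_even: "gau r (- x) = gau r x"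
  by (simp_all add: gau_def)

lemma gau_tendsto_1: "(\<lambda>n. gau (real (Suc n)) x) \<longlonglongrightarrow> 1"
proof -
  have "(\<lambda>n. x / real (Suc n)) \<longlonglongrightarrow> 0"
    by (rule LIMSEQ_Suc[OF lim_const_over_n])
  then have "(\<lambda>n. exp (- (x / real (Suc n))\<^sup>2)) \<longlonglongrightarrow> exp (- 0\<^sup>2)" by (intro tendsto_intros)
  then show ?thesis by (simp add: gau_def)
qed

lemma integrable_gau: "r > 0 \<Longrightarrow> integrable M (gau r)"
  using nn_gaussian_moment[of r 0] by (intro integrableI_bounded) (auto simp: gau_def)

text \<open>The transform of \<open>gau r\<close>. It is a Gaussian of width 2 / r and concentrates
  at 0 as r grows, while its mass stays 1 because \<open>g0 * g0\<close> cancels the power of 2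
  coming from the width.\<close>

definition gau_hat :: "real \<Rightarrow> real \<Rightarrow> real" where
  "gau_hat r t = r powr (2 * \<alpha> + 2) * g0 * gau (2 / r) t"

text \<open>The n-th Gaussian moment of x^2 carries \<open>pochhammer (\<alpha> + 1) n\<close>,
  which cancels the one in \<open>bes_coeff\<close>. The exponential series of -(rt/2)^2 is
  left.\<close>

lemma gaussian_transform:
  assumes r: "r > 0"
  shows "(LINT x|M. gau r x * ker_even (x * t)) = gau_hat r t"
proof -
  have [measurable]: "bes \<alpha> \<in> borel_measurable borel" by (rule bes_measurable[OF \<alpha>1(1)])
  let ?C = "r powr (2 * \<alpha> + 2) * g0"
  have C: "?C > 0" using r g0 by simp
  let ?N = "density M (\<lambda>x. ennreal (gau r x))"
  have pos: "pochhammer (\<alpha> + 1) n > 0" for n using \<alpha>1 by (intro pochhammer_pos) auto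
  have hb: "has_bochner_integral M (\<lambda>x. gau r x * (x\<^sup>2) ^ n) (?C * (pochhammer (\<alpha> + 1) n * (r\<^sup>2) ^ n))" for n
    using C pos[of n] r gau_pos[of r]
    by (intro has_bochner_integral_nn_integral) (auto simp: gau_def nn_gaussian_moment less_imp_le)
  have gi: "integrable ?N (\<lambda>x. (x\<^sup>2) ^ n)" "(LINT x|?N. (x\<^sup>2) ^ n) = ?C * (pochhammer (\<alpha> + 1) n * (r\<^sup>2) ^ n)" for n
    using hb[of n] gau_pos[of r]
    by (auto simp: integrable_density integral_density has_bochner_integral_iff less_imp_le)
  define w where "w = - (r * t / 2)\<^sup>2"
  have e: "bes_coeff \<alpha> n * (t\<^sup>2) ^ n * (?C * (pochhammer (\<alpha> + 1) n * (r\<^sup>2) ^ n)) = ?C * (w ^ n /\<^sub>R fact n)" for n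
  proof -
    have "w ^ n = (-1) ^ n * (r\<^sup>2) ^ n * (t\<^sup>2) ^ n / 4 ^ n"
      unfolding w_def by (subst power_minus) (simp add: power_mult_distrib power_divide)
    then show ?thesis using pos[of n] by (simp add: bes_coeff_def divide_inverse)
  qed
  have e2: "\<bar>bes_coeff \<alpha> n\<bar> * \<bar>t\<^sup>2\<bar> ^ n * (?C * (pochhammer (\<alpha> + 1) n * (r\<^sup>2) ^ n)) = ?C * norm (w ^ n /\<^sub>R fact n)" for n
    using arg_cong[OF e[of n], of abs] C pos[of n] by (simp add: abs_mult power_abs)
  have "(\<lambda>n. bes_coeff \<alpha> n * (t\<^sup>2) ^ n * (LINT x|?N. (x\<^sup>2) ^ n)) sums (LINT x|?N. bes \<alpha> (t\<^sup>2 * x\<^sup>2))"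
  proof (rule bes_moments(2)[OF \<alpha>1(1) gi(1)])
    show "summable (\<lambda>n. \<bar>bes_coeff \<alpha> n\<bar> * \<bar>t\<^sup>2\<bar> ^ n * (LINT x|?N. (x\<^sup>2) ^ n))"
      unfolding gi(2) e2 by (intro summable_mult summable_norm_exp)
  qed auto
  then have "(\<lambda>n. ?C * (w ^ n /\<^sub>R fact n)) sums (LINT x|?N. bes \<alpha> (t\<^sup>2 * x\<^sup>2))"
    unfolding gi(2) e .
  moreover have "(\<lambda>n. ?C * (w ^ n /\<^sub>R fact n)) sums (?C * exp w)"
    by (intro sums_mult exp_converges)
  ultimately have "(LINT x|?N. bes \<alpha> (t\<^sup>2 * x\<^sup>2)) = ?C * exp w" by (rule sums_unique2)
  moreover have "(LINT x|?N. bes \<alpha> (t\<^sup>2 * x\<^sup>2)) = (LINT x|M. gau r x * ker_even (x * t))"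
    using gau_pos[of r] by (subst integral_density) (auto simp: less_imp_le ker_even_def power_mult_distrib mult.commute)
  moreover have "exp w = gau (2 / r) t" by (simp add: gau_def w_def mult.commute)
  ultimately show ?thesis by (simp add: gau_hat_def)
qed

lemma gau_hat_nonneg: "gau_hat r t \<ge> 0"
  using g0 gau_pos[of "2 / r" t] by (simp add: gau_hat_def)

lemma gau_hat_measurable [measurable]: "gau_hat r \<in> borel_measurable borel"
  unfolding gau_hat_def by measurable

lemma gau_hat_mass:
  assumes r: "r > 0"
  shows "(\<integral>\<^sup>+t. ennreal (gau_hat r t) \<partial>M) = 1"
proof -
  have "(\<integral>\<^sup>+t. ennreal (gau_hat r t) \<partial>M) = (\<integral>\<^sup>+t. ennreal (r powr (2 * \<alpha> + 2) * g0) * ennreal (gau (2 / r) t) \<partial>M)"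
    using g0 gau_pos[of "2 / r"] by (intro nn_integral_cong) (simp add: gau_hat_def less_imp_le flip: ennreal_mult)
  also have "\<dots> = ennreal (r powr (2 * \<alpha> + 2) * g0) * ennreal ((2 / r) powr (2 * \<alpha> + 2) * g0)"
    using nn_gaussian_moment[of "2 / r" 0] r by (subst nn_integral_cmult) (auto simp: gau_def)
  also have "\<dots> = ennreal ((r powr (2 * \<alpha> + 2) * (2 / r) powr (2 * \<alpha> + 2)) * (g0 * g0))"
    using g0 by (simp add: mult_ac flip: ennreal_mult)
  also have "r powr (2 * \<alpha> + 2) * (2 / r) powr (2 * \<alpha> + 2) = 2 powr (2 * \<alpha> + 2)"
    using r by (simp flip: powr_mult)
  also have "g0 * g0 = 2 powr (- (2 * \<alpha> + 2))"
    unfolding g0_alt by (simp flip: powr_add)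
  also have "2 powr (2 * \<alpha> + 2) * 2 powr (- (2 * \<alpha> + 2)) = (1::real)"
    by (simp flip: powr_add)
  finally show ?thesis by simp
qed

text \<open>The kernel of the operator with multiplier \<open>gau r\<close>: the generalized heat
  kernel at time 1 / r^2.\<close>

definition heat :: "real \<Rightarrow> real \<Rightarrow> real \<Rightarrow> real" where
  "heat r y z = (LINT x|M. gau r x * bes_prod \<alpha> x y z)"

text \<open>The integral of W(t, y, z) over t for nonzero y and z: put x = 0 in
  \<open>W_product_formula\<close>.\<close>

definition \<kappa> :: real where "\<kappa> = W_mass * gmass \<alpha>"

lemma \<kappa>: "\<kappa> > 0" using W_mass gmass_pos[OF \<alpha>] by (simp add: \<kappa>_def)

lemma CW_\<kappa>: "CW = 4 * \<kappa>" by (simp add: CW_def \<kappa>_def W_mass_def)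

lemma bes_prod_measurable [measurable]:
  assumes [measurable]: "f \<in> borel_measurable N" "g \<in> borel_measurable N" "h \<in> borel_measurable N"
  shows "(\<lambda>x. bes_prod \<alpha> (f x) (g x) (h x)) \<in> borel_measurable N"
  unfolding bes_prod_alt by measurable

lemma bes_prod_bound: "\<bar>bes_prod \<alpha> x y z\<bar> \<le> 1"
proof -
  have "bes_prod \<alpha> x y z = Re (ker x y * cnj (ker x z))"
    by (subst ker_mult_cnj) simp
  also have "\<bar>\<dots>\<bar> \<le> norm (ker x y * cnj (ker x z))" by (rule abs_Re_le_cmod)
  also have "\<dots> \<le> 1 * 1" unfolding norm_mult by (intro mult_mono) (auto simp: norm_ker)
  finally show ?thesis by simp
qed

text \<open>Fubini applied to the product formula. It exhibits the kernel of an even multiplier as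
  an average of the transform of that multiplier, so bounds and concentration of the transform pass
  to the kernel.\<close>

lemma W_transform:
  assumes yz: "y \<noteq> 0" "z \<noteq> 0" and h: "integrable M h"
  shows "\<kappa> * (LINT x|M. h x * bes_prod \<alpha> x y z) = (LINT t|M. dunkl_W \<alpha> t y z * (LINT x|M. h x * ker_even (x * t)))"
proof -
  have [measurable]: "h \<in> borel_measurable borel" using borel_measurable_integrable[OF h] by simp
  have "\<kappa> * (LINT x|M. h x * bes_prod \<alpha> x y z) = (LINT x|M. h x * (LINT t|M. dunkl_W \<alpha> t y z * ker_even (x * t)))"
    unfolding W_product_formula[OF yz] \<kappa>_def[symmetric] by (simp add: mult.left_commute[of _ \<kappa>])
  also have "\<dots> = (LINT x|M. LINT t|M. h x * (dunkl_W \<alpha> t y z * ker_even (x * t)))"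
    by (simp only: Bochner_Integration.integral_mult_right_zero)
  also have "\<dots> = (LINT t|M. LINT x|M. h x * (dunkl_W \<alpha> t y z * ker_even (x * t)))"
  proof (rule Fubini_M(1))
    have "(\<integral>\<^sup>+x. \<integral>\<^sup>+t. ennreal (norm (h x * (dunkl_W \<alpha> t y z * ker_even (x * t)))) \<partial>M \<partial>M) \<le>
      (\<integral>\<^sup>+x. \<integral>\<^sup>+t. ennreal \<bar>h x\<bar> * ennreal \<bar>dunkl_W \<alpha> t y z\<bar> \<partial>M \<partial>M)"
      using ker_even_bound
      by (intro nn_integral_mono) (auto simp: abs_mult intro!: ennreal_leI mult_left_mono mult_left_le simp flip: ennreal_mult)
    also have "\<dots> \<le> (\<integral>\<^sup>+x. ennreal \<bar>h x\<bar> * ennreal CW \<partial>M)"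
      by (intro nn_integral_mono) (auto simp: nn_integral_cmult intro!: mult_left_mono W_integral_le)
    also have "\<dots> = (\<integral>\<^sup>+x. ennreal \<bar>h x\<bar> \<partial>M) * ennreal CW"
      by (rule nn_integral_multc) measurable
    also have "\<dots> < \<infinity>"
      using h by (auto simp: integrable_iff_bounded ennreal_mult_less_top)
    finally show "(\<integral>\<^sup>+x. \<integral>\<^sup>+t. ennreal (norm (h x * (dunkl_W \<alpha> t y z * ker_even (x * t)))) \<partial>M \<partial>M) < \<infinity>" .
  qed measurable
  also have "\<dots> = (LINT t|M. dunkl_W \<alpha> t y z * (LINT x|M. h x * ker_even (x * t)))"
    by (simp only: mult.left_commute[of "h _" "dunkl_W \<alpha> _ y z"] Bochner_Integration.integral_mult_right_zero)
  finally show ?thesis .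
qed

lemma heat_eq:
  assumes "y \<noteq> 0" "z \<noteq> 0" "r > 0"
  shows "\<kappa> * heat r y z = (LINT t|M. dunkl_W \<alpha> t y z * gau_hat r t)"
  using W_transform[OF assms(1,2) integrable_gau[OF assms(3)]] gaussian_transform[OF assms(3)]
  by (simp add: heat_def)

lemma heat_measurable [measurable]:
  assumes [measurable]: "f \<in> borel_measurable N" "g \<in> borel_measurable N"
  shows "(\<lambda>x. heat r (f x) (g x)) \<in> borel_measurable N"
  unfolding heat_def by measurable

lemma heat_le:
  assumes "y \<noteq> 0" "z \<noteq> 0" "r > 0"
  shows "ennreal \<bar>heat r y z\<bar> \<le> ennreal (1 / \<kappa>) * (\<integral>\<^sup>+t. ennreal \<bar>dunkl_W \<alpha> t y z\<bar> * ennreal (gau_hat r t) \<partial>M)"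
proof -
  have "ennreal \<bar>heat r y z\<bar> = ennreal (1 / \<kappa>) * ennreal (norm (LINT t|M. dunkl_W \<alpha> t y z * gau_hat r t))"
    using \<kappa> by (simp flip: heat_eq[OF assms] ennreal_mult add: abs_mult)
  also have "\<dots> \<le> ennreal (1 / \<kappa>) * (\<integral>\<^sup>+t. ennreal (norm (dunkl_W \<alpha> t y z * gau_hat r t)) \<partial>M)"
    by (intro mult_left_mono norm_integral_le_nn) auto
  also have "\<dots> = ennreal (1 / \<kappa>) * (\<integral>\<^sup>+t. ennreal \<bar>dunkl_W \<alpha> t y z\<bar> * ennreal (gau_hat r t) \<partial>M)"
    using gau_hat_nonneg by (simp add: abs_mult ennreal_mult)
  finally show ?thesis .
qed

text \<open>The bound is \<open>CW / \<kappa>\<close>, and it does not depend on r because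
  \<open>gau_hat r\<close> has mass 1. With the symmetry of the kernel this is the input of Schur's
  test.\<close>

lemma heat_integral_le:
  assumes "y \<noteq> 0" "r > 0"
  shows "(\<integral>\<^sup>+z. ennreal \<bar>heat r y z\<bar> \<partial>M) \<le> 4"
proof -
  have "(\<integral>\<^sup>+z. ennreal \<bar>heat r y z\<bar> \<partial>M) \<le> (\<integral>\<^sup>+z. ennreal (1 / \<kappa>) * (\<integral>\<^sup>+t. ennreal \<bar>dunkl_W \<alpha> t y z\<bar> * ennreal (gau_hat r t) \<partial>M) \<partial>M)"
    using AE_M_neq[of 0] by (intro nn_integral_mono_AE) (auto intro!: heat_le assms)
  also have "\<dots> = ennreal (1 / \<kappa>) * (\<integral>\<^sup>+z. (\<integral>\<^sup>+t. ennreal \<bar>dunkl_W \<alpha> t y z\<bar> * ennreal (gau_hat r t) \<partial>M) \<partial>M)"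
    by (rule nn_integral_cmult) measurable
  also have "(\<integral>\<^sup>+z. (\<integral>\<^sup>+t. ennreal \<bar>dunkl_W \<alpha> t y z\<bar> * ennreal (gau_hat r t) \<partial>M) \<partial>M) = 
     (\<integral>\<^sup>+t. (\<integral>\<^sup>+z. ennreal \<bar>dunkl_W \<alpha> t y z\<bar> * ennreal (gau_hat r t) \<partial>M) \<partial>M)"
    by (rule MM.Fubini') measurable
  also have "\<dots> \<le> (\<integral>\<^sup>+t. ennreal CW * ennreal (gau_hat r t) \<partial>M)"
    by (intro nn_integral_mono) (auto simp: nn_integral_multc intro!: mult_right_mono W_integral_le)
  also have "\<dots> = ennreal CW"
    by (subst nn_integral_cmult) (auto simp: gau_hat_mass assms)
  finally have "(\<integral>\<^sup>+z. ennreal \<bar>heat r y z\<bar> \<partial>M) \<le> ennreal (1 / \<kappa>) * ennreal CW" by (simp add: mult_left_mono)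
  also have "\<dots> = 4" using \<kappa> CW by (simp add: CW_\<kappa> flip: ennreal_mult')
  finally show ?thesis .
qed

lemma heat_commute: "heat r y z = heat r z y"
  by (simp add: heat_def bes_prod_alt mult.commute)

section \<open>The transform of integrable functions and its square-norm bound\<close>

abbreviation F1 :: "(real \<Rightarrow> complex) \<Rightarrow> real \<Rightarrow> complex" where "F1 \<equiv> dunkl_transform_L1 \<alpha>"

lemma F1_def: "F1 f x = (LINT y|M. ker x y * f y)"
  by (simp add: dunkl_transform_L1_def ker_def)

lemma F1_measurable [measurable]: 
  assumes [measurable]: "f \<in> borel_measurable borel"
  shows "F1 f \<in> borel_measurable borel"
  unfolding F1_def by measurable

lemma F1_bound: "ennreal (norm (F1 f x)) \<le> (\<integral>\<^sup>+y. ennreal (norm (f y)) \<partial>M)"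
  unfolding F1_def
  by (rule order_trans[OF norm_integral_le_nn])
     (auto intro!: nn_integral_mono ennreal_leI simp: norm_mult norm_ker mult_left_le_one_le)

lemma integrable_ker_mult:
  assumes "integrable M f"
  shows "integrable M (\<lambda>y. ker x y * f y)"
proof (rule Bochner_Integration.integrable_bound[OF assms])
  have [measurable]: "f \<in> borel_measurable borel" using borel_measurable_integrable[OF assms] by simp
  show "(\<lambda>y. ker x y * f y) \<in> borel_measurable M" by measurable
  show "AE y in M. norm (ker x y * f y) \<le> norm (f y)"
    by (auto simp: norm_mult norm_ker mult_left_le_one_le)
qed

lemma F1_bound': 
  assumes "integrable M f"
  shows "norm (F1 f x) \<le> (LINT y|M. norm (f y))"
proof -
  have "ennreal (norm (F1 f x)) \<le> ennreal (LINT y|M. norm (f y))"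
    using F1_bound[of f x] assms by (subst (asm) nn_integral_eq_integral) auto
  then show ?thesis by simp
qed

lemma integral_odd_zero:
  fixes f :: "real \<Rightarrow> complex"
  assumes [measurable]: "f \<in> borel_measurable borel" and "\<And>x. f (- x) = - f x"
  shows "(LINT x|M. f x) = 0"
  using integral_M_uminus(1)[of f] assms(2) by simp

text \<open>The imaginary part of the kernel product is odd in x, so it integrates to zero against
  an even function.\<close>

lemma integral_ker_prod_even:
  assumes h: "integrable M h" and even: "\<And>x. h (- x) = h x"
  shows "(LINT x|M. complex_of_real (h x) * (ker x y * cnj (ker x z))) = complex_of_real (LINT x|M. h x * bes_prod \<alpha> x y z)"
proof -
  let ?o = "\<lambda>x. ker_even (x * y) * ker_odd (x * z) - ker_odd (x * y) * ker_even (x * z)"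
  have [measurable]: "h \<in> borel_measurable borel" using borel_measurable_integrable[OF h] by simp
  have o: "\<bar>?o x\<bar> \<le> 1" for x
  proof -
    have "?o x = Im (ker x y * cnj (ker x z))" by (subst ker_mult_cnj) simp
    also have "\<bar>\<dots>\<bar> \<le> norm (ker x y * cnj (ker x z))" by (rule abs_Im_le_cmod)
    also have "\<dots> \<le> 1 * 1" unfolding norm_mult by (intro mult_mono) (auto simp: norm_ker)
    finally show ?thesis by simp
  qed
  have ib: "integrable M (\<lambda>x. h x * g x)" if [measurable]: "g \<in> borel_measurable borel" and "\<And>x. \<bar>g x\<bar> \<le> 1" for g
    using that by (intro Bochner_Integration.integrable_bound[OF h]) (auto simp: abs_mult mult_left_le)
  have "(LINT x|M. complex_of_real (h x) * (ker x y * cnj (ker x z))) = 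
    (LINT x|M. complex_of_real (h x * bes_prod \<alpha> x y z) + \<i> * complex_of_real (h x * ?o x))"
    by (intro Bochner_Integration.integral_cong refl) (subst ker_mult_cnj, simp add: algebra_simps)
  also have "\<dots> = (LINT x|M. complex_of_real (h x * bes_prod \<alpha> x y z)) + (LINT x|M. \<i> * complex_of_real (h x * ?o x))"
    using ib[of "\<lambda>x. bes_prod \<alpha> x y z"] ib[of ?o] bes_prod_bound o
    by (intro Bochner_Integration.integral_add integrable_mult_right integrable_of_real) auto
  also have "(LINT x|M. \<i> * complex_of_real (h x * ?o x)) = 0"
  proof (rule integral_odd_zero)
    show "\<i> * complex_of_real (h (- x) * ?o (- x)) = - (\<i> * complex_of_real (h x * ?o x))" for x
      by (simp add: even ker_even_def ker_odd_def algebra_simps)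
  qed measurable
  finally show ?thesis by (simp only: integral_complex_of_real) simp
qed

lemma heat_complex:
  assumes r: "r > 0"
  shows "(LINT x|M. complex_of_real (gau r x) * (ker x y * cnj (ker x z))) = complex_of_real (heat r y z)"
  unfolding heat_def by (rule integral_ker_prod_even[OF integrable_gau[OF r] gau_even])

text \<open>The p-th power of the norm, with values in \<open>ennreal\<close>: Tonelli and Fatou
  apply directly, and infinite values are not confused with 0. The triangle inequality is replaced
  by \<open>nnL_add\<close> with its factor 2^p.\<close>

definition nnL :: "real \<Rightarrow> (real \<Rightarrow> complex) \<Rightarrow> ennreal" where
  "nnL p f = (\<integral>\<^sup>+x. ennreal (norm (f x) powr p) \<partial>M)"

lemma Lp_space_iff: "f \<in> Lp_space M p \<longleftrightarrow> f \<in> borel_measurable borel \<and> nnL p f < \<infinity>"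
  by (auto simp: Lp_space_def nnL_def integrable_iff_bounded)

lemma Lp_norm_nnL: 
  assumes "f \<in> borel_measurable borel"
  shows "Lp_norm M p f = enn2real (nnL p f) powr (1 / p)"
  using assms by (simp add: Lp_norm_def nnL_def integral_eq_nn_integral)

text \<open>Writing out the square as a double integral over y and z and integrating over x first
  produces the heat kernel; the Gaussian makes this use of Fubini absolutely convergent. Schur's
  test with \<open>heat_integral_le\<close> then gives the constant 4.\<close>

lemma F1_L2_gaussian:
  assumes i: "integrable M u" and u2: "nnL 2 u < \<infinity>" and r: "r > 0"
  shows "(\<integral>\<^sup>+x. ennreal (gau r x * (norm (F1 u x))\<^sup>2) \<partial>M) \<le> 4 * nnL 2 u"
proof -
  have [measurable]: "u \<in> borel_measurable borel" using borel_measurable_integrable[OF i] by simp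
  have fin: "(\<integral>\<^sup>+y. ennreal (norm (u y)) \<partial>M) < \<infinity>" using i by (simp add: integrable_iff_bounded)
  define B where "B = (LINT y|M. norm (u y))"
  have FB: "norm (F1 u x) \<le> B" for x unfolding B_def by (rule F1_bound'[OF i])
  have B: "B \<ge> 0" by (simp add: B_def)
  have gfin: "(\<integral>\<^sup>+x. ennreal (gau r x) \<partial>M) < \<infinity>"
    using integrable_gau[OF r] gau_pos[of r] by (simp add: integrable_iff_bounded less_imp_le)
  have gint: "integrable M (\<lambda>x. gau r x * (norm (F1 u x))\<^sup>2)"
  proof (rule Bochner_Integration.integrable_bound)
    show "integrable M (\<lambda>x. gau r x * B\<^sup>2)" using integrable_gau[OF r] by simp
    show "AE x in M. norm (gau r x * (norm (F1 u x))\<^sup>2) \<le> norm (gau r x * B\<^sup>2)"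
      using FB B gau_pos[of r] by (auto simp: abs_mult less_imp_le intro!: mult_left_mono power_mono)
  qed measurable
  let ?g = "\<lambda>x. complex_of_real (gau r x)"
  have "complex_of_real (LINT x|M. gau r x * (norm (F1 u x))\<^sup>2) = (LINT x|M. ?g x * (F1 u x * cnj (F1 u x)))"
    by (simp flip: integral_complex_of_real complex_norm_square)
  also have "\<dots> = (LINT x|M. LINT y|M. ?g x * cnj (F1 u x) * (ker x y * u y))"
  proof (intro Bochner_Integration.integral_cong refl)
    fix x
    have "?g x * (F1 u x * cnj (F1 u x)) = ?g x * cnj (F1 u x) * F1 u x" by (simp add: mult_ac)
    also have "\<dots> = ?g x * cnj (F1 u x) * (LINT y|M. ker x y * u y)" by (simp only: F1_def)
    also have "\<dots> = (LINT y|M. ?g x * cnj (F1 u x) * (ker x y * u y))"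
      by (rule Bochner_Integration.integral_mult_right_zero[symmetric])
    finally show "?g x * (F1 u x * cnj (F1 u x)) = (LINT y|M. ?g x * cnj (F1 u x) * (ker x y * u y))" .
  qed
  also have "\<dots> = (LINT y|M. LINT x|M. ?g x * cnj (F1 u x) * (ker x y * u y))"
  proof (rule Fubini_M(1))
    have "(\<integral>\<^sup>+x. \<integral>\<^sup>+y. ennreal (norm (?g x * cnj (F1 u x) * (ker x y * u y))) \<partial>M \<partial>M) \<le>
       (\<integral>\<^sup>+x. \<integral>\<^sup>+y. ennreal (gau r x) * ennreal B * ennreal (norm (u y)) \<partial>M \<partial>M)"
    proof (intro nn_integral_mono)
      fix x y
      have "norm (?g x * cnj (F1 u x) * (ker x y * u y)) \<le> gau r x * B * (1 * norm (u y))"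
        unfolding norm_mult using FB[of x] gau_pos[of r x] B
        by (intro mult_mono norm_ker) (auto simp: norm_mult)
      then show "ennreal (norm (?g x * cnj (F1 u x) * (ker x y * u y))) \<le> ennreal (gau r x) * ennreal B * ennreal (norm (u y))"
        using gau_pos[of r x] B by (simp add: ennreal_leI less_imp_le flip: ennreal_mult)
    qed
    also have "\<dots> = (\<integral>\<^sup>+x. ennreal (gau r x) * (ennreal B * (\<integral>\<^sup>+y. ennreal (norm (u y)) \<partial>M)) \<partial>M)"
      by (simp add: nn_integral_cmult mult.assoc)
    also have "\<dots> = (\<integral>\<^sup>+x. ennreal (gau r x) \<partial>M) * (ennreal B * (\<integral>\<^sup>+y. ennreal (norm (u y)) \<partial>M))"
      by (rule nn_integral_multc) measurable
    also have "\<dots> < \<infinity>" using fin gfin by (auto simp: ennreal_mult_less_top)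
    finally show "(\<integral>\<^sup>+x. \<integral>\<^sup>+y. ennreal (norm (?g x * cnj (F1 u x) * (ker x y * u y))) \<partial>M \<partial>M) < \<infinity>" .
  qed measurable
  also have "\<dots> = (LINT y|M. u y * (LINT z|M. cnj (u z) * complex_of_real (heat r y z)))"
  proof (intro Bochner_Integration.integral_cong refl)
    fix y
    have "(LINT x|M. ?g x * cnj (F1 u x) * (ker x y * u y)) = u y * (LINT x|M. ?g x * ker x y * cnj (F1 u x))"
      by (simp add: mult_ac flip: Bochner_Integration.integral_mult_right_zero)
    also have "(LINT x|M. ?g x * ker x y * cnj (F1 u x)) = (LINT x|M. LINT z|M. ?g x * ker x y * cnj (ker x z * u z))"
      by (simp add: F1_def integral_cnj[symmetric] del: complex_cnj_mult)
    also have "\<dots> = (LINT z|M. LINT x|M. ?g x * ker x y * cnj (ker x z * u z))"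
    proof (rule Fubini_M(1))
      have "(\<integral>\<^sup>+x. \<integral>\<^sup>+z. ennreal (norm (?g x * ker x y * cnj (ker x z * u z))) \<partial>M \<partial>M) \<le>
         (\<integral>\<^sup>+x. \<integral>\<^sup>+z. ennreal (gau r x) * ennreal (norm (u z)) \<partial>M \<partial>M)"
      proof (intro nn_integral_mono)
        fix x z
        have "norm (?g x * ker x y * cnj (ker x z * u z)) \<le> gau r x * 1 * (1 * norm (u z))"
          unfolding norm_mult complex_mod_cnj using gau_pos[of r x]
          by (intro mult_mono norm_ker) (auto simp: norm_mult)
        then show "ennreal (norm (?g x * ker x y * cnj (ker x z * u z))) \<le> ennreal (gau r x) * ennreal (norm (u z))"
          using gau_pos[of r x] by (simp add: ennreal_leI less_imp_le flip: ennreal_mult)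
      qed
      also have "\<dots> = (\<integral>\<^sup>+x. ennreal (gau r x) * (\<integral>\<^sup>+y. ennreal (norm (u y)) \<partial>M) \<partial>M)"
        by (simp add: nn_integral_cmult)
      also have "\<dots> = (\<integral>\<^sup>+x. ennreal (gau r x) \<partial>M) * (\<integral>\<^sup>+y. ennreal (norm (u y)) \<partial>M)"
        by (rule nn_integral_multc) measurable
      also have "\<dots> < \<infinity>" using fin gfin by (auto simp: ennreal_mult_less_top)
      finally show "(\<integral>\<^sup>+x. \<integral>\<^sup>+z. ennreal (norm (?g x * ker x y * cnj (ker x z * u z))) \<partial>M \<partial>M) < \<infinity>" .
    qed measurable
    also have "\<dots> = (LINT z|M. cnj (u z) * complex_of_real (heat r y z))"
      by (simp add: heat_complex[OF r, symmetric] mult_ac flip: Bochner_Integration.integral_mult_right_zero)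
    finally show "(LINT x|M. ?g x * cnj (F1 u x) * (ker x y * u y)) = u y * (LINT z|M. cnj (u z) * complex_of_real (heat r y z))" .
  qed
  finally have eq: "complex_of_real (LINT x|M. gau r x * (norm (F1 u x))\<^sup>2) = (LINT y|M. u y * (LINT z|M. cnj (u z) * complex_of_real (heat r y z)))" .
  have u2': "nnL 2 u = (\<integral>\<^sup>+x. ennreal ((norm (u x))\<^sup>2) \<partial>M)" by (simp add: nnL_def)
  have "(\<integral>\<^sup>+x. ennreal (gau r x * (norm (F1 u x))\<^sup>2) \<partial>M) = ennreal (LINT x|M. gau r x * (norm (F1 u x))\<^sup>2)"
    using gint gau_pos[of r] by (intro nn_integral_eq_integral) (auto simp: less_imp_le)
  also have "\<dots> = ennreal (norm (complex_of_real (LINT x|M. gau r x * (norm (F1 u x))\<^sup>2)))"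
    using gau_pos[of r] by (simp add: less_imp_le)
  also have "\<dots> \<le> (\<integral>\<^sup>+y. ennreal (norm (u y * (LINT z|M. cnj (u z) * complex_of_real (heat r y z)))) \<partial>M)"
    unfolding eq by (rule norm_integral_le_nn)
  also have "\<dots> \<le> (\<integral>\<^sup>+y. \<integral>\<^sup>+z. ennreal (norm (u y)) * (ennreal (norm (u z)) * ennreal \<bar>heat r y z\<bar>) \<partial>M \<partial>M)"
  proof (intro nn_integral_mono)
    fix y
    have "ennreal (norm (u y * (LINT z|M. cnj (u z) * complex_of_real (heat r y z)))) \<le>
      ennreal (norm (u y)) * (\<integral>\<^sup>+z. ennreal (norm (cnj (u z) * complex_of_real (heat r y z))) \<partial>M)"
      unfolding norm_mult[of "u y"] by (simp only: ennreal_mult norm_ge_zero) (intro mult_left_mono norm_integral_le_nn zero_le)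
    then show "ennreal (norm (u y * (LINT z|M. cnj (u z) * complex_of_real (heat r y z)))) \<le>
       (\<integral>\<^sup>+z. ennreal (norm (u y)) * (ennreal (norm (u z)) * ennreal \<bar>heat r y z\<bar>) \<partial>M)"
      by (simp add: nn_integral_cmult norm_mult ennreal_mult)
  qed
  \<comment> \<open>Schur's test in the form 2ab \<le> a^2 + b^2. The kernel is symmetric, so the
    two halves have the same integral.\<close>
  also have "\<dots> \<le> (\<integral>\<^sup>+y. \<integral>\<^sup>+z. ennreal (1/2) * (ennreal ((norm (u y))\<^sup>2) * ennreal \<bar>heat r y z\<bar>) + ennreal (1/2) * (ennreal ((norm (u z))\<^sup>2) * ennreal \<bar>heat r z y\<bar>) \<partial>M \<partial>M)"
  proof (intro nn_integral_mono)
    fix y z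
    have "norm (u y) * norm (u z) \<le> 1/2 * (norm (u y))\<^sup>2 + 1/2 * (norm (u z))\<^sup>2"
      using sum_squares_bound[of "norm (u y)" "norm (u z)"] by simp
    then have "norm (u y) * norm (u z) * \<bar>heat r y z\<bar> \<le> (1/2 * (norm (u y))\<^sup>2 + 1/2 * (norm (u z))\<^sup>2) * \<bar>heat r y z\<bar>"
      by (intro mult_right_mono) auto
    then have "norm (u y) * (norm (u z) * \<bar>heat r y z\<bar>) \<le> 1/2 * ((norm (u y))\<^sup>2 * \<bar>heat r y z\<bar>) + 1/2 * ((norm (u z))\<^sup>2 * \<bar>heat r z y\<bar>)"
      by (simp add: heat_commute[of r z y] algebra_simps)
    from ennreal_leI[OF this]
    show "ennreal (norm (u y)) * (ennreal (norm (u z)) * ennreal \<bar>heat r y z\<bar>) \<le> ennreal (1/2) * (ennreal ((norm (u y))\<^sup>2) * ennreal \<bar>heat r y z\<bar>) + ennreal (1/2) * (ennreal ((norm (u z))\<^sup>2) * ennreal \<bar>heat r z y\<bar>)"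
      by (simp only: ennreal_plus ennreal_mult norm_ge_zero abs_ge_zero mult_nonneg_nonneg zero_le_power2 zero_le_divide_1_iff zero_le_numeral)
  qed
  also have "\<dots> = ennreal (1/2) * (\<integral>\<^sup>+y. \<integral>\<^sup>+z. ennreal ((norm (u y))\<^sup>2) * ennreal \<bar>heat r y z\<bar> \<partial>M \<partial>M) + 
     ennreal (1/2) * (\<integral>\<^sup>+y. \<integral>\<^sup>+z. ennreal ((norm (u z))\<^sup>2) * ennreal \<bar>heat r z y\<bar> \<partial>M \<partial>M)"
    by (simp add: nn_integral_add nn_integral_cmult)
  also have "(\<integral>\<^sup>+y. \<integral>\<^sup>+z. ennreal ((norm (u z))\<^sup>2) * ennreal \<bar>heat r z y\<bar> \<partial>M \<partial>M) = (\<integral>\<^sup>+z. \<integral>\<^sup>+y. ennreal ((norm (u z))\<^sup>2) * ennreal \<bar>heat r z y\<bar> \<partial>M \<partial>M)"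
    by (rule MM.Fubini') measurable
  also have "ennreal (1/2) * (\<integral>\<^sup>+y. \<integral>\<^sup>+z. ennreal ((norm (u y))\<^sup>2) * ennreal \<bar>heat r y z\<bar> \<partial>M \<partial>M) + 
     ennreal (1/2) * (\<integral>\<^sup>+y. \<integral>\<^sup>+z. ennreal ((norm (u y))\<^sup>2) * ennreal \<bar>heat r y z\<bar> \<partial>M \<partial>M) = 
     (\<integral>\<^sup>+y. \<integral>\<^sup>+z. ennreal ((norm (u y))\<^sup>2) * ennreal \<bar>heat r y z\<bar> \<partial>M \<partial>M)"
  proof -
    have "ennreal (1/2) + ennreal (1/2) = 1" by (subst ennreal_plus[symmetric]) auto
    then show ?thesis by (simp only: distrib_right[symmetric] mult_1_left)
  qed
  also have "\<dots> \<le> (\<integral>\<^sup>+y. ennreal ((norm (u y))\<^sup>2) * 4 \<partial>M)"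
    using AE_M_neq[of 0]
    by (intro nn_integral_mono_AE) (auto simp: nn_integral_cmult intro!: mult_left_mono heat_integral_le r)
  also have "\<dots> = 4 * nnL 2 u"
    unfolding u2' by (subst nn_integral_multc) (auto simp: mult.commute)
  finally show ?thesis .
qed

text \<open>Fatou's lemma as the Gaussian weights tend to 1; the bound of
  \<open>F1_L2_gaussian\<close> is uniform in their width.\<close>

lemma F1_L2_bound:
  assumes i: "integrable M u" and u2: "nnL 2 u < \<infinity>"
  shows "nnL 2 (F1 u) \<le> 4 * nnL 2 u"
proof -
  have [measurable]: "u \<in> borel_measurable borel" using borel_measurable_integrable[OF i] by simp
  have "nnL 2 (F1 u) = (\<integral>\<^sup>+x. liminf (\<lambda>n. ennreal (gau (real (Suc n)) x * (norm (F1 u x))\<^sup>2)) \<partial>M)"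
    unfolding nnL_def
  proof (intro nn_integral_cong)
    fix x
    have "(\<lambda>n. gau (real (Suc n)) x * (norm (F1 u x))\<^sup>2) \<longlonglongrightarrow> 1 * (norm (F1 u x))\<^sup>2"
      by (intro tendsto_intros gau_tendsto_1)
    then have "(\<lambda>n. ennreal (gau (real (Suc n)) x * (norm (F1 u x))\<^sup>2)) \<longlonglongrightarrow> ennreal (norm (F1 u x) powr 2)"
      by (intro tendsto_ennrealI) simp
    then show "ennreal (norm (F1 u x) powr 2) = liminf (\<lambda>n. ennreal (gau (real (Suc n)) x * (norm (F1 u x))\<^sup>2))"
      by (rule lim_imp_Liminf[symmetric, OF sequentially_bot])
  qed
  also have "\<dots> \<le> liminf (\<lambda>n. \<integral>\<^sup>+x. ennreal (gau (real (Suc n)) x * (norm (F1 u x))\<^sup>2) \<partial>M)"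
    by (rule nn_integral_liminf) measurable
  also have "\<dots> \<le> liminf (\<lambda>n::nat. 4 * nnL 2 u)"
    by (intro Liminf_mono always_eventually allI F1_L2_gaussian i u2) simp
  also have "\<dots> = 4 * nnL 2 u" by (simp add: Liminf_const)
  finally show ?thesis .
qed

end

section \<open>Lebesgue spaces\<close>

lemma powr_add_le:
  assumes "p > 0" and "a \<ge> 0" and "b \<ge> (0::real)"
  shows "(a + b) powr p \<le> 2 powr p * (a powr p + b powr p)"
proof -
  have "(a + b) powr p \<le> (2 * max a b) powr p" using assms by (intro powr_mono2) auto
  also have "\<dots> = 2 powr p * max a b powr p" by (simp add: powr_mult)
  also have "max a b powr p \<le> a powr p + b powr p" by (auto simp: max_def)
  finally show ?thesis by simp
qed

lemma le_one_plus_powr: "p \<ge> 1 \<Longrightarrow> a \<ge> 0 \<Longrightarrow> (a::real) \<le> 1 + a powr p"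
proof (cases "a \<le> 1")
  case False
  assume "p \<ge> 1"
  then show ?thesis using False powr_mono[of 1 p a] by simp
next
  case True
  then show ?thesis using powr_ge_zero[of a p] by linarith
qed

text \<open>For fixed l this is the tangent line inequality for the p-th power at l, with equality
  at a = l. The parameter is left free for \<open>nn_jensen_powr\<close> to choose.\<close>

lemma young_powr:
  assumes p: "p \<ge> 1" and l: "l > 0" and a: "a \<ge> (0::real)"
  shows "a \<le> l powr (1 - p) / p * a powr p + (p - 1) / p * l"
proof (cases "a = 0 \<or> p = 1")
  case True
  then show ?thesis using p l by auto
next
  case False
  then have a: "a > 0" and p: "p > 1" using assms by auto
  have "((a / l) powr p) powr (1 / p) * 1 powr (1 - 1 / p) \<le> (1 / p) * (a / l) powr p + (1 - 1 / p) * 1"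
    using a l p by (intro Youngs_inequality_0) auto
  then have "a / l \<le> (1 / p) * (a / l) powr p + (p - 1) / p"
    using p a l by (simp add: powr_powr diff_divide_distrib)
  then have "a / l * l \<le> ((1 / p) * (a / l) powr p + (p - 1) / p) * l" using l by (intro mult_right_mono) auto
  also have "\<dots> = (1 / p) * (a powr p * (l / l powr p)) + (p - 1) / p * l"
    by (simp add: powr_divide algebra_simps)
  also have "l / l powr p = l powr (1 - p)" using l by (simp add: powr_diff)
  finally show ?thesis using l by (simp add: mult_ac)
qed

text \<open>Jensen's inequality for the power p and a signed weight of mass at most m, obtained by
  integrating \<open>young_powr\<close>. This treats p = 1 together with p > 1 and avoids conjugate
  exponents.\<close>

lemma nn_jensen_powr:
  fixes f :: "'a \<Rightarrow> 'b::{banach, second_countable_topology, real_normed_algebra_1}" and w :: "'a \<Rightarrow> real"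
  assumes p: "p \<ge> 1" and [measurable]: "f \<in> borel_measurable N" "w \<in> borel_measurable N"
    and m: "m > 0" "(\<integral>\<^sup>+z. ennreal \<bar>w z\<bar> \<partial>N) \<le> ennreal m"
  shows "ennreal (norm (LINT z|N. of_real (w z) * f z) powr p) \<le> 
     ennreal (m powr (p - 1)) * (\<integral>\<^sup>+z. ennreal \<bar>w z\<bar> * ennreal (norm (f z) powr p) \<partial>N)" (is "_ \<le> _ * ?Y")
proof -
  define X where "X = norm (LINT z|N. of_real (w z) * f z)"
  show ?thesis
  proof (cases "X = 0 \<or> ?Y = \<infinity>")
    case True
    then show ?thesis
    proof
      assume "X = 0" then show ?thesis using p by (simp add: X_def)
    next
      assume Y: "?Y = \<infinity>"
      have "ennreal (m powr (p - 1)) \<noteq> 0" using m by simp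
      then have "ennreal (m powr (p - 1)) * ?Y = \<infinity>" unfolding Y by (simp add: ennreal_mult_eq_top_iff)
      then show ?thesis by (simp add: top.extremum)
    qed
  next
    case False
    then have X: "X > 0" and Y: "?Y \<noteq> \<infinity>" by (auto simp: X_def)
    then obtain y where y: "?Y = ennreal y" "y \<ge> 0" by (cases ?Y) auto
    \<comment> \<open>With this choice the second term of Young's inequality contributes at most (p
      - 1)/p * X, which is absorbed into the left-hand side.\<close>
    define l where "l = X / m"
    have l: "l > 0" using X m by (simp add: l_def)
    let ?c1 = "l powr (1 - p) / p" and ?c2 = "(p - 1) / p * l"
    have c: "?c1 \<ge> 0" "?c2 \<ge> 0" using p l by auto
    have "ennreal X \<le> (\<integral>\<^sup>+z. ennreal (norm (of_real (w z) * f z)) \<partial>N)"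
      unfolding X_def by (rule norm_integral_le_nn)
    also have "\<dots> \<le> (\<integral>\<^sup>+z. ennreal ?c1 * (ennreal \<bar>w z\<bar> * ennreal (norm (f z) powr p)) + ennreal ?c2 * ennreal \<bar>w z\<bar> \<partial>N)"
    proof (intro nn_integral_mono)
      fix z
      have "norm (of_real (w z) * f z) \<le> \<bar>w z\<bar> * norm (f z)"
        using norm_mult_ineq[of "of_real (w z)" "f z"] by simp
      also have "\<dots> \<le> \<bar>w z\<bar> * (?c1 * norm (f z) powr p + ?c2)"
        using p l by (intro mult_left_mono young_powr) auto
      also have "\<dots> = ?c1 * (\<bar>w z\<bar> * norm (f z) powr p) + ?c2 * \<bar>w z\<bar>" by (simp add: algebra_simps)
      finally have "ennreal (norm (of_real (w z) * f z)) \<le> ennreal (?c1 * (\<bar>w z\<bar> * norm (f z) powr p) + ?c2 * \<bar>w z\<bar>)"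
        by (rule ennreal_leI)
      also have "\<dots> = ennreal ?c1 * (ennreal \<bar>w z\<bar> * ennreal (norm (f z) powr p)) + ennreal ?c2 * ennreal \<bar>w z\<bar>"
        using c by (simp only: ennreal_plus ennreal_mult abs_ge_zero powr_ge_zero mult_nonneg_nonneg)
      finally show "ennreal (norm (of_real (w z) * f z)) \<le> ennreal ?c1 * (ennreal \<bar>w z\<bar> * ennreal (norm (f z) powr p)) + ennreal ?c2 * ennreal \<bar>w z\<bar>" .
    qed
    also have "\<dots> = ennreal ?c1 * ?Y + ennreal ?c2 * (\<integral>\<^sup>+z. ennreal \<bar>w z\<bar> \<partial>N)"
      by (subst nn_integral_add) (auto simp: nn_integral_cmult)
    also have "\<dots> \<le> ennreal ?c1 * ennreal y + ennreal ?c2 * ennreal m"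
      unfolding y(1) using m by (intro add_mono mult_left_mono) auto
    also have "\<dots> = ennreal (?c1 * y + ?c2 * m)"
      using c y(2) m by (simp only: ennreal_plus ennreal_mult less_imp_le mult_nonneg_nonneg)
    finally have *: "ennreal X \<le> ennreal (?c1 * y + ?c2 * m)" .
    have "0 \<le> ?c1 * y + ?c2 * m"
      using p l y(2) m by (intro add_nonneg_nonneg mult_nonneg_nonneg divide_nonneg_nonneg) auto
    from * have "X \<le> ?c1 * y + ?c2 * m"
      unfolding ennreal_le_iff[OF \<open>0 \<le> ?c1 * y + ?c2 * m\<close>] .
    also have "?c2 * m = (p - 1) / p * X" using m by (simp add: l_def)
    finally have "X * p \<le> l powr (1 - p) * y + (p - 1) * X"
      using p by (simp add: field_simps)
    then have "X \<le> l powr (1 - p) * y" by (simp add: algebra_simps)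
    then have "X * l powr (p - 1) \<le> l powr (1 - p) * y * l powr (p - 1)"
      by (intro mult_right_mono) auto
    also have "\<dots> = y" using l by (simp add: mult.commute[of _ y] mult.assoc flip: powr_add)
    finally have "X * l powr (p - 1) * m powr (p - 1) \<le> y * m powr (p - 1)"
      by (intro mult_right_mono) auto
    moreover have "X * l powr (p - 1) * m powr (p - 1) = X powr p"
    proof -
      have "l powr (p - 1) * m powr (p - 1) = X powr (p - 1)"
        using m X by (simp add: l_def powr_divide)
      then show ?thesis using X powr_add[of X 1 "p - 1"] by (simp add: mult.assoc)
    qed
    ultimately have "X powr p \<le> m powr (p - 1) * y" by (simp add: mult.commute)
    then show ?thesis unfolding y(1) X_def[symmetric] using y(2) by (simp add: ennreal_leI flip: ennreal_mult)
  qed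
qed

lemma tendsto_0_le_ennreal:
  fixes a b :: "nat \<Rightarrow> ennreal"
  assumes "\<And>n. a n \<le> b n" "b \<longlonglongrightarrow> 0"
  shows "a \<longlonglongrightarrow> 0"
  by (rule tendsto_sandwich[OF _ _ tendsto_const assms(2)]) (use assms(1) in auto)

text \<open>Finiteness matters because \<open>enn2real\<close> maps infinity to 0.\<close>

lemma enn2real_powr_tendsto:
  assumes p: "p > 0" and fin: "\<And>n. a n < \<infinity>"
  shows "(\<lambda>n. enn2real (a n) powr (1 / p)) \<longlonglongrightarrow> 0 \<longleftrightarrow> a \<longlonglongrightarrow> 0"
proof
  assume "(\<lambda>n. enn2real (a n) powr (1 / p)) \<longlonglongrightarrow> 0"
  then have "(\<lambda>n. (enn2real (a n) powr (1 / p)) powr p) \<longlonglongrightarrow> 0 powr p"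
    using p by (intro tendsto_powr') auto
  then have "(\<lambda>n. enn2real (a n)) \<longlonglongrightarrow> 0" using p by (simp add: powr_powr)
  then have "(\<lambda>n. ennreal (enn2real (a n))) \<longlonglongrightarrow> ennreal 0" by (rule tendsto_ennrealI)
  moreover have "ennreal (enn2real (a n)) = a n" for n using fin[of n] by simp
  ultimately show "a \<longlonglongrightarrow> 0" by simp
next
  assume "a \<longlonglongrightarrow> 0"
  then have "(\<lambda>n. enn2real (a n)) \<longlonglongrightarrow> enn2real 0" by (intro tendsto_enn2real) auto
  then have "(\<lambda>n. enn2real (a n) powr (1 / p)) \<longlonglongrightarrow> 0 powr (1 / p)"
    using p by (intro tendsto_powr') auto
  then show "(\<lambda>n. enn2real (a n) powr (1 / p)) \<longlonglongrightarrow> 0" using p by simp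
qed

context dunkl
begin

lemma nnL_add:
  assumes p: "p > 0" and [measurable]: "f \<in> borel_measurable borel" "g \<in> borel_measurable borel"
    and le: "\<And>x. norm (h x) \<le> norm (f x) + norm (g x)"
  shows "nnL p h \<le> ennreal (2 powr p) * (nnL p f + nnL p g)"
proof -
  have "nnL p h \<le> (\<integral>\<^sup>+x. ennreal (2 powr p) * (ennreal (norm (f x) powr p) + ennreal (norm (g x) powr p)) \<partial>M)"
    unfolding nnL_def
  proof (intro nn_integral_mono)
    fix x
    have "norm (h x) powr p \<le> (norm (f x) + norm (g x)) powr p"
      using p le by (intro powr_mono2) auto
    also have "\<dots> \<le> 2 powr p * (norm (f x) powr p + norm (g x) powr p)"
      using p by (intro powr_add_le) auto
    finally show "ennreal (norm (h x) powr p) \<le> ennreal (2 powr p) * (ennreal (norm (f x) powr p) + ennreal (norm (g x) powr p))"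
      by (simp add: ennreal_leI flip: ennreal_mult ennreal_plus)
  qed
  also have "\<dots> = ennreal (2 powr p) * (nnL p f + nnL p g)"
    by (simp add: nn_integral_cmult nn_integral_add nnL_def)
  finally show ?thesis .
qed

lemma nnL_diff:
  assumes p: "p > 0" and [measurable]: "f \<in> borel_measurable borel" "g \<in> borel_measurable borel"
  shows "nnL p (\<lambda>x. f x - g x) \<le> ennreal (2 powr p) * (nnL p f + nnL p g)"
  by (rule nnL_add[OF assms norm_triangle_ineq4])

lemma nnL_diff_finite:
  assumes "p > 0" "f \<in> borel_measurable borel" "g \<in> borel_measurable borel" "nnL p f < \<infinity>" "nnL p g < \<infinity>"
  shows "nnL p (\<lambda>x. f x - g x) < \<infinity>"
  by (rule le_less_trans[OF nnL_diff[OF assms(1-3)]]) (use assms(4,5) in \<open>simp add: ennreal_mult_less_top\<close>)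

lemma nnL_commute: "nnL p (\<lambda>x. f x - g x) = nnL p (\<lambda>x. g x - f x)"
  by (simp add: nnL_def norm_minus_commute)

lemma nnL_cong_AE: "AE x in M. f x = g x \<Longrightarrow> nnL p f = nnL p g"
  unfolding nnL_def by (rule nn_integral_cong_AE) auto

lemma nnL_eq_0: 
  assumes [measurable]: "f \<in> borel_measurable borel" and z: "nnL p f = 0"
  shows "AE x in M. f x = 0"
proof -
  have "AE x in M. ennreal (norm (f x) powr p) = 0"
    using z unfolding nnL_def by (subst (asm) nn_integral_0_iff_AE) auto
  then show ?thesis by eventually_elim auto
qed

lemma Lp_tendsto_iff:
  assumes p: "p > 0" and [measurable]: "f \<in> borel_measurable borel" "\<And>n. u n \<in> borel_measurable borel"
  shows "Lp_tendsto M p u f \<longleftrightarrow> (\<forall>n. nnL p (\<lambda>x. u n x - f x) < \<infinity>) \<and> (\<lambda>n. nnL p (\<lambda>x. u n x - f x)) \<longlonglongrightarrow> 0"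
proof -
  have n: "Lp_norm M p (\<lambda>x. u n x - f x) = enn2real (nnL p (\<lambda>x. u n x - f x)) powr (1 / p)" for n
    by (rule Lp_norm_nnL) measurable
  show ?thesis unfolding Lp_tendsto_def Lp_space_iff n
    using enn2real_powr_tendsto[OF p, of "\<lambda>n. nnL p (\<lambda>x. u n x - f x)"] by auto
qed

lemma nnL_limit_unique:
  assumes p: "p > 0" and [measurable]: "f \<in> borel_measurable borel" "g \<in> borel_measurable borel" "\<And>n. u n \<in> borel_measurable borel"
    and f: "(\<lambda>n. nnL p (\<lambda>x. u n x - f x)) \<longlonglongrightarrow> 0" and g: "(\<lambda>n. nnL p (\<lambda>x. u n x - g x)) \<longlonglongrightarrow> 0"
  shows "AE x in M. f x = g x"
proof -
  have "nnL p (\<lambda>x. f x - g x) \<le> ennreal (2 powr p) * (nnL p (\<lambda>x. u n x - f x) + nnL p (\<lambda>x. u n x - g x))" for n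
    using p
  proof (rule nnL_add)
    fix x show "norm (f x - g x) \<le> norm (u n x - f x) + norm (u n x - g x)"
      using norm_triangle_ineq4[of "u n x - g x" "u n x - f x"] by simp
  qed measurable
  moreover have "(\<lambda>n. ennreal (2 powr p) * (nnL p (\<lambda>x. u n x - f x) + nnL p (\<lambda>x. u n x - g x))) \<longlonglongrightarrow> ennreal (2 powr p) * (0 + 0)"
    by (intro ennreal_tendsto_cmult tendsto_add f g) auto
  ultimately have "nnL p (\<lambda>x. f x - g x) \<le> ennreal (2 powr p) * (0 + 0)"
    by (intro tendsto_lowerbound[OF _ _ sequentially_bot]) auto
  then have "nnL p (\<lambda>x. f x - g x) = 0" by simp
  then have "AE x in M. f x - g x = 0" by (intro nnL_eq_0) auto
  then show ?thesis by simp
qed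

lemma nnL_dominated:
  assumes p: "p > 0" and [measurable]: "f \<in> borel_measurable borel" "\<And>n. u n \<in> borel_measurable borel" "w \<in> borel_measurable borel"
    and lim: "AE x in M. (\<lambda>n. u n x) \<longlonglongrightarrow> f x" and w: "nnL p w < \<infinity>"
    and dom: "\<And>n x. norm (u n x - f x) \<le> norm (w x)"
  shows "(\<lambda>n. nnL p (\<lambda>x. u n x - f x)) \<longlonglongrightarrow> 0"
proof -
  have "(\<lambda>n. (\<integral>\<^sup>+x. ennreal (norm (u n x - f x) powr p) \<partial>M)) \<longlonglongrightarrow> (\<integral>\<^sup>+x. 0 \<partial>M)"
  proof (rule nn_integral_dominated_convergence[where w = "\<lambda>x. ennreal (norm (w x) powr p)"])
    show "AE x in M. ennreal (norm (u n x - f x) powr p) \<le> ennreal (norm (w x) powr p)" for n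
      using dom p by (intro always_eventually) (auto intro!: ennreal_leI powr_mono2)
    show "AE x in M. (\<lambda>n. ennreal (norm (u n x - f x) powr p)) \<longlonglongrightarrow> 0"
      using lim
    proof eventually_elim
      case (elim x)
      then have "(\<lambda>n. norm (u n x - f x)) \<longlonglongrightarrow> 0" by (simp add: LIM_zero tendsto_norm_zero)
      then have "(\<lambda>n. norm (u n x - f x) powr p) \<longlonglongrightarrow> 0 powr p" using p by (intro tendsto_powr') auto
      then show ?case using p by (simp flip: ennreal_0 add: tendsto_ennrealI)
    qed
  qed (use w in \<open>auto simp: nnL_def\<close>)
  then show ?thesis by (simp add: nnL_def)
qed

definition cut :: "real \<Rightarrow> (real \<Rightarrow> complex) \<Rightarrow> real \<Rightarrow> complex" where
  "cut R f x = (if \<bar>x\<bar> \<le> R then f x else 0)"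

lemma cut_measurable [measurable]: 
  assumes [measurable]: "f \<in> borel_measurable borel"
  shows "cut R f \<in> borel_measurable borel"
  unfolding cut_def[abs_def] by measurable

lemma norm_cut: "norm (cut R f x) \<le> norm (f x)"
  by (simp add: cut_def)

lemma nnL_mono: 
  assumes "p > 0" "\<And>x. norm (f x) \<le> norm (g x)"
  shows "nnL p f \<le> nnL p g"
  unfolding nnL_def using assms by (intro nn_integral_mono ennreal_leI powr_mono2) auto

lemma nnL_cut_tendsto:
  assumes p: "p > 0" and [measurable]: "f \<in> borel_measurable borel" and fin: "nnL p f < \<infinity>"
  shows "(\<lambda>n. nnL p (\<lambda>x. cut (real n) f x - f x)) \<longlonglongrightarrow> 0"
proof (rule nnL_dominated[OF p _ _ _ _ fin])
  have "(\<lambda>n. cut (real n) f x) \<longlonglongrightarrow> f x" for x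
  proof (rule tendsto_eventually)
    obtain N where "\<bar>x\<bar> \<le> real N" using real_arch_simple by blast
    then show "\<forall>\<^sub>F n in sequentially. cut (real n) f x = f x"
      unfolding eventually_sequentially cut_def by (intro exI[of _ N]) auto
  qed
  then show "AE x in M. (\<lambda>n. cut (real n) f x) \<longlonglongrightarrow> f x" by simp
  show "norm (cut (real n) f x - f x) \<le> norm (f x)" for n x by (simp add: cut_def)
qed measurable

lemma integrable_indicator_Icc: "integrable M (\<lambda>x. indicator {-R..R} x :: real)"
  using emeasure_M_bounded[of R] by (intro integrable_real_indicator) auto

text \<open>On [-R, R], which has finite measure, the norm is dominated by 1 plus its p-th
  power.\<close>

lemma integrable_cut:
  assumes p: "p \<ge> 1" and [measurable]: "f \<in> borel_measurable borel" and fin: "nnL p f < \<infinity>"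
  shows "integrable M (cut R f)"
proof (rule Bochner_Integration.integrable_bound)
  have "integrable M (\<lambda>x. norm (f x) powr p)" using fin by (auto simp: integrable_iff_bounded nnL_def)
  then show "integrable M (\<lambda>x. indicator {-R..R} x + norm (f x) powr p)"
    by (intro Bochner_Integration.integrable_add integrable_indicator_Icc)
  show "AE x in M. norm (cut R f x) \<le> norm (indicator {-R..R} x + norm (f x) powr p)"
    using le_one_plus_powr[OF p] by (auto simp: cut_def indicator_def abs_le_iff)
qed measurable

lemma F1_diff:
  assumes "integrable M u" "integrable M v"
  shows "F1 (\<lambda>x. u x - v x) y = F1 u y - F1 v y"
  unfolding F1_def using integrable_ker_mult[OF assms(1)] integrable_ker_mult[OF assms(2)]
  by (simp add: right_diff_distrib)

lemma L1_iff: "f \<in> Lp_space M 1 \<longleftrightarrow> integrable M f"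
  by (auto simp: Lp_space_iff nnL_def integrable_iff_bounded)

subsection \<open>Extension of the transform\<close>

text \<open>Completeness of the square-integrable functions done by hand: truncations of f that
  converge geometrically have transforms which converge almost everywhere, and Fatou's lemma
  upgrades this to convergence in the norm.\<close>

lemma F2_exists:
  assumes [measurable]: "f \<in> borel_measurable borel" and fin: "nnL 2 f < \<infinity>"
  shows "\<exists>h. h \<in> Lp_space M 2 \<and> (\<exists>u. (\<forall>n. u n \<in> Lp_space M 1 \<inter> Lp_space M 2) \<and>
          Lp_tendsto M 2 u f \<and> Lp_tendsto M 2 (\<lambda>n. F1 (u n)) h)"
proof -
  let ?t = "\<lambda>n. nnL 2 (\<lambda>x. cut (real n) f x - f x)"
  have t0: "?t \<longlonglongrightarrow> 0" by (rule nnL_cut_tendsto) (use fin in auto)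
  \<comment> \<open>The rate 1/16 leaves room for the weight 2^n on the squared differences below:
    2^n / 16^n = 1 / 8^n is still summable.\<close>
  have "\<exists>N. ?t N < ennreal ((1/16) ^ n)" for n
    using order_tendstoD(2)[OF t0, of "ennreal ((1/16) ^ n)"] by (auto simp: eventually_sequentially)
  then obtain R where R: "\<And>n. ?t (R n) < ennreal ((1/16) ^ n)" by metis
  define u where "u n = cut (real (R n)) f" for n
  have um [measurable]: "u n \<in> borel_measurable borel" for n unfolding u_def by measurable
  have ui: "integrable M (u n)" for n unfolding u_def by (rule integrable_cut[of 2]) (use fin in auto)
  have u2: "nnL 2 (u n) < \<infinity>" for n
    by (rule le_less_trans[OF nnL_mono[of 2 "u n" f] fin]) (auto simp: u_def norm_cut)
  have uf: "nnL 2 (\<lambda>x. u n x - f x) \<le> ennreal ((1/16) ^ n)" for n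
    using R[of n] by (simp add: u_def)
  have "(\<lambda>n. ennreal ((1/16) ^ n)) \<longlonglongrightarrow> ennreal 0"
    by (intro tendsto_ennrealI LIMSEQ_realpow_zero) auto
  then have e0: "(\<lambda>n. ennreal ((1/16) ^ n)) \<longlonglongrightarrow> 0" unfolding ennreal_0 .
  have uf0: "(\<lambda>n. nnL 2 (\<lambda>x. u n x - f x)) \<longlonglongrightarrow> 0"
    by (rule tendsto_0_le_ennreal[OF uf e0])
  \<comment> \<open>32 = 4 * 2^2 * 2: the bound on the transform, the constant of
    \<open>nnL_add\<close>, and two error terms.\<close>
  have diff: "nnL 2 (\<lambda>x. F1 (u n) x - F1 (u m) x) \<le> ennreal (32 * (1/16) ^ m)" if "m \<le> n" for m n
  proof -
    have "nnL 2 (\<lambda>x. F1 (u n) x - F1 (u m) x) = nnL 2 (F1 (\<lambda>x. u n x - u m x))"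
      by (simp add: F1_diff ui nnL_def)
    also have "\<dots> \<le> 4 * nnL 2 (\<lambda>x. u n x - u m x)"
      by (intro F1_L2_bound Bochner_Integration.integrable_diff ui nnL_diff_finite um u2) auto
    also have "\<dots> \<le> 4 * (ennreal (2 powr 2) * (nnL 2 (\<lambda>x. u n x - f x) + nnL 2 (\<lambda>x. u m x - f x)))"
    proof (intro mult_left_mono nnL_add)
      fix x show "norm (u n x - u m x) \<le> norm (u n x - f x) + norm (u m x - f x)"
        using norm_triangle_ineq4[of "u n x - f x" "u m x - f x"] by simp
    qed auto
    also have "\<dots> \<le> 4 * (ennreal (2 powr 2) * (ennreal ((1/16) ^ m) + ennreal ((1/16) ^ m)))"
    proof (intro mult_left_mono add_mono)
      have "ennreal ((1/16) ^ n) \<le> ennreal ((1/16) ^ m)" using that by (intro ennreal_leI power_decreasing) auto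
      then show "nnL 2 (\<lambda>x. u n x - f x) \<le> ennreal ((1/16) ^ m)" using uf[of n] by (rule order_trans[rotated])
    qed (use uf in auto)
    also have "\<dots> = ennreal 4 * (ennreal (2 powr 2) * (ennreal ((1/16) ^ m) + ennreal ((1/16) ^ m)))" by simp
    also have "\<dots> = ennreal (32 * (1/16) ^ m)"
      by (simp only: ennreal_mult[symmetric] ennreal_plus[symmetric] zero_le_power zero_le_divide_1_iff zero_le_numeral powr_ge_zero mult_nonneg_nonneg add_nonneg_nonneg) simp
    finally show ?thesis .
  qed
  define d where "d n x = F1 (u (Suc n)) x - F1 (u n) x" for n x
  have dm [measurable]: "d n \<in> borel_measurable borel" for n unfolding d_def by measurable
  have "(\<integral>\<^sup>+x. (\<Sum>n. ennreal (2 ^ n * (norm (d n x))\<^sup>2)) \<partial>M) = (\<Sum>n. \<integral>\<^sup>+x. ennreal (2 ^ n * (norm (d n x))\<^sup>2) \<partial>M)"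
    by (rule nn_integral_suminf) measurable
  also have "\<dots> \<le> (\<Sum>n. ennreal (32 * (1/8) ^ n))"
  proof (intro suminf_le)
    fix n
    have "(\<integral>\<^sup>+x. ennreal (2 ^ n * (norm (d n x))\<^sup>2) \<partial>M) = ennreal (2 ^ n) * nnL 2 (d n)"
      unfolding nnL_def by (subst nn_integral_cmult[symmetric]) (auto simp: ennreal_mult)
    also have "\<dots> \<le> ennreal (2 ^ n) * ennreal (32 * (1/16) ^ n)"
      using diff[of n "Suc n"] by (intro mult_left_mono) (auto simp: d_def[abs_def])
    also have "\<dots> = ennreal (2 ^ n * (32 * (1/16) ^ n))" by (rule ennreal_mult[symmetric]) auto
    also have "2 ^ n * (32 * (1/16) ^ n) = (32 * (1/8) ^ n :: real)"
      by (simp add: power_divide field_simps flip: power_mult_distrib)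
    finally show "(\<integral>\<^sup>+x. ennreal (2 ^ n * (norm (d n x))\<^sup>2) \<partial>M) \<le> ennreal (32 * (1/8) ^ n)" .
  qed auto
  also have "\<dots> < \<infinity>"
    by (subst suminf_ennreal2) (auto intro!: summable_mult)
  finally have "AE x in M. (\<Sum>n. ennreal (2 ^ n * (norm (d n x))\<^sup>2)) \<noteq> \<infinity>"
    by (intro nn_integral_PInf_AE) auto
  then have "AE x in M. convergent (\<lambda>n. F1 (u n) x)"
  proof eventually_elim
    case (elim x)
    have s: "summable (\<lambda>n. 2 ^ n * (norm (d n x))\<^sup>2)"
      using elim by (intro summable_suminf_not_top) auto
    have "summable (\<lambda>n. norm (d n x))"
    proof (rule summable_comparison_test')
      show "summable (\<lambda>n. (1/2) ^ n + 2 ^ n * (norm (d n x))\<^sup>2)"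
        by (intro summable_add s summable_geometric) auto
      fix n :: nat
      \<comment> \<open>Either the norm is at most 2^-n, or 2^n times the norm is at least 1 and the
        square term dominates.\<close>
      show "norm (norm (d n x)) \<le> (1/2) ^ n + 2 ^ n * (norm (d n x))\<^sup>2"
      proof (cases "norm (d n x) \<le> (1/2) ^ n")
        case False
        then have "1 \<le> 2 ^ n * norm (d n x)" by (simp add: power_divide field_simps)
        then have "1 * norm (d n x) \<le> (2 ^ n * norm (d n x)) * norm (d n x)" by (intro mult_right_mono) auto
        then have "norm (d n x) \<le> 2 ^ n * (norm (d n x))\<^sup>2" by (simp add: power2_eq_square)
        moreover have "(0::real) \<le> (1/2) ^ n" by simp
        ultimately show ?thesis unfolding real_norm_def abs_norm_cancel by linarith
      next
        case True
        moreover have "0 \<le> 2 ^ n * (norm (d n x))\<^sup>2" by simp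
        ultimately show ?thesis unfolding real_norm_def abs_norm_cancel by linarith
      qed
    qed
    then have "summable (\<lambda>n. d n x)" by (rule summable_norm_cancel)
    then have "convergent (\<lambda>n. (\<Sum>k<n. d k x) + F1 (u 0) x)"
      unfolding summable_iff_convergent by (intro convergent_add convergent_const)
    moreover have "(\<Sum>k<n. d k x) + F1 (u 0) x = F1 (u n) x" for n
      unfolding d_def by (induction n) (auto simp: algebra_simps)
    ultimately show "convergent (\<lambda>n. F1 (u n) x)" by simp
  qed
  note conv = this
  define h where "h x = lim (\<lambda>n. F1 (u n) x)" for x
  have hm [measurable]: "h \<in> borel_measurable borel" unfolding h_def by measurable
  \<comment> \<open>Fatou's lemma in n, with m fixed, carries the Cauchy estimate over to the
    limit.\<close>
  have hn: "nnL 2 (\<lambda>x. F1 (u m) x - h x) \<le> ennreal (32 * (1/16) ^ m)" for m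
  proof -
    have "nnL 2 (\<lambda>x. F1 (u m) x - h x) = (\<integral>\<^sup>+x. liminf (\<lambda>n. ennreal (norm (F1 (u n) x - F1 (u m) x) powr 2)) \<partial>M)"
      unfolding nnL_def
    proof (intro nn_integral_cong_AE)
      show "AE x in M. ennreal (norm (F1 (u m) x - h x) powr 2) = liminf (\<lambda>n. ennreal (norm (F1 (u n) x - F1 (u m) x) powr 2))"
        using conv
      proof eventually_elim
        case (elim x)
        then have "(\<lambda>n. F1 (u n) x) \<longlonglongrightarrow> h x" unfolding h_def by (rule convergent_LIMSEQ_iff[THEN iffD1])
        then have "(\<lambda>n. ennreal ((norm (F1 (u n) x - F1 (u m) x))\<^sup>2)) \<longlonglongrightarrow> ennreal ((norm (h x - F1 (u m) x))\<^sup>2)"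
          by (intro tendsto_ennrealI tendsto_intros)
        from lim_imp_Liminf[OF sequentially_bot this] show ?case by (simp add: norm_minus_commute)
      qed
    qed
    also have "\<dots> \<le> liminf (\<lambda>n. \<integral>\<^sup>+x. ennreal (norm (F1 (u n) x - F1 (u m) x) powr 2) \<partial>M)"
      by (rule nn_integral_liminf) measurable
    also have "\<dots> \<le> liminf (\<lambda>n::nat. ennreal (32 * (1/16) ^ m))"
      using diff[of m] unfolding nnL_def
      by (intro Liminf_mono) (auto simp: eventually_sequentially intro!: exI[of _ m])
    also have "\<dots> = ennreal (32 * (1/16) ^ m)" by (simp add: Liminf_const)
    finally show ?thesis .
  qed
  have "(\<lambda>n. ennreal (32 * (1/16) ^ n)) \<longlonglongrightarrow> ennreal (32 * 0)"
    by (intro tendsto_ennrealI tendsto_mult_left LIMSEQ_realpow_zero) auto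
  then have e1: "(\<lambda>n. ennreal (32 * (1/16) ^ n)) \<longlonglongrightarrow> 0" unfolding mult_zero_right ennreal_0 .
  have h0: "(\<lambda>n. nnL 2 (\<lambda>x. F1 (u n) x - h x)) \<longlonglongrightarrow> 0"
    by (rule tendsto_0_le_ennreal[OF hn e1])
  have hfin: "nnL 2 h < \<infinity>"
  proof -
    have "nnL 2 (F1 (u 0)) < \<infinity>"
      by (rule le_less_trans[OF F1_L2_bound[OF ui u2]]) (use u2[of 0] in \<open>simp add: ennreal_mult_less_top\<close>)
    moreover have "nnL 2 (\<lambda>x. F1 (u 0) x - h x) < \<infinity>" by (rule le_less_trans[OF hn[of 0]]) simp
    ultimately have "nnL 2 (\<lambda>x. F1 (u 0) x - (F1 (u 0) x - h x)) < \<infinity>"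
      by (intro nnL_diff_finite[of 2 "F1 (u 0)" "\<lambda>x. F1 (u 0) x - h x"]) measurable
    then show ?thesis by simp
  qed
  show ?thesis
  proof (intro exI[of _ h] conjI exI[of _ u] allI)
    show "h \<in> Lp_space M 2" using hfin by (simp add: Lp_space_iff)
    show "u n \<in> Lp_space M 1 \<inter> Lp_space M 2" for n
      using ui[of n] u2[of n] um[of n] by (metis IntI L1_iff Lp_space_iff)
    show "Lp_tendsto M 2 u f"
      using uf0 nnL_diff_finite[OF _ um _ u2 fin] by (subst Lp_tendsto_iff) auto
    show "Lp_tendsto M 2 (\<lambda>n. F1 (u n)) h"
      using h0 le_less_trans[OF hn ennreal_less_top] by (subst Lp_tendsto_iff) auto
  qed
qed

abbreviation F2 :: "(real \<Rightarrow> complex) \<Rightarrow> real \<Rightarrow> complex" where "F2 \<equiv> dunkl_transform_L2 \<alpha>"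

lemma F2_props:
  assumes f: "f \<in> borel_measurable borel" "nnL 2 f < \<infinity>"
  shows "F2 f \<in> borel_measurable borel" "nnL 2 (F2 f) < \<infinity>"
    "\<exists>u. (\<forall>n. integrable M (u n) \<and> nnL 2 (u n) < \<infinity>) \<and> (\<lambda>n. nnL 2 (\<lambda>x. u n x - f x)) \<longlonglongrightarrow> 0 \<and>
       (\<lambda>n. nnL 2 (\<lambda>x. F1 (u n) x - F2 f x)) \<longlonglongrightarrow> 0"
proof -
  have *: "F2 f \<in> Lp_space M 2 \<and> (\<exists>u. (\<forall>n. u n \<in> Lp_space M 1 \<inter> Lp_space M 2) \<and>
          Lp_tendsto M 2 u f \<and> Lp_tendsto M 2 (\<lambda>n. F1 (u n)) (F2 f))"
    unfolding dunkl_transform_L2_def by (rule someI_ex[OF F2_exists[OF assms]])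
  then show m: "F2 f \<in> borel_measurable borel" "nnL 2 (F2 f) < \<infinity>" by (auto simp: Lp_space_iff)
  from * obtain u where u: "\<And>n. u n \<in> Lp_space M 1 \<inter> Lp_space M 2" "Lp_tendsto M 2 u f" "Lp_tendsto M 2 (\<lambda>n. F1 (u n)) (F2 f)"
    by blast
  have um: "u n \<in> borel_measurable borel" for n using u(1)[of n] by (auto simp: Lp_space_iff)
  show "\<exists>u. (\<forall>n. integrable M (u n) \<and> nnL 2 (u n) < \<infinity>) \<and> (\<lambda>n. nnL 2 (\<lambda>x. u n x - f x)) \<longlonglongrightarrow> 0 \<and>
       (\<lambda>n. nnL 2 (\<lambda>x. F1 (u n) x - F2 f x)) \<longlonglongrightarrow> 0"
  proof (intro exI[of _ u] conjI allI)
    show "integrable M (u n)" for n using u(1)[of n] by (simp add: L1_iff)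
    show "nnL 2 (u n) < \<infinity>" for n using u(1)[of n] by (simp add: Lp_space_iff)
    show "(\<lambda>n. nnL 2 (\<lambda>x. u n x - f x)) \<longlonglongrightarrow> 0"
      using u(2) f(1) um by (subst (asm) Lp_tendsto_iff) auto
    show "(\<lambda>n. nnL 2 (\<lambda>x. F1 (u n) x - F2 f x)) \<longlonglongrightarrow> 0"
      using u(3) m(1) um by (subst (asm) Lp_tendsto_iff) (auto intro: F1_measurable)
  qed
qed

section \<open>The multiplication formula and the support of the transform\<close>

lemma nn_cauchy_schwarz:
  assumes [measurable]: "f \<in> borel_measurable borel" "g \<in> borel_measurable borel"
  shows "(\<integral>\<^sup>+x. ennreal (norm (f x * g x)) \<partial>M)\<^sup>2 \<le> nnL 2 f * nnL 2 g"
  using Cauchy_Schwarz_nn_integral[of "\<lambda>x. ennreal (norm (f x))" M "\<lambda>x. ennreal (norm (g x))"]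
  by (simp add: nnL_def norm_mult ennreal_mult ennreal_power)

lemma integrable_mult_L2:
  assumes [measurable]: "f \<in> borel_measurable borel" "g \<in> borel_measurable borel"
    and fin: "nnL 2 f < \<infinity>" "nnL 2 g < \<infinity>"
  shows "integrable M (\<lambda>x. f x * g x)"
proof (rule integrableI_bounded)
  have "nnL 2 f * nnL 2 g < \<infinity>" using fin by (simp add: ennreal_mult_less_top)
  then have "(\<integral>\<^sup>+x. ennreal (norm (f x * g x)) \<partial>M)\<^sup>2 < \<infinity>"
    by (rule le_less_trans[OF nn_cauchy_schwarz[OF assms(1,2)]])
  then show "(\<integral>\<^sup>+x. ennreal (norm (f x * g x)) \<partial>M) < \<infinity>"
    by (auto simp: power_less_top_ennreal)
qed measurable

lemma integral_mult_L2_tendsto: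
  assumes m [measurable]: "f \<in> borel_measurable borel" "g \<in> borel_measurable borel" "\<And>n. u n \<in> borel_measurable borel"
    and fin: "nnL 2 f < \<infinity>" "nnL 2 g < \<infinity>" "\<And>n. nnL 2 (u n) < \<infinity>"
    and lim: "(\<lambda>n. nnL 2 (\<lambda>x. u n x - f x)) \<longlonglongrightarrow> 0"
  shows "(\<lambda>n. LINT x|M. u n x * g x) \<longlonglongrightarrow> (LINT x|M. f x * g x)"
proof -
  have "(\<lambda>n. nnL 2 g * nnL 2 (\<lambda>x. u n x - f x)) \<longlonglongrightarrow> nnL 2 g * 0"
    using fin(2) by (intro ennreal_tendsto_cmult lim) auto
  then have "(\<lambda>n. nnL 2 (\<lambda>x. u n x - f x) * nnL 2 g) \<longlonglongrightarrow> 0" by (simp add: mult.commute)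
  moreover have "ennreal ((norm ((LINT x|M. u n x * g x) - (LINT x|M. f x * g x)))\<^sup>2) \<le> nnL 2 (\<lambda>x. u n x - f x) * nnL 2 g" for n
  proof -
    have "(LINT x|M. u n x * g x) - (LINT x|M. f x * g x) = (LINT x|M. (u n x - f x) * g x)"
      using integrable_mult_L2[OF m(1,2) fin(1,2)] integrable_mult_L2[OF m(3) m(2) fin(3) fin(2)]
      by (simp add: left_diff_distrib)
    then have "ennreal (norm ((LINT x|M. u n x * g x) - (LINT x|M. f x * g x))) \<le> (\<integral>\<^sup>+x. ennreal (norm ((u n x - f x) * g x)) \<partial>M)"
      by (simp only: norm_integral_le_nn)
    then have "(ennreal (norm ((LINT x|M. u n x * g x) - (LINT x|M. f x * g x))))\<^sup>2 \<le> (\<integral>\<^sup>+x. ennreal (norm ((u n x - f x) * g x)) \<partial>M)\<^sup>2"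
      by (intro power_mono) auto
    also have "\<dots> \<le> nnL 2 (\<lambda>x. u n x - f x) * nnL 2 g"
      by (rule nn_cauchy_schwarz) measurable
    finally show ?thesis by (simp add: ennreal_power)
  qed
  ultimately have "(\<lambda>n. ennreal ((norm ((LINT x|M. u n x * g x) - (LINT x|M. f x * g x)))\<^sup>2)) \<longlonglongrightarrow> 0"
    by (rule tendsto_0_le_ennreal[rotated])
  then have "(\<lambda>n. (norm ((LINT x|M. u n x * g x) - (LINT x|M. f x * g x)))\<^sup>2) \<longlonglongrightarrow> 0"
    by (subst (asm) ennreal_0[symmetric], subst (asm) tendsto_ennreal_iff) auto
  then have "(\<lambda>n. norm ((LINT x|M. u n x * g x) - (LINT x|M. f x * g x))) \<longlonglongrightarrow> 0"
    using tendsto_real_sqrt[of "\<lambda>n. (norm ((LINT x|M. u n x * g x) - (LINT x|M. f x * g x)))\<^sup>2" 0] by simp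
  then show ?thesis by (simp add: tendsto_norm_zero_iff LIM_zero_cancel)
qed

text \<open>The kernel is symmetric in its two arguments, so Fubini moves the transform from one
  factor to the other.\<close>

lemma F1_multiplication:
  assumes u: "integrable M u" and \<theta>: "integrable M \<theta>"
  shows "(LINT x|M. F1 u x * \<theta> x) = (LINT y|M. u y * F1 \<theta> y)"
proof -
  have [measurable]: "u \<in> borel_measurable borel" "\<theta> \<in> borel_measurable borel"
    using borel_measurable_integrable[OF u] borel_measurable_integrable[OF \<theta>] by simp_all
  have "(LINT x|M. F1 u x * \<theta> x) = (LINT x|M. LINT y|M. ker x y * u y * \<theta> x)"
    by (simp only: F1_def Bochner_Integration.integral_mult_left_zero)
  also have "\<dots> = (LINT y|M. LINT x|M. ker x y * u y * \<theta> x)"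
  proof (rule Fubini_M(1))
    have "(\<integral>\<^sup>+x. \<integral>\<^sup>+y. ennreal (norm (ker x y * u y * \<theta> x)) \<partial>M \<partial>M) \<le> (\<integral>\<^sup>+x. \<integral>\<^sup>+y. ennreal (norm (u y)) * ennreal (norm (\<theta> x)) \<partial>M \<partial>M)"
      by (intro nn_integral_mono) (auto simp: norm_mult norm_ker mult_left_le_one_le intro!: ennreal_leI mult_right_mono simp flip: ennreal_mult)
    also have "\<dots> = (\<integral>\<^sup>+x. (\<integral>\<^sup>+y. ennreal (norm (u y)) \<partial>M) * ennreal (norm (\<theta> x)) \<partial>M)"
      by (simp add: nn_integral_multc)
    also have "\<dots> = (\<integral>\<^sup>+y. ennreal (norm (u y)) \<partial>M) * (\<integral>\<^sup>+x. ennreal (norm (\<theta> x)) \<partial>M)"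
      by (rule nn_integral_cmult) measurable
    also have "\<dots> < \<infinity>" using u \<theta> by (auto simp: integrable_iff_bounded ennreal_mult_less_top)
    finally show "(\<integral>\<^sup>+x. \<integral>\<^sup>+y. ennreal (norm (ker x y * u y * \<theta> x)) \<partial>M \<partial>M) < \<infinity>" .
  qed measurable
  also have "\<dots> = (LINT y|M. u y * F1 \<theta> y)"
    by (simp only: F1_def ker_commute[of _ "_ :: real"] mult_ac Bochner_Integration.integral_mult_right_zero)
       (simp add: ker_commute mult.left_commute[of _ "u _"] mult.commute[of "\<theta> _"])
  finally show ?thesis .
qed

text \<open>Both sides are continuous in the square norm, so the formula passes to the limit along
  the sequence that defines \<open>F2 f\<close>. It holds for whichever representative was
  chosen.\<close>

lemma F2_multiplication:
  assumes f [measurable]: "f \<in> borel_measurable borel" and fin: "nnL 2 f < \<infinity>"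
    and \<theta>: "integrable M \<theta>" "nnL 2 \<theta> < \<infinity>"
  shows "(LINT x|M. F2 f x * \<theta> x) = (LINT y|M. f y * F1 \<theta> y)"
proof -
  have tm [measurable]: "\<theta> \<in> borel_measurable borel"
    using borel_measurable_integrable[OF \<theta>(1)] by simp
  obtain u where u: "\<And>n. integrable M (u n)" "\<And>n. nnL 2 (u n) < \<infinity>" "(\<lambda>n. nnL 2 (\<lambda>x. u n x - f x)) \<longlonglongrightarrow> 0"
    "(\<lambda>n. nnL 2 (\<lambda>x. F1 (u n) x - F2 f x)) \<longlonglongrightarrow> 0" using F2_props(3)[OF f fin] by blast
  have um [measurable]: "u n \<in> borel_measurable borel" for n using borel_measurable_integrable[OF u(1)] by simp
  have F1fin: "nnL 2 (F1 v) < \<infinity>" if "integrable M v" "nnL 2 v < \<infinity>" for v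
    by (rule le_less_trans[OF F1_L2_bound[OF that]]) (use that(2) in \<open>simp add: ennreal_mult_less_top\<close>)
  have "(\<lambda>n. LINT x|M. F1 (u n) x * \<theta> x) \<longlonglongrightarrow> (LINT x|M. F2 f x * \<theta> x)"
    using F1fin u(1,2) \<theta>(2) u(4) F2_props[OF f fin] by (intro integral_mult_L2_tendsto) auto
  moreover have "(\<lambda>n. LINT x|M. u n x * F1 \<theta> x) \<longlonglongrightarrow> (LINT x|M. f x * F1 \<theta> x)"
    using F1fin[OF \<theta>] u fin by (intro integral_mult_L2_tendsto) auto
  ultimately show ?thesis
    unfolding F1_multiplication[OF u(1) \<theta>(1)] by (rule LIMSEQ_unique)
qed

text \<open>To detect where the transform \<open>h\<close> of \<open>g\<close> vanishes, it is tested against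
  \<open>cnj h / (1 + \<bar>h\<bar>)\<close>.\<close>

lemma transform_support:
  assumes p: "1 \<le> p" "p \<le> 2" and gm [measurable]: "g \<in> borel_measurable borel" and gfin: "nnL p g < \<infinity>"
    and orth: "\<And>\<theta> R. \<theta> \<in> borel_measurable borel \<Longrightarrow> (\<And>x. norm (\<theta> x) \<le> 1) \<Longrightarrow> 
       (\<And>x. \<theta> x \<noteq> 0 \<Longrightarrow> a < \<bar>x\<bar> \<and> \<bar>x\<bar> \<le> R) \<Longrightarrow> (LINT y|M. g y * F1 \<theta> y) = 0"
  shows "ess_support M (dunkl_transform \<alpha> g) \<subseteq> {-a..a}"
proof -
  let ?P = "\<lambda>h. \<exists>f1 \<in> Lp_space M 1. \<exists>f2 \<in> Lp_space M 2. (AE x in M. g x = f1 x + f2 x) \<and> h = (\<lambda>x. F1 f1 x + F2 f2 x)"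
  have "\<exists>h. ?P h"
  proof -
    \<comment> \<open>Splitting at height 1 serves only to show that a decomposition exists; p \<ge>
      1 handles the large values and p \<le> 2 the small ones. The argument afterwards works with
      the decomposition that the choice operator returns.\<close>
    define f1 where "f1 x = (if norm (g x) > 1 then g x else 0)" for x
    define f2 where "f2 x = (if norm (g x) > 1 then 0 else g x)" for x
    have [measurable]: "f1 \<in> borel_measurable borel" "f2 \<in> borel_measurable borel"
      unfolding f1_def f2_def by measurable
    have "b \<le> b powr p" if "b > 1" for b :: real
      using powr_mono[of 1 p b] p that by simp
    then have "nnL 1 f1 \<le> nnL p g" unfolding nnL_def f1_def
      by (intro nn_integral_mono) (auto intro!: ennreal_leI)
    then have 1: "f1 \<in> Lp_space M 1" using gfin by (auto simp: Lp_space_iff)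
    have "nnL 2 f2 \<le> nnL p g" unfolding nnL_def f2_def
      using p powr_mono'[of p 2] by (intro nn_integral_mono) (auto intro!: ennreal_leI)
    then have 2: "f2 \<in> Lp_space M 2" using gfin by (auto simp: Lp_space_iff)
    have "AE x in M. g x = f1 x + f2 x" by (auto simp: f1_def f2_def)
    with 1 2 show ?thesis by blast
  qed
  then have "?P (dunkl_transform \<alpha> g)" unfolding dunkl_transform_def by (rule someI_ex)
  then obtain f1 f2 where f: "f1 \<in> Lp_space M 1" "f2 \<in> Lp_space M 2" "AE x in M. g x = f1 x + f2 x"
    and h: "dunkl_transform \<alpha> g = (\<lambda>x. F1 f1 x + F2 f2 x)" by blast
  have f1i: "integrable M f1" using f(1) by (simp add: L1_iff)
  have f1m [measurable]: "f1 \<in> borel_measurable borel" and f2m [measurable]: "f2 \<in> borel_measurable borel" and f2fin: "nnL 2 f2 < \<infinity>"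
    using f by (auto simp: Lp_space_iff)
  define H where "H = dunkl_transform \<alpha> g"
  note F2m [measurable] = F2_props(1)[OF f2m f2fin]
  have Hm [measurable]: "H \<in> borel_measurable borel" unfolding H_def h by measurable
  have zero: "AE x in M. a < \<bar>x\<bar> \<and> \<bar>x\<bar> \<le> R \<longrightarrow> H x = 0" for R
  proof -
    \<comment> \<open>The bound by 1 and the cut at R make \<open>\<theta>\<close> integrable and
      square integrable, so that both multiplication formulas apply, while
      \<open>H x * \<theta> x\<close> is nonnegative and vanishes exactly where \<open>H\<close>
      does in the annulus.\<close>
    define \<theta> where "\<theta> x = (if a < \<bar>x\<bar> \<and> \<bar>x\<bar> \<le> R then cnj (H x) / of_real (1 + norm (H x)) else 0)" for x
    have [measurable]: "\<theta> \<in> borel_measurable borel" unfolding \<theta>_def by measurable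
    have b: "norm (\<theta> x) \<le> 1" for x
    proof -
      have "norm (complex_of_real (1 + norm (H x))) = 1 + norm (H x)" 
        unfolding norm_of_real by simp
      moreover have "1 + norm (H x) > 0" by (intro add_pos_nonneg) auto
      ultimately show ?thesis by (auto simp: \<theta>_def norm_divide divide_le_eq simp del: of_real_add)
    qed
    have ind: "norm (\<theta> x) \<le> indicator {-R..R} x" for x
      using b[of x] by (auto simp: \<theta>_def indicator_def abs_le_iff)
    have ti: "integrable M \<theta>"
      by (rule Bochner_Integration.integrable_bound[OF integrable_indicator_Icc[of R]]) (use ind in auto)
    have t2: "nnL 2 \<theta> < \<infinity>"
    proof -
      have "nnL 2 \<theta> \<le> (\<integral>\<^sup>+x. indicator {-R..R} x \<partial>M)"
        unfolding nnL_def
      proof (intro nn_integral_mono)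
        fix x
        have "(norm (\<theta> x))\<^sup>2 \<le> indicator {-R..R} x"
          using ind[of x] b[of x] by (auto simp: indicator_def abs_square_le_1 split: if_splits)
        then have "ennreal (norm (\<theta> x) powr 2) \<le> ennreal (indicator {-R..R} x)" by (intro ennreal_leI) simp
        then show "ennreal (norm (\<theta> x) powr 2) \<le> indicator {-R..R} x" by (auto simp: indicator_def split: if_splits)
      qed
      then show ?thesis using emeasure_M_bounded[of R] by auto
    qed
    have F1\<theta>: "nnL 2 (F1 \<theta>) < \<infinity>"
      by (rule le_less_trans[OF F1_L2_bound[OF ti t2]]) (use t2 in \<open>simp add: ennreal_mult_less_top\<close>)
    have i1: "integrable M (\<lambda>x. F1 f1 x * \<theta> x)"
    proof (rule Bochner_Integration.integrable_bound)
      show "integrable M (\<lambda>x. of_real (LINT y|M. norm (f1 y)) * \<theta> x)" using ti by simp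
      show "AE x in M. norm (F1 f1 x * \<theta> x) \<le> norm (of_real (LINT y|M. norm (f1 y)) * \<theta> x)"
        using F1_bound'[OF f1i] by (auto simp: norm_mult intro!: mult_right_mono order_trans[OF F1_bound'[OF f1i]])
    qed measurable
    have i2: "integrable M (\<lambda>x. F2 f2 x * \<theta> x)"
      using F2_props[OF f2m f2fin] t2 by (intro integrable_mult_L2) auto
    have i3: "integrable M (\<lambda>y. f1 y * F1 \<theta> y)"
    proof (rule Bochner_Integration.integrable_bound)
      show "integrable M (\<lambda>x. f1 x * of_real (LINT y|M. norm (\<theta> y)))" using f1i by simp
      show "AE x in M. norm (f1 x * F1 \<theta> x) \<le> norm (f1 x * of_real (LINT y|M. norm (\<theta> y)))"
        using F1_bound'[OF ti] by (auto simp: norm_mult intro!: mult_left_mono order_trans[OF F1_bound'[OF ti]])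
    qed measurable
    have i4: "integrable M (\<lambda>y. f2 y * F1 \<theta> y)"
      using f2fin F1\<theta> by (intro integrable_mult_L2) auto
    have "(LINT x|M. H x * \<theta> x) = (LINT x|M. F1 f1 x * \<theta> x) + (LINT x|M. F2 f2 x * \<theta> x)"
      unfolding H_def h using i1 i2 by (simp add: distrib_right)
    also have "\<dots> = (LINT y|M. f1 y * F1 \<theta> y) + (LINT y|M. f2 y * F1 \<theta> y)"
      unfolding F1_multiplication[OF f1i ti] F2_multiplication[OF f2m f2fin ti t2] ..
    also have "\<dots> = (LINT y|M. (f1 y + f2 y) * F1 \<theta> y)"
      using i3 i4 by (simp add: distrib_right)
    also have "\<dots> = (LINT y|M. g y * F1 \<theta> y)"
      by (rule integral_cong_AE) (use f(3) in auto)
    also have "\<dots> = 0"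
      by (rule orth[of \<theta> R]) (auto simp: b, auto simp: \<theta>_def split: if_splits)
    finally have z: "(LINT x|M. H x * \<theta> x) = 0" .
    define q where "q x = (if a < \<bar>x\<bar> \<and> \<bar>x\<bar> \<le> R then (norm (H x))\<^sup>2 / (1 + norm (H x)) else 0)" for x
    have qe: "H x * \<theta> x = complex_of_real (q x)" for x
      by (simp add: \<theta>_def q_def complex_norm_square[symmetric])
    have qi: "integrable M q"
    proof -
      have "integrable M (\<lambda>x. H x * \<theta> x)" unfolding H_def h using i1 i2 by (simp add: distrib_right)
      then show ?thesis unfolding qe using integrable_Re by fastforce
    qed
    have "(LINT x|M. q x) = 0" using z unfolding qe by simp
    then have "AE x in M. q x = 0"
      using qi by (subst (asm) integral_nonneg_eq_0_iff_AE) (auto simp: q_def)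
    then show ?thesis
    proof eventually_elim
      case (elim x)
      have "1 + norm (H x) \<noteq> 0" using norm_ge_zero[of "H x"] by linarith
      then show ?case using elim by (auto simp: q_def split: if_splits)
    qed
  qed
  \<comment> \<open>Countably many annuli exhaust the complement of [-a, a], which is one of the
    open sets in the definition of the support.\<close>
  have "AE x in M. \<forall>n. a < \<bar>x\<bar> \<and> \<bar>x\<bar> \<le> real n \<longrightarrow> H x = 0"
    using zero by (subst AE_all_countable) auto
  then have "AE x in M. x \<in> - {-a..a} \<longrightarrow> H x = 0"
  proof eventually_elim
    case (elim x)
    obtain n where "\<bar>x\<bar> \<le> real n" using real_arch_simple by blast
    then show ?case using elim by (auto simp: abs_if split: if_splits)
  qed
  moreover have "open (- {-a..a})" by (intro open_Compl) simp
  ultimately have "- {-a..a} \<subseteq> \<Union>{U. open U \<and> (AE x in M. x \<in> U \<longrightarrow> H x = 0)}" by blast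
  then show ?thesis unfolding ess_support_def H_def by blast
qed

end

section \<open>Translations and the modulus of smoothness\<close>

context dunkl
begin

text \<open>An explicit representative of the translation, jointly measurable in t and y as Fubini
  requires. The integral formula is kept at y = 0, which is a null set.\<close>

definition trans :: "real \<Rightarrow> (real \<Rightarrow> complex) \<Rightarrow> real \<Rightarrow> complex" where
  "trans t f y = (if t = 0 then f y else LINT z|M. complex_of_real (dunkl_W \<alpha> t y z) * f z)"

lemma trans_measurable [measurable]:
  assumes [measurable]: "f \<in> borel_measurable borel" "a \<in> borel_measurable N" "b \<in> borel_measurable N"
  shows "(\<lambda>x. trans (a x) f (b x)) \<in> borel_measurable N"
  unfolding trans_def by measurable

lemma nn_W_mult_swap:
  assumes [measurable]: "h \<in> borel_measurable borel"
  shows "(\<integral>\<^sup>+y. \<integral>\<^sup>+z. ennreal \<bar>dunkl_W \<alpha> t y z\<bar> * h z \<partial>M \<partial>M) \<le> ennreal CW * (\<integral>\<^sup>+z. h z \<partial>M)"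
proof -
  have "(\<integral>\<^sup>+y. \<integral>\<^sup>+z. ennreal \<bar>dunkl_W \<alpha> t y z\<bar> * h z \<partial>M \<partial>M) = (\<integral>\<^sup>+z. \<integral>\<^sup>+y. ennreal \<bar>dunkl_W \<alpha> t y z\<bar> * h z \<partial>M \<partial>M)"
    by (rule MM.Fubini') measurable
  also have "\<dots> \<le> (\<integral>\<^sup>+z. ennreal CW * h z \<partial>M)"
    by (intro nn_integral_mono) (auto simp: nn_integral_multc intro!: mult_right_mono W_integral_le)
  also have "\<dots> = ennreal CW * (\<integral>\<^sup>+z. h z \<partial>M)"
    by (rule nn_integral_cmult) measurable
  finally show ?thesis .
qed

text \<open>Jensen's inequality with the mass of W in z, followed by the mass of W in y. The
  \<open>max 1\<close> covers t = 0, where the translation is the identity.\<close>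

lemma nnL_trans:
  assumes p: "p \<ge> 1" and [measurable]: "f \<in> borel_measurable borel"
  shows "nnL p (trans t f) \<le> ennreal (max 1 (CW powr p)) * nnL p f"
proof (cases "t = 0")
  case True
  have "1 * nnL p f \<le> ennreal (max 1 (CW powr p)) * nnL p f" by (intro mult_right_mono) auto
  then show ?thesis using True by (simp add: trans_def[abs_def])
next
  case False
  have "nnL p (trans t f) \<le> (\<integral>\<^sup>+y. ennreal (CW powr (p - 1)) * (\<integral>\<^sup>+z. ennreal \<bar>dunkl_W \<alpha> t y z\<bar> * ennreal (norm (f z) powr p) \<partial>M) \<partial>M)"
    unfolding nnL_def using p CW
    by (intro nn_integral_mono) (simp add: trans_def False nn_jensen_powr W_integral_le)
  also have "\<dots> = ennreal (CW powr (p - 1)) * (\<integral>\<^sup>+y. \<integral>\<^sup>+z. ennreal \<bar>dunkl_W \<alpha> t y z\<bar> * ennreal (norm (f z) powr p) \<partial>M \<partial>M)"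
    by (rule nn_integral_cmult) measurable
  also have "\<dots> \<le> ennreal (CW powr (p - 1)) * (ennreal CW * nnL p f)"
    unfolding nnL_def by (intro mult_left_mono nn_W_mult_swap) auto
  also have "\<dots> = ennreal (CW powr (p - 1) * CW) * nnL p f"
    using CW by (simp add: ennreal_mult mult.assoc)
  also have "CW powr (p - 1) * CW = CW powr p" using CW powr_add[of CW "p - 1" 1] by simp
  also have "ennreal (CW powr p) * nnL p f \<le> ennreal (max 1 (CW powr p)) * nnL p f"
    by (intro mult_right_mono ennreal_leI) auto
  finally show ?thesis .
qed

lemma trans_integrable_AE:
  assumes p: "p \<ge> 1" and [measurable]: "f \<in> borel_measurable borel" and fin: "nnL p f < \<infinity>"
  shows "AE y in M. integrable M (\<lambda>z. complex_of_real (dunkl_W \<alpha> t y z) * f z)"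
proof -
  have "(\<integral>\<^sup>+y. \<integral>\<^sup>+z. ennreal \<bar>dunkl_W \<alpha> t y z\<bar> * ennreal (norm (f z) powr p) \<partial>M \<partial>M) < \<infinity>"
    by (rule le_less_trans[OF nn_W_mult_swap]) (use fin in \<open>auto simp: ennreal_mult_less_top nnL_def\<close>)
  then have "AE y in M. (\<integral>\<^sup>+z. ennreal \<bar>dunkl_W \<alpha> t y z\<bar> * ennreal (norm (f z) powr p) \<partial>M) \<noteq> \<infinity>"
    by (intro nn_integral_PInf_AE) auto
  then show ?thesis
  proof eventually_elim
    case (elim y)
    show ?case
    proof (rule integrableI_bounded)
      have "(\<integral>\<^sup>+z. ennreal (norm (complex_of_real (dunkl_W \<alpha> t y z) * f z)) \<partial>M) \<le>
         (\<integral>\<^sup>+z. ennreal \<bar>dunkl_W \<alpha> t y z\<bar> + ennreal \<bar>dunkl_W \<alpha> t y z\<bar> * ennreal (norm (f z) powr p) \<partial>M)"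
      proof (intro nn_integral_mono)
        fix z
        have "\<bar>dunkl_W \<alpha> t y z\<bar> * norm (f z) \<le> \<bar>dunkl_W \<alpha> t y z\<bar> * (1 + norm (f z) powr p)"
          using p by (intro mult_left_mono le_one_plus_powr) auto
        also have "\<dots> = \<bar>dunkl_W \<alpha> t y z\<bar> + \<bar>dunkl_W \<alpha> t y z\<bar> * norm (f z) powr p" by (simp add: distrib_left)
        finally have "ennreal (norm (complex_of_real (dunkl_W \<alpha> t y z) * f z)) \<le> ennreal (\<bar>dunkl_W \<alpha> t y z\<bar> + \<bar>dunkl_W \<alpha> t y z\<bar> * norm (f z) powr p)"
          by (intro ennreal_leI) (simp add: norm_mult)
        then show "ennreal (norm (complex_of_real (dunkl_W \<alpha> t y z) * f z)) \<le> ennreal \<bar>dunkl_W \<alpha> t y z\<bar> + ennreal \<bar>dunkl_W \<alpha> t y z\<bar> * ennreal (norm (f z) powr p)"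
          by (simp add: ennreal_plus ennreal_mult)
      qed
      also have "\<dots> = (\<integral>\<^sup>+z. ennreal \<bar>dunkl_W \<alpha> t y z\<bar> \<partial>M) + (\<integral>\<^sup>+z. ennreal \<bar>dunkl_W \<alpha> t y z\<bar> * ennreal (norm (f z) powr p) \<partial>M)"
        by (rule nn_integral_add) auto
      also have "\<dots> < \<infinity>"
        using elim le_less_trans[OF W_integral_le(3)[of t y] ennreal_less_top] by (simp add: less_top)
      finally show "(\<integral>\<^sup>+z. ennreal (norm (complex_of_real (dunkl_W \<alpha> t y z) * f z)) \<partial>M) < \<infinity>" .
    qed measurable
  qed
qed

lemma trans_diff_AE:
  assumes p: "p \<ge> 1" and [measurable]: "f \<in> borel_measurable borel" "g \<in> borel_measurable borel"
    and fin: "nnL p f < \<infinity>" "nnL p g < \<infinity>"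
  shows "AE y in M. trans t (\<lambda>z. f z - g z) y = trans t f y - trans t g y"
  using trans_integrable_AE[OF p _ fin(1), of t] trans_integrable_AE[OF p _ fin(2), of t] assms(2,3)
  by (auto simp: trans_def right_diff_distrib)

text \<open>After truncation in height and range, the function is an almost everywhere limit of
  continuous functions. Clipping these in height and range keeps them continuous and provides a
  dominating function.\<close>

lemma continuous_dense:
  assumes p: "p > 0" and [measurable]: "f \<in> borel_measurable borel" and fin: "nnL p f < \<infinity>"
  shows "\<exists>u. (\<forall>n. continuous_on UNIV (u n) \<and> nnL p (u n) < \<infinity>) \<and> (\<lambda>n. nnL p (\<lambda>x. u n x - f x)) \<longlonglongrightarrow> 0"
proof -
  define \<eta> where "\<eta> R x = max 0 (min 1 (R + 1 - \<bar>x\<bar>))" for R x :: real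
  have \<eta>: "0 \<le> \<eta> R x" "\<eta> R x \<le> 1" "\<bar>x\<bar> \<le> R \<Longrightarrow> \<eta> R x = 1" "\<bar>x\<bar> > R + 1 \<Longrightarrow> \<eta> R x = 0" for R x
    by (auto simp: \<eta>_def)
  \<comment> \<open>The radial retraction of the plane onto the disc of radius R.\<close>
  define clip where "clip R z = z /\<^sub>R (max R (norm z) / R)" for R and z :: complex
  have clip_norm: "norm (clip R z) \<le> R" if "R > 0" for R z
    using that by (auto simp: clip_def max_def field_simps)
  have clip_id: "clip R z = z" if "R > 0" "norm z \<le> R" for R z
    using that by (auto simp: clip_def max_def)
  have clip_cont: "continuous_on UNIV (clip R)" if "R > 0" for R
    unfolding clip_def using that by (intro continuous_intros) (auto simp: max_def)
  define trunc where "trunc n x = (if \<bar>x\<bar> \<le> real (Suc n) \<and> norm (f x) \<le> real (Suc n) then f x else 0)" for n x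
  have tm [measurable]: "trunc n \<in> borel_measurable borel" for n unfolding trunc_def[abs_def] by measurable
  have trunc_lim: "(\<lambda>n. nnL p (\<lambda>x. trunc n x - f x)) \<longlonglongrightarrow> 0"
  proof (rule nnL_dominated[OF p _ _ _ _ fin])
    have "(\<lambda>n. trunc n x) \<longlonglongrightarrow> f x" for x
    proof (rule tendsto_eventually)
      obtain N where "max \<bar>x\<bar> (norm (f x)) \<le> real N" using real_arch_simple by blast
      then show "\<forall>\<^sub>F n in sequentially. trunc n x = f x"
        unfolding eventually_sequentially trunc_def by (intro exI[of _ N]) auto
    qed
    then show "AE x in M. (\<lambda>n. trunc n x) \<longlonglongrightarrow> f x" by simp
    show "norm (trunc n x - f x) \<le> norm (f x)" for n x by (simp add: trunc_def)
  qed measurable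
  have ex: "\<exists>u. continuous_on UNIV u \<and> nnL p u < \<infinity> \<and> nnL p (\<lambda>x. u x - trunc n x) < ennreal (1 / Suc n)" for n
  proof -
    define R where "R = real (Suc n)"
    have R: "R > 0" by (simp add: R_def)
    \<comment> \<open>The approximating functions \<open>v k\<close> come without any bound.
      Composing with \<open>clip R\<close> and multiplying by \<open>\<eta> R\<close> does not
      change the limit, since \<open>trunc n\<close> has values in the disc of radius R and vanishes
      outside [-R, R].\<close>
    have "trunc n measurable_on UNIV"
      by (rule lebesgue_measurable_imp_measurable_on) (auto intro: measurable_completion)
    then obtain N v where N: "negligible N" and vc: "\<And>k. continuous_on UNIV (v k)"
      and vl: "\<And>x. x \<notin> N \<Longrightarrow> (\<lambda>k. v k x) \<longlonglongrightarrow> trunc n x"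
      unfolding measurable_on_def by auto
    define u where "u k x = \<eta> R x *\<^sub>R clip R (v k x)" for k x
    have uc: "continuous_on UNIV (u k)" for k
      unfolding u_def \<eta>_def
      by (intro continuous_intros continuous_on_compose2[OF clip_cont[OF R] vc]) auto
    have um [measurable]: "u k \<in> borel_measurable borel" for k
      using uc by (rule borel_measurable_continuous_onI)
    define w where "w x = (if \<bar>x\<bar> \<le> R + 1 then complex_of_real (2 * R) else 0)" for x
    have [measurable]: "w \<in> borel_measurable borel" unfolding w_def[abs_def] by measurable
    have ub: "norm (u k x) \<le> (if \<bar>x\<bar> \<le> R + 1 then R else 0)" for k x
    proof -
      have "\<eta> R x * norm (clip R (v k x)) \<le> 1 * R"
        using \<eta>(1,2)[of R x] clip_norm[OF R] R by (intro mult_mono) auto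
      then show ?thesis using \<eta>(1,2,4)[of R x] by (auto simp: u_def)
    qed
    have tb: "norm (trunc n x) \<le> (if \<bar>x\<bar> \<le> R + 1 then R else 0)" for x
      by (auto simp: trunc_def R_def)
    have wfin: "nnL p w < \<infinity>"
    proof -
      have "nnL p w = (\<integral>\<^sup>+x. ennreal ((2 * R) powr p) * indicator {-(R + 1)..R + 1} x \<partial>M)"
        unfolding nnL_def using R p by (intro nn_integral_cong) (auto simp: w_def indicator_def abs_le_iff)
      also have "\<dots> < \<infinity>"
        using emeasure_M_bounded[of "R + 1"] by (simp add: nn_integral_cmult_indicator ennreal_mult_less_top)
      finally show ?thesis .
    qed
    have "(\<lambda>k. nnL p (\<lambda>x. u k x - trunc n x)) \<longlonglongrightarrow> 0"
    proof (rule nnL_dominated[OF p _ _ _ _ wfin])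
      have "AE x in M. x \<notin> N"
      proof (rule AE_M_lborel)
        have "AE x in lebesgue. x \<notin> N" using N by (simp add: negligible_iff_null_sets AE_not_in)
        then show "AE x in lborel. x \<notin> N" by (simp add: AE_completion_iff)
      qed
      then show "AE x in M. (\<lambda>k. u k x) \<longlonglongrightarrow> trunc n x"
      proof eventually_elim
        case (elim x)
        have "(\<lambda>k. clip R (v k x)) \<longlonglongrightarrow> clip R (trunc n x)"
          using clip_cont[OF R] vl[OF elim] by (intro isCont_tendsto_compose[of _ "clip R"]) (auto simp: continuous_on_eq_continuous_at)
        then have "(\<lambda>k. u k x) \<longlonglongrightarrow> \<eta> R x *\<^sub>R clip R (trunc n x)"
          unfolding u_def by (intro tendsto_intros)
        also have "\<eta> R x *\<^sub>R clip R (trunc n x) = trunc n x"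
          using clip_id[OF R, of "f x"] \<eta>(3)[of x R] clip_id[OF R, of 0] R by (auto simp: trunc_def R_def)
        finally show ?case .
      qed
      show "norm (u k x - trunc n x) \<le> norm (w x)" for k x
        using norm_triangle_ineq4[of "u k x" "trunc n x"] ub[of k x] tb[of x] R
        by (auto simp: w_def split: if_splits)
    qed measurable
    from order_tendstoD(2)[OF this, of "ennreal (1 / Suc n)"] obtain k where k: "nnL p (\<lambda>x. u k x - trunc n x) < ennreal (1 / Suc n)"
      by (auto simp: eventually_sequentially)
    have "nnL p (u k) < \<infinity>"
    proof (rule le_less_trans[OF nnL_mono[OF p] wfin])
      show "norm (u k x) \<le> norm (w x)" for x using ub[of k x] R by (auto simp: w_def split: if_splits)
    qed
    with k uc show ?thesis by blast
  qed
  then obtain u where u: "\<And>n. continuous_on UNIV (u n)" "\<And>n. nnL p (u n) < \<infinity>" "\<And>n. nnL p (\<lambda>x. u n x - trunc n x) < ennreal (1 / Suc n)"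
    by metis
  have um [measurable]: "u n \<in> borel_measurable borel" for n using u(1) by (rule borel_measurable_continuous_onI)
  have l1: "(\<lambda>n. nnL p (\<lambda>x. u n x - trunc n x)) \<longlonglongrightarrow> 0"
  proof (rule tendsto_0_le_ennreal[OF less_imp_le[OF u(3)]])
    have "(\<lambda>n. ennreal (1 / Suc n)) \<longlonglongrightarrow> ennreal 0"
      by (intro tendsto_ennrealI LIMSEQ_Suc[OF lim_1_over_n])
    then show "(\<lambda>n. ennreal (1 / Suc n)) \<longlonglongrightarrow> 0" unfolding ennreal_0 .
  qed
  have "(\<lambda>n. ennreal (2 powr p) * (nnL p (\<lambda>x. u n x - trunc n x) + nnL p (\<lambda>x. trunc n x - f x))) \<longlonglongrightarrow> ennreal (2 powr p) * (0 + 0)"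
    by (intro ennreal_tendsto_cmult tendsto_add l1 trunc_lim) auto
  then have l2: "(\<lambda>n. ennreal (2 powr p) * (nnL p (\<lambda>x. u n x - trunc n x) + nnL p (\<lambda>x. trunc n x - f x))) \<longlonglongrightarrow> 0" by simp
  have "(\<lambda>n. nnL p (\<lambda>x. u n x - f x)) \<longlonglongrightarrow> 0"
  proof (rule tendsto_0_le_ennreal[OF _ l2])
    fix n
    show "nnL p (\<lambda>x. u n x - f x) \<le> ennreal (2 powr p) * (nnL p (\<lambda>x. u n x - trunc n x) + nnL p (\<lambda>x. trunc n x - f x))"
    proof (rule nnL_add[OF p])
      show "norm (u n x - f x) \<le> norm (u n x - trunc n x) + norm (trunc n x - f x)" for x
        using norm_triangle_ineq[of "u n x - trunc n x" "trunc n x - f x"] by simp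
    qed measurable
  qed
  with u(1,2) show ?thesis by blast
qed

text \<open>The formula \<open>trans\<close> is continuous in the norm and agrees almost everywhere
  with the translation of continuous functions, so it is an admissible choice. Limits are unique up
  to null sets, hence every other choice agrees with it almost everywhere.\<close>

lemma translation_eq:
  assumes p: "p \<ge> 1" and fm [measurable]: "f \<in> borel_measurable borel" and fin: "nnL p f < \<infinity>"
  shows "dunkl_translation \<alpha> p t f \<in> borel_measurable borel"
    and "AE y in M. dunkl_translation \<alpha> p t f y = trans t f y"
proof -
  have p0: "p > 0" using p by simp
  let ?Q = "\<lambda>h u. (\<forall>n. continuous_on UNIV (u n) \<and> u n \<in> Lp_space M p) \<and> Lp_tendsto M p u f \<and>
          Lp_tendsto M p (\<lambda>n. dunkl_translation_cont \<alpha> t (u n)) h"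
  have cm: "dunkl_translation_cont \<alpha> t v \<in> borel_measurable borel" if [measurable]: "v \<in> borel_measurable borel" for v
    unfolding dunkl_translation_cont_def[abs_def] dunkl_gamma_integral_def[abs_def] by measurable
  have ca: "AE y in M. dunkl_translation_cont \<alpha> t v y = trans t v y" for v
    using AE_M_neq[of 0] by eventually_elim (simp add: dunkl_translation_cont_def dunkl_gamma_integral_def trans_def)
  have tfin: "nnL p (trans t v) < \<infinity>" if "v \<in> borel_measurable borel" "nnL p v < \<infinity>" for v
    by (rule le_less_trans[OF nnL_trans[OF p that(1)]]) (use that(2) in \<open>simp add: ennreal_mult_less_top\<close>)
  have lim: "(\<forall>n. nnL p (\<lambda>y. dunkl_translation_cont \<alpha> t (u n) y - trans t f y) < \<infinity>) \<and>
     (\<lambda>n. nnL p (\<lambda>y. dunkl_translation_cont \<alpha> t (u n) y - trans t f y)) \<longlonglongrightarrow> 0"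
    if um [measurable]: "\<And>n. u n \<in> borel_measurable borel" and ufin: "\<And>n. nnL p (u n) < \<infinity>"
      and ul: "(\<lambda>n. nnL p (\<lambda>x. u n x - f x)) \<longlonglongrightarrow> 0" for u
  proof -
    have e: "nnL p (\<lambda>y. dunkl_translation_cont \<alpha> t (u n) y - trans t f y) = nnL p (trans t (\<lambda>x. u n x - f x))" for n
    proof (rule nnL_cong_AE)
      show "AE y in M. dunkl_translation_cont \<alpha> t (u n) y - trans t f y = trans t (\<lambda>x. u n x - f x) y"
        using ca[of "u n"] trans_diff_AE[OF p um fm ufin fin, of t n] by eventually_elim simp
    qed
    have dfin: "nnL p (\<lambda>x. u n x - f x) < \<infinity>" for n
      using p0 ufin fin by (intro nnL_diff_finite) auto
    have "(\<lambda>n. ennreal (max 1 (CW powr p)) * nnL p (\<lambda>x. u n x - f x)) \<longlonglongrightarrow> ennreal (max 1 (CW powr p)) * 0"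
      by (intro ennreal_tendsto_cmult ul) auto
    then have l: "(\<lambda>n. ennreal (max 1 (CW powr p)) * nnL p (\<lambda>x. u n x - f x)) \<longlonglongrightarrow> 0" by simp
    have "(\<lambda>n. nnL p (trans t (\<lambda>x. u n x - f x))) \<longlonglongrightarrow> 0"
      by (rule tendsto_0_le_ennreal[OF nnL_trans[OF p] l]) measurable
    then show ?thesis unfolding e using tfin[OF _ dfin] by simp
  qed
  obtain u where u: "\<And>n. continuous_on UNIV (u n)" "\<And>n. nnL p (u n) < \<infinity>" "(\<lambda>n. nnL p (\<lambda>x. u n x - f x)) \<longlonglongrightarrow> 0"
    using continuous_dense[OF p0 fm fin] by blast
  have um: "u n \<in> borel_measurable borel" for n using u(1) by (rule borel_measurable_continuous_onI)
  have "trans t f \<in> Lp_space M p" using tfin[OF fm fin] by (simp add: Lp_space_iff)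
  moreover have "?Q (trans t f) u"
    using u um lim[OF um u(2,3)] nnL_diff_finite[OF p0 um fm u(2) fin] cm[OF um]
    by (simp add: Lp_space_iff Lp_tendsto_iff[OF p0])
  ultimately have "\<exists>h. h \<in> Lp_space M p \<and> (\<exists>u. ?Q h u)" by blast
  then have *: "dunkl_translation \<alpha> p t f \<in> Lp_space M p \<and> (\<exists>u. ?Q (dunkl_translation \<alpha> p t f) u)"
    unfolding dunkl_translation_def by (rule someI_ex)
  then show hm: "dunkl_translation \<alpha> p t f \<in> borel_measurable borel" by (simp add: Lp_space_iff)
  from * obtain v where v: "?Q (dunkl_translation \<alpha> p t f) v" by blast
  have vm: "v n \<in> borel_measurable borel" and vfin: "nnL p (v n) < \<infinity>" for n using v by (auto simp: Lp_space_iff)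
  have "(\<lambda>n. nnL p (\<lambda>x. v n x - f x)) \<longlonglongrightarrow> 0" using v Lp_tendsto_iff[OF p0 fm, of v] vm by blast
  from lim[OF vm vfin this] 
  have "(\<lambda>n. nnL p (\<lambda>y. dunkl_translation_cont \<alpha> t (v n) y - trans t f y)) \<longlonglongrightarrow> 0" by blast
  moreover have "(\<lambda>n. nnL p (\<lambda>y. dunkl_translation_cont \<alpha> t (v n) y - dunkl_translation \<alpha> p t f y)) \<longlonglongrightarrow> 0"
    using v Lp_tendsto_iff[OF p0 hm, of "\<lambda>n. dunkl_translation_cont \<alpha> t (v n)"] cm[OF vm] by blast
  ultimately show "AE y in M. dunkl_translation \<alpha> p t f y = trans t f y"
    using hm cm[OF vm] by (intro nnL_limit_unique[OF p0]) auto
qed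

text \<open>\<open>nnL_trans\<close> bounds the translations uniformly in t, so the suprema in the
  modulus are over bounded sets and behave as expected.\<close>

lemma modulus_props:
  assumes p: "p \<ge> 1" and fm [measurable]: "f \<in> borel_measurable borel" and fin: "nnL p f < \<infinity>"
  defines "w \<equiv> dunkl_modulus p \<alpha> f"
  shows "\<And>x y. 0 \<le> x \<Longrightarrow> x \<le> y \<Longrightarrow> w x \<le> w y" and "\<And>x. 0 \<le> x \<Longrightarrow> 0 \<le> w x"
    and "\<exists>B. \<forall>x\<ge>0. w x \<le> B"
    and "\<And>t. nnL p (\<lambda>y. f y - trans t f y) \<le> ennreal (w \<bar>t\<bar> powr p)"
proof -
  have p0: "p > 0" using p by simp
  let ?N = "\<lambda>t. Lp_norm M p (\<lambda>y. dunkl_translation \<alpha> p t f y - f y)"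
  note tm [measurable] = translation_eq(1)[OF p fm fin]
  have e: "nnL p (\<lambda>y. dunkl_translation \<alpha> p t f y - f y) = nnL p (\<lambda>y. f y - trans t f y)" for t
  proof -
    have "nnL p (\<lambda>y. dunkl_translation \<alpha> p t f y - f y) = nnL p (\<lambda>y. trans t f y - f y)"
      using translation_eq(2)[OF p fm fin, of t] by (intro nnL_cong_AE) auto
    then show ?thesis by (simp add: nnL_commute[of p f])
  qed
  have N: "?N t = enn2real (nnL p (\<lambda>y. f y - trans t f y)) powr (1 / p)" for t
    by (subst Lp_norm_nnL) (auto simp: e)
  define b where "b = ennreal (2 powr p) * (nnL p f + ennreal (max 1 (CW powr p)) * nnL p f)"
  have b: "b < \<infinity>" unfolding b_def using fin by (simp add: ennreal_mult_less_top)
  have le: "nnL p (\<lambda>y. f y - trans t f y) \<le> b" for t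
    unfolding b_def
    by (rule order_trans[OF nnL_diff[OF p0]]) (auto intro!: mult_left_mono add_left_mono nnL_trans p)
  have fin': "nnL p (\<lambda>y. f y - trans t f y) < \<infinity>" for t using le b by (rule le_less_trans)
  define B where "B = enn2real b powr (1 / p)"
  have NB: "?N t \<le> B" for t
    unfolding N B_def using p0 le b by (intro powr_mono2 enn2real_mono) auto
  have bdd: "bdd_above (?N ` A)" for A using NB by (auto simp: bdd_above_def)
  have Nw: "?N t \<le> w x" if "\<bar>t\<bar> \<le> x" for t x
    unfolding w_def dunkl_modulus_def using that by (intro cSUP_upper bdd) auto
  show mono: "w x \<le> w y" if "0 \<le> x" "x \<le> y" for x y
    unfolding w_def dunkl_modulus_def using that by (intro cSUP_subset_mono bdd) (auto intro: exI[of _ 0])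
  show "0 \<le> w x" if "0 \<le> x" for x
  proof -
    have "0 \<le> ?N 0" by (simp add: N)
    also have "\<dots> \<le> w x" using that by (intro Nw) simp
    finally show ?thesis .
  qed
  have "w x \<le> B" if "x \<ge> 0" for x
    unfolding w_def dunkl_modulus_def using that by (intro cSUP_least NB) (auto intro: exI[of _ 0])
  then show "\<exists>B. \<forall>x\<ge>0. w x \<le> B" by blast
  show "nnL p (\<lambda>y. f y - trans t f y) \<le> ennreal (w \<bar>t\<bar> powr p)" for t
  proof -
    have "nnL p (\<lambda>y. f y - trans t f y) = ennreal (?N t powr p)"
      unfolding N using p0 fin'[of t] by (simp add: powr_powr)
    also have "\<dots> \<le> ennreal (w \<bar>t\<bar> powr p)"
      using p0 by (intro ennreal_leI powr_mono2 Nw) (auto simp: N)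
    finally show ?thesis .
  qed
qed

section \<open>A band-limited kernel\<close>

text \<open>The Bochner-Riesz multiplier of order m for the band [-a, a], up to
  normalization.\<close>

definition psi :: "real \<Rightarrow> nat \<Rightarrow> real \<Rightarrow> real" where
  "psi a m x = (if \<bar>x\<bar> \<le> a then (a\<^sup>2 - x\<^sup>2) ^ m else 0)"

lemma psi_measurable [measurable]: "psi a m \<in> borel_measurable borel"
  unfolding psi_def[abs_def] by measurable

lemma psi_nonneg: "psi a m x \<ge> 0"
  by (auto simp: psi_def power2_le_iff_abs_le intro!: zero_le_power abs_le_square_iff[THEN iffD1])

lemma psi_even: "psi a m (- x) = psi a m x"
  by (simp add: psi_def)

lemma integrable_psi_power:
  assumes "a > 0"
  shows "integrable M (\<lambda>x. psi a m x * (x\<^sup>2) ^ n)"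
proof (rule Bochner_Integration.integrable_bound)
  show "integrable M (\<lambda>x. indicator {-a..a} x * ((a\<^sup>2) ^ m * (a\<^sup>2) ^ n))"
    by (intro integrable_mult_left integrable_indicator_Icc)
  have "norm (psi a m x * (x\<^sup>2) ^ n) \<le> norm (indicator {-a..a} x * ((a\<^sup>2) ^ m * (a\<^sup>2) ^ n))" for x
  proof (cases "\<bar>x\<bar> \<le> a")
    case True
    then have x: "x\<^sup>2 \<le> a\<^sup>2" using power_mono[of "\<bar>x\<bar>" a 2] by simp
    then have "(a\<^sup>2 - x\<^sup>2) ^ m * (x\<^sup>2) ^ n \<le> (a\<^sup>2) ^ m * (a\<^sup>2) ^ n"
      by (intro mult_mono power_mono[of _ _ m] power_mono[of _ _ n]) auto
    moreover have "0 \<le> (a\<^sup>2 - x\<^sup>2) ^ m * (x\<^sup>2) ^ n" using x by simp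
    ultimately show ?thesis using True by (simp add: psi_def indicator_def abs_le_iff)
  qed (simp add: psi_def)
  then show "AE x in M. norm (psi a m x * (x\<^sup>2) ^ n) \<le> norm (indicator {-a..a} x * ((a\<^sup>2) ^ m * (a\<^sup>2) ^ n))" by simp
qed measurable

lemma integral_M_real:
  fixes f :: "real \<Rightarrow> real"
  assumes [measurable]: "f \<in> borel_measurable borel"
  shows "(LINT x|M. f x) = (LINT x|lborel. \<bar>x\<bar> powr (2 * \<alpha> + 1) / mconst * f x)"
  unfolding M_def using mconst by (subst integral_density) auto

text \<open>The integral over [-a, a] of the derivative of
  \<open>x ^ (2 * n + 1) * (x^2) powr b * (a^2 - x^2) ^ Suc m\<close> is zero, since this function
  vanishes at both ends. With b = \<alpha> + 1/2 the middle factor is the density of the measure up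
  to a constant.\<close>

lemma psi_moment_rec:
  assumes a: "a > 0"
  shows "(n + \<alpha> + m + 2) * (LINT x|M. psi a m x * (x\<^sup>2) ^ Suc n) = a\<^sup>2 * (n + \<alpha> + 1) * (LINT x|M. psi a m x * (x\<^sup>2) ^ n)"
proof -
  define b where "b = \<alpha> + 1/2"
  have b: "b > 0" using \<alpha> by (simp add: b_def)
  let ?g = "\<lambda>x::real. (2 * n + 1 + 2 * b) * (x\<^sup>2) ^ n * (a\<^sup>2 - x\<^sup>2) - 2 * (real m + 1) * (x\<^sup>2) ^ Suc n"
  let ?G = "\<lambda>x::real. (x\<^sup>2) powr b * ((a\<^sup>2 - x\<^sup>2) ^ m * ?g x)"
  let ?F = "\<lambda>x::real. x ^ (2 * n + 1) * (x\<^sup>2) powr b * (a\<^sup>2 - x\<^sup>2) ^ Suc m"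
  have "(?G has_integral (?F a - ?F (- a))) {-a..a}"
  \<comment> \<open>The chain rule for \<open>(x^2) powr b\<close> requires a positive base, so the
    origin is an exceptional point.\<close>
  proof (rule fundamental_theorem_of_calculus_interior_strong[of "{0}"])
    show "continuous_on {-a..a} ?F"
      using b by (intro continuous_intros continuous_on_powr') auto
    fix x assume "x \<in> {-a<..<a} - {0}"
    then have x: "x\<^sup>2 > 0" by simp
    have pw: "(x\<^sup>2) powr b = (x\<^sup>2) powr (b - 1) * x\<^sup>2" using powr_add[of "x\<^sup>2" "b - 1" 1] x by simp
    have d1: "((\<lambda>x. x ^ (2 * n + 1)) has_real_derivative real (2 * n + 1) * x ^ (2 * n)) (at x)"
      using DERIV_pow[of "2 * n + 1" x] by simp
    have d2: "((\<lambda>x. (x\<^sup>2) powr b) has_real_derivative b * (x\<^sup>2) powr (b - 1) * (2 * x)) (at x)"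
      using x by (auto intro!: derivative_eq_intros)
    have "((\<lambda>x. a\<^sup>2 - x\<^sup>2) has_real_derivative - (2 * x)) (at x)"
      by (auto intro!: derivative_eq_intros)
    from DERIV_power_Suc[OF this, of m]
    have d3: "((\<lambda>x. (a\<^sup>2 - x\<^sup>2) ^ Suc m) has_real_derivative (1 + of_nat m) * (- (2 * x) * (a\<^sup>2 - x\<^sup>2) ^ m)) (at x)" .
    have "(?F has_real_derivative ((real (2 * n + 1) * x ^ (2 * n)) * (x\<^sup>2) powr b + x ^ (2 * n + 1) * (b * (x\<^sup>2) powr (b - 1) * (2 * x))) * (a\<^sup>2 - x\<^sup>2) ^ Suc m
       + x ^ (2 * n + 1) * (x\<^sup>2) powr b * (real (Suc m) * (a\<^sup>2 - x\<^sup>2) ^ m * (- (2 * x)))) (at x)"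
      using DERIV_mult[OF DERIV_mult[OF d1 d2] d3] by (rule DERIV_cong) (simp add: algebra_simps)
    also have "((real (2 * n + 1) * x ^ (2 * n)) * (x\<^sup>2) powr b + x ^ (2 * n + 1) * (b * (x\<^sup>2) powr (b - 1) * (2 * x))) * (a\<^sup>2 - x\<^sup>2) ^ Suc m
       + x ^ (2 * n + 1) * (x\<^sup>2) powr b * (real (Suc m) * (a\<^sup>2 - x\<^sup>2) ^ m * (- (2 * x))) = ?G x"
    proof -
      have e: "x ^ (2 * n) = (x\<^sup>2) ^ n" "x ^ (2 * n + 1) = (x\<^sup>2) ^ n * x" by (simp_all add: power_mult)
      show ?thesis unfolding e pw by (simp add: power2_eq_square algebra_simps)
    qed
    finally show "(?F has_vector_derivative ?G x) (at x)"
      by (simp add: has_real_derivative_iff_has_vector_derivative)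
  qed (use a in auto)
  then have 1: "((\<lambda>x. indicator {-a..a} x * ?G x) has_integral 0) UNIV"
  proof (subst (asm) has_integral_restrict_UNIV[symmetric])
    have "(\<lambda>x. if x \<in> {-a..a} then ?G x else 0) = (\<lambda>x. indicator {-a..a} x * ?G x)"
      by (auto simp: fun_eq_iff indicator_def)
    moreover assume "((\<lambda>x. if x \<in> {-a..a} then ?G x else 0) has_integral (?F a - ?F (- a))) UNIV"
    ultimately show ?thesis by simp
  qed
  have "set_integrable lborel {-a..a} ?G"
    using b by (intro borel_integrable_atLeastAtMost' continuous_intros continuous_on_powr') auto
  then have "integrable lborel (\<lambda>x. indicator {-a..a} x * ?G x)" by (simp add: set_integrable_def)
  from has_integral_integral_lborel[OF this] 1 have 2: "(LINT x|lborel. indicator {-a..a} x * ?G x) = 0"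
    by (rule has_integral_unique)
  have i: "integrable M (\<lambda>x. psi a m x * (x\<^sup>2) ^ k)" for k by (rule integrable_psi_power[OF a])
  have "(LINT x|M. psi a m x * ?g x) = (LINT x|lborel. (1 / mconst) * (indicator {-a..a} x * ?G x))"
  proof (subst integral_M_real, measurable, intro Bochner_Integration.integral_cong refl)
    fix x
    have "\<bar>x\<bar> powr (2 * \<alpha> + 1) = (x\<^sup>2) powr b"
      using powr_powr[of "\<bar>x\<bar>" 2 b] by (simp add: b_def algebra_simps)
    then show "\<bar>x\<bar> powr (2 * \<alpha> + 1) / mconst * (psi a m x * ?g x) = (1 / mconst) * (indicator {-a..a} x * ?G x)"
      by (auto simp: psi_def indicator_def abs_le_iff)
  qed
  also have "\<dots> = 0" using 2 by simp
  finally have 3: "(LINT x|M. psi a m x * ?g x) = 0" .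
  have "(LINT x|M. psi a m x * ?g x) = (LINT x|M. (2 * n + 1 + 2 * b) * a\<^sup>2 * (psi a m x * (x\<^sup>2) ^ n) - (2 * n + 1 + 2 * b + 2 * (real m + 1)) * (psi a m x * (x\<^sup>2) ^ Suc n))"
    by (intro Bochner_Integration.integral_cong refl) (simp add: algebra_simps)
  also have "\<dots> = (2 * n + 1 + 2 * b) * a\<^sup>2 * (LINT x|M. psi a m x * (x\<^sup>2) ^ n) - (2 * n + 1 + 2 * b + 2 * (real m + 1)) * (LINT x|M. psi a m x * (x\<^sup>2) ^ Suc n)"
    by (subst Bochner_Integration.integral_diff) (intro integrable_mult_right i | simp only: Bochner_Integration.integral_mult_right_zero)+
  finally have "(2 * n + 1 + 2 * b) * a\<^sup>2 * (LINT x|M. psi a m x * (x\<^sup>2) ^ n) = (2 * n + 1 + 2 * b + 2 * (real m + 1)) * (LINT x|M. psi a m x * (x\<^sup>2) ^ Suc n)"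
    using 3 by simp
  moreover have "2 * n + 1 + 2 * b = 2 * (n + \<alpha> + 1)" "2 * n + 1 + 2 * b + 2 * (real m + 1) = 2 * (n + \<alpha> + m + 2)"
    by (simp_all add: b_def)
  ultimately have "2 * (a\<^sup>2 * (n + \<alpha> + 1) * (LINT x|M. psi a m x * (x\<^sup>2) ^ n)) = 2 * ((n + \<alpha> + m + 2) * (LINT x|M. psi a m x * (x\<^sup>2) ^ Suc n))"
    by (simp only: mult_ac)
  then show ?thesis by simp
qed

lemma psi_moment:
  assumes a: "a > 0"
  shows "(LINT x|M. psi a m x * (x\<^sup>2) ^ n) = 
    (LINT x|M. psi a m x) * ((a\<^sup>2) ^ n * pochhammer (\<alpha> + 1) n / pochhammer (\<alpha> + m + 2) n)"
proof (induction n)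
  case (Suc n)
  have p: "pochhammer (\<alpha> + m + 2) n > 0" "n + \<alpha> + m + 2 > 0" using \<alpha> by (auto intro!: pochhammer_pos)
  have "(LINT x|M. psi a m x * (x\<^sup>2) ^ Suc n) = a\<^sup>2 * (n + \<alpha> + 1) / (n + \<alpha> + m + 2) * (LINT x|M. psi a m x * (x\<^sup>2) ^ n)"
    using psi_moment_rec[OF a, of n m] p by (simp add: field_simps del: power_Suc)
  then show ?case unfolding Suc using p by (simp add: pochhammer_Suc field_simps)
qed simp

text \<open>Sonine's integral. The larger \<open>m\<close>, the faster the transform of \<^const>\<open>psi\<close> decays.\<close>

lemma sonine:
  assumes a: "a > 0"
  shows "(LINT x|M. psi a m x * ker_even (x * t)) = (LINT x|M. psi a m x) * bes (\<alpha> + m + 1) ((a * t)\<^sup>2)"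
proof -
  have [measurable]: "bes \<alpha> \<in> borel_measurable borel" by (rule bes_measurable[OF \<alpha>1(1)])
  have \<nu>: "\<alpha> + m + 1 > -1" using \<alpha> by simp
  let ?N = "density M (\<lambda>x. ennreal (psi a m x))"
  define C where "C = (LINT x|M. psi a m x)"
  have C: "C \<ge> 0" unfolding C_def using psi_nonneg by (intro integral_nonneg_AE) auto
  have pos: "pochhammer (\<alpha> + 1) n > 0" "pochhammer (\<alpha> + m + 2) n > 0" for n using \<alpha> by (auto intro!: pochhammer_pos)
  have gi: "integrable ?N (\<lambda>x. (x\<^sup>2) ^ n)" "(LINT x|?N. (x\<^sup>2) ^ n) = C * ((a\<^sup>2) ^ n * pochhammer (\<alpha> + 1) n / pochhammer (\<alpha> + m + 2) n)" for n
    using integrable_psi_power[OF a, of m n] psi_moment[OF a, of m n] psi_nonneg[of a m]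
    by (simp_all add: integrable_density integral_density C_def)
  have e: "bes_coeff \<alpha> n * (t\<^sup>2) ^ n * (C * ((a\<^sup>2) ^ n * pochhammer (\<alpha> + 1) n / pochhammer (\<alpha> + m + 2) n)) = C * (bes_coeff (\<alpha> + m + 1) n * ((a * t)\<^sup>2) ^ n)" for n
  proof -
    have "\<alpha> + m + 1 + 1 = \<alpha> + m + 2" by simp
    then show ?thesis using pos[of n] by (simp add: bes_coeff_def power_mult_distrib field_simps)
  qed
  have e2: "\<bar>bes_coeff \<alpha> n\<bar> * \<bar>t\<^sup>2\<bar> ^ n * (C * ((a\<^sup>2) ^ n * pochhammer (\<alpha> + 1) n / pochhammer (\<alpha> + m + 2) n)) = C * norm (bes_coeff (\<alpha> + m + 1) n * ((a * t)\<^sup>2) ^ n)" for n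
    using arg_cong[OF e[of n], of abs] C pos[of n] by (simp add: abs_mult power_abs)
  have "(\<lambda>n. bes_coeff \<alpha> n * (t\<^sup>2) ^ n * (LINT x|?N. (x\<^sup>2) ^ n)) sums (LINT x|?N. bes \<alpha> (t\<^sup>2 * x\<^sup>2))"
  proof (rule bes_moments(2)[OF \<alpha>1(1) gi(1)])
    show "summable (\<lambda>n. \<bar>bes_coeff \<alpha> n\<bar> * \<bar>t\<^sup>2\<bar> ^ n * (LINT x|?N. (x\<^sup>2) ^ n))"
      unfolding gi(2) e2 by (intro summable_mult bes_norm_summable \<nu>)
  qed auto
  then have "(\<lambda>n. C * (bes_coeff (\<alpha> + m + 1) n * ((a * t)\<^sup>2) ^ n)) sums (LINT x|?N. bes \<alpha> (t\<^sup>2 * x\<^sup>2))"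
    unfolding gi(2) e .
  moreover have "(\<lambda>n. C * (bes_coeff (\<alpha> + m + 1) n * ((a * t)\<^sup>2) ^ n)) sums (C * bes (\<alpha> + m + 1) ((a * t)\<^sup>2))"
    by (intro sums_mult bes_sums \<nu>)
  ultimately have "(LINT x|?N. bes \<alpha> (t\<^sup>2 * x\<^sup>2)) = C * bes (\<alpha> + m + 1) ((a * t)\<^sup>2)" by (rule sums_unique2)
  moreover have "(LINT x|?N. bes \<alpha> (t\<^sup>2 * x\<^sup>2)) = (LINT x|M. psi a m x * ker_even (x * t))"
    using psi_nonneg[of a m] by (subst integral_density) (auto simp: ker_even_def power_mult_distrib mult.commute)
  ultimately show ?thesis by (simp add: C_def)
qed

lemma emeasure_M_pos:
  assumes "r > 0"
  shows "emeasure M {-r..r} > 0"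
proof (rule ccontr)
  assume "\<not> emeasure M {-r..r} > 0"
  then have "emeasure M {-r..r} = 0" by simp
  then have "(\<integral>\<^sup>+x. ennreal (\<bar>x\<bar> powr (2 * \<alpha> + 1) / mconst) * indicator {-r..r} x \<partial>lborel) = 0"
    unfolding M_def by (subst (asm) emeasure_density) auto
  then have "AE x in lborel. ennreal (\<bar>x\<bar> powr (2 * \<alpha> + 1) / mconst) * indicator {-r..r} x = 0"
    by (subst (asm) nn_integral_0_iff_AE) auto
  then have "AE x in lborel. x \<notin> {0<..<r}"
    by eventually_elim (use mconst in \<open>auto simp: indicator_def\<close>)
  then have "{0<..<r} \<in> null_sets lborel" by (subst AE_iff_null_sets) auto
  then show False using assms by (simp add: null_sets_def)
qed

lemma emeasure_M_scale:
  assumes "r > 0"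
  shows "emeasure M {-r..r} = ennreal (r powr (2 * \<alpha> + 2)) * emeasure M {-1..1}"
proof -
  have "emeasure M {-r..r} = (\<integral>\<^sup>+x. indicator {-r..r} x \<partial>M)" by simp
  also have "\<dots> = ennreal (r powr (2 * \<alpha> + 2)) * (\<integral>\<^sup>+x. indicator {-r..r} (r * x) \<partial>M)"
    by (rule nn_integral_M_scale[OF assms]) measurable
  also have "(\<integral>\<^sup>+x. indicator {-r..r} (r * x) \<partial>M) = (\<integral>\<^sup>+x. indicator {-1..1} x \<partial>M)"
  proof (intro nn_integral_cong)
    fix x
    have "r * x \<in> {-r..r} \<longleftrightarrow> x \<in> {-1..1}"
      using assms mult_le_cancel_left_pos[of r x 1] mult_le_cancel_left_pos[of r "-1" x] by simp
    then show "indicator {-r..r} (r * x) = (indicator {-1..1} x :: ennreal)" by (simp add: indicator_def)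
  qed
  finally show ?thesis by simp
qed

text \<open>On |x| \<le> 1/r \<le> a/2 the multiplier is at least (3/4 a^2)^m and the Gaussian
  factor at least exp(-1/4). The power of r in \<open>gau_hat\<close> cancels against the measure of
  this interval, so the bound is uniform in r.\<close>

lemma psi_integral_lower:
  assumes a: "a > 0" and r: "r > 0" "2 \<le> a * r"
  shows "(LINT x|M. psi a m x * gau_hat r x) \<ge> (3/4 * a\<^sup>2) ^ m * g0 * exp (-1/4) * measure M {-1..1}"
proof -
  let ?c = "(3/4 * a\<^sup>2) ^ m * (r powr (2 * \<alpha> + 2) * g0 * exp (-1/4))"
  have c: "?c \<ge> 0" using g0 by simp
  have fin: "emeasure M {-s..s} = ennreal (measure M {-s..s})" for s
    using emeasure_M_bounded[of s] by (intro emeasure_eq_ennreal_measure) auto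
  have i: "integrable M (\<lambda>x. psi a m x * gau_hat r x)"
  proof (rule Bochner_Integration.integrable_bound)
    show "integrable M (\<lambda>x. psi a m x * (x\<^sup>2) ^ 0 * (r powr (2 * \<alpha> + 2) * g0))"
      by (rule integrable_mult_left[OF integrable_psi_power[OF a]])
    show "AE x in M. norm (psi a m x * gau_hat r x) \<le> norm (psi a m x * (x\<^sup>2) ^ 0 * (r powr (2 * \<alpha> + 2) * g0))"
      using psi_nonneg g0 gau_pos[of "2 / r"] gau_le_1[of "2 / r"]
      by (auto simp: gau_hat_def abs_mult less_imp_le intro!: mult_left_mono mult_left_le)
  qed measurable
  have "(3/4 * a\<^sup>2) ^ m * g0 * exp (-1/4) * measure M {-1..1} = ?c * measure M {-(1/r)..1/r}"
  proof -
    have "ennreal (measure M {-(1/r)..1/r}) = ennreal ((1/r) powr (2 * \<alpha> + 2) * measure M {-1..1})"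
      using emeasure_M_scale[of "1/r"] r(1) unfolding fin by (simp add: ennreal_mult)
    then have "measure M {-(1/r)..1/r} = (1/r) powr (2 * \<alpha> + 2) * measure M {-1..1}" by simp
    then have "?c * measure M {-(1/r)..1/r} = (r powr (2 * \<alpha> + 2) * (1/r) powr (2 * \<alpha> + 2)) * 
        ((3/4 * a\<^sup>2) ^ m * g0 * exp (-1/4) * measure M {-1..1})"
      by (simp only: mult_ac)
    moreover have "r powr (2 * \<alpha> + 2) * (1/r) powr (2 * \<alpha> + 2) = 1"
      using r(1) by (simp flip: powr_mult)
    ultimately show ?thesis by (simp only: mult_1_left)
  qed
  also have "\<dots> = (LINT x|M. ?c * indicator {-(1/r)..1/r} x)"
    by simp
  also have "\<dots> \<le> (LINT x|M. psi a m x * gau_hat r x)"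
  proof (rule integral_mono_AE[OF _ i])
    show "integrable M (\<lambda>x. ?c * indicator {-(1/r)..1/r} x)" by (intro integrable_mult_right integrable_indicator_Icc)
    have "?c * indicator {-(1/r)..1/r} x \<le> psi a m x * gau_hat r x" for x
    proof (cases "x \<in> {-(1/r)..1/r}")
      case True
      then have "\<bar>x\<bar> \<le> 1 / r" by (auto simp: abs_le_iff)
      then have xr: "\<bar>r * x\<bar> \<le> 1" using r by (simp add: abs_mult field_simps)
      have "1 / r \<le> a / 2" using r by (simp add: field_simps)
      then have xa: "\<bar>x\<bar> \<le> a / 2" using \<open>\<bar>x\<bar> \<le> 1 / r\<close> by linarith
      then have "x\<^sup>2 \<le> (a / 2)\<^sup>2" using a by (simp add: abs_le_square_iff[symmetric])
      then have "3/4 * a\<^sup>2 \<le> a\<^sup>2 - x\<^sup>2" by (simp add: power_divide)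
      then have 1: "(3/4 * a\<^sup>2) ^ m \<le> psi a m x" using xa a by (auto simp: psi_def intro!: power_mono)
      have "(r * x)\<^sup>2 \<le> 1" using xr by (simp add: abs_square_le_1)
      then have "exp (-1/4) \<le> gau (2 / r) x" by (simp add: gau_def power_divide mult.commute)
      then have 2: "r powr (2 * \<alpha> + 2) * g0 * exp (-1/4) \<le> gau_hat r x"
        unfolding gau_hat_def using g0 by (intro mult_left_mono) auto
      have "?c \<le> psi a m x * gau_hat r x" using 1 2 g0 by (intro mult_mono psi_nonneg) auto
      then show ?thesis using True by simp
    qed (auto intro!: mult_nonneg_nonneg psi_nonneg gau_hat_nonneg)
    then show "AE x in M. ?c * indicator {-(1/r)..1/r} x \<le> psi a m x * gau_hat r x" by simp
  qed
  finally show ?thesis .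
qed

lemma gaussian_summability:
  fixes h :: "real \<Rightarrow> 'b::{banach, second_countable_topology}"
  assumes "integrable M h"
  shows "(\<lambda>n. LINT x|M. gau (real (Suc n)) x *\<^sub>R h x) \<longlonglongrightarrow> (LINT x|M. h x)"
proof (rule integral_dominated_convergence[where w = "\<lambda>x. norm (h x)"])
  show "h \<in> borel_measurable M" using assms by (rule borel_measurable_integrable)
  then show "(\<lambda>x. gau (real (Suc n)) x *\<^sub>R h x) \<in> borel_measurable M" for n by measurable
  show "integrable M (\<lambda>x. norm (h x))" using assms by simp
  have "(\<lambda>n. gau (real (Suc n)) x *\<^sub>R h x) \<longlonglongrightarrow> 1 *\<^sub>R h x" for x
    by (intro tendsto_intros gau_tendsto_1)
  then show "AE x in M. (\<lambda>n. gau (real (Suc n)) x *\<^sub>R h x) \<longlonglongrightarrow> h x" by simp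
  show "AE x in M. norm (gau (real (Suc n)) x *\<^sub>R h x) \<le> norm (h x)" for n
    using gau_pos[of "real (Suc n)"] gau_le_1[of "real (Suc n)"] by (auto simp: less_imp_le intro!: mult_left_le_one_le)
qed

text \<open>The Bessel function oscillates, so its integrand shows no sign. Up to a positive factor
  it is the transform of \<open>psi 1 m\<close>, and its mass reflects the value of
  \<open>psi 1 m\<close> near 0: with Gaussian weights the mass becomes the integral of
  \<open>psi 1 m\<close> against \<open>gau_hat r\<close>, which \<open>psi_integral_lower\<close>
  keeps away from 0 in the limit. Positivity is what allows the kernel to be normalized.\<close>

lemma bes_mass_pos:
  assumes "integrable M (\<lambda>t. bes (\<alpha> + real m + 1) (t\<^sup>2))"
  shows "(LINT t|M. bes (\<alpha> + real m + 1) (t\<^sup>2)) > 0"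
proof -
  define \<Phi> where "\<Phi> t = bes (\<alpha> + real m + 1) (t\<^sup>2)" for t
  have i: "integrable M \<Phi>" using assms by (simp add: \<Phi>_def[abs_def])
  define C where "C = (LINT x|M. psi 1 m x)"
  have pi: "integrable M (psi 1 m)" using integrable_psi_power[of 1 m 0] by simp
  have s: "(LINT x|M. psi 1 m x * ker_even (x * t)) = C * \<Phi> t" for t
    using sonine[of 1 m t] by (simp add: C_def \<Phi>_def)
  have sw: "C * (LINT t|M. gau r t * \<Phi> t) = (LINT x|M. psi 1 m x * gau_hat r x)" if r: "r > 0" for r
  proof -
    have "C * (LINT t|M. gau r t * \<Phi> t) = (LINT t|M. gau r t * (C * \<Phi> t))"
      by (simp add: mult.left_commute[of _ C])
    also have "\<dots> = (LINT t|M. LINT x|M. gau r t * (psi 1 m x * ker_even (x * t)))"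
      by (simp only: s[symmetric] Bochner_Integration.integral_mult_right_zero)
    also have "\<dots> = (LINT x|M. LINT t|M. gau r t * (psi 1 m x * ker_even (x * t)))"
    proof (rule Fubini_M(1))
      have "(\<integral>\<^sup>+t. \<integral>\<^sup>+x. ennreal (norm (gau r t * (psi 1 m x * ker_even (x * t)))) \<partial>M \<partial>M) \<le>
        (\<integral>\<^sup>+t. \<integral>\<^sup>+x. ennreal (gau r t) * ennreal (psi 1 m x) \<partial>M \<partial>M)"
        using ker_even_bound gau_pos[of r] psi_nonneg[of 1 m]
        by (intro nn_integral_mono) (auto simp: abs_mult less_imp_le intro!: ennreal_leI mult_left_mono mult_left_le simp flip: ennreal_mult)
      also have "\<dots> = (\<integral>\<^sup>+t. ennreal (gau r t) \<partial>M) * (\<integral>\<^sup>+x. ennreal (psi 1 m x) \<partial>M)"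
        by (simp add: nn_integral_cmult nn_integral_multc)
      also have "\<dots> < \<infinity>"
        using integrable_gau[OF r] pi gau_pos[of r] psi_nonneg[of 1 m]
        by (auto simp: integrable_iff_bounded ennreal_mult_less_top less_imp_le)
      finally show "(\<integral>\<^sup>+t. \<integral>\<^sup>+x. ennreal (norm (gau r t * (psi 1 m x * ker_even (x * t)))) \<partial>M \<partial>M) < \<infinity>" .
    qed measurable
    also have "\<dots> = (LINT x|M. psi 1 m x * (LINT t|M. gau r t * ker_even (t * x)))"
      by (simp add: mult.left_commute[of "gau r _"] mult.commute[of _ "_ :: real"])
    finally show ?thesis by (simp add: gaussian_transform[OF r])
  qed
  define \<delta> where "\<delta> = (3/4 * 1\<^sup>2) ^ m * g0 * exp (-1/4) * measure M {-1..1}"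
  have "measure M {-1..1} > 0"
    using emeasure_M_pos[of 1] emeasure_M_bounded[of 1] by (simp add: measure_def enn2real_positive_iff)
  then have \<delta>: "\<delta> > 0" using g0 by (simp add: \<delta>_def)
  have "(\<lambda>n. C * (LINT t|M. gau (real (Suc n)) t *\<^sub>R \<Phi> t)) \<longlonglongrightarrow> C * (LINT t|M. \<Phi> t)"
    by (intro tendsto_mult_left gaussian_summability i)
  moreover have "\<forall>\<^sub>F n in sequentially. \<delta> \<le> C * (LINT t|M. gau (real (Suc n)) t *\<^sub>R \<Phi> t)"
    unfolding eventually_sequentially
  proof (intro exI[of _ 1] allI impI)
    \<comment> \<open>From n = 1 on, the width n + 1 is at least 2, as
      \<open>psi_integral_lower\<close> demands for a = 1.\<close>
    fix n :: nat assume n: "1 \<le> n"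
    then have "2 \<le> 1 * real (Suc n)" by simp
    then show "\<delta> \<le> C * (LINT t|M. gau (real (Suc n)) t *\<^sub>R \<Phi> t)"
      using psi_integral_lower[of 1 "real (Suc n)" m] sw[of "real (Suc n)"] by (simp add: \<delta>_def)
  qed
  ultimately have "\<delta> \<le> C * (LINT t|M. \<Phi> t)" by (rule tendsto_lowerbound) simp
  then have "C * (LINT t|M. \<Phi> t) > 0" using \<delta> by linarith
  moreover have "C \<ge> 0" unfolding C_def using psi_nonneg by (intro integral_nonneg_AE) auto
  ultimately show ?thesis unfolding \<Phi>_def by (simp add: zero_less_mult_iff)
qed

text \<open>For t > 1 the integrand with its density is at most a constant times t powr (2\<alpha> +
  1 - 2k + s), and the condition on k says that this exponent is at most -2. Near 0 boundedness of
  the Bessel function suffices. The order is \<alpha> + m + 1 with m = 2k, which is the form that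
  \<open>sonine\<close> delivers.\<close>

lemma decay_integrable:
  assumes s: "s \<ge> 0" and k: "2 * real k \<ge> s + 2 * \<alpha> + 3"
  shows "(\<integral>\<^sup>+t. ennreal (\<bar>bes (\<alpha> + 1 + 2 * real k) (t\<^sup>2)\<bar> * (1 + \<bar>t\<bar>) powr s) \<partial>M) < \<infinity>"
proof -
  define \<nu> where "\<nu> = \<alpha> + 1 + 2 * real k"
  have \<nu>: "\<nu> > -1/2" using \<alpha> by (simp add: \<nu>_def)
  have [measurable]: "bes \<nu> \<in> borel_measurable borel" using \<nu> by (intro bes_measurable) auto
  obtain C where C: "\<And>v. v \<ge> 0 \<Longrightarrow> \<bar>bes \<nu> v\<bar> * v ^ k \<le> C"
    using bes_decay[of "\<alpha> + 1" k] \<alpha> by (auto simp: \<nu>_def)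
  have C0: "C \<ge> 0" using C[of 1] by (simp add: order_trans[OF abs_ge_zero])
  define c where "c = 2 powr s * C / mconst"
  have c: "c \<ge> 0" using C0 mconst by (simp add: c_def)
  have "(\<integral>\<^sup>+t. ennreal (\<bar>bes \<nu> (t\<^sup>2)\<bar> * (1 + \<bar>t\<bar>) powr s) \<partial>M) =
    (\<integral>\<^sup>+t. ennreal (\<bar>t\<bar> powr (2 * \<alpha> + 1) / mconst) * ennreal (\<bar>bes \<nu> (t\<^sup>2)\<bar> * (1 + \<bar>t\<bar>) powr s) \<partial>lborel)"
    by (subst nn_integral_M) auto
  also have "\<dots> = 2 * (\<integral>\<^sup>+t. ennreal (\<bar>t\<bar> powr (2 * \<alpha> + 1) / mconst) * ennreal (\<bar>bes \<nu> (t\<^sup>2)\<bar> * (1 + \<bar>t\<bar>) powr s) * indicator {0<..} t \<partial>lborel)"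
    by (rule nn_integral_even_half) auto
  also have "\<dots> \<le> 2 * (\<integral>\<^sup>+t. ennreal (2 powr s / mconst) * indicator {0..1} t + ennreal c * ennreal (indicator {1..} t * t powr -2) \<partial>lborel)"
  proof (intro mult_left_mono nn_integral_mono)
    fix t :: real
    show "ennreal (\<bar>t\<bar> powr (2 * \<alpha> + 1) / mconst) * ennreal (\<bar>bes \<nu> (t\<^sup>2)\<bar> * (1 + \<bar>t\<bar>) powr s) * indicator {0<..} t \<le> 
      ennreal (2 powr s / mconst) * indicator {0..1} t + ennreal c * ennreal (indicator {1..} t * t powr -2)"
    proof (cases "t > 0")
      case False
      then show ?thesis by simp
    next
      case True
      have e: "ennreal (\<bar>t\<bar> powr (2 * \<alpha> + 1) / mconst) * ennreal (\<bar>bes \<nu> (t\<^sup>2)\<bar> * (1 + \<bar>t\<bar>) powr s) =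
         ennreal (t powr (2 * \<alpha> + 1) / mconst * (\<bar>bes \<nu> (t\<^sup>2)\<bar> * (1 + t) powr s))"
        using True mconst by (simp flip: ennreal_mult)
      show ?thesis
      proof (cases "t \<le> 1")
        case t1: True
        have "t powr (2 * \<alpha> + 1) \<le> 1 powr (2 * \<alpha> + 1)" using True t1 \<alpha>1 by (intro powr_mono2) auto
        moreover have "\<bar>bes \<nu> (t\<^sup>2)\<bar> * (1 + t) powr s \<le> 1 * 2 powr s"
          using True t1 s by (intro mult_mono bes_bounded \<nu> powr_mono2) auto
        ultimately have "t powr (2 * \<alpha> + 1) / mconst * (\<bar>bes \<nu> (t\<^sup>2)\<bar> * (1 + t) powr s) \<le> (1 / mconst) * (1 * 2 powr s)"
          by - (rule mult_mono, use mconst in \<open>simp_all add: divide_right_mono\<close>)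
        then have "ennreal (t powr (2 * \<alpha> + 1) / mconst * (\<bar>bes \<nu> (t\<^sup>2)\<bar> * (1 + t) powr s)) \<le> ennreal (2 powr s / mconst)"
          by (intro ennreal_leI) simp
        then show ?thesis unfolding e using True t1 by (simp add: add_increasing2)
      next
        case t1: False
        have tk: "(t\<^sup>2) ^ k = t powr (2 * real k)" using powr_realpow[OF True, of "2 * k"] by (simp add: power_mult)
        have b: "\<bar>bes \<nu> (t\<^sup>2)\<bar> \<le> C * t powr (- 2 * real k)"
          using C[of "t\<^sup>2"] True unfolding tk by (simp add: powr_minus field_simps)
        have "(1 + t) powr s \<le> (2 * t) powr s" using t1 s by (intro powr_mono2) auto
        then have "\<bar>bes \<nu> (t\<^sup>2)\<bar> * (1 + t) powr s \<le> (C * t powr (- 2 * real k)) * (2 powr s * t powr s)"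
          using b C0 by (intro mult_mono) (auto simp: powr_mult)
        then have "t powr (2 * \<alpha> + 1) / mconst * (\<bar>bes \<nu> (t\<^sup>2)\<bar> * (1 + t) powr s) \<le> t powr (2 * \<alpha> + 1) / mconst * ((C * t powr (- 2 * real k)) * (2 powr s * t powr s))"
          using mconst by (intro mult_left_mono) auto
        also have "\<dots> = c * (t powr (2 * \<alpha> + 1) * t powr (- 2 * real k) * t powr s)" by (simp add: c_def mult_ac)
        also have "t powr (2 * \<alpha> + 1) * t powr (- 2 * real k) * t powr s = t powr (2 * \<alpha> + 1 - 2 * real k + s)"
          by (simp flip: powr_add)
        also have "c * t powr (2 * \<alpha> + 1 - 2 * real k + s) \<le> c * t powr -2"
          using k t1 c by (intro mult_left_mono powr_mono) auto
        finally have "ennreal (t powr (2 * \<alpha> + 1) / mconst * (\<bar>bes \<nu> (t\<^sup>2)\<bar> * (1 + t) powr s)) \<le> ennreal (c * t powr -2)"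
          by (rule ennreal_leI)
        then show ?thesis unfolding e using True t1 c by (simp add: ennreal_mult)
      qed
    qed
  qed simp
  also have "\<dots> = 2 * (ennreal (2 powr s / mconst) * 1 + ennreal c * (\<integral>\<^sup>+t. ennreal (indicator {1..} t * t powr -2) \<partial>lborel))"
    by (subst nn_integral_add) (auto simp: nn_integral_cmult nn_integral_cmult_indicator)
  also have "(\<integral>\<^sup>+t. ennreal (indicator {1..} t * t powr -2) \<partial>lborel) = ennreal 1"
    using has_integral_powr_to_inf[of "-2" 1] by (intro nn_integral_has_integral_lebesgue) auto
  also have "2 * (ennreal (2 powr s / mconst) * 1 + ennreal c * ennreal 1) < \<infinity>"
    by (simp add: ennreal_mult_less_top)
  finally show ?thesis by (simp add: \<nu>_def)
qed

end

section \<open>Convolution with a band-limited kernel\<close>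

context dunkl
begin

text \<open>W(t, y, z) vanishes unless |t| is at least the distance of |y| and |z|, so the average
  in \<open>heat_le\<close> sees only the tail of \<open>gau_hat\<close>.\<close>

lemma heat_decay:
  assumes yz: "y \<noteq> 0" "z \<noteq> 0" and r: "r > 0" and \<delta>: "0 \<le> \<delta>" "\<delta> \<le> \<bar>\<bar>y\<bar> - \<bar>z\<bar>\<bar>"
  shows "\<bar>heat r y z\<bar> \<le> 4 * gau_hat r \<delta>"
proof -
  have "ennreal \<bar>heat r y z\<bar> \<le> ennreal (1 / \<kappa>) * (\<integral>\<^sup>+t. ennreal \<bar>dunkl_W \<alpha> t y z\<bar> * ennreal (gau_hat r t) \<partial>M)"
    by (rule heat_le[OF yz r])
  also have "\<dots> \<le> ennreal (1 / \<kappa>) * (\<integral>\<^sup>+t. ennreal \<bar>dunkl_W \<alpha> t y z\<bar> * ennreal (gau_hat r \<delta>) \<partial>M)"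
  proof (rule mult_left_mono[OF nn_integral_mono])
    fix t
    show "ennreal \<bar>dunkl_W \<alpha> t y z\<bar> * ennreal (gau_hat r t) \<le> ennreal \<bar>dunkl_W \<alpha> t y z\<bar> * ennreal (gau_hat r \<delta>)"
    proof (cases "dunkl_Delta \<alpha> t y z = 0")
      case True
      then show ?thesis by (simp add: dunkl_W_alt)
    next
      case False
      then have "\<bar>z\<bar> \<le> \<bar>t\<bar> + \<bar>y\<bar> \<and> \<bar>t\<bar> \<le> \<bar>y\<bar> + \<bar>z\<bar> \<and> \<bar>y\<bar> \<le> \<bar>t\<bar> + \<bar>z\<bar>"
        unfolding dunkl_Delta_alt by presburger
      then have "\<delta> \<le> \<bar>t\<bar>" using \<delta> by arith
      then have "(\<delta> / (2 / r))\<^sup>2 \<le> (\<bar>t\<bar> / (2 / r))\<^sup>2"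
        using r \<delta> by (intro power_mono divide_right_mono) auto
      then have "gau (2 / r) t \<le> gau (2 / r) \<delta>" by (simp add: gau_def power_divide power_mult_distrib)
      then have "gau_hat r t \<le> gau_hat r \<delta>" unfolding gau_hat_def using g0 by (intro mult_left_mono) auto
      then show ?thesis by (intro mult_left_mono ennreal_leI) auto
    qed
  qed auto
  also have "\<dots> = ennreal (1 / \<kappa>) * ((\<integral>\<^sup>+t. ennreal \<bar>dunkl_W \<alpha> t y z\<bar> \<partial>M) * ennreal (gau_hat r \<delta>))"
    by (subst nn_integral_multc) auto
  also have "\<dots> \<le> ennreal (1 / \<kappa>) * (ennreal CW * ennreal (gau_hat r \<delta>))"
    by (intro mult_left_mono mult_right_mono W_integral_le) auto
  also have "\<dots> = ennreal ((1 / \<kappa>) * (CW * gau_hat r \<delta>))"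
    using \<kappa> CW gau_hat_nonneg[of r \<delta>] by (simp flip: ennreal_mult)
  also have "(1 / \<kappa>) * (CW * gau_hat r \<delta>) = 4 * gau_hat r \<delta>" using \<kappa> by (simp add: CW_\<kappa>)
  finally show ?thesis using gau_hat_nonneg[of r \<delta>] by (subst (asm) ennreal_le_iff) auto
qed

lemma gau_hat_tendsto_0:
  assumes "\<delta> > 0"
  shows "(\<lambda>n. gau_hat (real (Suc n)) \<delta>) \<longlonglongrightarrow> 0"
proof -
  define d where "d = \<delta> / 2"
  have d: "d > 0" using assms by (simp add: d_def)
  have "(\<lambda>n. real (Suc n) powr (2 * \<alpha> + 2) * exp (- (d * real (Suc n))\<^sup>2)) \<longlonglongrightarrow> 0"
    using d by real_asymp
  then have "(\<lambda>n. g0 * (real (Suc n) powr (2 * \<alpha> + 2) * exp (- (d * real (Suc n))\<^sup>2))) \<longlonglongrightarrow> g0 * 0"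
    by (intro tendsto_mult_left)
  moreover have "\<delta> / (2 / real (Suc n)) = d * real (Suc n)" for n by (simp add: d_def)
  ultimately show ?thesis by (simp only: gau_hat_def gau_def mult_ac mult_zero_right mult_zero_left)
qed

end

text \<open>What the convolution argument needs from the kernel: an even multiplier \<psi> supported
  in [-a, a] whose transform \<Phi> is integrable.\<close>

locale dunkl_band = dunkl +
  fixes a :: real and \<psi> \<Phi> :: "real \<Rightarrow> real"
  assumes psi_int: "integrable M \<psi>" and psi_sym: "\<And>x. \<psi> (- x) = \<psi> x"
    and psi_supp: "\<And>x. \<bar>x\<bar> > a \<Longrightarrow> \<psi> x = 0"
    and Phi_int: "integrable M \<Phi>" and Phi_eq: "\<And>t. \<Phi> t = (LINT x|M. \<psi> x * ker_even (x * t))"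
begin

lemma psi_meas [measurable]: "\<psi> \<in> borel_measurable borel"
  using borel_measurable_integrable[OF psi_int] by simp

lemma Phi_meas [measurable]: "\<Phi> \<in> borel_measurable borel"
  using borel_measurable_integrable[OF Phi_int] by simp

definition L1 :: ennreal where "L1 = (\<integral>\<^sup>+t. ennreal \<bar>\<Phi> t\<bar> \<partial>M)"

lemma L1_fin: "L1 < \<infinity>"
  using Phi_int by (simp add: L1_def integrable_iff_bounded)

text \<open>The translate of \<Phi>, arranged so that integrating it against f in z gives the
  average of the translates of f with weight \<Phi>.\<close>

definition K :: "real \<Rightarrow> real \<Rightarrow> real" where
  "K y z = (LINT t|M. dunkl_W \<alpha> t y z * \<Phi> t)"

text \<open>A majorant of the absolute value of \<open>K\<close> that can be estimated by Tonelli
  before any integrability is known.\<close>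

definition Kabs :: "real \<Rightarrow> real \<Rightarrow> ennreal" where
  "Kabs y z = (\<integral>\<^sup>+t. ennreal \<bar>dunkl_W \<alpha> t y z\<bar> * ennreal \<bar>\<Phi> t\<bar> \<partial>M)"

lemma K_measurable [measurable]:
  assumes [measurable]: "f \<in> borel_measurable N" "g \<in> borel_measurable N"
  shows "(\<lambda>x. K (f x) (g x)) \<in> borel_measurable N" "(\<lambda>x. Kabs (f x) (g x)) \<in> borel_measurable N"
  unfolding K_def Kabs_def by measurable

lemma K_le: "ennreal \<bar>K y z\<bar> \<le> Kabs y z"
  unfolding K_def Kabs_def using norm_integral_le_nn[of M "\<lambda>t. dunkl_W \<alpha> t y z * \<Phi> t"]
  by (simp add: abs_mult ennreal_mult)

lemma Kabs_integral_le: "(\<integral>\<^sup>+y. Kabs y z \<partial>M) \<le> ennreal CW * L1" "(\<integral>\<^sup>+z. Kabs y z \<partial>M) \<le> ennreal CW * L1"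
proof -
  have *: "(\<integral>\<^sup>+y. \<integral>\<^sup>+t. ennreal \<bar>w t y\<bar> * ennreal \<bar>\<Phi> t\<bar> \<partial>M \<partial>M) \<le> ennreal CW * L1"
    if [measurable]: "case_prod w \<in> borel_measurable (borel \<Otimes>\<^sub>M borel)" and w: "\<And>t. (\<integral>\<^sup>+y. ennreal \<bar>w t y\<bar> \<partial>M) \<le> ennreal CW" for w
  proof -
    have "(\<integral>\<^sup>+y. \<integral>\<^sup>+t. ennreal \<bar>w t y\<bar> * ennreal \<bar>\<Phi> t\<bar> \<partial>M \<partial>M) = (\<integral>\<^sup>+t. \<integral>\<^sup>+y. ennreal \<bar>w t y\<bar> * ennreal \<bar>\<Phi> t\<bar> \<partial>M \<partial>M)"
      by (rule MM.Fubini') measurable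
    also have "\<dots> \<le> (\<integral>\<^sup>+t. ennreal CW * ennreal \<bar>\<Phi> t\<bar> \<partial>M)"
      by (intro nn_integral_mono) (auto simp: nn_integral_multc intro!: mult_right_mono w)
    also have "\<dots> = ennreal CW * L1" unfolding L1_def by (rule nn_integral_cmult) measurable
    finally show ?thesis .
  qed
  show "(\<integral>\<^sup>+y. Kabs y z \<partial>M) \<le> ennreal CW * L1"
    unfolding Kabs_def by (rule *) (auto intro: W_integral_le)
  show "(\<integral>\<^sup>+z. Kabs y z \<partial>M) \<le> ennreal CW * L1"
    unfolding Kabs_def by (rule *) (auto intro: W_integral_le)
qed

lemma integrable_K: "integrable M (\<lambda>y. complex_of_real (K y z))"
proof (rule integrableI_bounded)
  have "(\<integral>\<^sup>+y. ennreal (norm (complex_of_real (K y z))) \<partial>M) \<le> (\<integral>\<^sup>+y. Kabs y z \<partial>M)"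
    by (intro nn_integral_mono) (simp add: K_le)
  also have "\<dots> \<le> ennreal CW * L1" by (rule Kabs_integral_le)
  also have "\<dots> < \<infinity>" using L1_fin by (simp add: ennreal_mult_less_top)
  finally show "(\<integral>\<^sup>+y. ennreal (norm (complex_of_real (K y z))) \<partial>M) < \<infinity>" .
qed measurable

lemma K_spectral:
  assumes "y \<noteq> 0" "z \<noteq> 0"
  shows "complex_of_real (K y z) = complex_of_real \<kappa> * (LINT \<mu>|M. complex_of_real (\<psi> \<mu>) * (ker \<mu> y * cnj (ker \<mu> z)))"
proof -
  have "K y z = \<kappa> * (LINT x|M. \<psi> x * bes_prod \<alpha> x y z)"
    unfolding W_transform[OF assms psi_int] K_def Phi_eq ..
  then show ?thesis unfolding integral_ker_prod_even[OF psi_int psi_sym] by simp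
qed

text \<open>With a Gaussian weight in y, the spectral form of \<open>K\<close> may be inserted and
  the integrals exchanged. The integral over y becomes a heat kernel between frequencies \<mu> in
  the band and -l outside it; by \<open>heat_decay\<close> it is small, uniformly in \<mu>, and
  tends to 0 as the weight is removed.\<close>

lemma K_spectral_support:
  assumes z: "z \<noteq> 0" and l: "a < \<bar>l\<bar>" "0 \<le> a"
  shows "(LINT y|M. complex_of_real (K y z) * ker l y) = 0"
proof -
  define \<delta> where "\<delta> = \<bar>l\<bar> - a"
  have \<delta>: "\<delta> > 0" using l by (simp add: \<delta>_def)
  have l0: "l \<noteq> 0" using l by auto
  have i: "integrable M (\<lambda>y. complex_of_real (K y z) * ker l y)"
    using integrable_ker_mult[OF integrable_K, of l z] by (simp add: mult.commute)
  define C where "C = (LINT \<mu>|M. \<bar>\<psi> \<mu>\<bar>)"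
  have Cfin: "(\<integral>\<^sup>+\<mu>. ennreal \<bar>\<psi> \<mu>\<bar> \<partial>M) = ennreal C"
    unfolding C_def using psi_int by (intro nn_integral_eq_integral) auto
  have bound: "norm (LINT y|M. gau r y *\<^sub>R (complex_of_real (K y z) * ker l y)) \<le> \<kappa> * (C * (4 * gau_hat r \<delta>))" if r: "r > 0" for r
  proof -
    let ?h = "\<lambda>y \<mu>. complex_of_real (gau r y) * (complex_of_real (\<psi> \<mu>) * (ker \<mu> y * cnj (ker \<mu> z))) * ker l y"
    have "(LINT y|M. gau r y *\<^sub>R (complex_of_real (K y z) * ker l y)) = 
      (LINT y|M. complex_of_real \<kappa> * (LINT \<mu>|M. ?h y \<mu>))"
    proof (rule integral_cong_AE)
      show "AE y in M. gau r y *\<^sub>R (complex_of_real (K y z) * ker l y) = complex_of_real \<kappa> * (LINT \<mu>|M. ?h y \<mu>)"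
        using AE_M_neq[of 0]
      proof eventually_elim
        case (elim y)
        have "gau r y *\<^sub>R (complex_of_real (K y z) * ker l y) = 
          complex_of_real \<kappa> * (complex_of_real (gau r y) * (LINT \<mu>|M. complex_of_real (\<psi> \<mu>) * (ker \<mu> y * cnj (ker \<mu> z))) * ker l y)"
          unfolding K_spectral[OF elim z] scaleR_conv_of_real by (simp only: mult_ac)
        then show ?case by (simp only: Bochner_Integration.integral_mult_right_zero Bochner_Integration.integral_mult_left_zero)
      qed
    qed measurable
    also have "\<dots> = complex_of_real \<kappa> * (LINT y|M. LINT \<mu>|M. ?h y \<mu>)" by simp
    also have "(LINT y|M. LINT \<mu>|M. ?h y \<mu>) = (LINT \<mu>|M. LINT y|M. ?h y \<mu>)"
    proof (rule Fubini_M(1))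
      have "(\<integral>\<^sup>+y. \<integral>\<^sup>+\<mu>. ennreal (norm (?h y \<mu>)) \<partial>M \<partial>M) \<le> (\<integral>\<^sup>+y. \<integral>\<^sup>+\<mu>. ennreal (gau r y) * ennreal \<bar>\<psi> \<mu>\<bar> \<partial>M \<partial>M)"
      proof (intro nn_integral_mono)
        fix y \<mu>
        have "norm (?h y \<mu>) \<le> gau r y * (\<bar>\<psi> \<mu>\<bar> * (1 * 1)) * 1"
          unfolding norm_mult complex_mod_cnj using gau_pos[of r y]
          by (intro mult_mono norm_ker) (auto simp: less_imp_le)
        then show "ennreal (norm (?h y \<mu>)) \<le> ennreal (gau r y) * ennreal \<bar>\<psi> \<mu>\<bar>"
          using gau_pos[of r y] by (simp add: ennreal_leI less_imp_le flip: ennreal_mult)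
      qed
      also have "\<dots> = (\<integral>\<^sup>+y. ennreal (gau r y) \<partial>M) * ennreal C"
        by (simp add: nn_integral_cmult nn_integral_multc Cfin)
      also have "\<dots> < \<infinity>" using integrable_gau[OF r] gau_pos[of r]
        by (auto simp: integrable_iff_bounded ennreal_mult_less_top less_imp_le)
      finally show "(\<integral>\<^sup>+y. \<integral>\<^sup>+\<mu>. ennreal (norm (?h y \<mu>)) \<partial>M \<partial>M) < \<infinity>" .
    qed measurable
    \<comment> \<open>The factor \<open>ker l y\<close> is the conjugate of
      \<open>ker y (- l)\<close>, which gives the kernel product in \<open>heat_complex\<close> its
      form.\<close>
    also have "\<dots> = (LINT \<mu>|M. complex_of_real (\<psi> \<mu>) * cnj (ker \<mu> z) * complex_of_real (heat r \<mu> (- l)))"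
    proof (intro Bochner_Integration.integral_cong refl)
      fix \<mu>
      have "?h y \<mu> = complex_of_real (\<psi> \<mu>) * cnj (ker \<mu> z) * (complex_of_real (gau r y) * (ker y \<mu> * cnj (ker y (- l))))" for y
        by (simp add: cnj_ker(2) ker_commute[of \<mu> y] ker_commute[of l y] mult_ac)
      then show "(LINT y|M. ?h y \<mu>) = complex_of_real (\<psi> \<mu>) * cnj (ker \<mu> z) * complex_of_real (heat r \<mu> (- l))"
        unfolding heat_complex[OF r, symmetric] by (simp only: Bochner_Integration.integral_mult_right_zero)
    qed
    finally have e: "norm (LINT y|M. gau r y *\<^sub>R (complex_of_real (K y z) * ker l y)) = 
       \<kappa> * norm (LINT \<mu>|M. complex_of_real (\<psi> \<mu>) * cnj (ker \<mu> z) * complex_of_real (heat r \<mu> (- l)))"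
      using \<kappa> by (simp add: norm_mult)
    have "ennreal (norm (LINT \<mu>|M. complex_of_real (\<psi> \<mu>) * cnj (ker \<mu> z) * complex_of_real (heat r \<mu> (- l)))) \<le>
       (\<integral>\<^sup>+\<mu>. ennreal (norm (complex_of_real (\<psi> \<mu>) * cnj (ker \<mu> z) * complex_of_real (heat r \<mu> (- l)))) \<partial>M)"
      by (rule norm_integral_le_nn)
    also have "\<dots> \<le> (\<integral>\<^sup>+\<mu>. ennreal \<bar>\<psi> \<mu>\<bar> * ennreal (4 * gau_hat r \<delta>) \<partial>M)"
    proof (intro nn_integral_mono_AE)
      show "AE \<mu> in M. ennreal (norm (complex_of_real (\<psi> \<mu>) * cnj (ker \<mu> z) * complex_of_real (heat r \<mu> (- l)))) \<le> ennreal \<bar>\<psi> \<mu>\<bar> * ennreal (4 * gau_hat r \<delta>)"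
        using AE_M_neq[of 0]
      proof eventually_elim
        case (elim \<mu>)
        show ?case
        proof (cases "\<bar>\<mu>\<bar> > a")
          case True
          then show ?thesis by (simp add: psi_supp)
        next
          case False
          then have "\<delta> \<le> \<bar>\<bar>\<mu>\<bar> - \<bar>- l\<bar>\<bar>" unfolding \<delta>_def by simp
          then have "\<bar>heat r \<mu> (- l)\<bar> \<le> 4 * gau_hat r \<delta>"
            using elim l0 \<delta> by (intro heat_decay r) auto
          then have "norm (complex_of_real (\<psi> \<mu>) * cnj (ker \<mu> z) * complex_of_real (heat r \<mu> (- l))) \<le> \<bar>\<psi> \<mu>\<bar> * 1 * (4 * gau_hat r \<delta>)"
            unfolding norm_mult complex_mod_cnj norm_of_real by (intro mult_mono norm_ker) auto
          from ennreal_leI[OF this] show ?thesis using gau_hat_nonneg[of r \<delta>] by (simp add: ennreal_mult)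
        qed
      qed
    qed
    also have "\<dots> = ennreal C * ennreal (4 * gau_hat r \<delta>)"
      by (subst nn_integral_multc) (auto simp: Cfin)
    also have "\<dots> = ennreal (C * (4 * gau_hat r \<delta>))"
      using gau_hat_nonneg[of r \<delta>] by (intro ennreal_mult[symmetric]) (auto simp: C_def)
    finally have "norm (LINT \<mu>|M. complex_of_real (\<psi> \<mu>) * cnj (ker \<mu> z) * complex_of_real (heat r \<mu> (- l))) \<le> C * (4 * gau_hat r \<delta>)"
      using gau_hat_nonneg[of r \<delta>] by (subst (asm) ennreal_le_iff) (auto simp: C_def)
    then show ?thesis unfolding e using \<kappa> by (intro mult_left_mono) auto
  qed
  have "(\<lambda>n. LINT y|M. gau (real (Suc n)) y *\<^sub>R (complex_of_real (K y z) * ker l y)) \<longlonglongrightarrow> (LINT y|M. complex_of_real (K y z) * ker l y)"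
    by (rule gaussian_summability[OF i])
  moreover have "(\<lambda>n. \<kappa> * (C * (4 * gau_hat (real (Suc n)) \<delta>))) \<longlonglongrightarrow> \<kappa> * (C * (4 * 0))"
    by (intro tendsto_mult_left gau_hat_tendsto_0 \<delta>)
  then have "(\<lambda>n. \<kappa> * (C * (4 * gau_hat (real (Suc n)) \<delta>))) \<longlonglongrightarrow> 0" by simp
  then have "(\<lambda>n. LINT y|M. gau (real (Suc n)) y *\<^sub>R (complex_of_real (K y z) * ker l y)) \<longlonglongrightarrow> 0"
    by (rule Lim_null_comparison[rotated]) (use bound in auto)
  ultimately show ?thesis by (rule LIMSEQ_unique)
qed

definition conv :: "(real \<Rightarrow> complex) \<Rightarrow> real \<Rightarrow> complex" where
  "conv f y = (LINT z|M. complex_of_real (K y z) * f z)"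

lemma conv_measurable [measurable]:
  assumes [measurable]: "f \<in> borel_measurable borel"
  shows "conv f \<in> borel_measurable borel"
  unfolding conv_def[abs_def] by measurable

text \<open>Two exchanges of integrals bring the transform onto \<open>K\<close> in its first
  variable, where it vanishes at every frequency in the support of \<theta>. This is the hypothesis
  \<open>orth\<close> of \<open>transform_support\<close>.\<close>

lemma conv_orthogonal:
  assumes p: "1 \<le> p" "p \<le> 2" and fm [measurable]: "f \<in> borel_measurable borel" and fin: "nnL p f < \<infinity>"
    and a: "0 \<le> a"
    and tm [measurable]: "\<theta> \<in> borel_measurable borel" and tb: "\<And>x. norm (\<theta> x) \<le> 1"
    and supp: "\<And>x. \<theta> x \<noteq> 0 \<Longrightarrow> a < \<bar>x\<bar> \<and> \<bar>x\<bar> \<le> R"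
  shows "(LINT y|M. conv f y * F1 \<theta> y) = 0"
proof -
  have ind: "norm (\<theta> x) \<le> indicator {-R..R} x" for x
    using tb[of x] supp[of x] by (cases "\<theta> x = 0") (auto simp: indicator_def abs_le_iff)
  have ti: "integrable M \<theta>"
    by (rule Bochner_Integration.integrable_bound[OF integrable_indicator_Icc[of R]]) (use ind in auto)
  have tfin: "(\<integral>\<^sup>+x. ennreal (norm (\<theta> x)) \<partial>M) < \<infinity>" using ti by (simp add: integrable_iff_bounded)
  have t2: "nnL 2 \<theta> < \<infinity>"
  proof -
    have "nnL 2 \<theta> \<le> (\<integral>\<^sup>+x. ennreal (norm (\<theta> x)) \<partial>M)"
      unfolding nnL_def
    proof (intro nn_integral_mono ennreal_leI)
      fix x
      have "norm (\<theta> x) * norm (\<theta> x) \<le> norm (\<theta> x) * 1" using tb by (intro mult_left_mono) auto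
      then show "norm (\<theta> x) powr 2 \<le> norm (\<theta> x)" by (simp add: power2_eq_square)
    qed
    then show ?thesis using tfin by (rule le_less_trans)
  qed
  have F1t: "nnL 2 (F1 \<theta>) < \<infinity>"
    by (rule le_less_trans[OF F1_L2_bound[OF ti t2]]) (use t2 in \<open>simp add: ennreal_mult_less_top\<close>)
  define B where "B = max 1 (LINT x|M. norm (\<theta> x))"
  have B: "B \<ge> 1" "norm (F1 \<theta> y) \<le> B" for y using F1_bound'[OF ti, of y] by (auto simp: B_def)
  have "(LINT y|M. conv f y * F1 \<theta> y) = (LINT y|M. LINT z|M. complex_of_real (K y z) * f z * F1 \<theta> y)"
    by (simp only: conv_def Bochner_Integration.integral_mult_left_zero)
  also have "\<dots> = (LINT z|M. LINT y|M. complex_of_real (K y z) * f z * F1 \<theta> y)"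
  proof (rule Fubini_M(1))
    have "(\<integral>\<^sup>+y. \<integral>\<^sup>+z. ennreal (norm (complex_of_real (K y z) * f z * F1 \<theta> y)) \<partial>M \<partial>M) \<le>
      (\<integral>\<^sup>+y. \<integral>\<^sup>+z. Kabs y z * (ennreal B * ennreal (norm (f z) powr p)) + Kabs y z * ennreal (norm (F1 \<theta> y) powr 2) \<partial>M \<partial>M)"
    proof (intro nn_integral_mono)
      fix y z
      \<comment> \<open>The transform of \<theta> is both bounded and square integrable. Where |f|
        \<le> 1 the square is used, with |f|^2 \<le> |f|^p from p \<le> 2; elsewhere the bound B is
        used, with |f| \<le> |f|^p.\<close>
      have "norm (f z) * norm (F1 \<theta> y) \<le> B * norm (f z) powr p + norm (F1 \<theta> y) powr 2"
      proof (cases "norm (f z) \<le> 1")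
        case True
        have "norm (f z) * norm (F1 \<theta> y) \<le> (norm (f z))\<^sup>2 + (norm (F1 \<theta> y))\<^sup>2"
        proof -
          have "0 \<le> norm (f z) * norm (F1 \<theta> y)" by simp
          then show ?thesis using sum_squares_bound[of "norm (f z)" "norm (F1 \<theta> y)"] unfolding mult.assoc by linarith
        qed
        moreover have "(norm (f z))\<^sup>2 \<le> 1 * norm (f z) powr p"
          using True p powr_mono'[of p 2 "norm (f z)"] by simp
        moreover have "1 * norm (f z) powr p \<le> B * norm (f z) powr p" using B(1) by (intro mult_right_mono) auto
        ultimately show ?thesis by simp
      next
        case False
        then have "norm (f z) \<le> norm (f z) powr p" using p powr_mono[of 1 p "norm (f z)"] by simp
        then have "norm (f z) * norm (F1 \<theta> y) \<le> norm (f z) powr p * B" using B(2) by (intro mult_mono) auto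
        then show ?thesis by (simp add: mult.commute add_increasing2)
      qed
      then have "ennreal (norm (f z) * norm (F1 \<theta> y)) \<le> ennreal (B * norm (f z) powr p + norm (F1 \<theta> y) powr 2)"
        by (rule ennreal_leI)
      also have "\<dots> = ennreal B * ennreal (norm (f z) powr p) + ennreal (norm (F1 \<theta> y) powr 2)"
        using B(1) by (simp add: ennreal_plus ennreal_mult)
      finally have *: "ennreal (norm (f z) * norm (F1 \<theta> y)) \<le> ennreal B * ennreal (norm (f z) powr p) + ennreal (norm (F1 \<theta> y) powr 2)" .
      have "ennreal (norm (complex_of_real (K y z) * f z * F1 \<theta> y)) = ennreal \<bar>K y z\<bar> * ennreal (norm (f z) * norm (F1 \<theta> y))"
        by (simp add: norm_mult ennreal_mult mult.assoc)
      also have "\<dots> \<le> Kabs y z * (ennreal B * ennreal (norm (f z) powr p) + ennreal (norm (F1 \<theta> y) powr 2))"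
        by (intro mult_mono K_le *) auto
      finally show "ennreal (norm (complex_of_real (K y z) * f z * F1 \<theta> y)) \<le> Kabs y z * (ennreal B * ennreal (norm (f z) powr p)) + Kabs y z * ennreal (norm (F1 \<theta> y) powr 2)"
        by (simp add: distrib_left)
    qed
    also have "\<dots> = (\<integral>\<^sup>+y. \<integral>\<^sup>+z. Kabs y z * (ennreal B * ennreal (norm (f z) powr p)) \<partial>M \<partial>M) + (\<integral>\<^sup>+y. \<integral>\<^sup>+z. Kabs y z * ennreal (norm (F1 \<theta> y) powr 2) \<partial>M \<partial>M)"
      by (simp add: nn_integral_add)
    also have "(\<integral>\<^sup>+y. \<integral>\<^sup>+z. Kabs y z * (ennreal B * ennreal (norm (f z) powr p)) \<partial>M \<partial>M) = (\<integral>\<^sup>+z. \<integral>\<^sup>+y. Kabs y z * (ennreal B * ennreal (norm (f z) powr p)) \<partial>M \<partial>M)"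
      by (rule MM.Fubini') measurable
    also have "\<dots> + (\<integral>\<^sup>+y. \<integral>\<^sup>+z. Kabs y z * ennreal (norm (F1 \<theta> y) powr 2) \<partial>M \<partial>M) \<le>
      (\<integral>\<^sup>+z. ennreal CW * L1 * (ennreal B * ennreal (norm (f z) powr p)) \<partial>M) + (\<integral>\<^sup>+y. ennreal CW * L1 * ennreal (norm (F1 \<theta> y) powr 2) \<partial>M)"
      by (intro add_mono nn_integral_mono) (auto simp: nn_integral_multc intro!: mult_right_mono Kabs_integral_le)
    also have "\<dots> = ennreal CW * L1 * (ennreal B * nnL p f) + ennreal CW * L1 * nnL 2 (F1 \<theta>)"
      unfolding nnL_def by (simp add: nn_integral_cmult)
    also have "\<dots> < \<infinity>" using L1_fin fin F1t by (simp add: ennreal_mult_less_top)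
    finally show "(\<integral>\<^sup>+y. \<integral>\<^sup>+z. ennreal (norm (complex_of_real (K y z) * f z * F1 \<theta> y)) \<partial>M \<partial>M) < \<infinity>" .
  qed measurable
  also have "\<dots> = (LINT z|M. 0)"
  proof (rule integral_cong_AE)
    show "AE z in M. (LINT y|M. complex_of_real (K y z) * f z * F1 \<theta> y) = 0"
      using AE_M_neq[of 0]
    proof eventually_elim
      case (elim z)
      have "(LINT y|M. complex_of_real (K y z) * F1 \<theta> y) = (LINT y|M. LINT x|M. complex_of_real (K y z) * (ker y x * \<theta> x))"
        by (simp only: F1_def Bochner_Integration.integral_mult_right_zero)
      also have "\<dots> = (LINT x|M. LINT y|M. complex_of_real (K y z) * (ker y x * \<theta> x))"
      proof (rule Fubini_M(1))
        have "(\<integral>\<^sup>+y. \<integral>\<^sup>+x. ennreal (norm (complex_of_real (K y z) * (ker y x * \<theta> x))) \<partial>M \<partial>M) \<le> (\<integral>\<^sup>+y. \<integral>\<^sup>+x. ennreal (norm (complex_of_real (K y z))) * ennreal (norm (\<theta> x)) \<partial>M \<partial>M)"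
          by (intro nn_integral_mono) (auto simp: norm_mult norm_ker mult_left_le_one_le intro!: ennreal_leI mult_left_mono simp flip: ennreal_mult)
        also have "\<dots> = (\<integral>\<^sup>+y. ennreal (norm (complex_of_real (K y z))) \<partial>M) * (\<integral>\<^sup>+x. ennreal (norm (\<theta> x)) \<partial>M)"
          by (simp add: nn_integral_cmult nn_integral_multc)
        also have "\<dots> < \<infinity>" using integrable_K[of z] tfin by (simp add: integrable_iff_bounded ennreal_mult_less_top)
        finally show "(\<integral>\<^sup>+y. \<integral>\<^sup>+x. ennreal (norm (complex_of_real (K y z) * (ker y x * \<theta> x))) \<partial>M \<partial>M) < \<infinity>" .
      qed measurable
      also have "\<dots> = (LINT x|M. \<theta> x * (LINT y|M. complex_of_real (K y z) * ker x y))"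
        by (simp only: ker_commute[of _ "_ :: real"] mult_ac Bochner_Integration.integral_mult_right_zero[symmetric])
      also have "\<dots> = (LINT x|M. 0)"
      proof (intro Bochner_Integration.integral_cong refl)
        fix x show "\<theta> x * (LINT y|M. complex_of_real (K y z) * ker x y) = 0"
          using K_spectral_support[OF elim _ a, of x] supp[of x] by (cases "\<theta> x = 0") auto
      qed
      finally have "(LINT y|M. complex_of_real (K y z) * F1 \<theta> y) = 0" by simp
      moreover have "(LINT y|M. complex_of_real (K y z) * f z * F1 \<theta> y) = f z * (LINT y|M. complex_of_real (K y z) * F1 \<theta> y)"
        by (simp add: mult.left_commute[of _ "f z"] mult.assoc)
      ultimately show ?case by simp
    qed
  qed measurable
  finally show ?thesis by simp
qed

text \<open>Because \<Phi> has mass one, f minus its convolution is the average of the differences f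
  - \<open>trans t f\<close> with weight \<Phi>, almost everywhere. Jensen's inequality for this
  average and Tonelli give the bound.\<close>

lemma conv_error:
  assumes p: "p \<ge> 1" and fm [measurable]: "f \<in> borel_measurable borel" and fin: "nnL p f < \<infinity>"
    and one: "(LINT t|M. \<Phi> t) = 1" and m: "m > 0" "L1 \<le> ennreal m"
  shows "nnL p (\<lambda>y. f y - conv f y) \<le> ennreal (m powr (p - 1)) * (\<integral>\<^sup>+t. ennreal \<bar>\<Phi> t\<bar> * nnL p (\<lambda>y. f y - trans t f y) \<partial>M)"
proof -
  have "(\<integral>\<^sup>+y. \<integral>\<^sup>+z. Kabs y z * ennreal (norm (f z) powr p) \<partial>M \<partial>M) = (\<integral>\<^sup>+z. \<integral>\<^sup>+y. Kabs y z * ennreal (norm (f z) powr p) \<partial>M \<partial>M)"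
    by (rule MM.Fubini') measurable
  also have "\<dots> \<le> (\<integral>\<^sup>+z. ennreal CW * L1 * ennreal (norm (f z) powr p) \<partial>M)"
    by (intro nn_integral_mono) (auto simp: nn_integral_multc intro!: mult_right_mono Kabs_integral_le)
  also have "\<dots> = ennreal CW * L1 * nnL p f" unfolding nnL_def by (rule nn_integral_cmult) measurable
  also have "\<dots> < \<infinity>" using L1_fin fin by (simp add: ennreal_mult_less_top)
  finally have "AE y in M. (\<integral>\<^sup>+z. Kabs y z * ennreal (norm (f z) powr p) \<partial>M) \<noteq> \<infinity>"
    by (intro nn_integral_PInf_AE) auto
  then have eq: "AE y in M. f y - conv f y = (LINT t|M. complex_of_real (\<Phi> t) * (f y - trans t f y))"
  proof eventually_elim
    case (elim y)
    let ?h = "\<lambda>t z. complex_of_real (dunkl_W \<alpha> t y z * \<Phi> t) * f z"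
    have fin: "(\<integral>\<^sup>+t. \<integral>\<^sup>+z. ennreal (norm (?h t z)) \<partial>M \<partial>M) < \<infinity>"
    proof -
      have "(\<integral>\<^sup>+t. \<integral>\<^sup>+z. ennreal (norm (?h t z)) \<partial>M \<partial>M) = (\<integral>\<^sup>+z. \<integral>\<^sup>+t. ennreal (norm (?h t z)) \<partial>M \<partial>M)"
        by (rule MM.Fubini') measurable
      also have "\<dots> = (\<integral>\<^sup>+z. \<integral>\<^sup>+t. (ennreal \<bar>dunkl_W \<alpha> t y z\<bar> * ennreal \<bar>\<Phi> t\<bar>) * ennreal (norm (f z)) \<partial>M \<partial>M)"
        by (simp add: norm_mult abs_mult ennreal_mult)
      also have "\<dots> = (\<integral>\<^sup>+z. Kabs y z * ennreal (norm (f z)) \<partial>M)"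
        unfolding Kabs_def by (simp add: nn_integral_multc)
      also have "\<dots> \<le> (\<integral>\<^sup>+z. Kabs y z + Kabs y z * ennreal (norm (f z) powr p) \<partial>M)"
      proof (intro nn_integral_mono)
        fix z
        have "ennreal (norm (f z)) \<le> ennreal (1 + norm (f z) powr p)"
          using p by (intro ennreal_leI le_one_plus_powr) auto
        then have "ennreal (norm (f z)) \<le> 1 + ennreal (norm (f z) powr p)" by (simp add: ennreal_plus)
        then have "Kabs y z * ennreal (norm (f z)) \<le> Kabs y z * (1 + ennreal (norm (f z) powr p))"
          by (intro mult_left_mono) auto
        then show "Kabs y z * ennreal (norm (f z)) \<le> Kabs y z + Kabs y z * ennreal (norm (f z) powr p)"
          by (simp add: distrib_left)
      qed
      also have "\<dots> = (\<integral>\<^sup>+z. Kabs y z \<partial>M) + (\<integral>\<^sup>+z. Kabs y z * ennreal (norm (f z) powr p) \<partial>M)"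
        by (rule nn_integral_add) auto
      also have "\<dots> < \<infinity>"
      proof -
        have "(\<integral>\<^sup>+z. Kabs y z \<partial>M) < \<infinity>"
          by (rule le_less_trans[OF Kabs_integral_le(2)]) (use L1_fin in \<open>simp add: ennreal_mult_less_top\<close>)
        then show ?thesis using elim by (simp add: less_top)
      qed
      finally show ?thesis .
    qed
    have hm: "case_prod ?h \<in> borel_measurable (borel \<Otimes>\<^sub>M borel)" by measurable
    have t0: "AE t in M. (LINT z|M. ?h t z) = complex_of_real (\<Phi> t) * trans t f y"
      using AE_M_neq[of 0]
    proof eventually_elim
      case (elim t)
      have "(LINT z|M. ?h t z) = (LINT z|M. complex_of_real (\<Phi> t) * (complex_of_real (dunkl_W \<alpha> t y z) * f z))"
        by (simp add: mult_ac)
      also have "\<dots> = complex_of_real (\<Phi> t) * trans t f y"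
        unfolding trans_def using elim by (simp only: Bochner_Integration.integral_mult_right_zero if_False)
      finally show ?case .
    qed
    have it: "integrable M (\<lambda>t. complex_of_real (\<Phi> t) * trans t f y)"
      using Fubini_M(4)[OF hm fin] t0 by (subst (asm) integrable_cong_AE) auto
    have "conv f y = (LINT z|M. LINT t|M. ?h t z)"
      unfolding conv_def K_def
      by (simp only: integral_complex_of_real[symmetric] Bochner_Integration.integral_mult_left_zero)
    also have "\<dots> = (LINT t|M. LINT z|M. ?h t z)"
      by (rule Fubini_M(1)[OF hm fin, symmetric])
    also have "\<dots> = (LINT t|M. complex_of_real (\<Phi> t) * trans t f y)"
      using t0 by (intro integral_cong_AE) auto
    finally have c: "conv f y = (LINT t|M. complex_of_real (\<Phi> t) * trans t f y)" .
    have ic: "integrable M (\<lambda>t. complex_of_real (\<Phi> t) * f y)"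
      using Phi_int by (intro integrable_mult_left integrable_of_real)
    have "(LINT t|M. complex_of_real (\<Phi> t) * f y) = f y" using one by simp
    then have "f y - conv f y = (LINT t|M. complex_of_real (\<Phi> t) * f y) - (LINT t|M. complex_of_real (\<Phi> t) * trans t f y)"
      unfolding c by simp
    also have "\<dots> = (LINT t|M. complex_of_real (\<Phi> t) * (f y - trans t f y))"
      using ic it by (simp add: right_diff_distrib)
    finally show ?case .
  qed
  have "nnL p (\<lambda>y. f y - conv f y) = nnL p (\<lambda>y. LINT t|M. complex_of_real (\<Phi> t) * (f y - trans t f y))"
    by (rule nnL_cong_AE[OF eq])
  also have "\<dots> \<le> (\<integral>\<^sup>+y. ennreal (m powr (p - 1)) * (\<integral>\<^sup>+t. ennreal \<bar>\<Phi> t\<bar> * ennreal (norm (f y - trans t f y) powr p) \<partial>M) \<partial>M)"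
    unfolding nnL_def using m p by (intro nn_integral_mono nn_jensen_powr) (auto simp: L1_def)
  also have "\<dots> = ennreal (m powr (p - 1)) * (\<integral>\<^sup>+y. \<integral>\<^sup>+t. ennreal \<bar>\<Phi> t\<bar> * ennreal (norm (f y - trans t f y) powr p) \<partial>M \<partial>M)"
    by (rule nn_integral_cmult) measurable
  also have "(\<integral>\<^sup>+y. \<integral>\<^sup>+t. ennreal \<bar>\<Phi> t\<bar> * ennreal (norm (f y - trans t f y) powr p) \<partial>M \<partial>M) = (\<integral>\<^sup>+t. \<integral>\<^sup>+y. ennreal \<bar>\<Phi> t\<bar> * ennreal (norm (f y - trans t f y) powr p) \<partial>M \<partial>M)"
    by (rule MM.Fubini') measurable
  also have "\<dots> = (\<integral>\<^sup>+t. ennreal \<bar>\<Phi> t\<bar> * nnL p (\<lambda>y. f y - trans t f y) \<partial>M)"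
    unfolding nnL_def by (simp add: nn_integral_cmult)
  finally show ?thesis .
qed

end

section \<open>Best approximation and the modulus of smoothness\<close>

text \<open>Logarithmic coordinates for the measure du/u, first on the compact intervals from
  exp(-n) to exp(n), then in the monotone limit.\<close>

lemma nn_integral_exp_substitution:
  assumes [measurable]: "H \<in> borel_measurable borel"
  shows "(\<integral>\<^sup>+u. H u * ennreal (1 / u) * indicator {0<..} u \<partial>lborel) = (\<integral>\<^sup>+s. H (exp s) \<partial>lborel)"
proof -
  let ?A = "\<lambda>n. {exp (- real n)..exp (real n)}" and ?B = "\<lambda>n. {- real n..real n}"
  have UA: "(\<Union>n. ?A n) = {0<..}"
  proof (intro equalityI subsetI)
    fix x :: real assume "x \<in> {0<..}"
    then have x: "x > 0" by simp
    obtain n where "\<bar>ln x\<bar> \<le> real n" using real_arch_simple by blast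
    then have "exp (- real n) \<le> exp (ln x) \<and> exp (ln x) \<le> exp (real n)" unfolding exp_le_cancel_iff by linarith
    then show "x \<in> (\<Union>n. ?A n)" using x by auto
  qed (auto intro: less_le_trans[OF exp_gt_zero])
  have UB: "(\<Union>n. ?B n) = UNIV"
  proof (intro equalityI subsetI)
    fix x :: real
    obtain n where "\<bar>x\<bar> \<le> real n" using real_arch_simple by blast
    then have "x \<in> ?B n" by (simp add: abs_le_iff)
    then show "x \<in> (\<Union>n. ?B n)" by blast
  qed simp
  have "(\<integral>\<^sup>+u. H u * ennreal (1 / u) * indicator {0<..} u \<partial>lborel) = (SUP n. \<integral>\<^sup>+u. H u * ennreal (1 / u) * indicator (?A n) u \<partial>lborel)"
    unfolding UA[symmetric] by (rule nn_integral_UN_incseq) (auto simp: incseq_def intro: order_trans)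
  also have "\<dots> = (SUP n. \<integral>\<^sup>+s. H (exp s) * indicator (?B n) s \<partial>lborel)"
  proof (rule SUP_cong[OF refl])
    fix n :: nat
    show "(\<integral>\<^sup>+u. H u * ennreal (1 / u) * indicator (?A n) u \<partial>lborel) = (\<integral>\<^sup>+s. H (exp s) * indicator (?B n) s \<partial>lborel)"
    \<comment> \<open>At n = 0 both intervals degenerate to a point and the substitution rule does
      not apply.\<close>
    proof (cases "n = 0")
      case True
      have "AE u in lborel. H u * ennreal (1 / u) * indicator (?A n) u = 0"
        using AE_lborel_neq[of 1] by eventually_elim (simp add: True)
      then have "(\<integral>\<^sup>+u. H u * ennreal (1 / u) * indicator (?A n) u \<partial>lborel) = (\<integral>\<^sup>+u. 0 \<partial>(lborel :: real measure))"
        by (rule nn_integral_cong_AE)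
      moreover have "AE s in lborel. H (exp s) * indicator (?B n) s = 0"
        using AE_lborel_neq[of 0] by eventually_elim (simp add: True)
      then have "(\<integral>\<^sup>+s. H (exp s) * indicator (?B n) s \<partial>lborel) = (\<integral>\<^sup>+u. 0 \<partial>(lborel :: real measure))"
        by (rule nn_integral_cong_AE)
      ultimately show ?thesis by simp
    next
      case False
      have "(\<integral>\<^sup>+u. H u * ennreal (1 / u) * indicator (?A n) u \<partial>lborel) = (\<integral>\<^sup>+s. H (exp s) * ennreal (1 / exp s) * ennreal (exp s) * indicator (?B n) s \<partial>lborel)"
        using False by (intro nn_integral_substitution_aux) (auto intro!: derivative_eq_intros continuous_intros)
      also have "\<dots> = (\<integral>\<^sup>+s. H (exp s) * indicator (?B n) s \<partial>lborel)"
        by (intro nn_integral_cong) (simp add: mult.assoc flip: ennreal_mult)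
      finally show ?thesis .
    qed
  qed
  also have "\<dots> = (\<integral>\<^sup>+s. H (exp s) * indicator (\<Union>n. ?B n) s \<partial>lborel)"
    by (rule nn_integral_UN_incseq[symmetric]) (auto simp: incseq_def)
  finally show ?thesis unfolding UB by simp
qed

text \<open>In logarithmic coordinates the map x to c/x is a reflection followed by a shift, under
  which Lebesgue measure is invariant.\<close>

lemma nn_integral_inversion:
  assumes [measurable]: "H \<in> borel_measurable borel" and c: "c > 0"
  shows "(\<integral>\<^sup>+x. H (c / x) * ennreal (1 / x) * indicator {0<..} x \<partial>lborel) = (\<integral>\<^sup>+u. H u * ennreal (1 / u) * indicator {0<..} u \<partial>lborel)"
proof -
  have "(\<integral>\<^sup>+x. H (c / x) * ennreal (1 / x) * indicator {0<..} x \<partial>lborel) = (\<integral>\<^sup>+s. H (c / exp s) \<partial>lborel)"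
    by (rule nn_integral_exp_substitution) measurable
  also have "\<dots> = (\<integral>\<^sup>+s. H (exp (ln c + (-1) * s)) \<partial>lborel)"
    using c by (simp add: exp_diff)
  also have "\<dots> = (\<integral>\<^sup>+s. H (exp s) \<partial>lborel)"
    using nn_integral_real_affine[of "\<lambda>s. H (exp s)" "-1" "ln c"] by simp
  finally show ?thesis by (simp add: nn_integral_exp_substitution)
qed

lemma ex_power_two_between:
  assumes "1 \<le> (y::real)"
  shows "\<exists>j::nat. y \<le> 2 ^ j \<and> 2 ^ j \<le> 2 * y"
proof -
  obtain n :: nat where "y < 2 ^ n" using real_arch_pow[of 2 y] by auto
  then have ex: "\<exists>n::nat. y \<le> 2 ^ n" by (auto intro: less_imp_le)
  define j where "j = (LEAST n::nat. y \<le> 2 ^ n)"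
  have j: "y \<le> 2 ^ j" unfolding j_def by (rule LeastI_ex[OF ex])
  have "2 ^ j \<le> 2 * y"
  proof (cases j)
    case 0 then show ?thesis using assms by simp
  next
    case (Suc i)
    then have "\<not> y \<le> 2 ^ i" using not_less_Least[of i "\<lambda>n. y \<le> 2 ^ n"] by (simp add: j_def)
    then show ?thesis using Suc by simp
  qed
  with j show ?thesis by blast
qed

context dunkl
begin

section \<open>Rescaling the kernel and the direct estimate for the best approximation\<close>

lemma M_scale:
  assumes "r > 0"
  shows "M = density (distr M borel (\<lambda>x. r * x)) (\<lambda>_. ennreal (r powr (2 * \<alpha> + 2)))" (is "_ = ?R")
proof (rule measure_eqI)
  fix A assume "A \<in> sets M"
  then have [measurable]: "A \<in> sets borel" by simp
  have "emeasure M A = (\<integral>\<^sup>+x. indicator A x \<partial>M)" by simp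
  also have "\<dots> = ennreal (r powr (2 * \<alpha> + 2)) * (\<integral>\<^sup>+x. indicator A (r * x) \<partial>M)"
    by (rule nn_integral_M_scale[OF assms]) measurable
  also have "(\<integral>\<^sup>+x. indicator A (r * x) \<partial>M) = (\<integral>\<^sup>+x. indicator A x \<partial>distr M borel (\<lambda>x. r * x))"
    by (subst nn_integral_distr) auto
  also have "ennreal (r powr (2 * \<alpha> + 2)) * \<dots> = emeasure ?R A"
    by (subst emeasure_density) (auto simp: nn_integral_cmult)
  finally show "emeasure M A = emeasure ?R A" .
qed simp

lemma integral_M_scale:
  fixes f :: "real \<Rightarrow> real"
  assumes r: "r > 0" and [measurable]: "f \<in> borel_measurable borel"
  shows "(LINT x|M. f x) = r powr (2 * \<alpha> + 2) * (LINT x|M. f (r * x))"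
    and "integrable M f \<Longrightarrow> integrable M (\<lambda>x. f (r * x))"
proof -
  have "(LINT x|M. f x) = (LINT x|density (distr M borel (\<lambda>x. r * x)) (\<lambda>_. ennreal (r powr (2 * \<alpha> + 2))). f x)"
    using M_scale[OF r] by simp
  also have "\<dots> = r powr (2 * \<alpha> + 2) * (LINT x|M. f (r * x))"
    by (simp add: integral_density integral_distr)
  finally show "(LINT x|M. f x) = r powr (2 * \<alpha> + 2) * (LINT x|M. f (r * x))" .
  assume "integrable M f"
  then have "integrable (density (distr M borel (\<lambda>x. r * x)) (\<lambda>_. ennreal (r powr (2 * \<alpha> + 2)))) f"
    using M_scale[OF r] by simp
  then show "integrable M (\<lambda>x. f (r * x))"
    using r by (simp add: integrable_density integrable_distr_eq)
qed

lemma psi_mass_pos: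
  assumes a: "a > 0"
  shows "(LINT x|M. psi a m x) > 0"
proof (rule ccontr)
  assume "\<not> (LINT x|M. psi a m x) > 0"
  moreover have "(LINT x|M. psi a m x) \<ge> 0" using psi_nonneg by (intro integral_nonneg_AE) auto
  ultimately have "(LINT x|M. psi a m x) = 0" by simp
  then have "AE x in M. psi a m x = 0"
    using integrable_psi_power[OF a, of m 0] psi_nonneg by (subst (asm) integral_nonneg_eq_0_iff_AE) auto
  then have "(LINT x|M. psi a m x * gau_hat (2 / a) x) = (LINT x|M. 0)"
    by (intro integral_cong_AE) auto
  moreover have "(3/4 * a\<^sup>2) ^ m * g0 * exp (-1/4) * measure M {-1..1} > 0"
    using a g0 emeasure_M_pos[of 1] emeasure_M_bounded[of 1] by (simp add: measure_def enn2real_positive_iff)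
  ultimately show False using psi_integral_lower[OF a, of "2 / a" m] a by simp
qed

text \<open>Dunkl translations do not form a group, so no doubling inequality bounds the modulus at
  \<open>2\<^sup>j / x\<close> by the one at \<open>1 / x\<close>; hence the estimate involves all dyadic scales.\<close>

lemma best_approx_bound:
  assumes p: "1 \<le> p" "p \<le> 2" and fm [measurable]: "f \<in> borel_measurable borel" and fin: "nnL p f < \<infinity>"
    and \<sigma>: "\<sigma> \<ge> 0"
  shows "\<exists>C\<ge>0. \<forall>x\<ge>1. \<forall>S\<ge>0. (\<forall>j::nat. dunkl_modulus p \<alpha> f (2 ^ j / x) \<le> (2 ^ j) powr \<sigma> * S) \<longrightarrow>
     0 \<le> dunkl_best_approx p \<alpha> f x \<and> dunkl_best_approx p \<alpha> f x \<le> C * S"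
proof -
  have p0: "p > 0" using p by simp
  \<comment> \<open>The modulus grows at most like (1 + |xt|) powr \<sigma>, and \<open>nnL\<close>
    contains its p-th power.\<close>
  define s where "s = \<sigma> * p"
  have s: "s \<ge> 0" using \<sigma> p by (simp add: s_def)
  obtain k :: nat where k: "s + 2 * \<alpha> + 3 \<le> real k" using real_arch_simple by blast
  then have k2: "s + 2 * \<alpha> + 3 \<le> 2 * real k" using of_nat_0_le_iff[of k] by linarith
  define \<nu> where "\<nu> = \<alpha> + 1 + 2 * real k"
  have \<nu>m: "\<nu> = \<alpha> + real (2 * k) + 1" by (simp add: \<nu>_def)
  have \<nu>: "\<nu> > -1" using \<alpha> by (simp add: \<nu>_def)
  have [measurable]: "bes \<nu> \<in> borel_measurable borel" by (rule bes_measurable[OF \<nu>])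
  define G where "G t = \<bar>bes \<nu> (t\<^sup>2)\<bar> * (1 + \<bar>t\<bar>) powr s" for t
  have [measurable]: "G \<in> borel_measurable borel" unfolding G_def[abs_def] by measurable
  define A where "A = (\<integral>\<^sup>+t. ennreal (G t) \<partial>M)"
  have A: "A < \<infinity>" unfolding A_def G_def \<nu>_def by (rule decay_integrable[OF s k2])
  have le_G: "\<bar>bes \<nu> (t\<^sup>2)\<bar> \<le> G t" for t
  proof -
    have "1 powr s \<le> (1 + \<bar>t\<bar>) powr s" using s by (intro powr_mono2) auto
    then have "\<bar>bes \<nu> (t\<^sup>2)\<bar> * 1 \<le> \<bar>bes \<nu> (t\<^sup>2)\<bar> * (1 + \<bar>t\<bar>) powr s" by (intro mult_left_mono) auto
    then show ?thesis by (simp add: G_def)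
  qed
  have bi: "integrable M (\<lambda>t. bes \<nu> (t\<^sup>2))"
  proof (rule integrableI_bounded)
    have "(\<integral>\<^sup>+t. ennreal (norm (bes \<nu> (t\<^sup>2))) \<partial>M) \<le> A"
      unfolding A_def using le_G by (intro nn_integral_mono ennreal_leI) auto
    then show "(\<integral>\<^sup>+t. ennreal (norm (bes \<nu> (t\<^sup>2))) \<partial>M) < \<infinity>" using A by (rule le_less_trans)
  qed measurable
  define I where "I = (LINT t|M. bes \<nu> (t\<^sup>2))"
  have I: "I > 0" using bes_mass_pos[of "2 * k"] bi unfolding I_def \<nu>m by simp
  \<comment> \<open>A bound for the weighted mass of the normalized kernel, independent of x by
    scaling. The summand 1 makes it positive, as Jensen's inequality requires.\<close>
  define m1 where "m1 = enn2real A / I + 1"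
  have m1: "m1 > 0" using I by (simp add: m1_def add_nonneg_pos)
  define C where "C = m1 * 2 powr \<sigma>"
  have C: "C \<ge> 0" using m1 by (simp add: C_def)
  note w_mono = modulus_props(1)[OF p(1) fm fin] and w_nonneg = modulus_props(2)[OF p(1) fm fin]
    and w_nnL = modulus_props(4)[OF p(1) fm fin]
  have main: "0 \<le> dunkl_best_approx p \<alpha> f x \<and> dunkl_best_approx p \<alpha> f x \<le> C * S"
    if x: "x \<ge> 1" and S: "S \<ge> 0" and wS: "\<And>j::nat. dunkl_modulus p \<alpha> f (2 ^ j / x) \<le> (2 ^ j) powr \<sigma> * S" for x S
  proof -
    have x0: "x > 0" using x by simp
    \<comment> \<open>The factor that gives the dilated Bessel kernel mass one: the power of x
      undoes the scaling of the measure.\<close>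
    define c where "c = x powr (2 * \<alpha> + 2) / I"
    have c: "c > 0" using x0 I by (simp add: c_def)
    define D where "D = (LINT y|M. psi x (2 * k) y)"
    have D: "D > 0" unfolding D_def by (rule psi_mass_pos[OF x0])
    have Gscale: "(\<integral>\<^sup>+t. ennreal (c * G (x * t)) \<partial>M) = ennreal (1 / I) * A"
    proof -
      have "A = ennreal (x powr (2 * \<alpha> + 2)) * (\<integral>\<^sup>+t. ennreal (G (x * t)) \<partial>M)"
        unfolding A_def by (rule nn_integral_M_scale[OF x0]) measurable
      then have "ennreal (1 / I) * A = ennreal (1 / I) * ennreal (x powr (2 * \<alpha> + 2)) * (\<integral>\<^sup>+t. ennreal (G (x * t)) \<partial>M)"
        by (simp add: mult.assoc)
      also have "ennreal (1 / I) * ennreal (x powr (2 * \<alpha> + 2)) = ennreal c"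
        using I by (simp add: c_def flip: ennreal_mult)
      also have "ennreal c * (\<integral>\<^sup>+t. ennreal (G (x * t)) \<partial>M) = (\<integral>\<^sup>+t. ennreal (c * G (x * t)) \<partial>M)"
        using c by (subst nn_integral_cmult[symmetric]) (auto simp: ennreal_mult G_def)
      finally show ?thesis ..
    qed
    have A_m1: "ennreal (1 / I) * A \<le> ennreal m1"
    proof -
      have "ennreal (1 / I) * A = ennreal (1 / I * enn2real A)"
        using A I by (cases A) (auto simp flip: ennreal_mult)
      then show ?thesis using I by (simp add: m1_def ennreal_leI)
    qed
    \<comment> \<open>Sonine's integral yields the Bessel function times the mass \<open>D\<close>
      of the multiplier, hence the division by \<open>D\<close>.\<close>
    interpret B: dunkl_band \<alpha> x "\<lambda>y. c / D * psi x (2 * k) y" "\<lambda>t. c * bes \<nu> ((x * t)\<^sup>2)"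
    proof
      show "integrable M (\<lambda>y. c / D * psi x (2 * k) y)"
        using integrable_psi_power[OF x0, of "2 * k" 0] by simp
      show "c / D * psi x (2 * k) (- y) = c / D * psi x (2 * k) y" for y by (simp add: psi_even)
      show "c / D * psi x (2 * k) y = 0" if "x < \<bar>y\<bar>" for y using that by (simp add: psi_def)
      have "integrable M (\<lambda>t. bes \<nu> ((x * t)\<^sup>2))"
        by (rule integral_M_scale(2)[OF x0 _ bi]) measurable
      then show "integrable M (\<lambda>t. c * bes \<nu> ((x * t)\<^sup>2))" by (rule integrable_mult_right)
      show "c * bes \<nu> ((x * t)\<^sup>2) = (LINT y|M. c / D * psi x (2 * k) y * ker_even (y * t))" for t
        using sonine[OF x0, of "2 * k" t] D by (simp add: \<nu>m D_def[symmetric] mult.assoc)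
    qed
    have one: "(LINT t|M. c * bes \<nu> ((x * t)\<^sup>2)) = 1"
    proof -
      have "I = x powr (2 * \<alpha> + 2) * (LINT t|M. bes \<nu> ((x * t)\<^sup>2))"
        unfolding I_def by (rule integral_M_scale(1)[OF x0]) measurable
      then have "c * (LINT t|M. bes \<nu> ((x * t)\<^sup>2)) = I / I" by (simp add: c_def)
      then show ?thesis using I by simp
    qed
    have L1: "B.L1 \<le> ennreal m1"
    proof -
      have "B.L1 \<le> (\<integral>\<^sup>+t. ennreal (c * G (x * t)) \<partial>M)"
        unfolding B.L1_def using le_G c by (intro nn_integral_mono ennreal_leI) (auto simp: abs_mult)
      then show ?thesis using A_m1 unfolding Gscale by (rule order_trans)
    qed
    \<comment> \<open>Choose j with 2^j between 1 + |xt| and twice that number. Then |t| \<le> 2^j /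
      x, and passing from 2^j back to 1 + |xt| costs the factor 2 powr \<sigma>.\<close>
    have wt: "dunkl_modulus p \<alpha> f \<bar>t\<bar> powr p \<le> (2 powr \<sigma> * S) powr p * (1 + \<bar>x * t\<bar>) powr s" for t
    proof -
      obtain j :: nat where j: "1 + \<bar>x * t\<bar> \<le> 2 ^ j" "2 ^ j \<le> 2 * (1 + \<bar>x * t\<bar>)"
        using ex_power_two_between[of "1 + \<bar>x * t\<bar>"] by auto
      have "\<bar>t\<bar> \<le> 2 ^ j / x" using j(1) x0 by (simp add: abs_mult field_simps)
      then have "dunkl_modulus p \<alpha> f \<bar>t\<bar> \<le> dunkl_modulus p \<alpha> f (2 ^ j / x)" by (intro w_mono) auto
      also have "\<dots> \<le> (2 ^ j) powr \<sigma> * S" by (rule wS)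
      also have "\<dots> \<le> (2 * (1 + \<bar>x * t\<bar>)) powr \<sigma> * S"
        using j S \<sigma> by (intro mult_right_mono powr_mono2) auto
      also have "\<dots> = (2 powr \<sigma> * S) * (1 + \<bar>x * t\<bar>) powr \<sigma>" by (simp only: powr_mult mult_ac)
      finally have "dunkl_modulus p \<alpha> f \<bar>t\<bar> powr p \<le> ((2 powr \<sigma> * S) * (1 + \<bar>x * t\<bar>) powr \<sigma>) powr p"
        using p0 w_nonneg by (intro powr_mono2) auto
      then show ?thesis by (simp add: powr_mult powr_powr s_def)
    qed
    have err: "nnL p (\<lambda>y. f y - B.conv f y) \<le> ennreal ((C * S) powr p)"
    proof -
      have "nnL p (\<lambda>y. f y - B.conv f y) \<le> ennreal (m1 powr (p - 1)) * (\<integral>\<^sup>+t. ennreal \<bar>c * bes \<nu> ((x * t)\<^sup>2)\<bar> * nnL p (\<lambda>y. f y - trans t f y) \<partial>M)"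
        by (rule B.conv_error[OF p(1) fm fin one m1 L1])
      also have "\<dots> \<le> ennreal (m1 powr (p - 1)) * (\<integral>\<^sup>+t. ennreal ((2 powr \<sigma> * S) powr p) * ennreal (c * G (x * t)) \<partial>M)"
      proof (intro mult_left_mono nn_integral_mono)
        fix t
        have "ennreal \<bar>c * bes \<nu> ((x * t)\<^sup>2)\<bar> * nnL p (\<lambda>y. f y - trans t f y) \<le> ennreal \<bar>c * bes \<nu> ((x * t)\<^sup>2)\<bar> * ennreal (dunkl_modulus p \<alpha> f \<bar>t\<bar> powr p)"
          by (intro mult_left_mono w_nnL) auto
        also have "\<dots> \<le> ennreal \<bar>c * bes \<nu> ((x * t)\<^sup>2)\<bar> * ennreal ((2 powr \<sigma> * S) powr p * (1 + \<bar>x * t\<bar>) powr s)"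
          by (intro mult_left_mono ennreal_leI wt) auto
        also have "\<dots> = ennreal ((2 powr \<sigma> * S) powr p) * ennreal (c * G (x * t))"
          using c by (simp add: G_def abs_mult mult_ac flip: ennreal_mult)
        finally show "ennreal \<bar>c * bes \<nu> ((x * t)\<^sup>2)\<bar> * nnL p (\<lambda>y. f y - trans t f y) \<le> ennreal ((2 powr \<sigma> * S) powr p) * ennreal (c * G (x * t))" .
      qed auto
      also have "\<dots> = ennreal (m1 powr (p - 1)) * (ennreal ((2 powr \<sigma> * S) powr p) * (ennreal (1 / I) * A))"
        by (simp add: nn_integral_cmult Gscale)
      also have "\<dots> \<le> ennreal (m1 powr (p - 1)) * (ennreal ((2 powr \<sigma> * S) powr p) * ennreal m1)"
        by (intro mult_left_mono A_m1) auto
      also have "\<dots> = ennreal (m1 powr (p - 1) * m1 * (2 powr \<sigma> * S) powr p)"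
        using m1 by (simp add: mult_ac flip: ennreal_mult)
      also have "m1 powr (p - 1) * m1 = m1 powr p" using m1 powr_add[of m1 "p - 1" 1] by simp
      also have "m1 powr p * (2 powr \<sigma> * S) powr p = (C * S) powr p" by (simp add: C_def powr_mult mult_ac)
      finally show ?thesis .
    qed
    have errfin: "nnL p (\<lambda>y. f y - B.conv f y) < \<infinity>" by (rule le_less_trans[OF err]) simp
    have cfin: "nnL p (B.conv f) < \<infinity>"
    proof -
      have "nnL p (\<lambda>y. f y - (f y - B.conv f y)) < \<infinity>"
        using fin errfin by (intro nnL_diff_finite[of p f "\<lambda>y. f y - B.conv f y"] p0) measurable
      then show ?thesis by simp
    qed
    have supp: "ess_support M (dunkl_transform \<alpha> (B.conv f)) \<subseteq> {-x..x}"
    proof (rule transform_support[OF p _ cfin])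
      fix \<theta> R assume "\<theta> \<in> borel_measurable borel" "\<And>y. norm (\<theta> y :: complex) \<le> 1" "\<And>y. \<theta> y \<noteq> 0 \<Longrightarrow> x < \<bar>y\<bar> \<and> \<bar>y\<bar> \<le> R"
      then show "(LINT y|M. B.conv f y * F1 \<theta> y) = 0"
        using x0 by (intro B.conv_orthogonal[OF p fm fin]) auto
    qed measurable
    let ?N = "{Lp_norm M p (\<lambda>y. f y - g y) | g. g \<in> Lp_space M p \<and> ess_support M (dunkl_transform \<alpha> g) \<subseteq> {-x..x}}"
    have mem: "Lp_norm M p (\<lambda>y. f y - B.conv f y) \<in> ?N"
      using cfin supp by (auto simp: Lp_space_iff)
    have nn: "v \<ge> 0" if "v \<in> ?N" for v using that by (auto simp: Lp_norm_def)
    have "dunkl_best_approx p \<alpha> f x \<ge> 0"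
      unfolding dunkl_best_approx_def using mem nn by (intro cInf_greatest) blast+
    moreover have "dunkl_best_approx p \<alpha> f x \<le> Lp_norm M p (\<lambda>y. f y - B.conv f y)"
      unfolding dunkl_best_approx_def using mem nn by (intro cInf_lower bdd_belowI[of _ 0]) blast+
    moreover have "Lp_norm M p (\<lambda>y. f y - B.conv f y) \<le> C * S"
    proof -
      have "Lp_norm M p (\<lambda>y. f y - B.conv f y) = enn2real (nnL p (\<lambda>y. f y - B.conv f y)) powr (1 / p)"
        by (rule Lp_norm_nnL) measurable
      also have "\<dots> \<le> ((C * S) powr p) powr (1 / p)"
        using p0 err by (intro powr_mono2 enn2real_leI) auto
      also have "\<dots> = C * S" using p0 C S by (simp add: powr_powr)
      finally show ?thesis .
    qed
    ultimately show ?thesis by linarith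
  qed
  show ?thesis using C main by blast
qed

theorem besov_subset_approx:
  assumes p: "1 \<le> p" "p \<le> 2" and q: "1 \<le> q" and \<beta>: "\<beta> > 0"
  shows "besov_dunkl p q \<beta> \<alpha> \<subseteq> approx_dunkl p q \<beta> \<alpha>"
proof
  fix f assume f: "f \<in> besov_dunkl p q \<beta> \<alpha>"
  then have fL: "f \<in> Lp_space M p" by (simp add: besov_dunkl_def)
  then have fm: "f \<in> borel_measurable borel" and fin: "nnL p f < \<infinity>" by (auto simp: Lp_space_iff)
  \<comment> \<open>Freezing the modulus at 0 for negative arguments makes it monotone on the whole
    line, and so Borel measurable.\<close>
  define w where "w x = dunkl_modulus p \<alpha> f (max 0 x)" for x
  note w_mono = modulus_props(1)[OF p(1) fm fin] and w_nonneg = modulus_props(2)[OF p(1) fm fin]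
  have wp: "dunkl_modulus p \<alpha> f x = w x" if "x > 0" for x using that by (simp add: w_def)
  have w0: "w x \<ge> 0" for x by (simp add: w_def w_nonneg)
  have "mono w" unfolding w_def by (intro monoI w_mono) auto
  then have [measurable]: "w \<in> borel_measurable borel" by (rule borel_measurable_mono)
  \<comment> \<open>The excess 1 over \<beta> leaves a factor 2^-j at scale j, which makes the sum
    over the scales converge.\<close>
  define \<sigma> where "\<sigma> = \<beta> + 1"
  have \<sigma>: "\<sigma> \<ge> 0" using \<beta> by (simp add: \<sigma>_def)
  let ?E = "dunkl_best_approx p \<alpha> f"
  obtain C where C: "C \<ge> 0" and E: "\<And>x S. x \<ge> 1 \<Longrightarrow> S \<ge> 0 \<Longrightarrow> (\<And>j::nat. w (2 ^ j / x) \<le> (2 ^ j) powr \<sigma> * S) \<Longrightarrow> 0 \<le> ?E x \<and> ?E x \<le> C * S"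
  proof -
    obtain C where C: "C \<ge> 0" "\<forall>x\<ge>1. \<forall>S\<ge>0. (\<forall>j::nat. dunkl_modulus p \<alpha> f (2 ^ j / x) \<le> (2 ^ j) powr \<sigma> * S) \<longrightarrow> 0 \<le> ?E x \<and> ?E x \<le> C * S"
      using best_approx_bound[OF p fm fin \<sigma>] by blast
    have "0 \<le> ?E x \<and> ?E x \<le> C * S" if "x \<ge> 1" "S \<ge> 0" "\<And>j::nat. w (2 ^ j / x) \<le> (2 ^ j) powr \<sigma> * S" for x S
      using C(2)[rule_format, of x S] that by (simp add: wp)
    with C(1) show ?thesis by (rule that)
  qed
  show "f \<in> approx_dunkl p q \<beta> \<alpha>"
  proof (cases "q < \<infinity>")
    case False
    then obtain B where B: "\<And>x. x > 0 \<Longrightarrow> w x / x powr \<beta> \<le> B"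
      using f by (auto simp: besov_dunkl_def bdd_above_def wp)
    have B0: "B \<ge> 0" using B[of 1] w0[of 1] by simp
    have "x powr \<beta> * ?E x \<le> C * B" if x: "x > 1" for x
    proof -
      \<comment> \<open>Here S = B x powr (-\<beta>). The required inequality holds at every scale
        already with exponent \<beta>, hence with the larger \<sigma>.\<close>
      have "?E x \<le> C * (B * x powr (- \<beta>))"
      proof (rule E[THEN conjunct2])
        fix j :: nat
        have "w (2 ^ j / x) \<le> B * (2 ^ j / x) powr \<beta>"
          using B[of "2 ^ j / x"] x by (simp add: pos_divide_le_eq)
        also have "\<dots> = (2 ^ j) powr \<beta> * (B * x powr (- \<beta>))"
          using x by (simp add: powr_divide powr_minus field_simps)
        also have "\<dots> \<le> (2 ^ j) powr \<sigma> * (B * x powr (- \<beta>))"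
          using B0 by (intro mult_right_mono powr_mono) (auto simp: \<sigma>_def)
        finally show "w (2 ^ j / x) \<le> (2 ^ j) powr \<sigma> * (B * x powr (- \<beta>))" .
      qed (use x B0 in auto)
      then have "x powr \<beta> * ?E x \<le> x powr \<beta> * (C * (B * x powr (- \<beta>)))" by (intro mult_left_mono) auto
      also have "\<dots> = C * B" using x by (simp add: powr_minus field_simps)
      finally show ?thesis .
    qed
    then have "bdd_above ((\<lambda>x. x powr \<beta> * ?E x) ` {1<..})" by (auto simp: bdd_above_def)
    then show ?thesis using fL False by (simp add: approx_dunkl_def)
  next
    case True
    define r where "r = enn2real q"
    have r: "r \<ge> 1" unfolding r_def using True q enn2real_mono[of 1 q] by simp
    obtain B where "\<forall>x\<ge>0. dunkl_modulus p \<alpha> f x \<le> B"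
      using modulus_props(3)[OF p(1) fm fin] by blast
    then have B: "w x \<le> B" for x by (simp add: w_def)
    define H where "H u = ennreal ((w u / u powr \<beta>) powr r)" for u
    have [measurable]: "H \<in> borel_measurable borel" unfolding H_def[abs_def] by measurable
    define Q where "Q = (\<integral>\<^sup>+u. H u * ennreal (1 / u) * indicator {0<..} u \<partial>lborel)"
    have "Q = (\<integral>\<^sup>+x\<in>{0<..}. ennreal ((dunkl_modulus p \<alpha> f x / x powr \<beta>) powr enn2real q / x) \<partial>lborel)"
      unfolding Q_def H_def
      by (intro nn_integral_cong) (auto simp: indicator_def wp r_def divide_inverse ennreal_mult')
    then have Q: "Q < \<infinity>" using f True by (simp add: besov_dunkl_def)
    define a where "a j x = w (2 ^ j / x) / (2 ^ j) powr \<sigma>" for j :: nat and x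
    have a0: "a j x \<ge> 0" for j x using w0 by (simp add: a_def)
    have [measurable]: "a j \<in> borel_measurable borel" for j unfolding a_def[abs_def] by measurable
    have pw: "ennreal ((x powr \<beta> * ?E x) powr r / x) \<le> ennreal ((2 * C) powr r) * (\<Sum>j. ennreal ((x powr \<beta> * a j x) powr r / x))" if x: "x > 1" for x
    proof -
      define S where "S = (SUP j. a j x)"
      have a_le: "a j x \<le> B" for j
      proof -
        have "1 \<le> (2 ^ j :: real) powr \<sigma>" using \<sigma> by (intro ge_one_powr_ge_zero) auto
        then have "w (2 ^ j / x) / (2 ^ j) powr \<sigma> \<le> w (2 ^ j / x) / 1" using w0 by (intro divide_left_mono) auto
        then show ?thesis using B[of "2 ^ j / x"] by (simp add: a_def)
      qed
      have bdd: "bdd_above (range (\<lambda>j. a j x))" using a_le by (auto simp: bdd_above_def)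
      have aS: "a j x \<le> S" for j unfolding S_def by (rule cSUP_upper[OF _ bdd]) simp
      have S0: "S \<ge> 0" using a0[of 0 x] aS[of 0] by linarith
      have "0 \<le> ?E x \<and> ?E x \<le> C * S"
      proof (rule E)
        fix j show "w (2 ^ j / x) \<le> (2 ^ j) powr \<sigma> * S"
          using aS[of j] by (simp add: a_def divide_le_eq mult.commute)
      qed (use x S0 in auto)
      then have E1: "0 \<le> ?E x" "?E x \<le> C * S" by auto
      \<comment> \<open>The supremum may not be attained; the factor 2 pays for an index that nearly
        attains it. The r-th power of that single term is then bounded by the sum over all
        j.\<close>
      have "\<exists>j. S \<le> 2 * a j x"
      proof (cases "S = 0")
        case True then show ?thesis using a0 by (intro exI[of _ 0]) simp
      next
        case False
        then have "S / 2 < S" using S0 by simp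
        then obtain j where "S / 2 < a j x"
          using less_cSUP_iff[OF _ bdd, of "S / 2"] unfolding S_def[symmetric] by auto
        then show ?thesis by (intro exI[of _ j]) simp
      qed
      then obtain j where j: "S \<le> 2 * a j x" by blast
      have "?E x \<le> C * (2 * a j x)" using E1(2) mult_left_mono[OF j C] by linarith
      then have "x powr \<beta> * ?E x \<le> x powr \<beta> * (C * (2 * a j x))" by (intro mult_left_mono) auto
      then have "(x powr \<beta> * ?E x) powr r \<le> ((2 * C) * (x powr \<beta> * a j x)) powr r"
        using r E1(1) by (intro powr_mono2) (auto simp: mult_ac)
      then have "(x powr \<beta> * ?E x) powr r / x \<le> (2 * C) powr r * ((x powr \<beta> * a j x) powr r / x)"
        using x by (simp add: powr_mult divide_right_mono)
      then have "ennreal ((x powr \<beta> * ?E x) powr r / x) \<le> ennreal ((2 * C) powr r) * ennreal ((x powr \<beta> * a j x) powr r / x)"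
        using x by (simp add: ennreal_leI flip: ennreal_mult)
      also have "\<dots> \<le> ennreal ((2 * C) powr r) * (\<Sum>j. ennreal ((x powr \<beta> * a j x) powr r / x))"
      proof (rule mult_left_mono)
        have "(\<Sum>i\<in>{j}. ennreal ((x powr \<beta> * a i x) powr r / x)) \<le> (\<Sum>j. ennreal ((x powr \<beta> * a j x) powr r / x))"
          by (rule sum_le_suminf) auto
        then show "ennreal ((x powr \<beta> * a j x) powr r / x) \<le> (\<Sum>j. ennreal ((x powr \<beta> * a j x) powr r / x))" by simp
      qed simp
      finally show ?thesis .
    qed
    have summand: "(\<integral>\<^sup>+x. ennreal ((x powr \<beta> * a j x) powr r / x) * indicator {0<..} x \<partial>lborel) \<le> ennreal ((1/2) ^ j) * Q" for j
    proof -
      have "(\<integral>\<^sup>+x. ennreal ((x powr \<beta> * a j x) powr r / x) * indicator {0<..} x \<partial>lborel) \<le>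
        (\<integral>\<^sup>+x. ennreal ((1/2) ^ j) * (H (2 ^ j / x) * ennreal (1 / x) * indicator {0<..} x) \<partial>lborel)"
      proof (intro nn_integral_mono)
        fix x :: real
        show "ennreal ((x powr \<beta> * a j x) powr r / x) * indicator {0<..} x \<le> ennreal ((1/2) ^ j) * (H (2 ^ j / x) * ennreal (1 / x) * indicator {0<..} x)"
        proof (cases "x > 0")
          case True
          have pj: "(2 ^ j :: real) powr \<sigma> = 2 ^ j * (2 ^ j) powr \<beta>" by (simp add: \<sigma>_def powr_add)
          have "x powr \<beta> * a j x = (1/2) ^ j * (w (2 ^ j / x) / (2 ^ j / x) powr \<beta>)"
            using True unfolding a_def pj by (simp add: powr_divide power_divide)
          then have "(x powr \<beta> * a j x) powr r = ((1/2) ^ j) powr r * (w (2 ^ j / x) / (2 ^ j / x) powr \<beta>) powr r"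
            by (simp only: powr_mult)
          also have "\<dots> \<le> (1/2) ^ j * (w (2 ^ j / x) / (2 ^ j / x) powr \<beta>) powr r"
          proof (intro mult_right_mono)
            \<comment> \<open>The exponent r = q is at least 1 and the base at most 1, so one factor
              2^-j survives and sums to 2.\<close>
            have "((1/2::real) ^ j) powr r \<le> ((1/2) ^ j) powr 1"
              using r by (intro powr_mono') (auto simp: power_le_one)
            then show "((1/2::real) ^ j) powr r \<le> (1/2) ^ j" by simp
          qed simp
          finally have "(x powr \<beta> * a j x) powr r / x \<le> (1/2) ^ j * ((w (2 ^ j / x) / (2 ^ j / x) powr \<beta>) powr r * (1 / x))"
            using True by (simp add: divide_right_mono)
          then have "ennreal ((x powr \<beta> * a j x) powr r / x) \<le> ennreal ((1/2) ^ j) * (H (2 ^ j / x) * ennreal (1 / x))"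
            unfolding H_def using True by (simp add: ennreal_leI flip: ennreal_mult)
          then show ?thesis using True by simp
        qed simp
      qed
      also have "\<dots> = ennreal ((1/2) ^ j) * Q"
        unfolding Q_def by (subst nn_integral_cmult) (auto simp: nn_integral_inversion)
      finally show ?thesis .
    qed
    have "(\<integral>\<^sup>+x\<in>{1<..}. ennreal ((x powr \<beta> * ?E x) powr r / x) \<partial>lborel) \<le>
      (\<integral>\<^sup>+x. ennreal ((2 * C) powr r) * (\<Sum>j. ennreal ((x powr \<beta> * a j x) powr r / x) * indicator {0<..} x) \<partial>lborel)"
    proof (intro nn_integral_mono)
      fix x :: real
      show "ennreal ((x powr \<beta> * ?E x) powr r / x) * indicator {1<..} x \<le> 
        ennreal ((2 * C) powr r) * (\<Sum>j. ennreal ((x powr \<beta> * a j x) powr r / x) * indicator {0<..} x)"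
      proof (cases "x > 1")
        case True
        then have "indicator {1<..} x = (1::ennreal)" "indicator {0<..} x = (1::ennreal)" by auto
        then show ?thesis using pw[OF True] by (simp only: mult_1_right)
      qed simp
    qed
    also have "\<dots> = ennreal ((2 * C) powr r) * (\<Sum>j. \<integral>\<^sup>+x. ennreal ((x powr \<beta> * a j x) powr r / x) * indicator {0<..} x \<partial>lborel)"
      by (subst nn_integral_cmult, measurable, subst nn_integral_suminf, measurable)
    also have "\<dots> \<le> ennreal ((2 * C) powr r) * (\<Sum>j. ennreal ((1/2) ^ j) * Q)"
      by (intro mult_left_mono suminf_le summand) auto
    also have "(\<Sum>j. ennreal ((1/2) ^ j) * Q) = (\<Sum>j. ennreal ((1/2) ^ j)) * Q" by simp
    also have "(\<Sum>j. ennreal ((1/2) ^ j)) = ennreal 2"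
      by (subst suminf_ennreal2) (auto simp: suminf_geometric)
    also have "ennreal ((2 * C) powr r) * (ennreal 2 * Q) < \<infinity>" using Q by (simp add: ennreal_mult_less_top)
    finally show ?thesis using fL True by (simp add: approx_dunkl_def r_def)
  qed
qed

end

theorem theorem2:
  fixes \<alpha> \<beta> p :: real and q :: ennreal
  assumes "\<alpha> > - 1 / 2" and "1 \<le> p" and "p \<le> 2" and "1 \<le> q" and "\<beta> > 0"
  shows "besov_dunkl p q \<beta> \<alpha> \<subseteq> approx_dunkl p q \<beta> \<alpha>"
proof -
  interpret dunkl \<alpha> using assms(1) by unfold_locales simp
  show ?thesis by (rule besov_subset_approx[OF assms(2-5)])
qed

end
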